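(* Let $n\geq 2$. The following are equivalent: (1) There exists a $\Sigma_n$-strong cardinal. (2) There exists a $\Pi_{n-1}$-strong cardinal. (3) $\Sigma_n$-$\mathrm{PRP}$. (4) $\Pi_{n-1}$-$\mathrm{PRP}$. (5) $\Sigma_n$-$\mathrm{SWVP}$. (6) $\Pi_{n-1}$-$\mathrm{SWVP}$. (7) $\Sigma_n$-$\mathrm{WVP}$. (8) $\Pi_{n-1}$-$\mathrm{WVP}$.
   Context: We work in ZFC; $n$ is a fixed metatheoretic natural number, $\Sigma_n,\Pi_n$ refer to the Levy hierarchy, and "class" means definable class. Graphs. A graph is a structure $\langle G,E_G\rangle$ with $G$ a non-empty set and $E_G$ a binary relation on $G$. A homomorphism $h:G\to H$ is a map such that $xE_Gy$ implies $h(x)E_Hh(y)$. For a set $S$ of graphs, $\prod S$ is the structure whose universe is the set of all functions $f$ with domain $S$ such that $f(\mathcal{A})$ belongs to the universe of $\mathcal{A}$ for every $\mathcal{A}\in S$, with the relation defined pointwise. Principles. Let $\Gamma$ be one of $\Sigma_m,\Pi_m$, $m>0$. All definitions below are without parameters. - $\Gamma$-$\mathrm{PRP}$ (Product Reflection Principle): for every $\Gamma$-definable proper class $\mathcal{C}$ of graphs there is a subset $S$ of $\mathcal{C}$ such that for every $G$ in $\mathcal{C}$ there is a homomorphism $\prod S\to G$. - $\Gamma$-$\mathrm{WVP}$ (Weak Vopěnka Principle): there is no $\Gamma$-definable sequence $\langle G_\alpha:\alpha\in\mathrm{OR}\rangle$ of graphs such that for every $\alpha\leq\beta$ there exists exactly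 one homomorphism $G_\beta\to G_\alpha$, and there is no homomorphism $G_\alpha\to G_\beta$ whenever $\alpha<\beta$. - $\Gamma$-$\mathrm{SWVP}$ (Semi-Weak Vopěnka Principle): the same as $\Gamma$-$\mathrm{WVP}$, with "exactly one homomorphism $G_\beta\to G_\alpha$" replaced by "at least one homomorphism $G_\beta\to G_\alpha$". $\Gamma$-strong cardinals. If $j:V\to M$ is elementary with $M$ transitive and $A$ is a class defined by a formula $\varphi$, put $j(A):=\{X\in M: M\models\varphi(X)\}$. A cardinal $\kappa$ is $\lambda$-$\Gamma$-strong if for every $\Gamma$-definable (without parameters) class $A$ there is an elementary embedding $j:V\to M$ with $M$ transitive, critical point $\kappa$, $V_\lambda\subseteq M$, and $A\cap V_\lambda\subseteq j(A)$. It is $\Gamma$-strong if it is $\lambda$-$\Gamma$-strong for every ordinal $\lambda$. *)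

theory Defs
  imports Main
begin

text \<open>
  The theorem is a theorem scheme of ZFC about definable classes. It is rendered as a statement
  about an arbitrary model \<open>(U, \<epsilon>)\<close> of ZFC whose universe \<open>U\<close> is (all of) a type \<open>'a\<close>: formulas are
  deeply embedded, the sets of the theory are the elements of \<open>'a\<close>, its classes are the definable
  subsets of \<open>'a\<close>, and every set-theoretic notion below is interpreted in the model. The model need
  be neither well-founded nor countable.
\<close>

section \<open>Formulas and the Levy hierarchy\<close>

datatype fm =
    Mem nat nat
  | Eq nat nat
  | Neg fm
  | Conj fm fm
  | Exists nat fm
  | Forall nat fm

abbreviation Imp :: "fm \<Rightarrow> fm \<Rightarrow> fm" where
  "Imp p q \<equiv> Neg (Conj p (Neg q))"

primrec fv :: "fm \<Rightarrow> nat set" where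
  "fv (Mem x y) = {x, y}"
| "fv (Eq x y) = {x, y}"
| "fv (Neg p) = fv p"
| "fv (Conj p q) = fv p \<union> fv q"
| "fv (Exists x p) = fv p - {x}"
| "fv (Forall x p) = fv p - {x}"

inductive_set Delta0_fm :: "fm set" where
  "Mem x y \<in> Delta0_fm"
| "Eq x y \<in> Delta0_fm"
| "p \<in> Delta0_fm \<Longrightarrow> Neg p \<in> Delta0_fm"
| "\<lbrakk>p \<in> Delta0_fm; q \<in> Delta0_fm\<rbrakk> \<Longrightarrow> Conj p q \<in> Delta0_fm"
| "\<lbrakk>p \<in> Delta0_fm; x \<noteq> y\<rbrakk> \<Longrightarrow> Exists x (Conj (Mem x y) p) \<in> Delta0_fm"
| "\<lbrakk>p \<in> Delta0_fm; x \<noteq> y\<rbrakk> \<Longrightarrow> Forall x (Imp (Mem x y) p) \<in> Delta0_fm"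

text \<open>Prenex formulas: alternating blocks of like quantifiers in front of a bounded matrix.\<close>

inductive is_Sigma :: "nat \<Rightarrow> fm \<Rightarrow> bool" and is_Pi :: "nat \<Rightarrow> fm \<Rightarrow> bool" where
  "p \<in> Delta0_fm \<Longrightarrow> is_Sigma 0 p"
| "p \<in> Delta0_fm \<Longrightarrow> is_Pi 0 p"
| "is_Pi m p \<Longrightarrow> is_Sigma (Suc m) (Exists x p)"
| "is_Sigma (Suc m) p \<Longrightarrow> is_Sigma (Suc m) (Exists x p)"
| "is_Sigma m p \<Longrightarrow> is_Pi (Suc m) (Forall x p)"
| "is_Pi (Suc m) p \<Longrightarrow> is_Pi (Suc m) (Forall x p)"

definition Sigma_fm :: "nat \<Rightarrow> fm set" where
  "Sigma_fm m = {p. is_Sigma m p}"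

definition Pi_fm :: "nat \<Rightarrow> fm set" where
  "Pi_fm m = {p. is_Pi m p}"

context
  fixes mem :: "'a \<Rightarrow> 'a \<Rightarrow> bool"  (infix \<open>\<epsilon>\<close> 50)
begin

text \<open>
  Satisfaction in the substructure \<open>(D, \<epsilon>)\<close>, i.e. satisfaction of the relativization to \<open>D\<close>.
\<close>

primrec sat :: "'a set \<Rightarrow> (nat \<Rightarrow> 'a) \<Rightarrow> fm \<Rightarrow> bool" where
  "sat D s (Mem x y) \<longleftrightarrow> s x \<epsilon> s y"
| "sat D s (Eq x y) \<longleftrightarrow> s x = s y"
| "sat D s (Neg p) \<longleftrightarrow> \<not> sat D s p"
| "sat D s (Conj p q) \<longleftrightarrow> sat D s p \<and> sat D s q"
| "sat D s (Exists x p) \<longleftrightarrow> (\<exists>a\<in>D. sat D (s(x := a)) p)"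
| "sat D s (Forall x p) \<longleftrightarrow> (\<forall>a\<in>D. sat D (s(x := a)) p)"

section \<open>Models of ZFC\<close>

definition sub :: "'a \<Rightarrow> 'a \<Rightarrow> bool" where
  "sub a b \<longleftrightarrow> (\<forall>x. x \<epsilon> a \<longrightarrow> x \<epsilon> b)"

text \<open>
  In the two schemes the parameters of the formula are the values of the assignment \<open>s\<close>
  outside the displayed variables.
\<close>

definition models_ZFC :: bool where
  "models_ZFC \<longleftrightarrow>
     \<comment> \<open>extensionality\<close>
     (\<forall>a b. (\<forall>x. x \<epsilon> a \<longleftrightarrow> x \<epsilon> b) \<longrightarrow> a = b) \<and>
     \<comment> \<open>foundation\<close>
     (\<forall>a. (\<exists>x. x \<epsilon> a) \<longrightarrow> (\<exists>x. x \<epsilon> a \<and> \<not> (\<exists>y. y \<epsilon> x \<and> y \<epsilon> a))) \<and>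
     \<comment> \<open>pairing\<close>
     (\<forall>a b. \<exists>c. \<forall>x. x \<epsilon> c \<longleftrightarrow> x = a \<or> x = b) \<and>
     \<comment> \<open>union\<close>
     (\<forall>a. \<exists>u. \<forall>x. x \<epsilon> u \<longleftrightarrow> (\<exists>y. y \<epsilon> a \<and> x \<epsilon> y)) \<and>
     \<comment> \<open>power set\<close>
     (\<forall>a. \<exists>p. \<forall>x. x \<epsilon> p \<longleftrightarrow> sub x a) \<and>
     \<comment> \<open>infinity\<close>
     (\<exists>w. (\<exists>e. e \<epsilon> w \<and> (\<forall>x. \<not> x \<epsilon> e)) \<and>
          (\<forall>x. x \<epsilon> w \<longrightarrow> (\<exists>y. y \<epsilon> w \<and> (\<forall>z. z \<epsilon> y \<longleftrightarrow> z \<epsilon> x \<or> z = x)))) \<and>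
     \<comment> \<open>separation\<close>
     (\<forall>p s a. \<exists>b. \<forall>x. x \<epsilon> b \<longleftrightarrow> x \<epsilon> a \<and> sat UNIV (s(0 := x)) p) \<and>
     \<comment> \<open>replacement\<close>
     (\<forall>p s a. (\<forall>x. x \<epsilon> a \<longrightarrow> (\<exists>!y. sat UNIV (s(0 := x, 1 := y)) p)) \<longrightarrow>
        (\<exists>b. \<forall>y. y \<epsilon> b \<longleftrightarrow> (\<exists>x. x \<epsilon> a \<and> sat UNIV (s(0 := x, 1 := y)) p))) \<and>
     \<comment> \<open>choice\<close>
     (\<forall>a. (\<forall>x. x \<epsilon> a \<longrightarrow> (\<exists>z. z \<epsilon> x)) \<and>
          (\<forall>x y z. x \<epsilon> a \<and> y \<epsilon> a \<and> z \<epsilon> x \<and> z \<epsilon> y \<longrightarrow> x = y) \<longrightarrow>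
        (\<exists>c. \<forall>x. x \<epsilon> a \<longrightarrow> (\<exists>!z. z \<epsilon> x \<and> z \<epsilon> c)))"

section \<open>Classes\<close>

definition set_like :: "'a set \<Rightarrow> bool" where
  "set_like C \<longleftrightarrow> (\<exists>c. C = {x. x \<epsilon> c})"

text \<open>The class \<open>{x \<in> D. D \<Turnstile> p(x)}\<close>, for a formula \<open>p\<close> with at most the free variable 0.\<close>

definition class_in :: "'a set \<Rightarrow> fm \<Rightarrow> 'a set" where
  "class_in D p = {x \<in> D. sat D (\<lambda>_. x) p}"

text \<open>Parameter-free definability by a formula from \<open>\<Gamma>\<close>.\<close>

definition definable_by :: "fm set \<Rightarrow> 'a set \<Rightarrow> bool" where
  "definable_by \<Gamma> C \<longleftrightarrow> (\<exists>p\<in>\<Gamma>. fv p \<subseteq> {0} \<and> C = class_in UNIV p)"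

text \<open>Definability by an arbitrary formula with parameters, for classes and class functions.\<close>

definition definable_class :: "'a set \<Rightarrow> bool" where
  "definable_class C \<longleftrightarrow> (\<exists>p s. C = {x. sat UNIV (s(0 := x)) p})"

definition definable_fun :: "('a \<Rightarrow> 'a) \<Rightarrow> bool" where
  "definable_fun j \<longleftrightarrow> (\<exists>p s. \<forall>x y. j x = y \<longleftrightarrow> sat UNIV (s(0 := x, 1 := y)) p)"

section \<open>Ordered pairs, functions, ordinals, and the cumulative hierarchy\<close>

definition is_upair :: "'a \<Rightarrow> 'a \<Rightarrow> 'a \<Rightarrow> bool" where
  "is_upair z x y \<longleftrightarrow> (\<forall>w. w \<epsilon> z \<longleftrightarrow> w = x \<or> w = y)"

definition is_pair :: "'a \<Rightarrow> 'a \<Rightarrow> 'a \<Rightarrow> bool" where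
  "is_pair z x y \<longleftrightarrow> (\<exists>a b. is_upair a x x \<and> is_upair b x y \<and> is_upair z a b)"

definition related :: "'a \<Rightarrow> 'a \<Rightarrow> 'a \<Rightarrow> bool" where
  "related r x y \<longleftrightarrow> (\<exists>z. is_pair z x y \<and> z \<epsilon> r)"

definition is_fun_on :: "'a \<Rightarrow> 'a \<Rightarrow> bool" where
  "is_fun_on f A \<longleftrightarrow>
     (\<forall>z. z \<epsilon> f \<longrightarrow> (\<exists>x y. x \<epsilon> A \<and> is_pair z x y)) \<and>
     (\<forall>x. x \<epsilon> A \<longrightarrow> (\<exists>!y. related f x y))"

definition is_map :: "'a \<Rightarrow> 'a \<Rightarrow> 'a \<Rightarrow> bool" where
  "is_map f A B \<longleftrightarrow> is_fun_on f A \<and> (\<forall>x y. related f x y \<longrightarrow> y \<epsilon> B)"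

definition is_bij :: "'a \<Rightarrow> 'a \<Rightarrow> 'a \<Rightarrow> bool" where
  "is_bij f A B \<longleftrightarrow> is_map f A B \<and> (\<forall>y. y \<epsilon> B \<longrightarrow> (\<exists>!x. related f x y))"

text \<open>Transitive and linearly ordered by membership; well-foundedness is by foundation.\<close>

definition is_ordinal :: "'a \<Rightarrow> bool" where
  "is_ordinal a \<longleftrightarrow>
     (\<forall>x. x \<epsilon> a \<longrightarrow> sub x a) \<and>
     (\<forall>x y. x \<epsilon> a \<and> y \<epsilon> a \<longrightarrow> x \<epsilon> y \<or> x = y \<or> y \<epsilon> x)"

definition is_cardinal :: "'a \<Rightarrow> bool" where
  "is_cardinal \<kappa> \<longleftrightarrow> is_ordinal \<kappa> \<and> \<not> (\<exists>\<alpha> f. \<alpha> \<epsilon> \<kappa> \<and> is_bij f \<alpha> \<kappa>)"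

text \<open>
  \<open>v\<close> is \<open>V\<^sub>\<theta>\<close>: the value at \<open>\<theta>\<close> of a function \<open>f\<close> on some ordinal \<open>\<delta> > \<theta>\<close>
  with \<open>f(\<beta>) = \<Union>{Pow (f(\<gamma>)) | \<gamma> < \<beta>}\<close> for all \<open>\<beta> < \<delta>\<close>.
\<close>

definition is_V :: "'a \<Rightarrow> 'a \<Rightarrow> bool" where
  "is_V \<theta> v \<longleftrightarrow>
     (\<exists>f \<delta>. is_ordinal \<delta> \<and> \<theta> \<epsilon> \<delta> \<and> is_fun_on f \<delta> \<and>
        (\<forall>\<beta> b. related f \<beta> b \<longrightarrow>
           (\<forall>x. x \<epsilon> b \<longleftrightarrow> (\<exists>\<gamma> c. \<gamma> \<epsilon> \<beta> \<and> related f \<gamma> c \<and> sub x c))) \<and>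
        related f \<theta> v)"

section \<open>Graphs, homomorphisms, and products\<close>

text \<open>\<open>A\<close> is the structure \<open>\<langle>G, R\<rangle>\<close>, \<open>G\<close> non-empty and \<open>R \<subseteq> G \<times> G\<close>.\<close>

definition is_graph_with :: "'a \<Rightarrow> 'a \<Rightarrow> 'a \<Rightarrow> bool" where
  "is_graph_with A G R \<longleftrightarrow>
     is_pair A G R \<and> (\<exists>x. x \<epsilon> G) \<and>
     (\<forall>z. z \<epsilon> R \<longrightarrow> (\<exists>x y. x \<epsilon> G \<and> y \<epsilon> G \<and> is_pair z x y))"

definition is_graph :: "'a \<Rightarrow> bool" where
  "is_graph A \<longleftrightarrow> (\<exists>G R. is_graph_with A G R)"

definition is_hom :: "'a \<Rightarrow> 'a \<Rightarrow> 'a \<Rightarrow> bool" where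
  "is_hom h A B \<longleftrightarrow>
     (\<exists>G R H T. is_graph_with A G R \<and> is_graph_with B H T \<and> is_map h G H \<and>
        (\<forall>x y x' y'. related R x y \<and> related h x x' \<and> related h y y' \<longrightarrow> related T x' y'))"

definition is_choice_fun :: "'a \<Rightarrow> 'a \<Rightarrow> bool" where
  "is_choice_fun f S \<longleftrightarrow>
     is_fun_on f S \<and>
     (\<forall>A x. related f A x \<longrightarrow> (\<exists>H T. is_graph_with A H T \<and> x \<epsilon> H))"

text \<open>\<open>P\<close> is \<open>\<Prod> S\<close>, for a set \<open>S\<close> of graphs.\<close>

definition is_product :: "'a \<Rightarrow> 'a \<Rightarrow> bool" where
  "is_product P S \<longleftrightarrow>
     (\<exists>G R. is_pair P G R \<and>
        (\<forall>f. f \<epsilon> G \<longleftrightarrow> is_choice_fun f S) \<and>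
        (\<forall>z. z \<epsilon> R \<longleftrightarrow>
           (\<exists>f g. f \<epsilon> G \<and> g \<epsilon> G \<and> is_pair z f g \<and>
              (\<forall>A H T x y. A \<epsilon> S \<and> is_graph_with A H T \<and> related f A x \<and> related g A y \<longrightarrow>
                 related T x y))))"

section \<open>The reflection principles\<close>

definition PRP :: "fm set \<Rightarrow> bool" where
  "PRP \<Gamma> \<longleftrightarrow>
     (\<forall>C. definable_by \<Gamma> C \<and> \<not> set_like C \<and> (\<forall>A\<in>C. is_graph A) \<longrightarrow>
        (\<exists>S. (\<forall>A. A \<epsilon> S \<longrightarrow> A \<in> C) \<and>
             (\<forall>G\<in>C. \<exists>P h. is_product P S \<and> is_hom h P G)))"

text \<open>\<open>F\<close> is a class of ordered pairs: a sequence \<open>\<langle>G\<^sub>\<alpha> : \<alpha> \<in> OR\<rangle>\<close> of graphs.\<close>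

definition is_graph_sequence :: "'a set \<Rightarrow> bool" where
  "is_graph_sequence F \<longleftrightarrow>
     (\<forall>z\<in>F. \<exists>\<alpha> G. is_ordinal \<alpha> \<and> is_graph G \<and> is_pair z \<alpha> G) \<and>
     (\<forall>\<alpha>. is_ordinal \<alpha> \<longrightarrow> (\<exists>!G. \<exists>z\<in>F. is_pair z \<alpha> G))"

definition seq_at :: "'a set \<Rightarrow> 'a \<Rightarrow> 'a \<Rightarrow> bool" where
  "seq_at F \<alpha> G \<longleftrightarrow> (\<exists>z\<in>F. is_pair z \<alpha> G)"

definition WVP :: "fm set \<Rightarrow> bool" where
  "WVP \<Gamma> \<longleftrightarrow>
     \<not> (\<exists>F. definable_by \<Gamma> F \<and> is_graph_sequence F \<and>
          (\<forall>\<alpha> \<beta> A B. seq_at F \<alpha> A \<and> seq_at F \<beta> B \<longrightarrow>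
             (\<alpha> \<epsilon> \<beta> \<or> \<alpha> = \<beta> \<longrightarrow> (\<exists>!h. is_hom h B A)) \<and>
             (\<alpha> \<epsilon> \<beta> \<longrightarrow> \<not> (\<exists>h. is_hom h A B))))"

definition SWVP :: "fm set \<Rightarrow> bool" where
  "SWVP \<Gamma> \<longleftrightarrow>
     \<not> (\<exists>F. definable_by \<Gamma> F \<and> is_graph_sequence F \<and>
          (\<forall>\<alpha> \<beta> A B. seq_at F \<alpha> A \<and> seq_at F \<beta> B \<longrightarrow>
             (\<alpha> \<epsilon> \<beta> \<or> \<alpha> = \<beta> \<longrightarrow> (\<exists>h. is_hom h B A)) \<and>
             (\<alpha> \<epsilon> \<beta> \<longrightarrow> \<not> (\<exists>h. is_hom h A B))))"

section \<open>Strong cardinals\<close>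

text \<open>
  \<open>j : V \<rightarrow> M\<close> is an elementary embedding into a transitive class. Both \<open>j\<close> and \<open>M\<close> are
  classes of the model, possibly defined from parameters (such as an extender).
\<close>

definition elementary_embedding :: "('a \<Rightarrow> 'a) \<Rightarrow> 'a set \<Rightarrow> bool" where
  "elementary_embedding j M \<longleftrightarrow>
     definable_fun j \<and> definable_class M \<and>
     (\<forall>x\<in>M. \<forall>y. y \<epsilon> x \<longrightarrow> y \<in> M) \<and>
     range j \<subseteq> M \<and>
     (\<forall>p s. sat UNIV s p \<longleftrightarrow> sat M (j \<circ> s) p)"

definition critical_point :: "('a \<Rightarrow> 'a) \<Rightarrow> 'a \<Rightarrow> bool" where
  "critical_point j \<kappa> \<longleftrightarrow> is_ordinal \<kappa> \<and> j \<kappa> \<noteq> \<kappa> \<and> (\<forall>\<alpha>. \<alpha> \<epsilon> \<kappa> \<longrightarrow> j \<alpha> = \<alpha>)"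

text \<open>
  For \<open>A = class_in UNIV p\<close>, the class \<open>j(A)\<close> is \<open>class_in M p\<close>; by elementarity it does not
  depend on the choice of \<open>p\<close>.
\<close>

definition level_strong :: "fm set \<Rightarrow> 'a \<Rightarrow> 'a \<Rightarrow> bool" where
  "level_strong \<Gamma> \<theta> \<kappa> \<longleftrightarrow>
     is_cardinal \<kappa> \<and>
     (\<forall>p\<in>\<Gamma>. fv p \<subseteq> {0} \<longrightarrow>
        (\<exists>j M v. elementary_embedding j M \<and> critical_point j \<kappa> \<and> is_V \<theta> v \<and>
           {x. x \<epsilon> v} \<subseteq> M \<and> class_in UNIV p \<inter> {x. x \<epsilon> v} \<subseteq> class_in M p))"

definition strong :: "fm set \<Rightarrow> 'a \<Rightarrow> bool" where
  "strong \<Gamma> \<kappa> \<longleftrightarrow> is_cardinal \<kappa> \<and> (\<forall>\<theta>. is_ordinal \<theta> \<longrightarrow> level_strong \<Gamma> \<theta> \<kappa>)"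

end

end

theory Submission
  imports Defs
begin

text \<open>
  Let \<open>m = n - 1\<close>. There is a closed unbounded \<open>\<Pi>\<^sub>m\<close> class \<open>E m\<close> of \<open>\<Sigma>\<^sub>m\<close>-correct levels \<open>V\<^sub>\<lambda>\<close> of the cumulative
  hierarchy. A cardinal that is strong for this single class is \<open>\<Sigma>\<^sub>n\<close>-strong, because a \<open>\<Sigma>\<^sub>n\<close> fact about
  \<open>x\<close> is witnessed inside some \<open>u \<in> E m\<close>, and \<open>u\<close> is seen to be correct in the target model.

  Given such a \<open>\<kappa>\<close> and a class of graphs violating \<open>PRP\<close>, enumerate a closed unbounded class of levels that are
  closed under the violation. With \<open>S\<close> the part of the class below the \<open>\<kappa>\<close>-th level and \<open>G\<close> a counterexample to
  \<open>S\<close> below the next one, \<open>G \<in> j S\<close> and \<open>f \<mapsto> (j f)(G)\<close> is a homomorphism \<open>\<Prod>S \<rightarrow> G\<close>, a contradiction. From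
  \<open>PRP\<close> one gets \<open>SWVP\<close>: for a bad sequence, reflect its range to \<open>S\<close>; some \<open>G\<^sub>\<beta>\<close> maps to all members of \<open>S\<close>,
  hence to \<open>\<Prod>S\<close> and to \<open>G\<^sub>\<beta>\<^sub>+\<^sub>1\<close>.

  Conversely suppose there is no such \<open>\<kappa>\<close>. An extender from \<open>v\<close> to \<open>w\<close> is a map \<open>P(v) \<rightarrow> P(w)\<close> commuting with
  finitely many operations on subsets of levels; it yields an ultrapower embedding. The class \<open>I\<close> of levels in \<open>E m\<close>
  that are limits of levels carrying no extenders with a given critical point is unbounded, and between members of
  \<open>I\<close> the only extenders are the maps \<open>X \<mapsto> X \<inter> w\<close> with \<open>w \<subseteq> v\<close>. Coding the power set of \<open>v\<close> with the operations
  by a graph \<open>Gr v\<close> makes homomorphisms \<open>Gr v \<rightarrow> Gr w\<close> correspond to extenders. So the graphs \<open>Gr v\<close> for \<open>v \<in> I\<close>,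
  in increasing order, refute the \<open>\<Pi>\<^sub>m\<close> forms of \<open>WVP\<close> and \<open>PRP\<close>.
\<close>

section \<open>Formulas: renaming, relativization, prenex classes\<close>

text \<open>Two obstacles shape the proof. The model can be ill-founded and its classes are the
  definable ones, so induction, recursion, separation and choice are available only for predicates
  shown to be definable; hence the judgements \<open>Dp\<close> and \<open>Dt\<close>. Moreover the
  hierarchy is prenex, while the refuting sequences must be \<open>\<Pi>\<^sub>m\<close>, so a
  \<open>\<Pi>\<^sub>m\<close> condition should not occur under bounded quantifiers. Such conditions
  are evaluated inside a level \<open>v\<close> that is itself correct, where truth is a bounded
  notion. The operations on subsets are chosen for what an ultrapower needs. Boolean connectives and
  changes of variables give Los's theorem, membership and bounded quantification represent every
  seed by the identity, an operation recognizing descending sequences gives well-foundedness, and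
  one operation records \<open>E m\<close>. The graphs have 15 layers: a source layer, a target
  layer for each of the 13 operations, and a layer 1 that keeps the edges of operations apart from
  those of the chain of layers.\<close>

lemma finite_fv: "finite (fv p)"
  by (induction p) auto

lemma sat_cong: "(\<And>i. i \<in> fv p \<Longrightarrow> s i = t i) \<Longrightarrow> sat mem D s p = sat mem D t p"
proof (induction p arbitrary: s t)
  case (Exists x p)
  have "sat mem D (s(x := a)) p = sat mem D (t(x := a)) p" for a
    by (rule Exists.IH) (use Exists.prems in auto)
  then show ?case by simp
next
  case (Forall x p)
  have "sat mem D (s(x := a)) p = sat mem D (t(x := a)) p" for a
    by (rule Forall.IH) (use Forall.prems in auto)
  then show ?case by simp
next
  case (Conj p q)
  have "sat mem D s p = sat mem D t p" "sat mem D s q = sat mem D t q"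
    by (rule Conj.IH; use Conj.prems in auto)+
  then show ?case by simp
next
  case (Neg p)
  have "sat mem D s p = sat mem D t p" by (rule Neg.IH) (use Neg.prems in auto)
  then show ?case by simp
qed simp_all

definition fresh :: "nat set \<Rightarrow> nat" where
  "fresh X = (SOME y. y \<notin> X)"

lemma fresh: "finite X \<Longrightarrow> fresh X \<notin> X"
  unfolding fresh_def by (rule someI_ex) (rule ex_new_if_finite[OF infinite_UNIV_nat])

text \<open>Bound variables are replaced by fresh ones on the way, so every map of variables is
  admissible, injective or not, and no capture occurs.\<close>

primrec ren :: "fm \<Rightarrow> (nat \<Rightarrow> nat) \<Rightarrow> fm" where
  "ren (Mem x y) f = Mem (f x) (f y)"
| "ren (Eq x y) f = Eq (f x) (f y)"
| "ren (Neg p) f = Neg (ren p f)"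
| "ren (Conj p q) f = Conj (ren p f) (ren q f)"
| "ren (Exists x p) f = (let y = fresh (f ` (fv p - {x})) in Exists y (ren p (f(x := y))))"
| "ren (Forall x p) f = (let y = fresh (f ` (fv p - {x})) in Forall y (ren p (f(x := y))))"

lemma fresh_image: "i \<in> fv p \<Longrightarrow> i \<noteq> x \<Longrightarrow> f i \<noteq> fresh (f ` (fv p - {x}))"
  using fresh[of "f ` (fv p - {x})"] finite_fv by (metis DiffI finite_Diff finite_imageI imageI singletonD)

lemma sat_ren: "sat mem D s (ren p f) = sat mem D (\<lambda>i. s (f i)) p"
proof (induction p arbitrary: s f)
  case (Exists x p)
  let ?y = "fresh (f ` (fv p - {x}))"
  have "sat mem D (\<lambda>i. (s(?y := a)) ((f(x := ?y)) i)) p = sat mem D ((\<lambda>i. s (f i))(x := a)) p" for a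
    by (rule sat_cong) (use fresh_image[of _ p x f] in auto)
  then show ?case by (simp add: Let_def Exists.IH)
next
  case (Forall x p)
  let ?y = "fresh (f ` (fv p - {x}))"
  have "sat mem D (\<lambda>i. (s(?y := a)) ((f(x := ?y)) i)) p = sat mem D ((\<lambda>i. s (f i))(x := a)) p" for a
    by (rule sat_cong) (use fresh_image[of _ p x f] in auto)
  then show ?case by (simp add: Let_def Forall.IH)
qed simp_all

lemma fv_ren: "fv (ren p f) = f ` fv p"
proof (induction p arbitrary: f)
  case (Exists x p)
  let ?y = "fresh (f ` (fv p - {x}))"
  show ?case using fresh_image[of _ p x f] by (auto simp: Let_def Exists.IH image_iff)
next
  case (Forall x p)
  let ?y = "fresh (f ` (fv p - {x}))"
  show ?case using fresh_image[of _ p x f] by (auto simp: Let_def Forall.IH image_iff)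
qed auto

lemma Delta0_ren: "p \<in> Delta0_fm \<Longrightarrow> ren p f \<in> Delta0_fm"
proof (induction arbitrary: f rule: Delta0_fm.induct)
  case (5 p x y)
  let ?y = "fresh (f ` (fv (Conj (Mem x y) p) - {x}))"
  \<comment> \<open>The bound \<open>y\<close> of the quantifier is free in the body, so the fresh
    name differs from \<open>f y\<close>, as the rule for bounded quantifiers demands.\<close>
  have y: "?y \<notin> f ` (fv (Conj (Mem x y) p) - {x})" by (rule fresh) (simp add: finite_fv)
  have ne: "?y \<noteq> f y" using y 5 by auto
  show ?case using ne 5 by (auto simp: Let_def intro!: Delta0_fm.intros)
next
  case (6 p x y)
  let ?y = "fresh (f ` (fv (Imp (Mem x y) p) - {x}))"
  have y: "?y \<notin> f ` (fv (Imp (Mem x y) p) - {x})" by (rule fresh) (simp add: finite_fv)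
  have ne: "?y \<noteq> f y" using y 6 by auto
  have "Forall ?y (Imp (Mem ?y (f y)) (ren p (f(x := ?y)))) \<in> Delta0_fm"
    using ne 6 by (intro Delta0_fm.intros) auto
  then show ?case using 6 by (simp add: Let_def)
qed (auto intro: Delta0_fm.intros)

lemma SP_ren: "is_Sigma m p \<Longrightarrow> is_Sigma m (ren p f)" "is_Pi m q \<Longrightarrow> is_Pi m (ren q g)"
proof (induction arbitrary: f and g rule: is_Sigma_is_Pi.inducts)
  case (1 p) then show ?case by (intro is_Sigma_is_Pi.intros Delta0_ren)
next
  case (2 p) then show ?case by (intro is_Sigma_is_Pi.intros Delta0_ren)
next
  case (3 m p x) show ?case unfolding ren.simps Let_def by (rule is_Sigma_is_Pi.intros(3)) (rule 3)
next
  case (4 m p x) show ?case unfolding ren.simps Let_def by (rule is_Sigma_is_Pi.intros(4)) (rule 4)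
next
  case (5 m p x) show ?case unfolding ren.simps Let_def by (rule is_Sigma_is_Pi.intros(5)) (rule 5)
next
  case (6 m p x) show ?case unfolding ren.simps Let_def by (rule is_Sigma_is_Pi.intros(6)) (rule 6)
qed

text \<open>The relativization of \<open>p\<close> to the value of the variable \<open>z\<close>; every bound variable must differ from \<open>z\<close>.\<close>

primrec bv :: "fm \<Rightarrow> nat set" where
  "bv (Mem x y) = {}"
| "bv (Eq x y) = {}"
| "bv (Neg p) = bv p"
| "bv (Conj p q) = bv p \<union> bv q"
| "bv (Exists x p) = insert x (bv p)"
| "bv (Forall x p) = insert x (bv p)"

lemma finite_bv: "finite (bv p)"
  by (induction p) auto

primrec rel :: "nat \<Rightarrow> fm \<Rightarrow> fm" where
  "rel z (Mem x y) = Mem x y"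
| "rel z (Eq x y) = Eq x y"
| "rel z (Neg p) = Neg (rel z p)"
| "rel z (Conj p q) = Conj (rel z p) (rel z q)"
| "rel z (Exists x p) = Exists x (Conj (Mem x z) (rel z p))"
| "rel z (Forall x p) = Forall x (Imp (Mem x z) (rel z p))"

lemma Delta0_rel: "z \<notin> bv p \<Longrightarrow> rel z p \<in> Delta0_fm"
  by (induction p) (auto intro!: Delta0_fm.intros)

lemma sat_rel: "z \<notin> bv p \<Longrightarrow> sat mem UNIV s (rel z p) = sat mem {x. mem x (s z)} s p"
  by (induction p arbitrary: s) auto

lemma sat_Delta0:
  assumes "p \<in> Delta0_fm" and tr: "\<And>x y. x \<in> D \<Longrightarrow> mem y x \<Longrightarrow> y \<in> D" and "range s \<subseteq> D"
  shows "sat mem D s p = sat mem UNIV s p"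
  using assms(1,3)
proof (induction arbitrary: s rule: Delta0_fm.induct)
  case (5 p x y)
  have *: "sat mem D (s(x := a)) p = sat mem UNIV (s(x := a)) p" if "a \<in> D" for a
    by (rule 5) (use 5 that in auto)
  have "s y \<in> D" using 5 by auto
  then have "a \<in> D" if "mem a (s y)" for a using tr that by blast
  then show ?case using * 5(2) by auto
next
  case (6 p x y)
  have *: "sat mem D (s(x := a)) p = sat mem UNIV (s(x := a)) p" if "a \<in> D" for a
    by (rule 6) (use 6 that in auto)
  have "s y \<in> D" using 6 by auto
  then have "a \<in> D" if "mem a (s y)" for a using tr that by blast
  then show ?case using * 6(2) by auto
qed auto

section \<open>Definability judgements\<close>

text \<open>Predicates on assignments stand for formulas up to equivalence. Quantifiers are handled
  in de Bruijn style: a new variable is prepended to the assignment.\<close>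

definition merge :: "(nat \<Rightarrow> 'a) \<Rightarrow> (nat \<Rightarrow> 'a) \<Rightarrow> nat \<Rightarrow> 'a" where
  "merge s t n = (if even n then s (n div 2) else t (n div 2))"

lemma merge_simps [simp]: "merge s t (2 * n) = s n" "merge s t (Suc (2 * n)) = t n"
  by (simp_all add: merge_def)

text \<open>Even variables of \<open>p\<close> carry the arguments and odd ones the parameters. With
  \<open>K = {}\<close> this is definability without parameters, with \<open>K = UNIV\<close>
  definability from arbitrary ones.\<close>

definition Dp :: "('a \<Rightarrow> 'a \<Rightarrow> bool) \<Rightarrow> 'a set \<Rightarrow> ((nat \<Rightarrow> 'a) \<Rightarrow> bool) \<Rightarrow> bool" where
  "Dp mem K Q \<longleftrightarrow> (\<exists>p t. (\<forall>n. Suc (2 * n) \<in> fv p \<longrightarrow> t n \<in> K) \<and> (\<forall>s. Q s = sat mem UNIV (merge s t) p))"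

definition Dt :: "('a \<Rightarrow> 'a \<Rightarrow> bool) \<Rightarrow> 'a set \<Rightarrow> ((nat \<Rightarrow> 'a) \<Rightarrow> 'a) \<Rightarrow> bool" where
  "Dt mem K T \<longleftrightarrow> Dp mem K (\<lambda>s. s 0 = T (\<lambda>i. s (Suc i)))"

named_theorems dfi

lemma Dp_mono: "Dp mem K Q \<Longrightarrow> K \<subseteq> L \<Longrightarrow> Dp mem L Q"
  unfolding Dp_def by blast

lemma odd_ne: "Suc (2 * n) \<noteq> 2 * i"
  by presburger

lemma Dp_mem0: "Dp mem K (\<lambda>s. mem (s i) (s j))"
  unfolding Dp_def by (intro exI[of _ "Mem (2*i) (2*j)"] exI[of _ undefined]) (simp add: odd_ne)

lemma Dp_eq0: "Dp mem K (\<lambda>s. s i = s j)"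
  unfolding Dp_def by (intro exI[of _ "Eq (2*i) (2*j)"] exI[of _ undefined]) (simp add: odd_ne)

lemma Dp_eqc: "c \<in> K \<Longrightarrow> Dp mem K (\<lambda>s. s i = c)"
  unfolding Dp_def by (rule exI[of _ "Eq (2*i) 1"], rule exI[of _ "\<lambda>_. c"]) (auto simp: merge_def)

lemma Dp_not: "Dp mem K Q \<Longrightarrow> Dp mem K (\<lambda>s. \<not> Q s)"
  unfolding Dp_def by (metis fv.simps(3) sat.simps(3))

lemma Dp_conj:
  assumes "Dp mem K Q" "Dp mem K R"
  shows "Dp mem K (\<lambda>s. Q s \<and> R s)"
proof -
  obtain p t where p: "\<forall>n. Suc (2 * n) \<in> fv p \<longrightarrow> t n \<in> K" "\<And>s. Q s = sat mem UNIV (merge s t) p"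
    using assms(1) unfolding Dp_def by auto
  obtain q u where q: "\<forall>n. Suc (2 * n) \<in> fv q \<longrightarrow> u n \<in> K" "\<And>s. R s = sat mem UNIV (merge s u) q"
    using assms(2) unfolding Dp_def by auto
  \<comment> \<open>The two parameter lists are interleaved to \<open>merge t u\<close>;
    \<open>f\<close> and \<open>g\<close> redirect odd variables to the respective half and fix the
    even ones.\<close>
  define f where "f n = (if even n then n else Suc (2 * (2 * (n div 2))))" for n :: nat
  define g where "g n = (if even n then n else Suc (2 * (Suc (2 * (n div 2)))))" for n :: nat
  have 1: "(\<lambda>i. merge s (merge t u) (f i)) = merge s t" for s
    by (rule ext) (auto simp: f_def merge_def elim!: oddE)
  have 2: "(\<lambda>i. merge s (merge t u) (g i)) = merge s u" for s
    by (rule ext) (auto simp: g_def merge_def elim!: oddE)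
  have f: "merge t u n \<in> K" if h: "f x = Suc (2 * n)" "x \<in> fv p" for x n
  proof -
    have "odd x" using h(1) by (auto simp: f_def split: if_splits)
    then obtain k where k: "x = Suc (2 * k)" by (auto elim!: oddE)
    then have "n = 2 * k" using h(1) by (simp add: f_def)
    then show ?thesis using p h k by simp
  qed
  have g: "merge t u n \<in> K" if h: "g x = Suc (2 * n)" "x \<in> fv q" for x n
  proof -
    have "odd x" using h(1) by (auto simp: g_def split: if_splits)
    then obtain k where k: "x = Suc (2 * k)" by (auto elim!: oddE)
    then have "n = Suc (2 * k)" using h(1) by (simp add: g_def)
    then show ?thesis using q h k by simp
  qed
  show ?thesis unfolding Dp_def
  proof (intro exI conjI allI impI)
    fix n assume "Suc (2 * n) \<in> fv (Conj (ren p f) (ren q g))"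
    then consider x where "x \<in> fv p" "f x = Suc (2 * n)" | x where "x \<in> fv q" "g x = Suc (2 * n)"
      by (auto simp: fv_ren)
    then show "merge t u n \<in> K" by cases (auto intro: f g)
  next
    fix s show "(Q s \<and> R s) = sat mem UNIV (merge s (merge t u)) (Conj (ren p f) (ren q g))"
      by (simp add: sat_ren 1 2 p q)
  qed
qed

lemma Dp_ren:
  assumes "Dp mem K Q" shows "Dp mem K (\<lambda>s. Q (\<lambda>i. s (f i)))"
proof -
  obtain p t where p: "\<forall>n. Suc (2 * n) \<in> fv p \<longrightarrow> t n \<in> K" "\<And>s. Q s = sat mem UNIV (merge s t) p"
    using assms(1) unfolding Dp_def by auto
  define g where "g n = (if even n then 2 * f (n div 2) else n)" for n :: nat
  have 1: "(\<lambda>i. merge s t (g i)) = merge (\<lambda>i. s (f i)) t" for s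
    by (rule ext) (simp add: g_def merge_def)
  have g: "Suc (2 * n) \<in> fv p" if "g x = Suc (2 * n)" "x \<in> fv p" for x n
    using that by (auto simp: g_def split: if_splits) presburger
  show ?thesis unfolding Dp_def
  proof (intro exI conjI allI impI)
    fix n assume "Suc (2 * n) \<in> fv (ren p g)"
    then show "t n \<in> K" using g p by (auto simp: fv_ren dest: sym)
  next
    fix s show "Q (\<lambda>i. s (f i)) = sat mem UNIV (merge s t) (ren p g)"
      by (simp add: sat_ren 1 p)
  qed
qed

lemma Dp_ex [dfi]:
  assumes "Dp mem K (\<lambda>s. Q (s 0) (\<lambda>i. s (Suc i)))"
  shows "Dp mem K (\<lambda>s. \<exists>x. Q x s)"
proof -
  obtain p t where p: "\<forall>n. Suc (2 * n) \<in> fv p \<longrightarrow> t n \<in> K"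
      "\<And>s. Q (s 0) (\<lambda>i. s (Suc i)) = sat mem UNIV (merge s t) p"
    using assms(1) unfolding Dp_def by auto
  \<comment> \<open>An even variable beyond all those of \<open>p\<close>, to be bound. The map
    \<open>g\<close> sends variable 0 to it, lowers every other argument by one index and leaves the
    odd variables, the parameters, in place.\<close>
  define z where "z = 2 * Suc (\<Sum>i\<in>fv p. i)"
  have z: "n - 2 \<noteq> z" if "n \<in> fv p" for n
    using that member_le_sum[of n "fv p" "\<lambda>i. i"] finite_fv by (fastforce simp: z_def)
  have z': "n \<noteq> z" if "n \<in> fv p" for n
    using that member_le_sum[of n "fv p" "\<lambda>i. i"] finite_fv by (fastforce simp: z_def)
  have ez: "even z" by (simp add: z_def)
  define g where "g n = (if n = 0 then z else if even n then n - 2 else n)" for n :: nat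
  have 1: "sat mem UNIV ((merge s t)(z := a)) (ren p g) = sat mem UNIV (merge (case_nat a s) t) p" for s a
    unfolding sat_ren
  proof (rule sat_cong)
    fix i assume i: "i \<in> fv p"
    show "((merge s t)(z := a)) (g i) = merge (case_nat a s) t i"
    proof (cases "even i")
      case True
      then obtain k where k: "i = 2 * k" by auto
      show ?thesis
      proof (cases k)
        case 0 then show ?thesis using k by (simp add: g_def merge_def)
      next
        case (Suc l)
        then have "g i = 2 * l" "2 * l \<noteq> z" using k z[OF i] by (auto simp: g_def)
        then show ?thesis using k Suc by (simp add: merge_def)
      qed
    next
      case False
      then show ?thesis using ez z'[OF i] by (cases i) (auto simp: g_def merge_def)
    qed
  qed
  have g: "Suc (2 * n) \<in> fv p" if "g x = Suc (2 * n)" "x \<in> fv p" for x n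
  proof -
    have "odd (g x)" using that by simp
    then have "g x = x" using ez by (auto simp: g_def split: if_splits)
    then show ?thesis using that by simp
  qed
  show ?thesis unfolding Dp_def
  proof (intro exI conjI allI impI)
    fix n assume "Suc (2 * n) \<in> fv (Exists z (ren p g))"
    then show "t n \<in> K" using g p by (auto simp: fv_ren dest: sym)
  next
    fix s show "(\<exists>x. Q x s) = sat mem UNIV (merge s t) (Exists z (ren p g))"
      using p(2)[of "case_nat _ s"] by (simp add: 1)
  qed
qed

lemma Dp_disj [dfi]: "Dp mem K Q \<Longrightarrow> Dp mem K R \<Longrightarrow> Dp mem K (\<lambda>s. Q s \<or> R s)"
  using Dp_not[OF Dp_conj[OF Dp_not Dp_not]] by simp

lemma Dp_imp [dfi]: "Dp mem K Q \<Longrightarrow> Dp mem K R \<Longrightarrow> Dp mem K (\<lambda>s. Q s \<longrightarrow> R s)"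
  unfolding imp_conv_disj by (intro Dp_disj Dp_not)

lemma Dp_iff: "Dp mem K Q \<Longrightarrow> Dp mem K R \<Longrightarrow> Dp mem K (\<lambda>s. Q s \<longleftrightarrow> R s)"
  using Dp_conj[OF Dp_imp Dp_imp, of mem K Q R R Q] by (simp add: iff_conv_conj_imp)

lemma Dp_all [dfi]:
  assumes "Dp mem K (\<lambda>s. Q (s 0) (\<lambda>i. s (Suc i)))"
  shows "Dp mem K (\<lambda>s. \<forall>x. Q x s)"
  using Dp_not[OF Dp_ex[OF Dp_not[OF assms]]] by simp

lemma Dp_const [dfi]: "Dp mem K (\<lambda>s. b)"
proof -
  have "Dp mem K (\<lambda>s. s 0 = s 0)" by (rule Dp_eq0)
  then show ?thesis using Dp_not by (cases b) fastforce+
qed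

lemmas [dfi] = Dp_not Dp_conj

lemma Dt_var [dfi]: "Dt mem K (\<lambda>s. s i)"
  unfolding Dt_def by (rule Dp_eq0)

lemma Dt_const: "c \<in> K \<Longrightarrow> Dt mem K (\<lambda>s. c)"
  unfolding Dt_def by (rule Dp_eqc)

lemma Dt_constU [dfi]: "Dt mem UNIV (\<lambda>s. c)"
  by (rule Dt_const) simp

lemma Dt_shift: "Dt mem K T \<Longrightarrow> Dt mem K (\<lambda>s. T (\<lambda>i. s (f i)))"
  unfolding Dt_def using Dp_ren[of mem K "\<lambda>s. s 0 = T (\<lambda>i. s (Suc i))" "case_nat 0 (\<lambda>i. Suc (f i))"]
  by simp

text \<open>The language has no function symbols, so a definable term is substituted by quantifying
  over its value.\<close>

lemma Dp_sub1:
  assumes "Dp mem K (\<lambda>s. P (s 0))" "Dt mem K T"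
  shows "Dp mem K (\<lambda>s. P (T s))"
proof -
  have "Dp mem K (\<lambda>s. \<exists>x. x = T s \<and> P x)"
    by (rule Dp_ex, rule Dp_conj) (use assms in \<open>auto simp: Dt_def\<close>)
  then show ?thesis by simp
qed

lemma Dp_sub2:
  assumes P: "Dp mem K (\<lambda>s. P (s 0) (s 1))" and "Dt mem K T" "Dt mem K U"
  shows "Dp mem K (\<lambda>s. P (T s) (U s))"
proof -
  have "Dp mem K (\<lambda>s. \<exists>x. x = T s \<and> (\<exists>y. y = U s \<and> P x y))"
    apply (rule Dp_ex, rule Dp_conj)
    using assms(2) apply (simp add: Dt_def)
    apply (rule Dp_ex, rule Dp_conj)
    using Dt_shift[OF assms(3), of Suc] apply (simp add: Dt_def)
    using Dp_ren[OF P, of "\<lambda>i. if i = 0 then 1 else 0"] by simp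
  then show ?thesis by simp
qed

lemma Dp_sub3:
  assumes P: "Dp mem K (\<lambda>s. P (s 0) (s 1) (s 2))" and T: "Dt mem K T" "Dt mem K U" "Dt mem K V"
  shows "Dp mem K (\<lambda>s. P (T s) (U s) (V s))"
proof -
  have 0: "Dp mem K (\<lambda>s. \<exists>y. y = U (\<lambda>i. s (Suc i)) \<and> (\<exists>z. z = V (\<lambda>i. s (Suc i)) \<and> P (s 0) y z))"
    apply (rule Dp_ex, rule Dp_conj)
    using Dt_shift[OF T(2), of Suc] apply (simp add: Dt_def)
    apply (rule Dp_ex, rule Dp_conj)
    using Dt_shift[OF T(3), of "\<lambda>i. Suc (Suc i)"] apply (simp add: Dt_def)
    using Dp_ren[OF P, of "\<lambda>i. if i = 0 then 2 else if i = 1 then 1 else 0"]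
    by (simp add: numeral_2_eq_2)
  have "Dp mem K (\<lambda>s. \<exists>x. x = T s \<and> (\<exists>y. y = U s \<and> (\<exists>z. z = V s \<and> P x y z)))"
    apply (rule Dp_ex, rule Dp_conj)
    using T(1) apply (simp add: Dt_def)
    using 0 by simp
  then show ?thesis by simp
qed

lemma Dp_sub4:
  assumes P: "Dp mem K (\<lambda>s. P (s 0) (s 1) (s 2) (s 3))"
    and T: "Dt mem K T" "Dt mem K U" "Dt mem K V" "Dt mem K W"
  shows "Dp mem K (\<lambda>s. P (T s) (U s) (V s) (W s))"
proof -
  have 0: "Dp mem K (\<lambda>s. \<exists>y. y = U (\<lambda>i. s (Suc i)) \<and> (\<exists>z. z = V (\<lambda>i. s (Suc i)) \<and> 
      (\<exists>w. w = W (\<lambda>i. s (Suc i)) \<and> P (s 0) y z w)))"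
    apply (rule Dp_ex, rule Dp_conj)
    using Dt_shift[OF T(2), of Suc] apply (simp add: Dt_def)
    apply (rule Dp_ex, rule Dp_conj)
    using Dt_shift[OF T(3), of "\<lambda>i. Suc (Suc i)"] apply (simp add: Dt_def)
    apply (rule Dp_ex, rule Dp_conj)
    using Dt_shift[OF T(4), of "\<lambda>i. Suc (Suc (Suc i))"] apply (simp add: Dt_def)
    using Dp_ren[OF P, of "\<lambda>i. if i = 0 then 3 else if i = 1 then 2 else if i = 2 then 1 else 0"]
    by (simp add: numeral_3_eq_3 numeral_2_eq_2)
  have "Dp mem K (\<lambda>s. \<exists>x. x = T s \<and> (\<exists>y. y = U s \<and> (\<exists>z. z = V s \<and> (\<exists>w. w = W s \<and> P x y z w))))"
    apply (rule Dp_ex, rule Dp_conj)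
    using T(1) apply (simp add: Dt_def)
    using 0 by simp
  then show ?thesis by simp
qed

lemma Dp_mem [dfi]: "Dt mem K T \<Longrightarrow> Dt mem K U \<Longrightarrow> Dp mem K (\<lambda>s. mem (T s) (U s))"
  by (rule Dp_sub2[of mem K mem]) (auto intro: Dp_mem0)

lemma Dp_eq [dfi]: "Dt mem K T \<Longrightarrow> Dt mem K U \<Longrightarrow> Dp mem K (\<lambda>s. T s = U s)"
  by (rule Dp_sub2[of mem K "(=)"]) (auto intro: Dp_eq0)

lemma Dp_iff' [dfi]: "Dp mem K Q \<Longrightarrow> Dp mem K R \<Longrightarrow> Dp mem K (\<lambda>s. Q s = R s)"
  by (rule Dp_iff)

lemma Dt_sub1:
  assumes "Dp mem K (\<lambda>s. s 0 = F (s 1))" "Dt mem K T"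
  shows "Dt mem K (\<lambda>s. F (T s))"
  unfolding Dt_def
  by (rule Dp_sub2[of mem K "\<lambda>y x. y = F x"]) (use assms Dt_shift[OF assms(2), of Suc] Dt_var in auto)

lemma Dt_sub2:
  assumes "Dp mem K (\<lambda>s. s 0 = F (s 1) (s 2))" "Dt mem K T" "Dt mem K U"
  shows "Dt mem K (\<lambda>s. F (T s) (U s))"
  unfolding Dt_def
  by (rule Dp_sub3[of mem K "\<lambda>z x y. z = F x y"])
     (use assms Dt_shift[OF assms(2), of Suc] Dt_shift[OF assms(3), of Suc] Dt_var in auto)

lemma Dt_if [dfi]:
  assumes "Dp mem K Q" "Dt mem K T" "Dt mem K U"
  shows "Dt mem K (\<lambda>s. if Q s then T s else U s)"
proof -
  have *: "Dp mem K (\<lambda>s. Q (\<lambda>i. s (Suc i)) \<and> s 0 = T (\<lambda>i. s (Suc i)) \<or> \<not> Q (\<lambda>i. s (Suc i)) \<and> s 0 = U (\<lambda>i. s (Suc i)))"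
    using assms Dp_ren[OF assms(1), of Suc] unfolding Dt_def by (intro Dp_disj Dp_conj Dp_not)
  have e: "(\<lambda>s. s 0 = (if Q (\<lambda>i. s (Suc i)) then T (\<lambda>i. s (Suc i)) else U (\<lambda>i. s (Suc i)))) =
     (\<lambda>s. Q (\<lambda>i. s (Suc i)) \<and> s 0 = T (\<lambda>i. s (Suc i)) \<or> \<not> Q (\<lambda>i. s (Suc i)) \<and> s 0 = U (\<lambda>i. s (Suc i)))"
    by (rule ext) (simp split: if_splits)
  show ?thesis unfolding Dt_def e by (rule *)
qed

text \<open>The way back from deeply embedded formulas to the judgement. Below a quantifier all
  terms are shifted past the new variable, and the bound variable of \<open>p\<close> reads variable
  0.\<close>

lemma Dp_sat [dfi]: "(\<And>i. Dt mem K (T i)) \<Longrightarrow> Dp mem K (\<lambda>s. sat mem UNIV (\<lambda>i. T i s) p)"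
proof (induction p arbitrary: T)
  case (Exists x p)
  have "Dp mem K (\<lambda>s. sat mem UNIV (\<lambda>i. (if i = x then (\<lambda>s. s 0) else (\<lambda>s. T i (\<lambda>i. s (Suc i)))) s) p)"
    by (rule Exists.IH) (auto intro: Dt_var Dt_shift[OF Exists.prems, where f=Suc])
  moreover have "(\<lambda>i. (if i = x then (\<lambda>s. s 0) else (\<lambda>s. T i (\<lambda>i. s (Suc i)))) s) =
      ((\<lambda>i. T i (\<lambda>i. s (Suc i)))(x := s 0))" for s
    by (rule ext) auto
  ultimately have "Dp mem K (\<lambda>s. sat mem UNIV ((\<lambda>i. T i (\<lambda>i. s (Suc i)))(x := s 0)) p)" by simp
  then show ?case by (simp add: Dp_ex)
next
  case (Forall x p)
  have "Dp mem K (\<lambda>s. sat mem UNIV (\<lambda>i. (if i = x then (\<lambda>s. s 0) else (\<lambda>s. T i (\<lambda>i. s (Suc i)))) s) p)"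
    by (rule Forall.IH) (auto intro: Dt_var Dt_shift[OF Forall.prems, where f=Suc])
  moreover have "(\<lambda>i. (if i = x then (\<lambda>s. s 0) else (\<lambda>s. T i (\<lambda>i. s (Suc i)))) s) =
      ((\<lambda>i. T i (\<lambda>i. s (Suc i)))(x := s 0))" for s
    by (rule ext) auto
  ultimately have "Dp mem K (\<lambda>s. sat mem UNIV ((\<lambda>i. T i (\<lambda>i. s (Suc i)))(x := s 0)) p)" by simp
  then show ?case by (simp add: Dp_all)
qed (auto intro: dfi)

subsection \<open>Bounded formulas\<close>

definition D0 :: "('a \<Rightarrow> 'a \<Rightarrow> bool) \<Rightarrow> ((nat \<Rightarrow> 'a) \<Rightarrow> bool) \<Rightarrow> bool" where
  "D0 mem Q \<longleftrightarrow> (\<exists>p\<in>Delta0_fm. \<forall>s. Q s = sat mem UNIV s p)"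

named_theorems d0i

lemma D0_mem [d0i]: "D0 mem (\<lambda>s. mem (s i) (s j))"
  unfolding D0_def by (rule bexI[of _ "Mem i j"]) (auto intro: Delta0_fm.intros)

lemma D0_eq [d0i]: "D0 mem (\<lambda>s. s i = s j)"
  unfolding D0_def by (rule bexI[of _ "Eq i j"]) (auto intro: Delta0_fm.intros)

lemma D0_not [d0i]: "D0 mem Q \<Longrightarrow> D0 mem (\<lambda>s. \<not> Q s)"
  unfolding D0_def by (metis Delta0_fm.intros(3) sat.simps(3))

lemma D0_conj [d0i]: "D0 mem Q \<Longrightarrow> D0 mem R \<Longrightarrow> D0 mem (\<lambda>s. Q s \<and> R s)"
  unfolding D0_def by (metis Delta0_fm.intros(4) sat.simps(4))

lemma D0_disj [d0i]: "D0 mem Q \<Longrightarrow> D0 mem R \<Longrightarrow> D0 mem (\<lambda>s. Q s \<or> R s)"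
  using D0_not[OF D0_conj[OF D0_not D0_not]] by simp

lemma D0_imp [d0i]: "D0 mem Q \<Longrightarrow> D0 mem R \<Longrightarrow> D0 mem (\<lambda>s. Q s \<longrightarrow> R s)"
  unfolding imp_conv_disj by (intro D0_disj D0_not)

lemma D0_iff [d0i]: "D0 mem Q \<Longrightarrow> D0 mem R \<Longrightarrow> D0 mem (\<lambda>s. Q s = R s)"
  using D0_conj[OF D0_imp D0_imp, of mem Q R R Q] by (simp add: iff_conv_conj_imp)

lemma D0_const [d0i]: "D0 mem (\<lambda>s. b)"
proof -
  have "D0 mem (\<lambda>s. s 0 = s 0)" by (rule D0_eq)
  then show ?thesis using D0_not by (cases b) fastforce+
qed

lemma D0_ren: "D0 mem Q \<Longrightarrow> D0 mem (\<lambda>s. Q (\<lambda>i. s (f i)))"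
  unfolding D0_def by (metis Delta0_ren sat_ren)

text \<open>Turns a formula about a prepended variable into one quantifying a fresh named variable.\<close>

definition unshift :: "nat \<Rightarrow> fm \<Rightarrow> fm" where
  "unshift z p = ren p (\<lambda>i. case i of 0 \<Rightarrow> z | Suc k \<Rightarrow> k)"

lemma sat_unshift:
  assumes "\<And>k. Suc k \<in> fv p \<Longrightarrow> k \<noteq> z"
  shows "sat mem D (s(z := a)) (unshift z p) = sat mem D (case_nat a s) p"
  unfolding unshift_def sat_ren
  by (rule sat_cong) (use assms in \<open>auto split: nat.splits\<close>)

lemma unshift_var: "\<exists>z. z \<notin> X \<and> (\<forall>k. Suc k \<in> fv p \<longrightarrow> k \<noteq> z)" if "finite X"
proof -
  have "finite (X \<union> {k. Suc k \<in> fv p})"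
    using that finite_vimageI[OF finite_fv[of p], of Suc] by (simp add: vimage_def)
  then obtain z where "z \<notin> X \<union> {k. Suc k \<in> fv p}" using ex_new_if_finite[OF infinite_UNIV_nat] by blast
  then show ?thesis by auto
qed

lemma D0_bex [d0i]:
  assumes "D0 mem (\<lambda>s. Q (s 0) (\<lambda>i. s (Suc i)))"
  shows "D0 mem (\<lambda>s. \<exists>x. mem x (s j) \<and> Q x s)"
proof -
  obtain p where p: "p \<in> Delta0_fm" "\<And>s. Q (s 0) (\<lambda>i. s (Suc i)) = sat mem UNIV s p"
    using assms unfolding D0_def by auto
  obtain z where z: "z \<notin> {j}" "\<forall>k. Suc k \<in> fv p \<longrightarrow> k \<noteq> z"
    using unshift_var[of "{j}" p] by auto
  have 1: "Exists z (Conj (Mem z j) (unshift z p)) \<in> Delta0_fm"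
    using p z by (auto intro!: Delta0_fm.intros Delta0_ren simp: unshift_def)
  have 2: "sat mem UNIV (s(z := x)) (unshift z p) = Q x s" for x s
    using p(2)[of "case_nat x s"] sat_unshift[of p z] z by simp
  show ?thesis unfolding D0_def by (rule bexI[OF _ 1]) (use z 2 in auto)
qed

lemma D0_ball [d0i]:
  assumes "D0 mem (\<lambda>s. Q (s 0) (\<lambda>i. s (Suc i)))"
  shows "D0 mem (\<lambda>s. \<forall>x. mem x (s j) \<longrightarrow> Q x s)"
  using D0_not[OF D0_bex[OF D0_not[OF assms]]] by simp

text \<open>Relativization bounds every quantifier, so truth in a set is a bounded notion however
  complex \<open>p\<close> is. This is what lets conditions of high complexity enter
  \<open>\<Pi>\<^sub>m\<close> definitions.\<close>

lemma D0_sat [d0i]: "D0 mem (\<lambda>s. sat mem {x. mem x (s k)} (\<lambda>i. s (f i)) p)"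
proof -
  define N where "N = Suc (\<Sum>i\<in>bv p \<union> f ` fv p \<union> {k}. i)"
  have "finite (insert k (bv p \<union> f ` fv p))" by (simp add: finite_bv finite_fv)
  let ?q = "ren p f"
  \<comment> \<open>The bounding variable may not be bound in the formula, which \<open>k\<close>
    could violate. So the relativization uses a new variable \<open>z\<close>, which is renamed to
    \<open>k\<close> afterwards.\<close>
  define z where "z = fresh (bv ?q \<union> fv ?q \<union> {k})"
  have z: "z \<notin> bv ?q" "z \<notin> fv ?q"
    using fresh[of "bv ?q \<union> fv ?q \<union> {k}"] by (auto simp: z_def finite_bv finite_fv)
  let ?r = "ren (rel z ?q) (id(z := k))"
  have "?r \<in> Delta0_fm" by (intro Delta0_ren Delta0_rel z)
  moreover have "sat mem UNIV s ?r = sat mem {x. mem x (s k)} (\<lambda>i. s (f i)) p" for s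
  proof -
    have "sat mem UNIV s ?r = sat mem {x. mem x (s k)} (\<lambda>i. s ((id(z := k)) i)) ?q"
      by (simp add: sat_ren[of _ _ _ "rel z ?q"] sat_rel z)
    also have "\<dots> = sat mem {x. mem x (s k)} s ?q"
      by (rule sat_cong) (use z in auto)
    finally show ?thesis by (simp add: sat_ren)
  qed
  ultimately show ?thesis unfolding D0_def by auto
qed

lemma Dp_D0: "D0 mem Q \<Longrightarrow> Dp mem K Q"
proof -
  assume "D0 mem Q"
  then obtain p where p: "\<And>s. Q s = sat mem UNIV s p" unfolding D0_def by auto
  have "Dp mem K (\<lambda>s. sat mem UNIV (\<lambda>i. (\<lambda>s. s i) s) p)" by (rule Dp_sat) (rule Dt_var)
  moreover have "Q = (\<lambda>s. sat mem UNIV s p)" by (rule ext) (rule p)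
  ultimately show ?thesis by simp
qed

lemma D0_exnat [d0i]: "(\<And>i. D0 mem (Q i)) \<Longrightarrow> D0 mem (\<lambda>s. \<exists>i<(N::nat). Q i s)"
proof (induction N)
  case 0 then show ?case by (simp add: D0_const)
next
  case (Suc N)
  then have "D0 mem (\<lambda>s. Q N s \<or> (\<exists>i<N. Q i s))" by (intro D0_disj) auto
  then show ?case by (simp add: less_Suc_eq ex_disj_distrib conj_disj_distribR disj_commute)
qed

subsection \<open>The Levy hierarchy\<close>

definition SigP :: "('a \<Rightarrow> 'a \<Rightarrow> bool) \<Rightarrow> nat \<Rightarrow> ((nat \<Rightarrow> 'a) \<Rightarrow> bool) \<Rightarrow> bool" where
  "SigP mem m Q \<longleftrightarrow> (\<exists>p. is_Sigma m p \<and> (\<forall>s. Q s = sat mem UNIV s p))"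

definition PiP :: "('a \<Rightarrow> 'a \<Rightarrow> bool) \<Rightarrow> nat \<Rightarrow> ((nat \<Rightarrow> 'a) \<Rightarrow> bool) \<Rightarrow> bool" where
  "PiP mem m Q \<longleftrightarrow> (\<exists>p. is_Pi m p \<and> (\<forall>s. Q s = sat mem UNIV s p))"

inductive_cases is_Sigma_0E: "is_Sigma 0 p"
inductive_cases is_Pi_0E: "is_Pi 0 p"

lemma SigP_0: "SigP mem 0 Q = D0 mem Q" "PiP mem 0 Q = D0 mem Q"
  unfolding SigP_def PiP_def D0_def
  by (auto intro: is_Sigma_is_Pi.intros elim: is_Sigma_0E is_Pi_0E)

lemma SigP_ren: "SigP mem m Q \<Longrightarrow> SigP mem m (\<lambda>s. Q (\<lambda>i. s (f i)))"
  unfolding SigP_def by (metis SP_ren(1) sat_ren)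

lemma PiP_ren: "PiP mem m Q \<Longrightarrow> PiP mem m (\<lambda>s. Q (\<lambda>i. s (f i)))"
  unfolding PiP_def by (metis SP_ren(2) sat_ren)

lemma SP_neg:
  fixes mem :: "'a \<Rightarrow> 'a \<Rightarrow> bool"
  shows "is_Sigma m p \<Longrightarrow> \<exists>q. is_Pi m q \<and> (\<forall>D s. sat mem D s q \<longleftrightarrow> \<not> sat mem D s p)"
    and "is_Pi m p' \<Longrightarrow> \<exists>q. is_Sigma m q \<and> (\<forall>D s. sat mem D s q \<longleftrightarrow> \<not> sat mem D s p')"
proof (induction rule: is_Sigma_is_Pi.inducts)
  case (1 p) then show ?case by (intro exI[of _ "Neg p"]) (auto intro: is_Sigma_is_Pi.intros Delta0_fm.intros)
next
  case (2 p) then show ?case by (intro exI[of _ "Neg p"]) (auto intro: is_Sigma_is_Pi.intros Delta0_fm.intros)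
next
  case (3 m p x) then obtain q where "is_Sigma m q" "\<forall>D s. sat mem D s q \<longleftrightarrow> \<not> sat mem D s p" by auto
  then show ?case by (intro exI[of _ "Forall x q"]) (auto intro: is_Sigma_is_Pi.intros)
next
  case (4 m p x) then obtain q where "is_Pi (Suc m) q" "\<forall>D s. sat mem D s q \<longleftrightarrow> \<not> sat mem D s p" by auto
  then show ?case by (intro exI[of _ "Forall x q"]) (auto intro: is_Sigma_is_Pi.intros)
next
  case (5 m p x) then obtain q where "is_Pi m q" "\<forall>D s. sat mem D s q \<longleftrightarrow> \<not> sat mem D s p" by auto
  then show ?case by (intro exI[of _ "Exists x q"]) (auto intro: is_Sigma_is_Pi.intros)
next
  case (6 m p x) then obtain q where "is_Sigma (Suc m) q" "\<forall>D s. sat mem D s q \<longleftrightarrow> \<not> sat mem D s p" by auto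
  then show ?case by (intro exI[of _ "Exists x q"]) (auto intro: is_Sigma_is_Pi.intros)
qed

lemma PiP_not: "SigP mem m Q \<Longrightarrow> PiP mem m (\<lambda>s. \<not> Q s)"
  unfolding SigP_def PiP_def using SP_neg(1) by metis

lemma SigP_not: "PiP mem m Q \<Longrightarrow> SigP mem m (\<lambda>s. \<not> Q s)"
  unfolding SigP_def PiP_def using SP_neg(2) by metis

lemma PiP_notD: "SigP mem m (\<lambda>s. \<not> Q s) \<Longrightarrow> PiP mem m Q"
  using PiP_not[of mem m "\<lambda>s. \<not> Q s"] by simp

lemma SigP_notD: "PiP mem m (\<lambda>s. \<not> Q s) \<Longrightarrow> SigP mem m Q"
  using SigP_not[of mem m "\<lambda>s. \<not> Q s"] by simp

lemma SigP_ex0: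
  assumes "PiP mem m Q" shows "SigP mem (Suc m) (\<lambda>s. \<exists>x. Q (case_nat x s))"
proof -
  obtain p where p: "is_Pi m p" "\<And>s. Q s = sat mem UNIV s p" using assms unfolding PiP_def by auto
  obtain z where z: "\<forall>k. Suc k \<in> fv p \<longrightarrow> k \<noteq> z" using unshift_var[of "{}" p] by auto
  have "is_Sigma (Suc m) (Exists z (unshift z p))"
    unfolding unshift_def by (intro is_Sigma_is_Pi.intros SP_ren p)
  then show ?thesis unfolding SigP_def
    by (intro exI[of _ "Exists z (unshift z p)"]) (use p(2) sat_unshift[of p z mem UNIV] z in auto)
qed

lemma SigP_ex1:
  assumes "SigP mem (Suc m) Q" shows "SigP mem (Suc m) (\<lambda>s. \<exists>x. Q (case_nat x s))"
proof -
  obtain p where p: "is_Sigma (Suc m) p" "\<And>s. Q s = sat mem UNIV s p" using assms unfolding SigP_def by auto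
  obtain z where z: "\<forall>k. Suc k \<in> fv p \<longrightarrow> k \<noteq> z" using unshift_var[of "{}" p] by auto
  have "is_Sigma (Suc m) (Exists z (unshift z p))"
    unfolding unshift_def by (intro is_Sigma_is_Pi.intros SP_ren p)
  then show ?thesis unfolding SigP_def
    by (intro exI[of _ "Exists z (unshift z p)"]) (use p(2) sat_unshift[of p z mem UNIV] z in auto)
qed

lemma SigP_ex:
  assumes "SigP mem (Suc m) (\<lambda>s. Q (s 0) (\<lambda>i. s (Suc i)))"
  shows "SigP mem (Suc m) (\<lambda>s. \<exists>x. Q x s)"
  using SigP_ex1[OF assms] by simp

lemma PiP_all:
  assumes "PiP mem (Suc m) (\<lambda>s. Q (s 0) (\<lambda>i. s (Suc i)))"
  shows "PiP mem (Suc m) (\<lambda>s. \<forall>x. Q x s)"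
  using PiP_notD[of mem "Suc m" "\<lambda>s. \<forall>x. Q x s"] SigP_ex[OF SigP_not[OF assms]] by simp

lemma SigP_PiP: "PiP mem m Q \<Longrightarrow> SigP mem (Suc m) Q"
  using SigP_ex0[OF PiP_ren[of mem m Q Suc]] by simp

lemma upd_shift: "(\<lambda>i. (case_nat a s) (((\<lambda>i. Suc i)(x := 0)) i)) = s(x := a)"
  by (rule ext) auto

lemma SigP_exn0:
  assumes "PiP mem m (\<lambda>s. sat mem UNIV s p)" shows "SigP mem (Suc m) (\<lambda>s. sat mem UNIV s (Exists x p))"
  using SigP_ex0[OF PiP_ren[OF assms, of "(\<lambda>i. Suc i)(x := 0)"]] unfolding upd_shift by simp

lemma SigP_exn1:
  assumes "SigP mem (Suc m) (\<lambda>s. sat mem UNIV s p)" shows "SigP mem (Suc m) (\<lambda>s. sat mem UNIV s (Exists x p))"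
  using SigP_ex1[OF SigP_ren[OF assms, of "(\<lambda>i. Suc i)(x := 0)"]] unfolding upd_shift by simp

text \<open>No syntactic inclusion holds between the strict prenex classes. The kernel below the
  leading block is lifted by induction on the level, and the block is put back.\<close>

lemma SigP_Suc: "SigP mem m Q \<Longrightarrow> SigP mem (Suc m) Q"
proof (induction m arbitrary: Q)
  case 0 then show ?case using SigP_PiP SigP_0 by metis
next
  case (Suc m)
  obtain p where p: "is_Sigma (Suc m) p" "\<And>s. Q s = sat mem UNIV s p" using Suc.prems unfolding SigP_def by auto
  have "SigP mem (Suc (Suc m)) (\<lambda>s. sat mem UNIV s p)" using p(1)
  proof (induction "Suc m" p rule: is_Sigma_is_Pi.inducts(1)[where ?P2.0="\<lambda>_ _. True"])
    case (3 p x)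
    have "PiP mem m (\<lambda>s. sat mem UNIV s p)" using 3 unfolding PiP_def by blast
    then have "PiP mem (Suc m) (\<lambda>s. sat mem UNIV s p)" by (rule PiP_notD[OF Suc.IH[OF SigP_not]])
    then show ?case by (rule SigP_exn0)
  next
    case (4 p x) show ?case by (rule SigP_exn1) (rule 4)
  qed auto
  then show ?case unfolding p(2) .
qed

lemma PiP_Suc: "PiP mem m Q \<Longrightarrow> PiP mem (Suc m) Q"
  by (rule PiP_notD[OF SigP_Suc[OF SigP_not]])

lemma SigP_D0: "D0 mem Q \<Longrightarrow> SigP mem m Q" "D0 mem Q \<Longrightarrow> PiP mem m Q"
  by (induction m) (auto simp: SigP_0 intro: SigP_Suc PiP_Suc)

text \<open>Conjunction and disjunction at once: only distribution over existential quantifiers and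
  commutativity matter. Fact 1 pulls out the block of \<open>p\<close> against a \<open>Q\<close>
  without a block; fact 2 pulls out the block of \<open>p\<close> in general and applies 1 with the
  roles exchanged.\<close>

lemma SigP_bin_aux:
  assumes B: "\<And>q f. B q (\<exists>a::'a. f a) \<longleftrightarrow> (\<exists>a. B q (f a))" "\<And>p q. B p q = B q p"
    and "\<And>Q R. PiP mem m Q \<Longrightarrow> PiP mem m R \<Longrightarrow> PiP mem m (\<lambda>s. B (Q s) (R s))"
    and "SigP mem (Suc m) Q" and "SigP mem (Suc m) R"
  shows "SigP mem (Suc m) (\<lambda>s :: nat \<Rightarrow> 'a. B (Q s) (R s))"
proof -
  have step: "SigP mem (Suc m) (\<lambda>s. B (Q s) (sat mem UNIV s (Exists x p)))"
    if "\<And>Q. C Q \<Longrightarrow> SigP mem (Suc m) (\<lambda>s. B (Q s) (sat mem UNIV s p))" "C Q"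
      "\<And>Q f. C Q \<Longrightarrow> C (\<lambda>s. Q (\<lambda>i. s (f i)))" for C and Q :: "(nat \<Rightarrow> 'a) \<Rightarrow> bool" and x p
  proof -
    have "SigP mem (Suc m) (\<lambda>s. B (Q (\<lambda>i. s (Suc i))) (sat mem UNIV (\<lambda>i. s (((\<lambda>i. Suc i)(x := 0)) i)) p))"
    proof -
      \<comment> \<open>All free variables of \<open>p\<close> are below \<open>N\<close>. The
        variables of \<open>Q\<close> are first moved above \<open>N\<close>, so that quantifying
        \<open>x\<close> in \<open>p\<close> cannot catch any of them.\<close>
      obtain N where N: "\<forall>i\<in>fv p. i < N" using finite_nat_set_iff_bounded finite_fv by blast
      let ?g = "\<lambda>i. if i < N then (if i = x then 0 else Suc i) else Suc (i - N)"
      have "SigP mem (Suc m) (\<lambda>s. B (Q (\<lambda>i. s (i + N))) (sat mem UNIV s p))"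
        by (rule that(1)) (rule that(3)[OF that(2)])
      then have "SigP mem (Suc m) (\<lambda>s. B (Q (\<lambda>i. s (?g (i + N)))) (sat mem UNIV (\<lambda>i. s (?g i)) p))"
        by (rule SigP_ren)
      moreover have "sat mem UNIV (\<lambda>i. s (?g i)) p = sat mem UNIV (\<lambda>i. s (((\<lambda>i. Suc i)(x := 0)) i)) p" for s
        by (rule sat_cong) (use N in auto)
      ultimately show ?thesis by simp
    qed
    then have "SigP mem (Suc m) (\<lambda>s. \<exists>a. B (Q s) (sat mem UNIV (\<lambda>i. (case_nat a s) (((\<lambda>i. Suc i)(x := 0)) i)) p))"
      using SigP_ex1 by fastforce
    then show ?thesis unfolding upd_shift by (simp add: B(1))
  qed
  have 1: "SigP mem (Suc m) (\<lambda>s. B (Q s) (sat mem UNIV s p))" if "is_Sigma (Suc m) p" "PiP mem m Q" for p Q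
    using that
  proof (induction "Suc m" p arbitrary: Q rule: is_Sigma_is_Pi.inducts(1)[where ?P2.0="\<lambda>_ _. True"])
    case (3 p x)
    then have "PiP mem m (\<lambda>s. sat mem UNIV s p)" by (auto simp: PiP_def)
    then have *: "SigP mem (Suc m) (\<lambda>s. B (Q s) (sat mem UNIV s p))" if "PiP mem m Q" for Q
      using assms(3) that by (intro SigP_PiP) auto
    show ?case by (rule step[where C="PiP mem m"]) (use * 3 PiP_ren in auto)
  next
    case (4 p x) show ?case by (rule step[where C="PiP mem m"]) (use 4 PiP_ren in auto)
  qed auto
  have 2: "SigP mem (Suc m) (\<lambda>s. B (Q s) (sat mem UNIV s p))" if "is_Sigma (Suc m) p" "SigP mem (Suc m) Q" for p Q
    using that
  proof (induction "Suc m" p arbitrary: Q rule: is_Sigma_is_Pi.inducts(1)[where ?P2.0="\<lambda>_ _. True"])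
    case (3 p x)
    then have P: "PiP mem m (\<lambda>s. sat mem UNIV s p)" by (auto simp: PiP_def)
    have *: "SigP mem (Suc m) (\<lambda>s. B (Q s) (sat mem UNIV s p))" if Q: "SigP mem (Suc m) Q" for Q
    proof -
      obtain q where q: "is_Sigma (Suc m) q" "\<And>s. Q s = sat mem UNIV s q" using Q unfolding SigP_def by auto
      show ?thesis using 1[OF q(1) P] by (simp add: q(2) B(2))
    qed
    show ?case by (rule step[where C="SigP mem (Suc m)"]) (use * 3 SigP_ren in auto)
  next
    case (4 p x) show ?case by (rule step[where C="SigP mem (Suc m)"]) (use 4 SigP_ren in auto)
  qed auto
  obtain p where p: "is_Sigma (Suc m) p" "\<And>s. R s = sat mem UNIV s p" using assms(5) unfolding SigP_def by auto
  show ?thesis unfolding p(2) by (rule 2) (rule p assms)+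
qed

lemma SP_bin:
  "PiP mem m Q \<Longrightarrow> PiP mem m R \<Longrightarrow> PiP mem m (\<lambda>s. Q s \<and> R s)"
  "PiP mem m Q \<Longrightarrow> PiP mem m R \<Longrightarrow> PiP mem m (\<lambda>s. Q s \<or> R s)"
proof (induction m arbitrary: Q R)
  case 0
  { case 1 then show ?case by (auto simp: SigP_0 intro: D0_conj) }
  { case 2 then show ?case by (auto simp: SigP_0 intro: D0_disj) }
next
  case (Suc m)
  have c: "SigP mem (Suc m) (\<lambda>s. Q s \<and> R s)" if "SigP mem (Suc m) Q" "SigP mem (Suc m) R" for Q R
    by (rule SigP_bin_aux[where B="(\<and>)"]) (use that Suc.IH in auto)
  have d: "SigP mem (Suc m) (\<lambda>s. Q s \<or> R s)" if "SigP mem (Suc m) Q" "SigP mem (Suc m) R" for Q R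
    by (rule SigP_bin_aux[where B="(\<or>)"]) (use that Suc.IH in auto)
  { case 1 then show ?case using PiP_notD[of mem "Suc m" "\<lambda>s. Q s \<and> R s"] d[OF SigP_not[OF 1(1)] SigP_not[OF 1(2)]] by simp }
  { case 2 then show ?case using PiP_notD[of mem "Suc m" "\<lambda>s. Q s \<or> R s"] c[OF SigP_not[OF 2(1)] SigP_not[OF 2(2)]] by simp }
qed

lemmas PiP_conj = SP_bin(1) and PiP_disj = SP_bin(2)

lemma SigP_conj:
  assumes "SigP mem m Q" "SigP mem m R" shows "SigP mem m (\<lambda>s. Q s \<and> R s)"
  using SigP_notD[of mem m "\<lambda>s. Q s \<and> R s"] PiP_disj[OF PiP_not[OF assms(1)] PiP_not[OF assms(2)]] by simp

lemma PiP_imp: "SigP mem m Q \<Longrightarrow> PiP mem m R \<Longrightarrow> PiP mem m (\<lambda>s. Q s \<longrightarrow> R s)"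
  unfolding imp_conv_disj by (intro PiP_disj PiP_not)

lemma definable_byI:
  assumes "\<And>s. Q s = sat mem UNIV s p" "\<And>s. Q s \<longleftrightarrow> s 0 \<in> C"
    and "\<And>f. ren p f \<in> \<Gamma>"
  shows "definable_by mem \<Gamma> C"
  unfolding definable_by_def class_in_def
\<comment> \<open>The truth value depends on the value of variable 0 alone, so all variables may be
  collapsed to 0, which yields the required bound on the free variables.\<close>
proof (rule bexI[of _ "ren p (\<lambda>_. 0)"], intro conjI)
  show "C = {x \<in> UNIV. sat mem UNIV (\<lambda>_. x) (ren p (\<lambda>_. 0))}"
    unfolding sat_ren assms(1)[symmetric] assms(2) by simp
qed (auto simp: fv_ren assms(3))

lemma definable_by_Sigma: "SigP mem m (\<lambda>s. s 0 \<in> C) \<Longrightarrow> definable_by mem (Sigma_fm m) C"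
  unfolding SigP_def by (elim exE conjE, rule definable_byI[where Q="\<lambda>s. s 0 \<in> C"]) (auto simp: Sigma_fm_def intro: SP_ren)

lemma definable_by_Pi: "PiP mem m (\<lambda>s. s 0 \<in> C) \<Longrightarrow> definable_by mem (Pi_fm m) C"
  unfolding PiP_def by (elim exE conjE, rule definable_byI[where Q="\<lambda>s. s 0 \<in> C"]) (auto simp: Pi_fm_def intro: SP_ren)

lemma definable_by_SigmaD: "definable_by mem (Sigma_fm m) C \<Longrightarrow> SigP mem m (\<lambda>s. s i \<in> C)"
proof -
  assume "definable_by mem (Sigma_fm m) C"
  then obtain p where p: "is_Sigma m p" "\<And>x. x \<in> C \<longleftrightarrow> sat mem UNIV (\<lambda>_. x) p"
    unfolding definable_by_def class_in_def Sigma_fm_def by auto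
  have "SigP mem m (\<lambda>s. sat mem UNIV s p)" unfolding SigP_def using p(1) by blast
  from SigP_ren[OF this, of "\<lambda>_. i"] show ?thesis unfolding p(2) .
qed

lemma Pi_sub_Sigma:
  assumes "definable_by mem (Pi_fm m) C" shows "definable_by mem (Sigma_fm (Suc m)) C"
proof -
  from assms obtain p where p: "is_Pi m p" "\<And>x. x \<in> C \<longleftrightarrow> sat mem UNIV (\<lambda>_. x) p"
    unfolding definable_by_def class_in_def Pi_fm_def by auto
  have "PiP mem m (\<lambda>s. sat mem UNIV s p)" unfolding PiP_def using p(1) by blast
  from SigP_PiP[OF PiP_ren[OF this, of "\<lambda>_. 0"]] show ?thesis
    by (intro definable_by_Sigma) (unfold p(2))
qed

section \<open>Set theory inside a model\<close>

locale zfc =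
  fixes mem :: "'a \<Rightarrow> 'a \<Rightarrow> bool"  (infix \<open>\<epsilon>\<close> 50)
  assumes ZFC: "models_ZFC mem"
begin

lemmas ax_ext = ZFC[unfolded models_ZFC_def, THEN conjunct1]
lemmas ax_found = ZFC[unfolded models_ZFC_def, THEN conjunct2, THEN conjunct1]
lemmas ax_pair = ZFC[unfolded models_ZFC_def, THEN conjunct2, THEN conjunct2, THEN conjunct1]
lemmas ax_Union = ZFC[unfolded models_ZFC_def, THEN conjunct2, THEN conjunct2, THEN conjunct2, THEN conjunct1]
lemmas ax_Pow = ZFC[unfolded models_ZFC_def, THEN conjunct2, THEN conjunct2, THEN conjunct2, THEN conjunct2, THEN conjunct1]
lemmas ax_inf = ZFC[unfolded models_ZFC_def, THEN conjunct2, THEN conjunct2, THEN conjunct2, THEN conjunct2, THEN conjunct2, THEN conjunct1]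
lemmas ax_sep = ZFC[unfolded models_ZFC_def, THEN conjunct2, THEN conjunct2, THEN conjunct2, THEN conjunct2, THEN conjunct2, THEN conjunct2, THEN conjunct1]
lemmas ax_repl = ZFC[unfolded models_ZFC_def, THEN conjunct2, THEN conjunct2, THEN conjunct2, THEN conjunct2, THEN conjunct2, THEN conjunct2, THEN conjunct2, THEN conjunct1]
lemmas ax_choice = ZFC[unfolded models_ZFC_def, THEN conjunct2, THEN conjunct2, THEN conjunct2, THEN conjunct2, THEN conjunct2, THEN conjunct2, THEN conjunct2, THEN conjunct2]

abbreviation "Df \<equiv> Dp mem"
abbreviation "Tm \<equiv> Dt mem"

definition ext :: "'a \<Rightarrow> 'a set" where "ext a = {x. x \<epsilon> a}"

definition mk :: "'a set \<Rightarrow> 'a" where "mk A = (SOME c. ext c = A)"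

abbreviation "small A \<equiv> set_like mem A"

lemma in_ext [simp]: "x \<in> ext a \<longleftrightarrow> x \<epsilon> a"
  by (simp add: ext_def)

lemma small_alt: "small A \<longleftrightarrow> (\<exists>c. ext c = A)"
  by (auto simp: set_like_def ext_def)

lemma ext_mk: "small A \<Longrightarrow> ext (mk A) = A"
  unfolding mk_def small_alt by (rule someI_ex)

lemma mem_mk: "small A \<Longrightarrow> x \<epsilon> mk A \<longleftrightarrow> x \<in> A"
  unfolding ext_def[of "mk A"] using ext_mk[of A] by (simp only: in_ext[symmetric])

lemma small_ext [simp]: "small (ext a)"
  unfolding small_alt by blast

lemma ext_eqI: "(\<And>x. x \<epsilon> a \<longleftrightarrow> x \<epsilon> b) \<Longrightarrow> a = b"
  using ax_ext by simp

lemma mk_eq: "small A \<Longrightarrow> mk A = c \<longleftrightarrow> (\<forall>x. x \<epsilon> c \<longleftrightarrow> x \<in> A)"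
  using ext_mk[of A] by (metis ext_eqI mem_mk)

lemma foundation: "x \<epsilon> a \<Longrightarrow> \<exists>x. x \<epsilon> a \<and> (\<forall>y. y \<epsilon> x \<longrightarrow> \<not> y \<epsilon> a)"
  using ax_found by metis

lemma small_pair: "small {a, b}"
proof -
  have "\<exists>c. \<forall>x. x \<epsilon> c \<longleftrightarrow> x = a \<or> x = b" using ax_pair by simp
  then show ?thesis unfolding small_alt ext_def by auto
qed

lemma small_Union: "small {x. \<exists>y. y \<epsilon> a \<and> x \<epsilon> y}"
proof -
  have "\<exists>c. \<forall>x. x \<epsilon> c \<longleftrightarrow> (\<exists>y. y \<epsilon> a \<and> x \<epsilon> y)" using ax_Union by simp
  then show ?thesis unfolding small_alt ext_def by auto
qed

lemma small_Pow: "small {x. sub mem x a}"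
proof -
  have "\<exists>c. \<forall>x. x \<epsilon> c \<longleftrightarrow> sub mem x a" using ax_Pow by simp
  then show ?thesis unfolding small_alt ext_def by auto
qed

lemma small_sep:
  assumes "Df UNIV (\<lambda>s. P (s 0))" shows "small {x. x \<epsilon> a \<and> P x}"
proof -
  obtain p t where p: "\<And>s. P (s 0) = sat mem UNIV (merge s t) p" using assms unfolding Dp_def by auto
  \<comment> \<open>The separation scheme varies variable 0 only. All argument variables are merged
    into it, and the odd variables keep the parameters.\<close>
  let ?q = "ren p (\<lambda>i. if even i then 0 else i)"
  have "(\<lambda>i. ((merge t t)(0 := x)) (if even i then 0 else i)) = merge (\<lambda>_. x) t" for x
    by (rule ext) (auto simp: merge_def elim!: oddE)
  then have *: "sat mem UNIV ((merge t t)(0 := x)) ?q = P x" for x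
    unfolding sat_ren using p[of "\<lambda>_. x"] by simp
  have "\<exists>b. \<forall>x. x \<epsilon> b \<longleftrightarrow> x \<epsilon> a \<and> sat mem UNIV ((merge t t)(0 := x)) ?q"
    by (rule ax_sep[rule_format])
  then show ?thesis unfolding * small_alt ext_def by auto
qed

lemma small_subset: "small B \<Longrightarrow> Df UNIV (\<lambda>s. P (s 0)) \<Longrightarrow> (\<And>x. P x \<Longrightarrow> x \<in> B) \<Longrightarrow> small {x. P x}"
proof -
  assume B: "small B" and P: "Df UNIV (\<lambda>s. P (s 0))" and PB: "\<And>x. P x \<Longrightarrow> x \<in> B"
  have "{x. x \<epsilon> mk B \<and> P x} = {x. P x}" using PB B by (auto simp: mem_mk)
  then show ?thesis using small_sep[OF P, of "mk B"] by simp
qed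

lemma small_repl:
  assumes "Tm UNIV (\<lambda>s. F (s 0))" shows "small (F ` ext a)"
proof -
  have "Df UNIV (\<lambda>s. s 0 = F (s 1))" using assms by (simp add: Dt_def)
  then obtain p t where p: "\<And>s. (s 0 = F (s 1)) = sat mem UNIV (merge s t) p" unfolding Dp_def by auto
  \<comment> \<open>The scheme expects the argument in variable 0 and the value in 1, opposite to
    the order used here. Parameters move up by 2 to stay clear of variable 1, and \<open>?u\<close>
    undoes the shift.\<close>
  let ?f = "\<lambda>i::nat. if i = 0 then 1 else if even i then 0 else i + 2"
  let ?u = "\<lambda>i. t (i div 2 - 1)"
  have "(\<lambda>i. (?u(0 := x, 1 := y)) (?f i)) = merge (case_nat y (\<lambda>_. x)) t" for x y
    by (rule ext) (auto simp: merge_def elim!: oddE evenE split: nat.splits)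
  then have *: "sat mem UNIV (?u(0 := x, 1 := y)) (ren p ?f) = (y = F x)" for x y
    unfolding sat_ren using p[of "case_nat y (\<lambda>_. x)"] by simp
  have "(\<forall>x. x \<epsilon> a \<longrightarrow> (\<exists>!y. sat mem UNIV (?u(0 := x, 1 := y)) (ren p ?f))) \<longrightarrow>
        (\<exists>b. \<forall>y. y \<epsilon> b \<longleftrightarrow> (\<exists>x. x \<epsilon> a \<and> sat mem UNIV (?u(0 := x, 1 := y)) (ren p ?f)))"
    by (rule ax_repl[THEN spec, THEN spec, THEN spec])
  then obtain b where "\<forall>y. y \<epsilon> b \<longleftrightarrow> (\<exists>x. x \<epsilon> a \<and> y = F x)" unfolding * by auto
  then have "ext b = F ` ext a" by (auto simp: ext_def)
  then show ?thesis unfolding small_alt by blast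
qed

lemma Dt_mk:
  assumes "\<And>s. small {x. Q x s}" "Df K (\<lambda>s. Q (s 0) (\<lambda>i. s (Suc i)))"
  shows "Tm K (\<lambda>s. mk {x. Q x s})"
proof -
  have "Df K (\<lambda>s. \<forall>x. x \<epsilon> s 0 \<longleftrightarrow> Q x (\<lambda>i. s (Suc i)))"
    apply (intro dfi)
    using Dp_ren[OF assms(2), of "case_nat 0 (\<lambda>i. Suc (Suc i))"] by simp
  moreover have "s 0 = mk {x. Q x (\<lambda>i. s (Suc i))} \<longleftrightarrow> (\<forall>x. x \<epsilon> s 0 \<longleftrightarrow> Q x (\<lambda>i. s (Suc i)))" for s
    using mk_eq[OF assms(1)[of "\<lambda>i. s (Suc i)"], of "s 0"] by auto
  ultimately show ?thesis unfolding Dt_def by simp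
qed

subsection \<open>Pairs and functions\<close>

definition "emp = mk {}"
definition "up a b = mk {a, b}"
definition "bU a = mk {x. \<exists>y. y \<epsilon> a \<and> x \<epsilon> y}"
definition "pow a = mk {x. sub mem x a}"
definition "un a b = bU (up a b)"
definition "pr a b = up (up a a) (up a b)"
definition "succ a = un a (up a a)"
abbreviation "sing a \<equiv> up a a"

lemma small_empty [simp]: "small {}"
proof -
  have "small {x. x \<epsilon> undefined \<and> False}" by (rule small_sep) (intro dfi)
  then show ?thesis by simp
qed

lemma mem_emp [simp]: "\<not> x \<epsilon> emp" by (simp add: emp_def mem_mk)
lemma mem_up [simp]: "x \<epsilon> up a b \<longleftrightarrow> x = a \<or> x = b" by (simp add: up_def mem_mk small_pair)
lemma mem_bU [simp]: "x \<epsilon> bU a \<longleftrightarrow> (\<exists>y. y \<epsilon> a \<and> x \<epsilon> y)" by (simp add: bU_def mem_mk small_Union)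
lemma mem_pow [simp]: "x \<epsilon> pow a \<longleftrightarrow> sub mem x a" by (simp add: pow_def mem_mk small_Pow)
lemma mem_un [simp]: "x \<epsilon> un a b \<longleftrightarrow> x \<epsilon> a \<or> x \<epsilon> b" by (auto simp: un_def)
lemma mem_succ [simp]: "x \<epsilon> succ a \<longleftrightarrow> x \<epsilon> a \<or> x = a" by (simp add: succ_def)

lemma emp_iff: "a = emp \<longleftrightarrow> (\<forall>x. \<not> x \<epsilon> a)"
  using ext_eqI[of a emp] by auto

lemma up_eq: "up a b = up c d \<longleftrightarrow> (a = c \<and> b = d) \<or> (a = d \<and> b = c)"
proof
  assume h: "up a b = up c d"
  have "x \<epsilon> up a b \<longleftrightarrow> x \<epsilon> up c d" for x by (simp add: h)
  then have "x = a \<or> x = b \<longleftrightarrow> x = c \<or> x = d" for x by simp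
  then show "(a = c \<and> b = d) \<or> (a = d \<and> b = c)" by metis
next
  show "(a = c \<and> b = d) \<or> (a = d \<and> b = c) \<Longrightarrow> up a b = up c d"
    by (auto intro: ext_eqI)
qed

lemma pr_inj [simp]: "pr a b = pr c d \<longleftrightarrow> a = c \<and> b = d"
  unfolding pr_def up_eq by auto

lemma mem_sub: "sub mem a b \<Longrightarrow> x \<epsilon> a \<Longrightarrow> x \<epsilon> b"
  by (simp add: sub_def)

lemma is_upair_iff [simp]: "is_upair mem z x y \<longleftrightarrow> z = up x y"
  unfolding is_upair_def using ext_eqI[of z "up x y"] by auto

lemma is_pair_iff [simp]: "is_pair mem z x y \<longleftrightarrow> z = pr x y"
  unfolding is_pair_def pr_def by auto

lemma related_iff [simp]: "related mem r x y \<longleftrightarrow> pr x y \<epsilon> r"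
  unfolding related_def by auto

lemma Df_sub [dfi]: "Tm K T \<Longrightarrow> Tm K U \<Longrightarrow> Df K (\<lambda>s. sub mem (T s) (U s))"
  by (rule Dp_sub2[of mem K "sub mem"]) (unfold sub_def, (intro dfi)+)

lemma Tm_emp [dfi]: "Tm K (\<lambda>s. emp)"
  unfolding emp_def using Dt_mk[of "\<lambda>x s. False" K] by (simp add: Dp_const)

lemma Tm_up [dfi]: "Tm K T \<Longrightarrow> Tm K U \<Longrightarrow> Tm K (\<lambda>s. up (T s) (U s))"
proof (rule Dt_sub2[of mem K up])
  have "Df K (\<lambda>s. \<forall>x. x \<epsilon> s 0 \<longleftrightarrow> x = s 1 \<or> x = s 2)" by (intro dfi)
  moreover have "s 0 = up (s 1) (s 2) \<longleftrightarrow> (\<forall>x. x \<epsilon> s 0 \<longleftrightarrow> x = s 1 \<or> x = s 2)" for s :: "nat \<Rightarrow> 'a"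
    using ext_eqI[of "s 0" "up (s 1) (s 2)"] by auto
  ultimately show "Df K (\<lambda>s. s 0 = up (s 1) (s 2))" by simp
qed

lemma Tm_bU [dfi]: "Tm K T \<Longrightarrow> Tm K (\<lambda>s. bU (T s))"
proof (rule Dt_sub1[of mem K bU])
  have "Df K (\<lambda>s. \<forall>x. x \<epsilon> s 0 \<longleftrightarrow> (\<exists>y. y \<epsilon> s 1 \<and> x \<epsilon> y))" by (intro dfi)
  moreover have "s 0 = bU (s 1) \<longleftrightarrow> (\<forall>x. x \<epsilon> s 0 \<longleftrightarrow> (\<exists>y. y \<epsilon> s 1 \<and> x \<epsilon> y))" for s :: "nat \<Rightarrow> 'a"
    using ext_eqI[of "s 0" "bU (s 1)"] by auto
  ultimately show "Df K (\<lambda>s. s 0 = bU (s 1))" by simp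
qed

lemma Tm_pow [dfi]: "Tm K T \<Longrightarrow> Tm K (\<lambda>s. pow (T s))"
proof (rule Dt_sub1[of mem K pow])
  have "Df K (\<lambda>s. \<forall>x. x \<epsilon> s 0 \<longleftrightarrow> sub mem x (s 1))" by (intro dfi)
  moreover have "s 0 = pow (s 1) \<longleftrightarrow> (\<forall>x. x \<epsilon> s 0 \<longleftrightarrow> sub mem x (s 1))" for s :: "nat \<Rightarrow> 'a"
    using ext_eqI[of "s 0" "pow (s 1)"] by auto
  ultimately show "Df K (\<lambda>s. s 0 = pow (s 1))" by simp
qed

lemma Tm_un [dfi]: "Tm K T \<Longrightarrow> Tm K U \<Longrightarrow> Tm K (\<lambda>s. un (T s) (U s))"
  unfolding un_def by (intro dfi)

lemma Tm_succ [dfi]: "Tm K T \<Longrightarrow> Tm K (\<lambda>s. succ (T s))"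
  unfolding succ_def by (intro dfi)

lemma Tm_pr [dfi]: "Tm K T \<Longrightarrow> Tm K U \<Longrightarrow> Tm K (\<lambda>s. pr (T s) (U s))"
  unfolding pr_def by (intro dfi)

lemma pr_parts: "pr x y \<epsilon> r \<Longrightarrow> x \<epsilon> bU (bU r) \<and> y \<epsilon> bU (bU r)"
  unfolding mem_bU pr_def by (metis mem_up)

text \<open>For a function \<open>f\<close> the set \<open>{y. pr x y \<epsilon> f}\<close> is a singleton, and its union is the value;
  outside the domain the value is the empty set.\<close>

definition "app f x = bU (mk {y. pr x y \<epsilon> f})"

lemma small_image: "small {y. pr x y \<epsilon> f}"
proof (rule small_subset[of "ext (bU (bU f))"])
  show "Df UNIV (\<lambda>s. pr x (s 0) \<epsilon> f)" by (intro dfi)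
qed (use pr_parts in auto)

lemma Tm_app [dfi]: "Tm K T \<Longrightarrow> Tm K U \<Longrightarrow> Tm K (\<lambda>s. app (T s) (U s))"
proof (rule Dt_sub2[of mem K app])
  have "Tm K (\<lambda>s. bU (mk {y. pr (s 1) y \<epsilon> s 0}))"
    by (rule Tm_bU, rule Dt_mk[of "\<lambda>y s. pr (s 1) y \<epsilon> s 0"]) (rule small_image, intro dfi)
  then have "Df K (\<lambda>s. s 0 = app (s (Suc 0)) (s (Suc 1)))" unfolding app_def Dt_def by simp
  then show "Df K (\<lambda>s. s 0 = app (s 1) (s 2))" by (simp add: numeral_2_eq_2)
qed

lemma app_eq: "pr x y \<epsilon> f \<Longrightarrow> (\<And>z. pr x z \<epsilon> f \<Longrightarrow> z = y) \<Longrightarrow> app f x = y"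
proof (rule ext_eqI)
  fix w assume *: "pr x y \<epsilon> f" "\<And>z. pr x z \<epsilon> f \<Longrightarrow> z = y"
  have "{y. pr x y \<epsilon> f} = {y}" using * by blast
  then show "w \<epsilon> app f x \<longleftrightarrow> w \<epsilon> y" using mem_mk[OF small_image, of _ x f] by (simp add: app_def)
qed

definition "fn f a \<longleftrightarrow> is_fun_on mem f a"

lemma fn_alt: "fn f a \<longleftrightarrow> (\<forall>z. z \<epsilon> f \<longrightarrow> (\<exists>x y. x \<epsilon> a \<and> z = pr x y)) \<and> (\<forall>x. x \<epsilon> a \<longrightarrow> (\<exists>!y. pr x y \<epsilon> f))"
  unfolding fn_def is_fun_on_def by (simp add: Ex1_def)

lemma fn_app: "fn f a \<Longrightarrow> x \<epsilon> a \<Longrightarrow> pr x y \<epsilon> f \<longleftrightarrow> app f x = y"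
  unfolding fn_alt using app_eq by metis

lemma fn_dom: "fn f a \<Longrightarrow> pr x y \<epsilon> f \<Longrightarrow> x \<epsilon> a"
  unfolding fn_alt by (metis pr_inj)

lemma fn_mem: "fn f a \<Longrightarrow> z \<epsilon> f \<longleftrightarrow> (\<exists>x. x \<epsilon> a \<and> z = pr x (app f x))"
proof
  assume f: "fn f a"
  { assume "z \<epsilon> f"
    then obtain x y where xy: "x \<epsilon> a" "z = pr x y" using f unfolding fn_alt by blast
    then show "\<exists>x. x \<epsilon> a \<and> z = pr x (app f x)" using fn_app[OF f xy(1), of y] \<open>z \<epsilon> f\<close> by auto }
  { assume "\<exists>x. x \<epsilon> a \<and> z = pr x (app f x)"
    then show "z \<epsilon> f" using fn_app[OF f] by auto }
qed

lemma fn_eqI: "fn f a \<Longrightarrow> fn g a \<Longrightarrow> (\<And>x. x \<epsilon> a \<Longrightarrow> app f x = app g x) \<Longrightarrow> f = g"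
  by (rule ext_eqI) (auto simp: fn_mem)

definition "lam a F = mk ((\<lambda>x. pr x (F x)) ` ext a)"

lemma mem_lam: "Tm UNIV (\<lambda>s. F (s 0)) \<Longrightarrow> z \<epsilon> lam a F \<longleftrightarrow> (\<exists>x. x \<epsilon> a \<and> z = pr x (F x))"
proof -
  assume F: "Tm UNIV (\<lambda>s. F (s 0))"
  have "small ((\<lambda>x. pr x (F x)) ` ext a)" by (rule small_repl) (intro dfi F)
  then show ?thesis by (auto simp: lam_def mem_mk)
qed

lemma fn_lam: "Tm UNIV (\<lambda>s. F (s 0)) \<Longrightarrow> fn (lam a F) a"
  unfolding fn_alt by (auto simp: mem_lam)

lemma app_lam: "Tm UNIV (\<lambda>s. F (s 0)) \<Longrightarrow> x \<epsilon> a \<Longrightarrow> app (lam a F) x = F x"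
  by (rule app_eq) (auto simp: mem_lam)

definition "sep a P = mk {x. x \<epsilon> a \<and> P x}"

lemma mem_sep: "Df UNIV (\<lambda>s. P (s 0)) \<Longrightarrow> x \<epsilon> sep a P \<longleftrightarrow> x \<epsilon> a \<and> P x"
  by (simp add: sep_def mem_mk small_sep)

lemma not_mem_self [simp]: "\<not> x \<epsilon> x"
  using foundation[of x "sing x"] by auto

lemma not_mem_cycle: "x \<epsilon> y \<Longrightarrow> \<not> y \<epsilon> x"
  using foundation[of x "up x y"] by auto

definition "tra a \<longleftrightarrow> (\<forall>x y. x \<epsilon> a \<and> y \<epsilon> x \<longrightarrow> y \<epsilon> a)"

lemma traD: "tra a \<Longrightarrow> x \<epsilon> a \<Longrightarrow> y \<epsilon> x \<Longrightarrow> y \<epsilon> a"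
  unfolding tra_def by blast

lemma Df_tra [dfi]: "Tm K T \<Longrightarrow> Df K (\<lambda>s. tra (T s))"
  by (rule Dp_sub1[of mem K tra]) (unfold tra_def, (intro dfi)+)

section \<open>Ordinals and recursion\<close>

abbreviation "ord \<equiv> is_ordinal mem"

lemma ord_alt: "ord a \<longleftrightarrow> tra a \<and> (\<forall>x y. x \<epsilon> a \<and> y \<epsilon> a \<longrightarrow> x \<epsilon> y \<or> x = y \<or> y \<epsilon> x)"
  unfolding is_ordinal_def tra_def sub_def by blast

lemma Df_ord [dfi]: "Tm K T \<Longrightarrow> Df K (\<lambda>s. ord (T s))"
  by (rule Dp_sub1[of mem K ord]) (unfold ord_alt, (intro dfi)+)

lemma ord_trans: "ord a \<Longrightarrow> tra a" by (simp add: ord_alt)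

lemma ord_mem: assumes "ord a" "b \<epsilon> a" shows "ord b"
proof -
  have t: "\<And>x y. x \<epsilon> a \<Longrightarrow> y \<epsilon> x \<Longrightarrow> y \<epsilon> a" using assms unfolding ord_alt tra_def by blast
  have l: "\<And>x y. x \<epsilon> a \<Longrightarrow> y \<epsilon> a \<Longrightarrow> x \<epsilon> y \<or> x = y \<or> y \<epsilon> x" using assms unfolding ord_alt by blast
  have "y \<epsilon> b" if "x \<epsilon> b" "y \<epsilon> x" for x y
  proof -
    have "y \<epsilon> b \<or> y = b \<or> b \<epsilon> y" using l t that assms by metis
    moreover have "y \<noteq> b" using that not_mem_cycle by blast
    moreover have "\<not> b \<epsilon> y"
      using foundation[of x "un (up x y) (sing b)"] that by auto
    ultimately show ?thesis by blast
  qed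
  then show ?thesis unfolding ord_alt tra_def using l t assms by blast
qed

lemma least_mem:
  assumes "Df UNIV (\<lambda>s. P (s 0))" "x \<epsilon> a" "P x"
  shows "\<exists>x. x \<epsilon> a \<and> P x \<and> (\<forall>y. y \<epsilon> x \<and> y \<epsilon> a \<longrightarrow> \<not> P y)"
  using foundation[of x "sep a P"] assms by (auto simp: mem_sep)

lemma ord_least:
  assumes "Df UNIV (\<lambda>s. P (s 0))" "ord a" "P a"
  shows "\<exists>b. ord b \<and> P b \<and> (\<forall>c. c \<epsilon> b \<longrightarrow> \<not> P c) \<and> (b = a \<or> b \<epsilon> a)"
proof -
  obtain b where b: "b \<epsilon> succ a" "P b" "\<forall>y. y \<epsilon> b \<and> y \<epsilon> succ a \<longrightarrow> \<not> P y"
    using least_mem[OF assms(1), of a "succ a"] assms by auto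
  then have "ord b" using ord_mem assms by auto
  moreover have "\<not> P c" if "c \<epsilon> b" for c
    using b that assms ord_trans traD by (metis mem_succ)
  ultimately show ?thesis using b by auto
qed

lemma ord_subset: assumes "ord a" "ord b" "sub mem a b" "a \<noteq> b" shows "a \<epsilon> b"
proof -
  obtain z where "z \<epsilon> b" "\<not> z \<epsilon> a" using assms ext_eqI[of a b] by (auto simp: sub_def)
  moreover have "Df UNIV (\<lambda>s. \<not> s 0 \<epsilon> a)" by (intro dfi)
  ultimately obtain c where c: "c \<epsilon> b" "\<not> c \<epsilon> a" "\<forall>y. y \<epsilon> c \<and> y \<epsilon> b \<longrightarrow> y \<epsilon> a"
    using least_mem[of "\<lambda>z. \<not> z \<epsilon> a" z b] by auto
  have "c = a"
  proof (rule ext_eqI)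
    fix x show "x \<epsilon> c \<longleftrightarrow> x \<epsilon> a"
    proof
      assume "x \<epsilon> c" then show "x \<epsilon> a" using c assms ord_trans traD by metis
    next
      assume x: "x \<epsilon> a"
      then have "x \<epsilon> c \<or> x = c \<or> c \<epsilon> x" using assms c unfolding ord_alt sub_def by blast
      then show "x \<epsilon> c" using x c(2) assms ord_trans traD by metis
    qed
  qed
  then show ?thesis using c by simp
qed

lemma ord_linear: assumes "ord a" "ord b" shows "a \<epsilon> b \<or> a = b \<or> b \<epsilon> a"
proof -
  define c where "c = sep a (\<lambda>x. x \<epsilon> b)"
  have c: "x \<epsilon> c \<longleftrightarrow> x \<epsilon> a \<and> x \<epsilon> b" for x
    unfolding c_def by (rule mem_sep) (intro dfi)
  have oc: "ord c" using assms unfolding ord_alt tra_def c by blast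
  have s: "sub mem c a" "sub mem c b" by (auto simp: sub_def c)
  show ?thesis
  proof (cases "c = a \<or> c = b")
    case True then show ?thesis using s ord_subset assms by metis
  next
    case False
    then have "c \<epsilon> a" "c \<epsilon> b" using s ord_subset oc assms by auto
    then have "c \<epsilon> c" using c[of c] by blast
    then show ?thesis by simp
  qed
qed

lemma ord_succ: "ord a \<Longrightarrow> ord (succ a)"
  unfolding ord_alt tra_def by auto

lemma ord_class:
  assumes "\<And>x. x \<epsilon> a \<Longrightarrow> ord x" "tra a" shows "ord a"
  unfolding ord_alt using assms ord_linear by blast

lemma ord_emp: "ord emp"
  by (rule ord_class) (auto simp: tra_def)

text \<open>The von Neumann naturals of the model, possibly nonstandard ones. Facts about all of
  them need the internal induction \<open>natu_induct\<close> and thus a definable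
  predicate.\<close>

definition "natu x \<longleftrightarrow> ord x \<and> (\<forall>y. y = x \<or> y \<epsilon> x \<longrightarrow> y = emp \<or> (\<exists>z. z \<epsilon> y \<and> y = succ z))"

lemma Df_natu [dfi]: "Tm K T \<Longrightarrow> Df K (\<lambda>s. natu (T s))"
  by (rule Dp_sub1[of mem K natu]) (unfold natu_def, (intro dfi)+)

lemma natu_emp: "natu emp" by (simp add: natu_def ord_emp)
lemma natu_succ: "natu x \<Longrightarrow> natu (succ x)" by (auto simp: natu_def intro: ord_succ)
lemma natu_mem: "natu x \<Longrightarrow> y \<epsilon> x \<Longrightarrow> natu y"
  unfolding natu_def using ord_mem ord_trans traD by metis

lemma natu_induct:
  assumes "Df UNIV (\<lambda>s. P (s 0))" "P emp" "\<And>n. natu n \<Longrightarrow> P n \<Longrightarrow> P (succ n)" "natu n"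
  shows "P n"
proof (rule ccontr)
  assume "\<not> P n"
  then obtain b where b: "\<not> P b" "\<forall>c. c \<epsilon> b \<longrightarrow> P c" "b = n \<or> b \<epsilon> n"
    using ord_least[OF Dp_not[OF assms(1)], of n] assms(4) unfolding natu_def by blast
  then have "natu b" using assms natu_mem by auto
  then have "b = emp \<or> (\<exists>z. z \<epsilon> b \<and> b = succ z)" by (auto simp: natu_def)
  then show False using assms(2,3) b natu_mem[OF \<open>natu b\<close>] by auto
qed

lemma small_natu: "small {x. natu x}"
proof -
  have "\<exists>w. (\<exists>e. e \<epsilon> w \<and> (\<forall>x. \<not> x \<epsilon> e)) \<and>
      (\<forall>x. x \<epsilon> w \<longrightarrow> (\<exists>y. y \<epsilon> w \<and> (\<forall>z. z \<epsilon> y \<longleftrightarrow> z \<epsilon> x \<or> z = x)))"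
    by (rule ax_inf)
  then obtain w e where w: "e \<epsilon> w" "\<forall>x. \<not> x \<epsilon> e"
      "\<And>x. x \<epsilon> w \<Longrightarrow> \<exists>y. y \<epsilon> w \<and> (\<forall>z. z \<epsilon> y \<longleftrightarrow> z \<epsilon> x \<or> z = x)" by auto
  have "e = emp" using w emp_iff by simp
  have s: "succ x \<epsilon> w" if xw: "x \<epsilon> w" for x
  proof -
    obtain y where y: "y \<epsilon> w" "\<forall>z. z \<epsilon> y \<longleftrightarrow> z \<epsilon> x \<or> z = x" using w(3)[OF xw] by auto
    then have "y = succ x" by (intro ext_eqI) simp
    then show ?thesis using y by simp
  qed
  have "n \<epsilon> w" if "natu n" for n
    by (rule natu_induct[of "\<lambda>n. n \<epsilon> w"]) (use w s that \<open>e = emp\<close> in \<open>auto intro: dfi\<close>)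
  then show ?thesis by (intro small_subset[of "ext w"]) (auto intro: dfi)
qed

definition "om = mk {x. natu x}"

lemma mem_om [simp]: "x \<epsilon> om \<longleftrightarrow> natu x" by (simp add: om_def mem_mk small_natu)

lemma Tm_om [dfi]: "Tm K (\<lambda>s. om)"
  unfolding om_def by (rule Dt_mk) (rule small_natu, intro dfi)

end

text \<open>Recursion along a definable relation \<open>R\<close> on a definable class \<open>D\<close>. Set-likeness is replaced by the
  requirement that every point lies in an \<open>R\<close>-closed set, so that transitive closures along \<open>R\<close> are
  not needed.\<close>

locale recursion = zfc +
  fixes K :: "'a set" and D :: "'a \<Rightarrow> bool" and R :: "'a \<Rightarrow> 'a \<Rightarrow> bool" and G :: "'a \<Rightarrow> 'a \<Rightarrow> 'a"
  assumes dD0: "Dp mem K (\<lambda>s. D (s 0))" and dR0: "Dp mem K (\<lambda>s. R (s 0) (s 1))"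
    and dG0: "Dp mem K (\<lambda>s. s 0 = G (s 1) (s 2))"
    and closure: "\<And>x. D x \<Longrightarrow> \<exists>c. x \<epsilon> c \<and> (\<forall>y. y \<epsilon> c \<longrightarrow> D y) \<and> (\<forall>y z. y \<epsilon> c \<and> R z y \<longrightarrow> z \<epsilon> c)"
    and wf: "\<And>c x. x \<epsilon> c \<Longrightarrow> (\<forall>y. y \<epsilon> c \<longrightarrow> D y) \<Longrightarrow> \<exists>y. y \<epsilon> c \<and> (\<forall>z. z \<epsilon> c \<longrightarrow> \<not> R z y)"
begin

definition "apx c h \<longleftrightarrow> (\<forall>y. y \<epsilon> c \<longrightarrow> D y) \<and> (\<forall>y z. y \<epsilon> c \<and> R z y \<longrightarrow> z \<epsilon> c) \<and>
  (\<forall>y. y \<epsilon> c \<longrightarrow> (\<exists>w. (\<forall>u. u \<epsilon> w \<longleftrightarrow> (\<exists>z. R z y \<and> u = app h z)) \<and> app h y = G y w))"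

definition "good x \<longleftrightarrow> (\<exists>c h. apx c h \<and> x \<epsilon> c)"

definition "recf x = (if good x then THE v. \<exists>c h. apx c h \<and> x \<epsilon> c \<and> v = app h x else emp)"

lemma dD: "Dt mem K T \<Longrightarrow> Df K (\<lambda>s. D (T s))" by (rule Dp_sub1[OF dD0])
lemma dR: "Dt mem K T \<Longrightarrow> Dt mem K U \<Longrightarrow> Df K (\<lambda>s. R (T s) (U s))" by (rule Dp_sub2[OF dR0])
lemma dG: "Dt mem K T \<Longrightarrow> Dt mem K U \<Longrightarrow> Tm K (\<lambda>s. G (T s) (U s))" by (rule Dt_sub2[OF dG0])

lemma apx_unique:
  assumes 1: "apx c h" and 2: "apx c' h'" and x: "x \<epsilon> c" "x \<epsilon> c'"
  shows "app h x = app h' x"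
proof (rule ccontr)
  assume ne: "app h x \<noteq> app h' x"
  let ?P = "\<lambda>y. y \<epsilon> c' \<and> app h y \<noteq> app h' y"
  have P: "y \<epsilon> sep c ?P \<longleftrightarrow> y \<epsilon> c \<and> ?P y" for y by (rule mem_sep) (intro dfi)
  obtain y where y: "y \<epsilon> c" "?P y" "\<forall>z. z \<epsilon> c \<and> ?P z \<longrightarrow> \<not> R z y"
    using wf[of x "sep c ?P"] ne x 1 unfolding P apx_def by metis
  have cl: "z \<epsilon> c" "z \<epsilon> c'" if "R z y" for z using that y 1 2 unfolding apx_def by blast+
  then have eq: "app h z = app h' z" if "R z y" for z using that y by blast
  obtain w where w: "\<forall>u. u \<epsilon> w \<longleftrightarrow> (\<exists>z. R z y \<and> u = app h z)" "app h y = G y w"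
    using 1 y unfolding apx_def by meson
  obtain w' where w': "\<forall>u. u \<epsilon> w' \<longleftrightarrow> (\<exists>z. R z y \<and> u = app h' z)" "app h' y = G y w'"
    using 2 y unfolding apx_def by meson
  have "w = w'" by (rule ext_eqI) (use w w' eq in metis)
  then show False using w w' y by simp
qed

lemma recf_apx: "apx c h \<Longrightarrow> x \<epsilon> c \<Longrightarrow> recf x = app h x"
proof -
  assume h: "apx c h" "x \<epsilon> c"
  have "(THE v. \<exists>c h. apx c h \<and> x \<epsilon> c \<and> v = app h x) = app h x"
    by (rule the_equality) (use h apx_unique in blast)+
  then show ?thesis using h by (auto simp: recf_def good_def)
qed

lemma Df_apx: "Tm K T \<Longrightarrow> Tm K U \<Longrightarrow> Df K (\<lambda>s. apx (T s) (U s))"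
  by (rule Dp_sub2[of mem K apx]) (unfold apx_def, (intro dfi dD dR dG)+)

lemma Df_good: "Tm K T \<Longrightarrow> Df K (\<lambda>s. good (T s))"
  by (rule Dp_sub1[of mem K good]) (unfold good_def, (intro dfi Df_apx)+)

lemma Tm_recf: "Tm K T \<Longrightarrow> Tm K (\<lambda>s. recf (T s))"
proof (rule Dt_sub1[of mem K recf])
  have "Df K (\<lambda>s. (good (s 1) \<and> (\<exists>c h. apx c h \<and> s 1 \<epsilon> c \<and> s 0 = app h (s 1))) \<or> (\<not> good (s 1) \<and> s 0 = emp))"
    by (intro dfi Df_apx Df_good)
  moreover have e: "s 0 = recf (s 1) \<longleftrightarrow>
    (good (s 1) \<and> (\<exists>c h. apx c h \<and> s 1 \<epsilon> c \<and> s 0 = app h (s 1))) \<or> (\<not> good (s 1) \<and> s 0 = emp)" for s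
  proof (cases "good (s 1)")
    case True
    then obtain c h where h: "apx c h" "s 1 \<epsilon> c" unfolding good_def by blast
    show ?thesis using True h recf_apx by metis
  qed (simp add: recf_def)
  ultimately show "Df K (\<lambda>s. s 0 = recf (s 1))" unfolding e by blast
qed

lemma Tm_U: "Tm K T \<Longrightarrow> Tm UNIV T"
  unfolding Dt_def by (rule Dp_mono) auto

lemma Df_U: "Df K T \<Longrightarrow> Df UNIV T"
  by (rule Dp_mono) auto

lemma recf_eq0: "good x \<Longrightarrow> \<exists>w. (\<forall>u. u \<epsilon> w \<longleftrightarrow> (\<exists>z. R z x \<and> u = recf z)) \<and> recf x = G x w"
proof -
  assume "good x"
  then obtain c h where h: "apx c h" "x \<epsilon> c" unfolding good_def by auto
  then obtain w where w: "\<forall>u. u \<epsilon> w \<longleftrightarrow> (\<exists>z. R z x \<and> u = app h z)" "app h x = G x w"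
    unfolding apx_def by meson
  have "app h z = recf z" if "R z x" for z using h that recf_apx[OF h(1), of z] unfolding apx_def by metis
  then show ?thesis using w recf_apx[OF h] by metis
qed

lemma good_mem: "good x \<Longrightarrow> R y x \<Longrightarrow> good y"
  unfolding good_def apx_def by blast

text \<open>At an \<open>R\<close>-minimal point \<open>y\<close> without approximation all
  predecessors are good. One function then serves for all good points of a closed set
  \<open>c\<close> and for \<open>y\<close>: it is \<open>recf\<close> on the former, and at
  \<open>y\<close> it has the value prescribed by \<open>G\<close>.\<close>

lemma all_good: assumes "D x" shows "good x"
proof (rule ccontr)
  assume ng: "\<not> good x"
  obtain c where c: "x \<epsilon> c" "\<forall>y. y \<epsilon> c \<longrightarrow> D y" "\<forall>y z. y \<epsilon> c \<and> R z y \<longrightarrow> z \<epsilon> c"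
    using closure[OF assms] by blast
  let ?b = "sep c (\<lambda>y. \<not> good y)"
  have b: "y \<epsilon> ?b \<longleftrightarrow> y \<epsilon> c \<and> \<not> good y" for y
    by (rule mem_sep) (intro Df_U dfi Df_good)
  obtain y where y: "y \<epsilon> c" "\<not> good y" "\<forall>z. z \<epsilon> c \<and> \<not> good z \<longrightarrow> \<not> R z y"
    using wf[of x ?b] ng c unfolding b by metis
  have gy: "good z" if "R z y" for z using that y c by blast
  define w where "w = mk {u. \<exists>z. R z y \<and> u = recf z}"
  have sw: "small {u. \<exists>z. R z y \<and> u = recf z}"
  proof -
    have 1: "Df UNIV (\<lambda>s. R (s 0) y)"
      by (rule Dp_sub2[OF Df_U[OF dR0]]) (intro dfi)+
    have "small (recf ` ext (sep c (\<lambda>z. R z y)))"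
      by (intro small_repl Tm_U Tm_recf dfi)
    moreover have "recf ` ext (sep c (\<lambda>z. R z y)) = {u. \<exists>z. R z y \<and> u = recf z}"
      using c y by (auto simp: mem_sep[OF 1])
    ultimately show ?thesis by simp
  qed
  define c' where "c' = sep c (\<lambda>z. good z \<or> z = y)"
  have c': "z \<epsilon> c' \<longleftrightarrow> z \<epsilon> c \<and> (good z \<or> z = y)" for z
    unfolding c'_def by (rule mem_sep) (intro dfi Df_U[OF Df_good])
  have dF: "Tm UNIV (\<lambda>s. if s 0 = y then G y w else recf (s 0))"
    by (intro dfi Tm_U[OF Tm_recf])
  define h where "h = lam c' (\<lambda>z. if z = y then G y w else recf z)"
  have h: "app h z = (if z = y then G y w else recf z)" if "z \<epsilon> c'" for z
    unfolding h_def using app_lam[OF dF that] by simp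
  have ny: "z \<noteq> y" if "good z" for z using that y by auto
  have cl: "v \<epsilon> c'" if "z \<epsilon> c'" "R v z" for v z
    using that c' c gy good_mem by blast
  have eq: "app h v = recf v" if "z \<epsilon> c'" "R v z" for v z
    using h[OF cl[OF that]] that gy good_mem ny c' by metis
  have "apx c' h" unfolding apx_def
  proof (intro conjI allI impI)
    fix z assume z: "z \<epsilon> c'"
    have e: "(\<exists>v. R v z \<and> u = app h v) \<longleftrightarrow> (\<exists>v. R v z \<and> u = recf v)" for u
      using eq[OF z] by metis
    show "\<exists>w. (\<forall>u. u \<epsilon> w \<longleftrightarrow> (\<exists>v. R v z \<and> u = app h v)) \<and> app h z = G z w"
    proof (cases "z = y")
      case True
      then show ?thesis unfolding e using h[OF z] by (intro exI[of _ w]) (simp add: w_def mem_mk[OF sw])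
    next
      case False
      then have "good z" using z c' by auto
      then show ?thesis unfolding e using h[OF z] False recf_eq0[of z] by simp
    qed
  qed (use c' c cl in blast)+
  moreover have "y \<epsilon> c'" using c' y by simp
  ultimately show False using y unfolding good_def by blast
qed

lemma recf_small: assumes "D x" shows "small {u. \<exists>z. R z x \<and> u = recf z}"
  using recf_eq0[OF all_good[OF assms]] unfolding small_alt ext_def by blast

lemma recf_eq: assumes "D x" shows "recf x = G x (mk {u. \<exists>z. R z x \<and> u = recf z})"
proof -
  obtain w where w: "\<forall>u. u \<epsilon> w \<longleftrightarrow> (\<exists>z. R z x \<and> u = recf z)" "recf x = G x w"
    using recf_eq0[OF all_good[OF assms]] by blast
  then have "w = mk {u. \<exists>z. R z x \<and> u = recf z}"
    using mk_eq[OF recf_small[OF assms], of w] by auto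
  then show ?thesis using w by simp
qed

end

context zfc
begin

text \<open>Freezes all arguments but the first. Their values become parameters, hence
  \<open>UNIV\<close>. Smallness of a comprehension has to be checked in this form, for each
  assignment separately.\<close>

lemma Dp_inst:
  assumes "Df K Q" shows "Df UNIV (\<lambda>t. Q (case_nat (t 0) s))"
proof -
  obtain p u where p: "\<And>s. Q s = sat mem UNIV (merge s u) p" using assms unfolding Dp_def by auto
  have "Df UNIV (\<lambda>t. sat mem UNIV (\<lambda>i. (if i = 0 then (\<lambda>t. t 0) else (\<lambda>t. merge (case_nat undefined s) u i)) t) p)"
    by (rule Dp_sat) (auto intro: dfi)
  moreover have e: "(\<lambda>i. (if i = 0 then (\<lambda>t. t 0) else (\<lambda>t. merge (case_nat undefined s) u i)) t) = merge (case_nat (t 0) s) u" for t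
    by (rule ext) (auto simp: merge_def split: nat.splits)
  ultimately show ?thesis unfolding p e by blast
qed

lemma Dt_inst:
  assumes "Tm K T" shows "Tm UNIV (\<lambda>t. T (case_nat (t 0) s))"
proof -
  have 1: "Df K (\<lambda>t. t 0 = T (\<lambda>i. t (Suc i)))" using assms by (simp add: Dt_def)
  obtain p u where p: "\<And>t. (t 0 = T (\<lambda>i. t (Suc i))) = sat mem UNIV (merge t u) p" using 1 unfolding Dp_def by auto
  let ?c = "\<lambda>x y. case_nat x (case_nat y s)"
  have "Df UNIV (\<lambda>t. sat mem UNIV (\<lambda>i. (if i = 0 then (\<lambda>t. t 0) else if i = 2 then (\<lambda>t. t 1) else (\<lambda>t. merge (?c undefined undefined) u i)) t) p)"
    by (rule Dp_sat) (auto intro: dfi)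
  moreover have e: "(\<lambda>i. (if i = 0 then (\<lambda>t. t 0) else if i = 2 then (\<lambda>t. t 1) else (\<lambda>t. merge (?c undefined undefined) u i)) t) = merge (?c (t 0) (t 1)) u" for t
    by (rule ext) (auto simp: merge_def split: nat.splits elim!: evenE)
  ultimately have "Df UNIV (\<lambda>t. sat mem UNIV (merge (?c (t 0) (t 1)) u) p)" unfolding e by blast
  moreover have e2: "sat mem UNIV (merge (?c x y) u) p \<longleftrightarrow> x = T (case_nat y s)" for x y
  proof -
    have "(\<lambda>i. ?c x y (Suc i)) = case_nat y s" by (rule HOL.ext) simp
    then show ?thesis using p[of "?c x y"] by (simp only: nat.case)
  qed
  ultimately have "Df UNIV (\<lambda>t. t 0 = T (case_nat (t 1) s))" unfolding e2 by blast
  then show ?thesis unfolding Dt_def by simp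
qed

lemma Tm_sep [dfi]:
  assumes "Df K (\<lambda>s. Q (s 0) (\<lambda>i. s (Suc i)))" "Tm K T"
  shows "Tm K (\<lambda>s. sep (T s) (\<lambda>x. Q x s))"
  unfolding sep_def
proof (rule Dt_mk)
  fix s
  have "Df UNIV (\<lambda>t. Q (t 0) s)" using Dp_inst[OF assms(1), of s] by simp
  then show "small {x. x \<epsilon> T s \<and> Q x s}" by (rule small_sep)
next
  show "Df K (\<lambda>s. s 0 \<epsilon> T (\<lambda>i. s (Suc i)) \<and> Q (s 0) (\<lambda>i. s (Suc i)))"
    by (intro dfi assms(1) Dt_shift[OF assms(2)])
qed

lemma Tm_lam [dfi]:
  assumes "Tm K (\<lambda>s. F (s 0) (\<lambda>i. s (Suc i)))" "Tm K T"
  shows "Tm K (\<lambda>s. lam (T s) (\<lambda>x. F x s))"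
proof -
  have F: "Tm UNIV (\<lambda>t. F (t 0) s)" for s using Dt_inst[OF assms(1), of s] by simp
  have e: "((\<lambda>x. pr x (F x s)) ` ext (T s)) = {z. \<exists>x. x \<epsilon> T s \<and> z = pr x (F x s)}" for s by auto
  show ?thesis unfolding lam_def e
  proof (rule Dt_mk)
    fix s have "small ((\<lambda>x. pr x (F x s)) ` ext (T s))" by (rule small_repl) (intro dfi F)
    then show "small {z. \<exists>x. x \<epsilon> T s \<and> z = pr x (F x s)}" unfolding e .
  next
    show "Df K (\<lambda>s. \<exists>x. x \<epsilon> T (\<lambda>i. s (Suc i)) \<and> s 0 = pr x (F x (\<lambda>i. s (Suc i))))"
      using Dt_shift[OF assms(1), where f="case_nat 0 (\<lambda>i. Suc (Suc i))"]
      by (intro dfi Dt_shift[OF assms(2)]) simp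
  qed
qed

lemma Df_fn [dfi]: "Tm K T \<Longrightarrow> Tm K U \<Longrightarrow> Df K (\<lambda>s. fn (T s) (U s))"
  by (rule Dp_sub2[of mem K fn]) (unfold fn_alt Ex1_def, (intro dfi)+)

lemma succ_inj: "succ a = succ b \<Longrightarrow> a = b"
proof -
  assume h: "succ a = succ b"
  have "a \<epsilon> succ b" "b \<epsilon> succ a" using h mem_succ[of a a] mem_succ[of b b] by metis+
  then show ?thesis using not_mem_cycle by auto
qed

lemma succ_ne: "succ a \<noteq> emp" "emp \<noteq> succ a"
  using mem_succ[of a a] mem_emp by metis+

lemma iterate:
  assumes F: "Tm UNIV (\<lambda>s. F (s 0))"
  shows "\<exists>a. fn a om \<and> app a emp = x \<and> (\<forall>n. natu n \<longrightarrow> app a (succ n) = F (app a n))"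
proof -
  \<comment> \<open>The recursion runs along the predecessor relation, so the set of earlier values
    is a singleton except at \<open>emp\<close>, and \<open>bU\<close> extracts its element.\<close>
  let ?G = "\<lambda>z S. if z = emp then x else F (bU S)"
  have F': "Tm UNIV T \<Longrightarrow> Tm UNIV (\<lambda>s. F (T s))" for T
    by (rule Dt_sub1) (use F in \<open>simp_all add: Dt_def\<close>)
  interpret r: recursion mem UNIV natu "\<lambda>y z. natu y \<and> z = succ y" ?G
  proof
    show "Df UNIV (\<lambda>s. natu (s 0))" by (intro dfi)
    show "Df UNIV (\<lambda>s. natu (s 0) \<and> s 1 = succ (s 0))" by (intro dfi)
    show "Df UNIV (\<lambda>s. s 0 = ?G (s 1) (s 2))" by (intro dfi F')
    show "\<exists>c. x \<epsilon> c \<and> (\<forall>y. y \<epsilon> c \<longrightarrow> natu y) \<and> (\<forall>y z. y \<epsilon> c \<and> natu z \<and> y = succ z \<longrightarrow> z \<epsilon> c)" if "natu x" for x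
      by (rule exI[of _ om]) (use that in auto)
    show "\<exists>y. y \<epsilon> c \<and> (\<forall>z. z \<epsilon> c \<longrightarrow> \<not> (natu z \<and> y = succ z))" if "x \<epsilon> c" for c x
    proof -
      obtain y where "y \<epsilon> c" "\<forall>z. z \<epsilon> y \<longrightarrow> \<not> z \<epsilon> c" using foundation[of x c] \<open>x \<epsilon> c\<close> by blast
      then show ?thesis by (intro exI[of _ y]) auto
    qed
  qed
  let ?f = "lam om r.recf"
  have T: "Tm UNIV (\<lambda>s. r.recf (s 0))" by (intro r.Tm_recf dfi)
  have "r.recf emp = x" using r.recf_eq[OF natu_emp] by simp
  moreover have "r.recf (succ n) = F (r.recf n)" if "natu n" for n
  proof -
    have "{u. \<exists>z. (natu z \<and> succ n = succ z) \<and> u = r.recf z} = {r.recf n}"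
      using that succ_inj by auto
    moreover have "mk {a} = sing a" for a by (simp add: up_def)
    moreover have "bU (sing a) = a" for a by (rule ext_eqI) simp
    ultimately show ?thesis using r.recf_eq[OF natu_succ[OF that]] succ_ne by simp
  qed
  ultimately show ?thesis
    by (intro exI[of _ ?f]) (simp add: fn_lam[OF T] app_lam[OF T] natu_emp natu_succ)
qed

lemma ex_tra: "\<exists>c. tra c \<and> sub mem x c"
proof -
  have "Tm UNIV (\<lambda>s. bU (s 0))" by (intro dfi)
  from iterate[OF this, of x] obtain a where
    a: "fn a om" "app a emp = x" "\<And>n. natu n \<Longrightarrow> app a (succ n) = bU (app a n)" by blast
  have T: "Tm UNIV (\<lambda>s. app a (s 0))" by (intro dfi)
  define c where "c = bU (mk (app a ` ext om))"
  have c: "z \<epsilon> c \<longleftrightarrow> (\<exists>n. natu n \<and> z \<epsilon> app a n)" for z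
    unfolding c_def by (auto simp: mem_mk[OF small_repl[OF T]])
  have "tra c" unfolding tra_def c using a(3) natu_succ by (metis mem_bU)
  moreover have "sub mem x c" unfolding sub_def c using a(2) natu_emp by metis
  ultimately show ?thesis by blast
qed

lemma mem_induct:
  assumes "Df UNIV (\<lambda>s. P (s 0))" "\<And>x. (\<And>y. y \<epsilon> x \<Longrightarrow> P y) \<Longrightarrow> P x"
  shows "P x"
proof (rule ccontr)
  assume "\<not> P x"
  obtain c where c: "tra c" "sub mem (sing x) c" using ex_tra by blast
  then have "x \<epsilon> c" by (simp add: sub_def)
  then obtain y where "y \<epsilon> c" "\<not> P y" "\<forall>z. z \<epsilon> y \<and> z \<epsilon> c \<longrightarrow> P z"
    using least_mem[OF Dp_not[OF assms(1)], of x c] \<open>\<not> P x\<close> by blast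
  then show False using assms(2)[of y] traD[OF c(1)] by blast
qed

lemma recursion_mem:
  assumes "Df K (\<lambda>s. s 0 = G (s 1) (s 2))"
  shows "recursion mem K (\<lambda>_. True) mem G"
proof
  show "Df K (\<lambda>s. True)" by (intro dfi)
  show "Df K (\<lambda>s. s 0 \<epsilon> s 1)" by (intro dfi)
  show "\<exists>c. x \<epsilon> c \<and> (\<forall>y. y \<epsilon> c \<longrightarrow> True) \<and> (\<forall>y z. y \<epsilon> c \<and> z \<epsilon> y \<longrightarrow> z \<epsilon> c)" for x
    using ex_tra[of "sing x"] by (auto simp: sub_def tra_def)
  show "\<exists>y. y \<epsilon> c \<and> (\<forall>z. z \<epsilon> c \<longrightarrow> \<not> z \<epsilon> y)" if "x \<epsilon> c" for c x
    using foundation[OF that] by blast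
qed (rule assms)

section \<open>The cumulative hierarchy\<close>

text \<open>\<open>VV x\<close> is \<open>V\<^sub>\<alpha>\<close> for \<open>\<alpha>\<close> the rank of \<open>x\<close>.\<close>

definition "psu S = sep (pow (bU S)) (\<lambda>z. \<exists>t. t \<epsilon> S \<and> sub mem z t)"

lemma Tm_psu [dfi]: "Tm K T \<Longrightarrow> Tm K (\<lambda>s. psu (T s))"
  by (rule Dt_sub1[of mem K psu]) (unfold psu_def, (intro dfi)+)

lemma mem_psu: "z \<epsilon> psu S \<longleftrightarrow> (\<exists>t. t \<epsilon> S \<and> sub mem z t)"
proof -
  have "Df UNIV (\<lambda>s. \<exists>t. t \<epsilon> S \<and> sub mem (s 0) t)" by (intro dfi)
  from mem_sep[OF this] show ?thesis unfolding psu_def by (auto simp: sub_def)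
qed

interpretation VVr: recursion mem "{}" "\<lambda>_. True" mem "\<lambda>_. psu"
  by (rule recursion_mem) (intro dfi)

definition "VV = VVr.recf"

lemma Tm_VV [dfi]: "Tm K T \<Longrightarrow> Tm K (\<lambda>s. VV (T s))"
proof (rule Dt_sub1[of mem K VV])
  have "Tm {} (\<lambda>s. VV (s 0))" unfolding VV_def by (intro VVr.Tm_recf dfi)
  then have "Df K (\<lambda>s. s 0 = VV (s (Suc 0)))" unfolding Dt_def by (rule Dp_mono) simp
  then show "Df K (\<lambda>s. s 0 = VV (s 1))" by simp
qed

lemma mem_VV: "z \<epsilon> VV x \<longleftrightarrow> (\<exists>y. y \<epsilon> x \<and> sub mem z (VV y))"
proof -
  have "VV x = psu (mk {u. \<exists>y. y \<epsilon> x \<and> u = VV y})" unfolding VV_def by (rule VVr.recf_eq) simp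
  moreover have "small {u. \<exists>y. y \<epsilon> x \<and> u = VV y}" unfolding VV_def by (rule VVr.recf_small) simp
  ultimately show ?thesis by (auto simp: mem_psu mem_mk)
qed

lemma sub_refl [simp]: "sub mem x x" by (simp add: sub_def)
lemma sub_trans: "sub mem x y \<Longrightarrow> sub mem y z \<Longrightarrow> sub mem x z" by (simp add: sub_def)
lemma sub_antisym: "sub mem x y \<Longrightarrow> sub mem y x \<Longrightarrow> x = y" by (rule ext_eqI) (auto simp: sub_def)
lemma tra_sub: "tra x \<Longrightarrow> y \<epsilon> x \<Longrightarrow> sub mem y x" by (auto simp: sub_def tra_def)

lemma sub_VV: "sub mem x (VV x)"
proof (rule mem_induct[of "\<lambda>x. sub mem x (VV x)"])
  show "Df UNIV (\<lambda>s. sub mem (s 0) (VV (s 0)))" by (intro dfi)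
  fix x assume "\<And>y. y \<epsilon> x \<Longrightarrow> sub mem y (VV y)"
  then have "\<And>y. y \<epsilon> x \<Longrightarrow> y \<epsilon> VV x" unfolding mem_VV[of _ x] by blast
  then show "sub mem x (VV x)" by (simp add: sub_def)
qed

lemma VV_mono: "y \<epsilon> x \<Longrightarrow> VV y \<epsilon> VV x"
  unfolding mem_VV[of _ x] by auto

lemma VV_super: "z \<epsilon> VV x \<Longrightarrow> sub mem w z \<Longrightarrow> w \<epsilon> VV x"
  unfolding mem_VV using sub_trans by blast

lemma VV_tra: "tra (VV x)"
proof (rule mem_induct[of "\<lambda>x. tra (VV x)"])
  show "Df UNIV (\<lambda>s. tra (VV (s 0)))" by (intro dfi)
  fix x assume IH: "\<And>y. y \<epsilon> x \<Longrightarrow> tra (VV y)"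
  show "tra (VV x)" unfolding tra_def
  proof (intro allI impI)
    fix z w assume h: "z \<epsilon> VV x \<and> w \<epsilon> z"
    then obtain y where y: "y \<epsilon> x" "sub mem z (VV y)" unfolding mem_VV by blast
    then have "w \<epsilon> VV y" using h by (auto simp: sub_def)
    then show "w \<epsilon> VV x" using y tra_sub[OF IH] unfolding mem_VV[of _ x] by blast
  qed
qed

lemma VV_le: "sub mem x (VV b) \<Longrightarrow> sub mem (VV x) (VV b)"
proof -
  have "\<forall>b. sub mem x (VV b) \<longrightarrow> sub mem (VV x) (VV b)"
  proof (rule mem_induct[of "\<lambda>x. \<forall>b. sub mem x (VV b) \<longrightarrow> sub mem (VV x) (VV b)"])
    show "Df UNIV (\<lambda>s. \<forall>b. sub mem (s 0) (VV b) \<longrightarrow> sub mem (VV (s 0)) (VV b))" by (intro dfi)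
    fix x assume IH: "\<And>y. y \<epsilon> x \<Longrightarrow> \<forall>b. sub mem y (VV b) \<longrightarrow> sub mem (VV y) (VV b)"
    show "\<forall>b. sub mem x (VV b) \<longrightarrow> sub mem (VV x) (VV b)"
    proof (intro allI impI)
      fix b assume b: "sub mem x (VV b)"
      show "sub mem (VV x) (VV b)" unfolding sub_def[of mem "VV x"]
      proof (intro allI impI)
        fix z assume "z \<epsilon> VV x"
        then obtain y where y: "y \<epsilon> x" "sub mem z (VV y)" unfolding mem_VV by blast
        then have "y \<epsilon> VV b" using b by (auto simp: sub_def)
        then obtain c where c: "c \<epsilon> b" "sub mem y (VV c)" unfolding mem_VV by blast
        then have "sub mem z (VV c)" using IH y sub_trans by blast
        then show "z \<epsilon> VV b" using c unfolding mem_VV[of z b] by blast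
      qed
    qed
  qed
  then show "sub mem x (VV b) \<Longrightarrow> sub mem (VV x) (VV b)" by blast
qed

lemma VV_idem: "VV (VV x) = VV x"
  by (rule sub_antisym) (rule VV_le, simp, rule sub_VV)

text \<open>Set induction without ordinals. If \<open>z\<close> is a subset of \<open>VV b\<close>
  for some \<open>b \<epsilon> y\<close> and not in \<open>VV x\<close>, then no \<open>VV a\<close>
  with \<open>a \<epsilon> x\<close> can include \<open>VV b\<close>, so by induction all of them
  are elements of \<open>VV b\<close>, and \<open>VV x\<close> is a subset of it.\<close>

lemma VV_linear: "VV x \<epsilon> VV y \<or> sub mem (VV y) (VV x)"
proof -
  have "\<forall>y. VV x \<epsilon> VV y \<or> sub mem (VV y) (VV x)"
  proof (rule mem_induct[of "\<lambda>x. \<forall>y. VV x \<epsilon> VV y \<or> sub mem (VV y) (VV x)"])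
    show "Df UNIV (\<lambda>s. \<forall>y. VV (s 0) \<epsilon> VV y \<or> sub mem (VV y) (VV (s 0)))" by (intro dfi)
    fix x assume IH: "\<And>a. a \<epsilon> x \<Longrightarrow> \<forall>y. VV a \<epsilon> VV y \<or> sub mem (VV y) (VV a)"
    show "\<forall>y. VV x \<epsilon> VV y \<or> sub mem (VV y) (VV x)"
    proof (intro allI disjCI)
      fix y assume n: "\<not> sub mem (VV y) (VV x)"
      then obtain z b where z: "\<not> z \<epsilon> VV x" "sub mem z (VV b)" "b \<epsilon> y"
        unfolding sub_def[of mem "VV y"] mem_VV[of _ y] by blast
      have "sub mem (VV x) (VV b)" unfolding sub_def[of mem "VV x"]
      proof (intro allI impI)
        fix w assume "w \<epsilon> VV x"
        then obtain a where a: "a \<epsilon> x" "sub mem w (VV a)" unfolding mem_VV[of w] by blast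
        have "VV a \<epsilon> VV b \<or> sub mem (VV b) (VV a)" using IH a by blast
        then show "w \<epsilon> VV b"
        proof
          assume "sub mem (VV b) (VV a)"
          then have "sub mem z (VV a)" using z sub_trans by blast
          then show ?thesis using z a unfolding mem_VV[of z x] by blast
        qed (use a VV_super in blast)
      qed
      then show "VV x \<epsilon> VV y" using z unfolding mem_VV[of _ y] by blast
    qed
  qed
  then show ?thesis by blast
qed

text \<open>Levels are the sets \<open>V\<^sub>\<lambda>\<close> with \<open>\<lambda>\<close> a limit ordinal.\<close>

definition "level v \<longleftrightarrow> (\<exists>x. x \<epsilon> v) \<and> VV v = v \<and> (\<forall>x. x \<epsilon> v \<longrightarrow> sing x \<epsilon> v)"

lemma Df_level [dfi]: "Tm K T \<Longrightarrow> Df K (\<lambda>s. level (T s))"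
  by (rule Dp_sub1[of mem K level]) (unfold level_def, (intro dfi)+)

lemma level_tra: "level v \<Longrightarrow> tra v" using VV_tra[of v] by (simp add: level_def)
lemma level_memD: "level v \<Longrightarrow> x \<epsilon> v \<Longrightarrow> y \<epsilon> x \<Longrightarrow> y \<epsilon> v" using level_tra traD by blast
lemma level_super: "level v \<Longrightarrow> x \<epsilon> v \<Longrightarrow> sub mem y x \<Longrightarrow> y \<epsilon> v" using VV_super[of x v y] by (simp add: level_def)
lemma level_sing: "level v \<Longrightarrow> x \<epsilon> v \<Longrightarrow> sing x \<epsilon> v" by (simp add: level_def)

lemma level_VV: "level v \<Longrightarrow> x \<epsilon> v \<Longrightarrow> VV x \<epsilon> v"
proof -
  assume v: "level v" "x \<epsilon> v"
  then have "x \<epsilon> VV v" by (simp add: level_def)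
  then obtain b where b: "b \<epsilon> v" "sub mem x (VV b)" unfolding mem_VV by blast
  then have "VV x \<epsilon> VV v" using VV_le unfolding mem_VV[of _ v] by blast
  then show ?thesis using v by (simp add: level_def)
qed

lemma level_pow: "level v \<Longrightarrow> x \<epsilon> v \<Longrightarrow> pow x \<epsilon> v"
proof -
  assume v: "level v" "x \<epsilon> v"
  have "sub mem (pow x) (VV (sing x))"
    using sub_VV[of x] sub_trans by (auto simp: sub_def[of mem "pow x"] mem_VV)
  then show ?thesis using level_super level_VV level_sing v by blast
qed

lemma level_up: "level v \<Longrightarrow> x \<epsilon> v \<Longrightarrow> y \<epsilon> v \<Longrightarrow> up x y \<epsilon> v"
proof -
  have *: "up x y \<epsilon> v" if v: "level v" "x \<epsilon> v" "y \<epsilon> v" and s: "sub mem (VV x) (VV y)" for x y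
  proof -
    have "sub mem x (VV y)" using s sub_VV sub_trans by blast
    then have "sub mem (up x y) (VV (sing y))" using sub_VV[of y] by (auto simp: sub_def[of mem "up x y"] mem_VV)
    then show ?thesis using level_super level_VV level_sing v by blast
  qed
  assume v: "level v" "x \<epsilon> v" "y \<epsilon> v"
  have "sub mem (VV x) (VV y) \<or> sub mem (VV y) (VV x)"
    using VV_linear[of x y] tra_sub[OF VV_tra] by blast
  then show ?thesis using *[OF v] *[OF v(1,3,2)] up_eq by metis
qed

lemma level_pr: "level v \<Longrightarrow> x \<epsilon> v \<Longrightarrow> y \<epsilon> v \<Longrightarrow> pr x y \<epsilon> v"
  unfolding pr_def by (intro level_up)

lemma level_prD: "level v \<Longrightarrow> pr x y \<epsilon> v \<Longrightarrow> x \<epsilon> v \<and> y \<epsilon> v"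
  unfolding pr_def using level_memD mem_up by metis

lemma level_bU: "level v \<Longrightarrow> x \<epsilon> v \<Longrightarrow> bU x \<epsilon> v"
proof -
  assume v: "level v" "x \<epsilon> v"
  have "sub mem (bU x) (VV x)" using sub_VV[of x] traD[OF VV_tra] by (auto simp: sub_def)
  then show ?thesis using level_super level_VV v by blast
qed

lemma level_un: "level v \<Longrightarrow> x \<epsilon> v \<Longrightarrow> y \<epsilon> v \<Longrightarrow> un x y \<epsilon> v"
  unfolding un_def by (intro level_bU level_up)

lemma level_succ: "level v \<Longrightarrow> x \<epsilon> v \<Longrightarrow> succ x \<epsilon> v"
  unfolding succ_def by (intro level_un level_up)

lemma level_emp: "level v \<Longrightarrow> emp \<epsilon> v"
  using level_super[of v _ emp] by (auto simp: level_def sub_def)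

lemma level_linear: "level v \<Longrightarrow> level w \<Longrightarrow> v \<epsilon> w \<or> v = w \<or> w \<epsilon> v"
  using VV_linear[of v w] VV_linear[of w v] sub_antisym[of v w] unfolding level_def by auto

lemma level_Union:
  assumes "x \<epsilon> c" "\<And>v. v \<epsilon> c \<Longrightarrow> level v" shows "level (bU c)"
  unfolding level_def
proof (intro conjI)
  obtain y where "y \<epsilon> x" using assms unfolding level_def by blast
  then show "\<exists>x. x \<epsilon> bU c" using assms(1) by auto
  show "VV (bU c) = bU c"
  proof (rule sub_antisym)
    show "sub mem (VV (bU c)) (bU c)" unfolding sub_def[of mem "VV (bU c)"]
    proof (intro allI impI)
      fix z assume "z \<epsilon> VV (bU c)"
      then obtain y where y: "y \<epsilon> bU c" "sub mem z (VV y)" using mem_VV[of z "bU c"] by blast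
      then obtain v where v: "v \<epsilon> c" "y \<epsilon> v" by auto
      then have "z \<epsilon> VV v" using y mem_VV[of z v] by blast
      then show "z \<epsilon> bU c" using v assms(2)[OF v(1)] unfolding level_def mem_bU by metis
    qed
  qed (rule sub_VV)
  show "\<forall>x. x \<epsilon> bU c \<longrightarrow> sing x \<epsilon> bU c" using assms level_sing by (metis mem_bU)
qed

lemma ex_level: "\<exists>v. level v \<and> x \<epsilon> v"
proof -
  have "Tm UNIV (\<lambda>s. sing (s 0))" by (intro dfi)
  from iterate[OF this, of x] obtain a where a: "fn a om" "app a emp = x" "\<And>n. natu n \<Longrightarrow> app a (succ n) = sing (app a n)"
    by blast
  have T: "Tm UNIV (\<lambda>s. app a (s 0))" by (intro dfi)
  define w where "w = mk (app a ` ext om)"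
  have w: "z \<epsilon> w \<longleftrightarrow> (\<exists>n. natu n \<and> z = app a n)" for z
    unfolding w_def mem_mk[OF small_repl[OF T]] by auto
  have x: "x \<epsilon> w" using a natu_emp w by metis
  have "level (VV w)" unfolding level_def VV_idem
  proof (intro conjI allI impI refl)
    show "\<exists>x. x \<epsilon> VV w" using x sub_VV[of w] by (auto simp: sub_def)
    fix z assume "z \<epsilon> VV w"
    then obtain n where n: "natu n" "sub mem z (VV (app a n))" unfolding mem_VV[of _ w] w by blast
    then have "sub mem (sing z) (VV (app a (succ n)))"
      using a(3) by (auto simp: sub_def[of mem "sing z"] mem_VV[of z])
    moreover have "app a (succ n) \<epsilon> w" using n natu_succ w by blast
    ultimately show "sing z \<epsilon> VV w" unfolding mem_VV[of _ w] by blast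
  qed
  moreover have "x \<epsilon> VV w" using x sub_VV[of w] by (auto simp: sub_def)
  ultimately show ?thesis by blast
qed

text \<open>Provides, inside a level, sets large enough to serve as domains of partial enumerations
  of the hierarchy; \<open>level_alt\<close> needs them.\<close>

lemma level_VV_sing: "level v \<Longrightarrow> x \<epsilon> v \<Longrightarrow> \<exists>d. d \<epsilon> v \<and> tra d \<and> x \<epsilon> d \<and> (\<forall>y. y \<epsilon> d \<longrightarrow> VV y \<epsilon> d) \<and> (\<forall>y z. y \<epsilon> d \<and> sub mem z y \<longrightarrow> z \<epsilon> d)"
proof (rule exI[of _ "VV (sing x)"], intro conjI allI impI)
  assume v: "level v" "x \<epsilon> v"
  show "VV (sing x) \<epsilon> v" using v by (intro level_VV level_sing)
  show "x \<epsilon> VV (sing x)" using sub_VV by (auto simp: mem_VV[of x])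
  show "VV y \<epsilon> VV (sing x)" if "y \<epsilon> VV (sing x)" for y using that VV_le unfolding mem_VV[of _ "sing x"] by blast
qed (auto intro: VV_tra VV_super)

subsection \<open>Least levels, collection, choice\<close>

text \<open>The intersection of all levels with \<open>P\<close>, hence the least one, since levels
  are well-ordered. It is empty if there is none, so \<open>lev\<close> is a total definable
  term.\<close>

definition "lev P = mk {x. (\<exists>v. level v \<and> P v) \<and> (\<forall>v. level v \<and> P v \<longrightarrow> x \<epsilon> v)}"

lemma lev_small:
  assumes "Df UNIV (\<lambda>s. P (s 0))" shows "small {x. (\<exists>v. level v \<and> P v) \<and> (\<forall>v. level v \<and> P v \<longrightarrow> x \<epsilon> v)}"
proof (cases "\<exists>v. level v \<and> P v")
  case True
  then obtain v where v: "level v" "P v" by blast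
  have P: "Tm UNIV T \<Longrightarrow> Df UNIV (\<lambda>s. P (T s))" for T by (rule Dp_sub1[OF assms])
  have "small {x. x \<epsilon> v \<and> (\<forall>v. level v \<and> P v \<longrightarrow> x \<epsilon> v)}"
    by (rule small_sep) (intro dfi P)
  moreover have "{x. x \<epsilon> v \<and> (\<forall>v. level v \<and> P v \<longrightarrow> x \<epsilon> v)} = {x. (\<exists>v. level v \<and> P v) \<and> (\<forall>v. level v \<and> P v \<longrightarrow> x \<epsilon> v)}"
    using v by blast
  ultimately show ?thesis by simp
next
  case False
  then have "{x. (\<exists>v. level v \<and> P v) \<and> (\<forall>v. level v \<and> P v \<longrightarrow> x \<epsilon> v)} = {}" by blast
  then show ?thesis by (metis small_empty)
qed

lemma Tm_lev [dfi]:
  assumes "Df K (\<lambda>s. P (s 0) (\<lambda>i. s (Suc i)))" shows "Tm K (\<lambda>s. lev (\<lambda>v. P v s))"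
  unfolding lev_def
proof (rule Dt_mk)
  fix s
  have "Df UNIV (\<lambda>t. P (t 0) s)" using Dp_inst[OF assms(1), of s] by simp
  then show "small {x. (\<exists>v. level v \<and> P v s) \<and> (\<forall>v. level v \<and> P v s \<longrightarrow> x \<epsilon> v)}" by (rule lev_small)
next
  have "Df K (\<lambda>s. P (s 0) (\<lambda>i. s (Suc (Suc i))))"
    using Dp_ren[OF assms, of "case_nat 0 (\<lambda>i. Suc (Suc i))"] by simp
  then show "Df K (\<lambda>s. (\<exists>v. level v \<and> P v (\<lambda>i. s (Suc i))) \<and> (\<forall>v. level v \<and> P v (\<lambda>i. s (Suc i)) \<longrightarrow> s 0 \<epsilon> v))"
    by (intro dfi)
qed

lemma level_least:
  assumes "Df UNIV (\<lambda>s. P (s 0))" "level v" "P v"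
  shows "\<exists>w. level w \<and> P w \<and> (\<forall>u. level u \<and> P u \<longrightarrow> w = u \<or> w \<epsilon> u)"
proof -
  have "Df UNIV (\<lambda>s. level (s 0) \<and> P (s 0))" by (intro dfi assms)
  from least_mem[OF this, of v "succ v"]
  obtain w where w: "w \<epsilon> succ v" "level w" "P w" "\<And>y. y \<epsilon> w \<Longrightarrow> y \<epsilon> succ v \<Longrightarrow> \<not> (level y \<and> P y)"
    using assms by auto
  have "w = u \<or> w \<epsilon> u" if "level u" "P u" for u
  proof -
    have "\<not> u \<epsilon> w" using w that level_memD[OF assms(2)] by auto
    then show ?thesis using level_linear that w by blast
  qed
  then show ?thesis using w by blast
qed

lemma lev_props:
  assumes P: "Df UNIV (\<lambda>s. P (s 0))" and v: "level v" "P v"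
  shows "level (lev P)" "P (lev P)"
proof -
  obtain w where w: "level w" "P w" "\<And>u. level u \<and> P u \<Longrightarrow> w = u \<or> w \<epsilon> u" using level_least[OF assms] by blast
  have "lev P = w"
  proof (rule ext_eqI)
    fix x show "x \<epsilon> lev P \<longleftrightarrow> x \<epsilon> w" unfolding lev_def mem_mk[OF lev_small[OF P]]
      using w level_memD by blast
  qed
  then show "level (lev P)" "P (lev P)" using w by auto
qed

lemma Tm_inst: "Tm UNIV (\<lambda>s. F (s 0)) \<Longrightarrow> Tm UNIV T \<Longrightarrow> Tm UNIV (\<lambda>s. F (T s))"
  by (rule Dt_sub1) (simp_all add: Dt_def)

text \<open>Scott's trick: the witnesses for \<open>x\<close> may form a proper class, but the least
  level containing one of them is a set, and replacement applies to it.\<close>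

lemma collection:
  assumes R: "Df UNIV (\<lambda>s. R (s 0) (s 1))"
  shows "\<exists>b. \<forall>x. x \<epsilon> a \<and> (\<exists>y. R x y) \<longrightarrow> (\<exists>y. y \<epsilon> b \<and> R x y)"
proof -
  have R': "Tm UNIV T \<Longrightarrow> Tm UNIV U \<Longrightarrow> Df UNIV (\<lambda>s. R (T s) (U s))" for T U by (rule Dp_sub2[OF R])
  define F where "F x = lev (\<lambda>v. \<exists>y. y \<epsilon> v \<and> R x y)" for x
  have T: "Tm UNIV (\<lambda>s. F (s 0))" unfolding F_def by (intro dfi R')
  define b where "b = bU (mk (F ` ext a))"
  have b: "z \<epsilon> b \<longleftrightarrow> (\<exists>x. x \<epsilon> a \<and> z \<epsilon> F x)" for z unfolding b_def by (auto simp: mem_mk[OF small_repl[OF T]])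
  show ?thesis
  proof (rule exI[of _ b], intro allI impI)
    fix x assume x: "x \<epsilon> a \<and> (\<exists>y. R x y)"
    then obtain y v where y: "R x y" "level v" "y \<epsilon> v" using ex_level by blast
    have "\<exists>y. y \<epsilon> F x \<and> R x y" unfolding F_def
      by (rule lev_props(2)[of "\<lambda>v. \<exists>y. y \<epsilon> v \<and> R x y" v]) (use y in \<open>auto intro!: dfi R'\<close>)
    then show "\<exists>y. y \<epsilon> b \<and> R x y" using x b by blast
  qed
qed

lemma choice_fn:
  assumes "\<And>x. x \<epsilon> a \<Longrightarrow> \<exists>z. z \<epsilon> x"
  shows "\<exists>f. \<forall>x. x \<epsilon> a \<longrightarrow> app f x \<epsilon> x"
proof -
  \<comment> \<open>The axiom of choice is given for disjoint families, so each \<open>x\<close> is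
    replaced by its copy consisting of the pairs \<open>pr z x\<close>.\<close>
  define F where "F x = lam x (\<lambda>z. x)" for x
  have F: "p \<epsilon> F x \<longleftrightarrow> (\<exists>z. z \<epsilon> x \<and> p = pr z x)" for p x unfolding F_def by (rule mem_lam) (intro dfi)
  have T: "Tm UNIV (\<lambda>s. F (s 0))" unfolding F_def by (intro dfi)
  define A where "A = mk (F ` ext a)"
  have A: "y \<epsilon> A \<longleftrightarrow> (\<exists>x. x \<epsilon> a \<and> y = F x)" for y unfolding A_def by (auto simp: mem_mk[OF small_repl[OF T]])
  have 1: "\<forall>x. x \<epsilon> A \<longrightarrow> (\<exists>z. z \<epsilon> x)" unfolding A using assms F by blast
  have 2: "\<forall>x y z. x \<epsilon> A \<and> y \<epsilon> A \<and> z \<epsilon> x \<and> z \<epsilon> y \<longrightarrow> x = y" unfolding A using F pr_inj by metis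
  obtain c where c: "\<And>x. x \<epsilon> A \<Longrightarrow> \<exists>!z. z \<epsilon> x \<and> z \<epsilon> c"
    using ax_choice[THEN spec[of _ A]] 1 2 by blast
  define f where "f = sep (pow (pow (un a (bU a)))) (\<lambda>p. \<exists>x z. x \<epsilon> a \<and> z \<epsilon> x \<and> p = pr x z \<and> pr z x \<epsilon> c)"
  have f: "p \<epsilon> f \<longleftrightarrow> p \<epsilon> pow (pow (un a (bU a))) \<and> (\<exists>x z. x \<epsilon> a \<and> z \<epsilon> x \<and> p = pr x z \<and> pr z x \<epsilon> c)" for p
    unfolding f_def by (rule mem_sep) (intro dfi)
  have P: "pr x z \<epsilon> pow (pow (un a (bU a)))" if "x \<epsilon> a" "z \<epsilon> x" for x z
    using that by (auto simp: pr_def sub_def)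
  show ?thesis
  proof (rule exI[of _ f], intro allI impI)
    fix x assume x: "x \<epsilon> a"
    then have "\<exists>!p. p \<epsilon> F x \<and> p \<epsilon> c" using c A by blast
    then obtain z where z: "z \<epsilon> x" "pr z x \<epsilon> c" "\<And>z'. z' \<epsilon> x \<Longrightarrow> pr z' x \<epsilon> c \<Longrightarrow> z' = z"
      unfolding F by (metis pr_inj)
    have "app f x = z"
    proof (rule app_eq)
      show "pr x z \<epsilon> f" unfolding f using x z P by blast
      show "z' = z" if "pr x z' \<epsilon> f" for z' using that z(3) unfolding f by auto
    qed
    then show "app f x \<epsilon> x" using z(1) by simp
  qed
qed

lemma choice:
  assumes R: "Df UNIV (\<lambda>s. R (s 0) (s 1))" and ex: "\<And>x. x \<epsilon> a \<Longrightarrow> \<exists>y. R x y"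
  shows "\<exists>f. fn f a \<and> (\<forall>x. x \<epsilon> a \<longrightarrow> R x (app f x))"
proof -
  have R': "Tm UNIV T \<Longrightarrow> Tm UNIV U \<Longrightarrow> Df UNIV (\<lambda>s. R (T s) (U s))" for T U by (rule Dp_sub2[OF R])
  obtain b where b: "\<And>x. x \<epsilon> a \<Longrightarrow> \<exists>y. y \<epsilon> b \<and> R x y" using collection[OF R, of a] ex by blast
  define F where "F x = sep b (\<lambda>y. R x y)" for x
  have F: "y \<epsilon> F x \<longleftrightarrow> y \<epsilon> b \<and> R x y" for x y unfolding F_def by (rule mem_sep) (intro dfi R')
  have T: "Tm UNIV (\<lambda>s. F (s 0))" unfolding F_def by (intro dfi R')
  have A: "y \<epsilon> mk (F ` ext a) \<longleftrightarrow> (\<exists>x. x \<epsilon> a \<and> y = F x)" for y by (auto simp: mem_mk[OF small_repl[OF T]])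
  have "\<And>y. y \<epsilon> mk (F ` ext a) \<Longrightarrow> \<exists>z. z \<epsilon> y" unfolding A using b F by blast
  from choice_fn[OF this] obtain g where "\<forall>x. x \<epsilon> mk (F ` ext a) \<longrightarrow> app g x \<epsilon> x" by blast
  then have g: "\<And>x. x \<epsilon> a \<Longrightarrow> app g (F x) \<epsilon> F x" unfolding A by blast
  have T2: "Tm UNIV (\<lambda>s. app g (F (s 0)))" by (intro dfi T)
  show ?thesis by (rule exI[of _ "lam a (\<lambda>x. app g (F x))"]) (use g F in \<open>auto simp: fn_lam[OF T2] app_lam[OF T2]\<close>)
qed

text \<open>The closure argument behind all unboundedness proofs: an \<open>\<omega>\<close>-limit of levels in \<open>Q\<close>, each good for
  the previous one in the sense of \<open>N\<close>.\<close>

lemma club: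
  assumes Q: "Df UNIV (\<lambda>s. Q (s 0))" and N: "Df UNIV (\<lambda>s. N (s 0) (s 1))"
    and step: "\<And>y. \<exists>v. level v \<and> Q v \<and> y \<epsilon> v \<and> N y v"
    and lim: "\<And>c x. x \<epsilon> c \<Longrightarrow> (\<And>v. v \<epsilon> c \<Longrightarrow> level v \<and> Q v) \<Longrightarrow> Q (bU c)"
  shows "\<exists>v. level v \<and> Q v \<and> x \<epsilon> v \<and>
    (\<forall>y. y \<epsilon> v \<longrightarrow> (\<exists>z u. y \<epsilon> z \<and> z \<epsilon> u \<and> u \<epsilon> v \<and> level z \<and> Q z \<and> level u \<and> Q u \<and> N z u))"
proof -
  have Q': "Tm UNIV T \<Longrightarrow> Df UNIV (\<lambda>s. Q (T s))" for T by (rule Dp_sub1[OF Q])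
  have N': "Tm UNIV T \<Longrightarrow> Tm UNIV U \<Longrightarrow> Df UNIV (\<lambda>s. N (T s) (U s))" for T U by (rule Dp_sub2[OF N])
  define F where "F y = lev (\<lambda>v. Q v \<and> y \<epsilon> v \<and> N y v)" for y
  have T: "Tm UNIV (\<lambda>s. F (s 0))" unfolding F_def by (intro dfi Q' N')
  have F: "level (F y) \<and> Q (F y) \<and> y \<epsilon> F y \<and> N y (F y)" for y
  proof -
    obtain v where v: "level v" "Q v \<and> y \<epsilon> v \<and> N y v" using step by blast
    have "Df UNIV (\<lambda>s. Q (s 0) \<and> y \<epsilon> s 0 \<and> N y (s 0))" by (intro dfi Q' N')
    from lev_props[OF this v] show ?thesis unfolding F_def by blast
  qed
  obtain a where a: "fn a om" "app a emp = F x" "\<And>n. natu n \<Longrightarrow> app a (succ n) = F (app a n)"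
    using iterate[OF T] by blast
  have Ta: "Tm UNIV (\<lambda>s. app a (s 0))" by (intro dfi)
  define c where "c = mk (app a ` ext om)"
  have c: "z \<epsilon> c \<longleftrightarrow> (\<exists>n. natu n \<and> z = app a n)" for z
    unfolding c_def mem_mk[OF small_repl[OF Ta]] by auto
  have lq: "level (app a n) \<and> Q (app a n)" if "natu n" for n
  proof (rule natu_induct[of "\<lambda>n. level (app a n) \<and> Q (app a n)"])
    show "Df UNIV (\<lambda>s. level (app a (s 0)) \<and> Q (app a (s 0)))" by (intro dfi Q')
  qed (use a F that in auto)
  have c0: "F x \<epsilon> c" using a natu_emp c by metis
  have lqc: "\<And>v. v \<epsilon> c \<Longrightarrow> level v \<and> Q v"
    unfolding c using lq by auto
  show ?thesis
  proof (rule exI[of _ "bU c"], intro conjI allI impI)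
    show "level (bU c)" using level_Union c0 lqc by blast
    show "Q (bU c)" using lim[OF c0 lqc] .
    show "x \<epsilon> bU c" using c0 F by auto
    fix y assume "y \<epsilon> bU c"
    then obtain n where n: "natu n" "y \<epsilon> app a n" using c by auto
    have m: "app a (succ n) \<epsilon> c" "app a (succ (succ n)) \<epsilon> c" "natu (succ n)" using n natu_succ c by blast+
    then show "\<exists>z u. y \<epsilon> z \<and> z \<epsilon> u \<and> u \<epsilon> bU c \<and> level z \<and> Q z \<and> level u \<and> Q u \<and> N z u"
      using n lq a(3) F by (intro exI[of _ "app a n"] exI[of _ "app a (succ n)"]) auto
  qed
qed

section \<open>Bounded formulas for basic notions\<close>

abbreviation "B0 \<equiv> D0 mem"

lemma d0_sub [d0i]: "B0 (\<lambda>s. sub mem (s i) (s j))"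
  unfolding sub_def by (intro d0i)

lemma d0_emp [d0i]: "B0 (\<lambda>s. s i = emp)"
proof -
  have "s i = emp \<longleftrightarrow> (\<forall>x. x \<epsilon> s i \<longrightarrow> False)" for s :: "nat \<Rightarrow> 'a" by (simp add: emp_iff)
  then show ?thesis by (simp only:) (intro d0i)
qed

lemma d0_up [d0i]: "B0 (\<lambda>s. s k = up (s i) (s j))"
proof -
  have "s k = up (s i) (s j) \<longleftrightarrow> s i \<epsilon> s k \<and> s j \<epsilon> s k \<and> (\<forall>x. x \<epsilon> s k \<longrightarrow> x = s i \<or> x = s j)" for s :: "nat \<Rightarrow> 'a"
    using ext_eqI[of "s k" "up (s i) (s j)"] by auto
  then show ?thesis by (simp only:) (intro d0i)
qed

lemma d0_succ [d0i]: "B0 (\<lambda>s. s k = succ (s i))"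
proof -
  have "s k = succ (s i) \<longleftrightarrow> s i \<epsilon> s k \<and> sub mem (s i) (s k) \<and> (\<forall>x. x \<epsilon> s k \<longrightarrow> x \<epsilon> s i \<or> x = s i)" for s :: "nat \<Rightarrow> 'a"
    using ext_eqI[of "s k" "succ (s i)"] by (auto simp: sub_def)
  then show ?thesis by (simp only:) (intro d0i)
qed

lemma d0_pr [d0i]: "B0 (\<lambda>s. s k = pr (s i) (s j))"
proof -
  have "s k = pr (s i) (s j) \<longleftrightarrow> (\<exists>a. a \<epsilon> s k \<and> a = up (s i) (s i) \<and> (\<exists>b. b \<epsilon> s k \<and> b = up (s i) (s j) \<and> s k = up a b))" for s :: "nat \<Rightarrow> 'a"
    unfolding pr_def by auto
  then show ?thesis by (simp only:) (intro d0i)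
qed

lemma d0_prin [d0i]: "B0 (\<lambda>s. pr (s i) (s j) \<epsilon> s k)"
proof -
  have "pr (s i) (s j) \<epsilon> s k \<longleftrightarrow> (\<exists>p. p \<epsilon> s k \<and> p = pr (s i) (s j))" for s :: "nat \<Rightarrow> 'a" by auto
  then show ?thesis by (simp only:) (intro d0i)
qed

text \<open>The components of a pair are members of its members, so quantifying over them is
  bounded.\<close>

lemma d0_pex [d0i]:
  assumes "B0 (\<lambda>s. Q (s 1) (s 0) (\<lambda>i. s (Suc (Suc i))))"
  shows "B0 (\<lambda>s. \<exists>x y. s k = pr x y \<and> Q x y s)"
proof -
  have "(\<exists>x y. s k = pr x y \<and> Q x y s) \<longleftrightarrow>
     (\<exists>a. a \<epsilon> s k \<and> (\<exists>x. x \<epsilon> a \<and> (\<exists>b. b \<epsilon> s k \<and> (\<exists>y. y \<epsilon> b \<and> (s k = pr x y \<and> Q x y s)))))" for s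
    unfolding pr_def by (metis mem_up)
  moreover have "B0 (\<lambda>s. \<exists>a. a \<epsilon> s k \<and> (\<exists>x. x \<epsilon> a \<and> (\<exists>b. b \<epsilon> s k \<and> (\<exists>y. y \<epsilon> b \<and> (s k = pr x y \<and> Q x y s)))))"
    apply (intro D0_bex D0_conj d0_pr)
    using D0_ren[OF assms, of "\<lambda>i. if i = 0 then 0 else if i = 1 then 2 else i + 2"] by (simp add: numeral_2_eq_2)
  ultimately show ?thesis by (simp only:)
qed

lemma d0_rex [d0i]:
  assumes "B0 (\<lambda>s. Q (s 1) (s 0) (\<lambda>i. s (Suc (Suc i))))"
  shows "B0 (\<lambda>s. \<exists>x y. pr x y \<epsilon> s k \<and> Q x y s)"
proof -
  have "(\<exists>x y. pr x y \<epsilon> s k \<and> Q x y s) \<longleftrightarrow> (\<exists>p. p \<epsilon> s k \<and> (\<exists>x y. p = pr x y \<and> Q x y s))" for s by blast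
  moreover have "B0 (\<lambda>s. \<exists>p. p \<epsilon> s k \<and> (\<exists>x y. p = pr x y \<and> Q x y s))"
    apply (rule D0_bex, rule d0_pex)
    using D0_ren[OF assms, of "\<lambda>i. if i = 0 then 0 else if i = 1 then 1 else Suc i"] by (simp add: numeral_2_eq_2)
  ultimately show ?thesis by (simp only:)
qed

lemma d0_rex1 [d0i]:
  assumes "B0 (\<lambda>s. Q (s 0) (\<lambda>i. s (Suc i)))"
  shows "B0 (\<lambda>s. \<exists>y. pr (s i) y \<epsilon> s k \<and> Q y s)"
proof -
  have "(\<exists>y. pr (s i) y \<epsilon> s k \<and> Q y s) \<longleftrightarrow> (\<exists>x y. pr x y \<epsilon> s k \<and> (x = s i \<and> Q y s))" for s by blast
  moreover have "B0 (\<lambda>s. \<exists>x y. pr x y \<epsilon> s k \<and> (x = s i \<and> Q y s))"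
    apply (rule d0_rex, intro D0_conj D0_eq)
    using D0_ren[OF assms, of "\<lambda>i. if i = 0 then 0 else Suc i"] by simp
  ultimately show ?thesis by (simp only:)
qed

lemma d0_pall [d0i]:
  assumes "B0 (\<lambda>s. Q (s 1) (s 0) (\<lambda>i. s (Suc (Suc i))))"
  shows "B0 (\<lambda>s. \<forall>x y. s k = pr x y \<longrightarrow> Q x y s)"
  using D0_not[OF d0_pex[OF D0_not[OF assms], of k]] by simp

lemma d0_rall [d0i]:
  assumes "B0 (\<lambda>s. Q (s 1) (s 0) (\<lambda>i. s (Suc (Suc i))))"
  shows "B0 (\<lambda>s. \<forall>x y. pr x y \<epsilon> s k \<longrightarrow> Q x y s)"
  using D0_not[OF d0_rex[OF D0_not[OF assms], of k]] by simp

lemma d0_rall1 [d0i]: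
  assumes "B0 (\<lambda>s. Q (s 0) (\<lambda>i. s (Suc i)))"
  shows "B0 (\<lambda>s. \<forall>y. pr (s i) y \<epsilon> s k \<longrightarrow> Q y s)"
  using D0_not[OF d0_rex1[OF D0_not[OF assms], of i k]] by simp

lemma d0_tra [d0i]: "B0 (\<lambda>s. tra (s i))"
proof -
  have "tra a \<longleftrightarrow> (\<forall>x. x \<epsilon> a \<longrightarrow> (\<forall>y. y \<epsilon> x \<longrightarrow> y \<epsilon> a))" for a unfolding tra_def by blast
  then show ?thesis by (simp only:) (intro d0i)
qed

lemma d0_ord [d0i]: "B0 (\<lambda>s. ord (s i))"
proof -
  have "ord a \<longleftrightarrow> tra a \<and> (\<forall>x. x \<epsilon> a \<longrightarrow> (\<forall>y. y \<epsilon> a \<longrightarrow> x \<epsilon> y \<or> x = y \<or> y \<epsilon> x))" for a unfolding ord_alt by blast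
  then show ?thesis by (simp only:) (intro d0i)
qed

lemma d0_natu [d0i]: "B0 (\<lambda>s. natu (s i))"
proof -
  have "natu a \<longleftrightarrow> ord a \<and> (a = emp \<or> (\<exists>z. z \<epsilon> a \<and> a = succ z)) \<and> (\<forall>y. y \<epsilon> a \<longrightarrow> y = emp \<or> (\<exists>z. z \<epsilon> y \<and> y = succ z))" for a
    unfolding natu_def by blast
  then show ?thesis by (simp only:) (intro d0i)
qed

lemma om_iff: "w = om \<longleftrightarrow> (\<forall>x. x \<epsilon> w \<longrightarrow> natu x \<and> (\<exists>y. y \<epsilon> w \<and> y = succ x)) \<and> (\<exists>x. x \<epsilon> w \<and> x = emp)"
proof
  assume w: "(\<forall>x. x \<epsilon> w \<longrightarrow> natu x \<and> (\<exists>y. y \<epsilon> w \<and> y = succ x)) \<and> (\<exists>x. x \<epsilon> w \<and> x = emp)"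
  have "n \<epsilon> w" if n: "natu n" for n
    by (rule natu_induct[of "\<lambda>n. n \<epsilon> w"]) (use w n in \<open>auto intro: dfi\<close>)
  then show "w = om" using w by (intro ext_eqI) auto
qed (auto intro: natu_succ natu_emp)

lemma d0_om [d0i]: "B0 (\<lambda>s. s i = om)"
  unfolding om_iff by (intro d0i)

lemma d0_fn [d0i]: "B0 (\<lambda>s. fn (s i) (s j))"
proof -
  have "fn f a \<longleftrightarrow> (\<forall>z. z \<epsilon> f \<longrightarrow> (\<exists>x y. z = pr x y \<and> x \<epsilon> a)) \<and> (\<forall>x. x \<epsilon> a \<longrightarrow> (\<exists>y. pr x y \<epsilon> f \<and> (\<forall>z. pr x z \<epsilon> f \<longrightarrow> z = y)))" for f a
    unfolding fn_alt by metis
  then show ?thesis by (simp only:) (intro d0i)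
qed

lemma d0_sat_ext [d0i]: "B0 (\<lambda>s. sat mem (ext (s k)) (\<lambda>i. s (f i)) p)"
  unfolding ext_def by (rule D0_sat)

primrec num :: "nat \<Rightarrow> 'a" where
  "num 0 = emp"
| "num (Suc n) = succ (num n)"

lemma d0_num [d0i]: "B0 (\<lambda>s. s i = num n)"
proof (induction n arbitrary: i)
  case 0 then show ?case by (simp add: d0_emp)
next
  case (Suc n)
  have "s i = num (Suc n) \<longleftrightarrow> (\<exists>y. y \<epsilon> s i \<and> y = num n \<and> s i = succ y)" for s :: "nat \<Rightarrow> 'a" by auto
  then show ?case by (simp only:) (intro d0i Suc)
qed

lemma Tm_num [dfi]: "Tm K (\<lambda>s. num n)"
  by (induction n) (simp_all add: Tm_emp Tm_succ)

lemma num_less: "i < j \<Longrightarrow> num i \<epsilon> num j"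
  by (induction j) (auto simp: less_Suc_eq)

lemma num_inj [simp]: "num i = num j \<longleftrightarrow> i = j"
  using num_less[of i j] num_less[of j i] by (cases i j rule: linorder_cases) auto

lemma level_num: "level v \<Longrightarrow> num i \<epsilon> v"
  by (induction i) (auto intro: level_emp level_succ)

text \<open>A level certifies itself by its elements: each \<open>x\<close> lies in a transitive
  \<open>d\<close> on which some \<open>f \<epsilon> v\<close> satisfies the recursion equation of
  \<open>VV\<close>. Only closure under subsets quantifies beyond \<open>v\<close>, so levels form a
  \<open>\<Pi>\<^sub>1\<close> class.\<close>

lemma level_alt:
  "level v \<longleftrightarrow> (\<forall>x y. x \<epsilon> v \<and> sub mem y x \<longrightarrow> y \<epsilon> v) \<and> (\<exists>x. x \<epsilon> v) \<and> tra v \<and> (\<forall>x. x \<epsilon> v \<longrightarrow> (\<exists>y. y \<epsilon> v \<and> y = up x x)) \<and>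
    (\<forall>x. x \<epsilon> v \<longrightarrow> (\<exists>d. d \<epsilon> v \<and> tra d \<and> x \<epsilon> d \<and> (\<exists>f. f \<epsilon> v \<and> fn f d \<and>
       (\<forall>y b. pr y b \<epsilon> f \<longrightarrow> (\<forall>z. z \<epsilon> v \<longrightarrow> (z \<epsilon> b \<longleftrightarrow> (\<exists>w. w \<epsilon> y \<and> (\<exists>c. pr w c \<epsilon> f \<and> sub mem z c))))))))"
  (is "_ \<longleftrightarrow> ?super \<and> ?ne \<and> tra v \<and> ?sing \<and> (\<forall>x. x \<epsilon> v \<longrightarrow> ?H x)")
proof
  assume v: "level v"
  have "?H x" if x: "x \<epsilon> v" for x
  proof -
    obtain d where d: "d \<epsilon> v" "tra d" "x \<epsilon> d" "\<And>y. y \<epsilon> d \<Longrightarrow> VV y \<epsilon> d" "\<And>y z. y \<epsilon> d \<Longrightarrow> sub mem z y \<Longrightarrow> z \<epsilon> d"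
      using level_VV_sing[OF v x] by blast
    have T: "Tm UNIV (\<lambda>s. VV (s 0))" by (intro dfi)
    let ?f = "lam d VV"
    have "sub mem ?f (pow (pow d))"
      unfolding sub_def[of mem ?f] mem_lam[OF T] using d(4) by (auto simp: pr_def sub_def[of mem _ "pow d"] sub_def[of mem _ d])
    then have f: "?f \<epsilon> v" using level_super[OF v] level_pow[OF v] d(1) by blast
    have "z \<epsilon> b \<longleftrightarrow> (\<exists>w. w \<epsilon> y \<and> (\<exists>c. pr w c \<epsilon> ?f \<and> sub mem z c))" if "pr y b \<epsilon> ?f" for y b z
    proof -
      have y: "y \<epsilon> d" "b = VV y" using that unfolding mem_lam[OF T] by auto
      have "w \<epsilon> d" if "w \<epsilon> y" for w using traD[OF d(2) y(1) that] .
      then show ?thesis unfolding y(2) mem_VV[of z y] mem_lam[OF T] by auto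
    qed
    then show ?thesis using d f fn_lam[OF T] by blast
  qed
  then show "?super \<and> ?ne \<and> tra v \<and> ?sing \<and> (\<forall>x. x \<epsilon> v \<longrightarrow> ?H x)"
    using v level_super[OF v] level_tra[OF v] level_sing[OF v] unfolding level_def by blast
next
  assume h: "?super \<and> ?ne \<and> tra v \<and> ?sing \<and> (\<forall>x. x \<epsilon> v \<longrightarrow> ?H x)"
  then have super: "\<And>x y. x \<epsilon> v \<Longrightarrow> sub mem y x \<Longrightarrow> y \<epsilon> v" by (elim conjE) blast
  have vv: "VV x \<epsilon> v" if x: "x \<epsilon> v" for x
  proof -
    have "?H x" using h x by blast
    then obtain d f where df: "d \<epsilon> v" "tra d" "x \<epsilon> d" "f \<epsilon> v" "fn f d" and
      f0: "\<forall>y b. pr y b \<epsilon> f \<longrightarrow> (\<forall>z. z \<epsilon> v \<longrightarrow> (z \<epsilon> b \<longleftrightarrow> (\<exists>w. w \<epsilon> y \<and> (\<exists>c. pr w c \<epsilon> f \<and> sub mem z c))))"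
      by (elim exE conjE)
    note f = f0[rule_format]
    have tv: "tra v" using h by blast
    have fv: "c \<epsilon> v" if "pr w c \<epsilon> f" for w c
    proof -
      have "pr w c \<epsilon> v" using traD[OF tv df(4) that] .
      then have "up w c \<epsilon> v" using traD[OF tv, of "pr w c"] by (simp add: pr_def)
      then show ?thesis using traD[OF tv, of "up w c"] by simp
    qed
    have "y \<epsilon> d \<longrightarrow> app f y = VV y" for y
    proof (rule mem_induct[of "\<lambda>y. y \<epsilon> d \<longrightarrow> app f y = VV y"])
      show "Df UNIV (\<lambda>s. s 0 \<epsilon> d \<longrightarrow> app f (s 0) = VV (s 0))" by (intro dfi)
      fix y assume IH: "\<And>w. w \<epsilon> y \<Longrightarrow> w \<epsilon> d \<longrightarrow> app f w = VV w"
      show "y \<epsilon> d \<longrightarrow> app f y = VV y"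
      proof
        assume y: "y \<epsilon> d"
        have yb: "pr y (app f y) \<epsilon> f" using fn_app[OF df(5) y] by blast
        have w: "pr w c \<epsilon> f \<longleftrightarrow> c = VV w" if "w \<epsilon> y" for w c
          using IH[OF that] traD[OF df(2) y that] fn_app[OF df(5)] by metis
        show "app f y = VV y"
        proof (rule ext_eqI)
          fix z
          \<comment> \<open>The recursion equation is assumed for \<open>z \<epsilon> v\<close>
            only. This suffices because both sides consist of elements of \<open>v\<close>; here it
            follows from closure under subsets.\<close>
          have "z \<epsilon> v" if "z \<epsilon> VV y"
            using that unfolding mem_VV[of z] using w fv super fn_app[OF df(5)] traD[OF df(2) y] IH by metis
          moreover have "z \<epsilon> v" if "z \<epsilon> app f y" using fv[OF yb] traD[OF tv] that by blast
          moreover have "z \<epsilon> app f y \<longleftrightarrow> z \<epsilon> VV y" if "z \<epsilon> v"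
            unfolding f[OF yb that] mem_VV[of z y] using w by metis
          ultimately show "z \<epsilon> app f y \<longleftrightarrow> z \<epsilon> VV y" by blast
        qed
      qed
    qed
    then show ?thesis using fv fn_app[OF df(5) df(3)] df(3) by metis
  qed
  have "VV v = v"
  proof (rule sub_antisym)
    show "sub mem (VV v) v" unfolding sub_def[of mem "VV v"]
    proof (intro allI impI)
      fix z assume "z \<epsilon> VV v"
      then obtain y where "y \<epsilon> v" "sub mem z (VV y)" using mem_VV[of z v] by blast
      then show "z \<epsilon> v" using vv super by blast
    qed
  qed (rule sub_VV)
  then show "level v" unfolding level_def using h by auto
qed

lemma PiP_level: "PiP mem (Suc m) (\<lambda>s. level (s i))"
proof -
  have "PiP mem (Suc m) (\<lambda>s. \<forall>x y. x \<epsilon> s i \<and> sub mem y x \<longrightarrow> y \<epsilon> s i)"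
    by (intro PiP_all SigP_D0 d0i)
  moreover have "PiP mem (Suc m) (\<lambda>s. \<exists>x. x \<epsilon> s i)"
    using SigP_D0(2)[OF D0_bex[of mem "\<lambda>_ _. True" i]] by (simp add: D0_const)
  ultimately show ?thesis unfolding level_alt
    by (rule PiP_conj[OF _ PiP_conj]) (rule SigP_D0(2), (intro d0i))
qed

lemma level_VV_om: "level (VV om)"
  unfolding level_def VV_idem
proof (intro conjI allI impI refl)
  show "\<exists>x. x \<epsilon> VV om" using sub_VV[of om] natu_emp mem_om by (metis mem_sub)
  fix z assume "z \<epsilon> VV om"
  then obtain n where n: "natu n" "sub mem z (VV n)" using mem_VV[of z om] by auto
  then have "z \<epsilon> VV (succ n)" using mem_VV[of z "succ n"] by auto
  then have "sub mem (sing z) (VV (succ n))" by (simp add: sub_def[of mem "sing z"])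
  then show "sing z \<epsilon> VV om" using n natu_succ mem_VV[of "sing z" om] by auto
qed

section \<open>Internal satisfaction\<close>

text \<open>Codes of formulas and indices of variables are both taken from an arbitrary set \<open>c\<close>, so that
  assignments are functions on \<open>c\<close>; \<open>T\<close> is a satisfaction relation for the structure \<open>u\<close> and a set
  \<open>U\<close> of assignments closed under modification at one index.\<close>

definition "cM i j = pr (num 0) (pr i j)"
definition "cE i j = pr (num 1) (pr i j)"
definition "cN p = pr (num 2) p"
definition "cC p q = pr (num 3) (pr p q)"
definition "cX i p = pr (num 4) (pr i p)"

lemmas c_defs = cM_def cE_def cN_def cC_def cX_def

text \<open>For functions \<open>s\<close> and \<open>t\<close> on \<open>c\<close> this says that
  \<open>t\<close> arises from \<open>s\<close> by assigning \<open>x\<close> to \<open>i\<close>;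
  one inclusion is enough and keeps the formula bounded.\<close>

definition "upd c s i x t \<longleftrightarrow> pr i x \<epsilon> t \<and> (\<forall>k. k \<epsilon> c \<longrightarrow> k \<noteq> i \<longrightarrow> (\<forall>y. pr k y \<epsilon> s \<longrightarrow> pr k y \<epsilon> t))"

definition "Valid c u U T \<longleftrightarrow>
  (\<forall>s. s \<epsilon> U \<longrightarrow> fn s c \<and> (\<forall>i x. pr i x \<epsilon> s \<longrightarrow> x \<epsilon> u) \<and>
     (\<forall>i. i \<epsilon> c \<longrightarrow> (\<forall>x. x \<epsilon> u \<longrightarrow> (\<exists>t. t \<epsilon> U \<and> upd c s i x t))) \<and>
     (\<forall>e. e \<epsilon> c \<longrightarrow> (\<forall>i. i \<epsilon> c \<longrightarrow> (\<forall>j. j \<epsilon> c \<longrightarrow>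
        (e = cM i j \<longrightarrow> (pr e s \<epsilon> T \<longleftrightarrow> (\<exists>x. pr i x \<epsilon> s \<and> (\<exists>y. pr j y \<epsilon> s \<and> x \<epsilon> y)))) \<and>
        (e = cE i j \<longrightarrow> (pr e s \<epsilon> T \<longleftrightarrow> (\<exists>x. pr i x \<epsilon> s \<and> (\<exists>y. pr j y \<epsilon> s \<and> x = y)))) \<and>
        (e = cN i \<longrightarrow> (pr e s \<epsilon> T \<longleftrightarrow> \<not> pr i s \<epsilon> T)) \<and>
        (e = cC i j \<longrightarrow> (pr e s \<epsilon> T \<longleftrightarrow> pr i s \<epsilon> T \<and> pr j s \<epsilon> T)) \<and>
        (e = cX i j \<longrightarrow> (pr e s \<epsilon> T \<longleftrightarrow> (\<exists>x. x \<epsilon> u \<and> (\<exists>t. t \<epsilon> U \<and> upd c s i x t \<and> pr j t \<epsilon> T))))))))"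

lemma d0_codes [d0i]:
  "B0 (\<lambda>s. s k = cM (s i) (s j))" "B0 (\<lambda>s. s k = cE (s i) (s j))" "B0 (\<lambda>s. s k = cN (s i))"
  "B0 (\<lambda>s. s k = cC (s i) (s j))" "B0 (\<lambda>s. s k = cX (s i) (s j))"
proof -
  have 2: "s k = pr (num n) (pr (s i) (s j)) \<longleftrightarrow> (\<exists>x y. s k = pr x y \<and> (x = num n \<and> y = pr (s i) (s j)))" for n and s :: "nat \<Rightarrow> 'a" by auto
  have 1: "s k = pr (num n) (s i) \<longleftrightarrow> (\<exists>x y. s k = pr x y \<and> (x = num n \<and> y = s i))" for n and s :: "nat \<Rightarrow> 'a" by auto
  show "B0 (\<lambda>s. s k = cM (s i) (s j))" "B0 (\<lambda>s. s k = cE (s i) (s j))" "B0 (\<lambda>s. s k = cC (s i) (s j))" "B0 (\<lambda>s. s k = cX (s i) (s j))"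
    unfolding c_defs 2 by (intro d0i)+
  show "B0 (\<lambda>s. s k = cN (s i))" unfolding c_defs 1 by (intro d0i)
qed

lemma d0_upd [d0i]: "B0 (\<lambda>s. upd (s a) (s b) (s c) (s d) (s e))"
  unfolding upd_def by (intro d0i)

lemma d0_Valid [d0i]: "B0 (\<lambda>s. Valid (s a) (s b) (s c) (s d))"
  unfolding Valid_def by (intro d0i)

lemma Df_Valid: "Df K (\<lambda>s. Valid (s a) (s b) (s c) (s d))"
  by (intro Dp_D0 d0i)

lemma Df_Valid' [dfi]: "Tm K T \<Longrightarrow> Tm K U \<Longrightarrow> Tm K V \<Longrightarrow> Tm K W \<Longrightarrow> Df K (\<lambda>s. Valid (T s) (U s) (V s) (W s))"
  by (rule Dp_sub4[of mem K Valid]) (auto intro: Df_Valid)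

text \<open>The universal quantifier is coded through negation and existence, so that
  \<open>Valid\<close> gets by with five clauses.\<close>

primrec code :: "fm \<Rightarrow> 'a" where
  "code (Mem i j) = cM (num i) (num j)"
| "code (Eq i j) = cE (num i) (num j)"
| "code (Neg p) = cN (code p)"
| "code (Conj p q) = cC (code p) (code q)"
| "code (Exists i p) = cX (num i) (code p)"
| "code (Forall i p) = cN (cX (num i) (cN (code p)))"

definition "env s i = app s (num i)"

lemma level_codes:
  "level c \<Longrightarrow> i \<epsilon> c \<Longrightarrow> j \<epsilon> c \<Longrightarrow> cM i j \<epsilon> c \<and> cE i j \<epsilon> c \<and> cN i \<epsilon> c \<and> cC i j \<epsilon> c \<and> cX i j \<epsilon> c"
  unfolding c_defs by (auto intro!: level_pr level_num simp del: num.simps)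

lemma level_code: "level c \<Longrightarrow> code p \<epsilon> c"
  by (induction p) (use level_codes level_num in auto)

text \<open>Induction on the actual formula \<open>p\<close>. The set \<open>c\<close> may contain
  further, nonstandard codes, of which nothing is claimed; that \<open>c\<close> is a level ensures
  that it contains all codes and variable indices of actual formulas.\<close>

lemma Valid_sat:
  assumes V: "Valid c u U T" and c: "level c"
  shows "s \<epsilon> U \<Longrightarrow> pr (code p) s \<epsilon> T \<longleftrightarrow> sat mem (ext u) (env s) p"
proof (induction p arbitrary: s)
  note lc = level_codes[OF c] level_num[OF c] level_code[OF c]
  note V0 = V[unfolded Valid_def, THEN spec, THEN mp]
  note V4 = V0[THEN conjunct2, THEN conjunct2, THEN conjunct2, THEN spec, THEN mp, THEN spec, THEN mp, THEN spec, THEN mp]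
  have V1: "fn s c" if "s \<epsilon> U" for s
    using V0[OF that] by blast
  have V3: "\<exists>t. t \<epsilon> U \<and> upd c s i x t" if "s \<epsilon> U" "i \<epsilon> c" "x \<epsilon> u" for s i x
    using V0[OF that(1), THEN conjunct2, THEN conjunct2, THEN conjunct1] that by blast
  have VM: "pr (cM i j) s \<epsilon> T \<longleftrightarrow> (\<exists>x. pr i x \<epsilon> s \<and> (\<exists>y. pr j y \<epsilon> s \<and> x \<epsilon> y))" if "s \<epsilon> U" "i \<epsilon> c" "j \<epsilon> c" for s i j
    by (rule V4[OF that(1) _ that(2,3), THEN conjunct1, THEN mp]) (use lc(1) that in auto)
  have VE: "pr (cE i j) s \<epsilon> T \<longleftrightarrow> (\<exists>x. pr i x \<epsilon> s \<and> (\<exists>y. pr j y \<epsilon> s \<and> x = y))" if "s \<epsilon> U" "i \<epsilon> c" "j \<epsilon> c" for s i j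
    by (rule V4[OF that(1) _ that(2,3), THEN conjunct2, THEN conjunct1, THEN mp]) (use lc(1) that in auto)
  have VN: "pr (cN i) s \<epsilon> T \<longleftrightarrow> \<not> pr i s \<epsilon> T" if "s \<epsilon> U" "i \<epsilon> c" for s i
    by (rule V4[OF that(1) _ that(2,2), THEN conjunct2, THEN conjunct2, THEN conjunct1, THEN mp]) (use lc(1) that in auto)
  have VC: "pr (cC i j) s \<epsilon> T \<longleftrightarrow> pr i s \<epsilon> T \<and> pr j s \<epsilon> T" if "s \<epsilon> U" "i \<epsilon> c" "j \<epsilon> c" for s i j
    by (rule V4[OF that(1) _ that(2,3), THEN conjunct2, THEN conjunct2, THEN conjunct2, THEN conjunct1, THEN mp]) (use lc(1) that in auto)
  have VX: "pr (cX i j) s \<epsilon> T \<longleftrightarrow> (\<exists>x. x \<epsilon> u \<and> (\<exists>t. t \<epsilon> U \<and> upd c s i x t \<and> pr j t \<epsilon> T))" if "s \<epsilon> U" "i \<epsilon> c" "j \<epsilon> c" for s i j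
    by (rule V4[OF that(1) _ that(2,3), THEN conjunct2, THEN conjunct2, THEN conjunct2, THEN conjunct2, THEN mp]) (use lc(1) that in auto)
  have ev: "pr (num i) x \<epsilon> s \<longleftrightarrow> env s i = x" if "s \<epsilon> U" for s i x
    unfolding env_def by (rule fn_app) (use V1 that lc in auto)
  have eu: "env t = (env s)(i := x)" if s: "s \<epsilon> U" and t: "t \<epsilon> U" and u: "upd c s (num i) x t" for s t i x
  proof (rule HOL.ext)
    fix k
    have "env t i = x" using u ev[OF t] unfolding upd_def by blast
    moreover have "env t k = env s k" if "k \<noteq> i"
    proof -
      have "pr (num k) (env s k) \<epsilon> s" using ev[OF s] by blast
      then have "pr (num k) (env s k) \<epsilon> t" using u that lc(2) unfolding upd_def by simp
      then show ?thesis using ev[OF t] by blast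
    qed
    ultimately show "env t k = ((env s)(i := x)) k" by auto
  qed
  have X: "pr (cX (num i) e) s \<epsilon> T \<longleftrightarrow> (\<exists>a\<in>ext u. P ((env s)(i := a)))"
    if s: "s \<epsilon> U" and e: "e \<epsilon> c" and P: "\<And>t. t \<epsilon> U \<Longrightarrow> pr e t \<epsilon> T \<longleftrightarrow> P (env t)" for s i e P
  proof
    assume "pr (cX (num i) e) s \<epsilon> T"
    then obtain x t where "x \<epsilon> u" "t \<epsilon> U" "upd c s (num i) x t" "pr e t \<epsilon> T" using VX[OF s _ e] lc by blast
    then show "\<exists>a\<in>ext u. P ((env s)(i := a))" using P eu[OF s] by (metis in_ext)
  next
    assume "\<exists>a\<in>ext u. P ((env s)(i := a))"
    then obtain a where a: "a \<epsilon> u" "P ((env s)(i := a))" by auto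
    obtain t where t: "t \<epsilon> U" "upd c s (num i) a t" using V3[OF s, of "num i" a] a lc by blast
    then show "pr (cX (num i) e) s \<epsilon> T" using VX[OF s _ e] lc a P eu[OF s] by metis
  qed
  {
    case (Mem i j) then show ?case using VM ev lc by auto
  next
    case (Eq i j) then show ?case using VE ev lc by auto
  next
    case (Neg p) then show ?case using VN lc by auto
  next
    case (Conj p q) then show ?case using VC lc by auto
  next
    case (Exists i p) show ?case
      using X[where P="\<lambda>s. sat mem (ext u) s p", OF Exists.prems _ Exists.IH] lc by simp
  next
    case (Forall i p)
    have "pr (cN (code p)) t \<epsilon> T \<longleftrightarrow> \<not> sat mem (ext u) (env t) p" if "t \<epsilon> U" for t
      using VN[OF that] Forall.IH[OF that] lc by auto
    from X[where P="\<lambda>s. \<not> sat mem (ext u) s p", OF Forall.prems _ this] have "pr (cX (num i) (cN (code p))) s \<epsilon> T \<longleftrightarrow> (\<exists>a\<in>ext u. \<not> sat mem (ext u) ((env s)(i := a)) p)"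
      using lc by blast
    moreover have "cX (num i) (cN (code p)) \<epsilon> c" using lc by blast
    ultimately show ?case using VN[OF Forall.prems] by auto
  }
qed

text \<open>The subformulas of a code are components of nested pairs and not members, so recursion
  on \<open>\<epsilon>\<close> does not fit, whereas the rank decreases.\<close>

lemma rank_recursion:
  assumes "Df UNIV (\<lambda>s. s 0 = G (s 1) (s 2))"
  shows "\<exists>F. Tm UNIV (\<lambda>s. F (s 0)) \<and> (\<forall>x. \<exists>f. (\<forall>z. VV z \<epsilon> VV x \<longrightarrow> app f z = F z) \<and> F x = G x f)"
proof -
  have G: "Tm UNIV T \<Longrightarrow> Tm UNIV U \<Longrightarrow> Tm UNIV (\<lambda>s. G (T s) (U s))" for T U by (rule Dt_sub2[OF assms])
  \<comment> \<open>Values are tagged with their arguments; the set of earlier values, which is all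
    that the recursion hands over, is then a function that can be applied.\<close>
  interpret r: recursion mem UNIV "\<lambda>_. True" "\<lambda>z x. VV z \<epsilon> VV x" "\<lambda>x S. pr x (G x S)"
  proof
    show "Df UNIV (\<lambda>s. True)" by (intro dfi)
    show "Df UNIV (\<lambda>s. VV (s 0) \<epsilon> VV (s 1))" by (intro dfi)
    show "Df UNIV (\<lambda>s. s 0 = pr (s 1) (G (s 1) (s 2)))" by (intro dfi G)
    show "\<exists>c. x \<epsilon> c \<and> (\<forall>y. y \<epsilon> c \<longrightarrow> True) \<and> (\<forall>y z. y \<epsilon> c \<and> VV z \<epsilon> VV y \<longrightarrow> z \<epsilon> c)" for x
    proof -
      obtain v where v: "level v" "x \<epsilon> v" using ex_level by blast
      have "z \<epsilon> v" if "y \<epsilon> v" "VV z \<epsilon> VV y" for y z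
        using that level_VV[OF v(1)] level_memD[OF v(1)] level_super[OF v(1)] sub_VV by blast
      then show ?thesis using v by blast
    qed
    show "\<exists>y. y \<epsilon> c \<and> (\<forall>z. z \<epsilon> c \<longrightarrow> \<not> VV z \<epsilon> VV y)" if x: "x \<epsilon> c" for c x
    proof -
      have T: "Tm UNIV (\<lambda>s. VV (s 0))" by (intro dfi)
      let ?d = "mk (VV ` ext c)"
      have d: "z \<epsilon> ?d \<longleftrightarrow> (\<exists>y. y \<epsilon> c \<and> z = VV y)" for z unfolding mem_mk[OF small_repl[OF T]] by auto
      then have "VV x \<epsilon> ?d" using x by blast
      then obtain w where w: "w \<epsilon> ?d" "\<forall>z. z \<epsilon> w \<longrightarrow> \<not> z \<epsilon> ?d" using foundation by blast
      then show ?thesis unfolding d by blast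
    qed
  qed
  define F where "F x = bU (mk {y. r.recf x = pr x y})" for x
  have rp: "\<exists>S. r.recf x = pr x (G x S) \<and> (\<forall>u. u \<epsilon> S \<longleftrightarrow> (\<exists>z. VV z \<epsilon> VV x \<and> u = r.recf z))" for x
    using r.recf_eq[of x] mem_mk[OF r.recf_small[of x]] by auto
  have sF: "{y. r.recf x = pr x y} = {b}" if "r.recf x = pr x b" for x b using that by auto
  have m1: "mk {b} = sing b" for b by (simp add: up_def)
  have b1: "bU (sing b) = b" for b by (rule ext_eqI) simp
  have F: "r.recf x = pr x (F x)" for x
  proof -
    obtain b where b: "r.recf x = pr x b" using rp by blast
    then show ?thesis unfolding F_def sF[OF b] m1 b1 .
  qed
  show ?thesis
  proof (intro exI[of _ F] conjI allI)
    have "Tm UNIV (\<lambda>s. bU (mk {y. r.recf (s 0) = pr (s 0) y}))"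
    proof (rule Tm_bU, rule Dt_mk)
      show "small {y. r.recf (s 0) = pr (s 0) y}" for s
        using sF[OF F[of "s 0"]] small_pair[of "F (s 0)" "F (s 0)"] by simp
      show "Df UNIV (\<lambda>s. r.recf (s (Suc 0)) = pr (s (Suc 0)) (s 0))" by (intro dfi r.Tm_recf)
    qed
    then show "Tm UNIV (\<lambda>s. F (s 0))" unfolding F_def .
    fix x
    obtain S where S: "r.recf x = pr x (G x S)" "\<And>u. u \<epsilon> S \<longleftrightarrow> (\<exists>z. VV z \<epsilon> VV x \<and> u = r.recf z)" using rp by blast
    have "app S z = F z" if "VV z \<epsilon> VV x" for z
      by (rule app_eq) (use that in \<open>auto simp: S F\<close>)
    then show "\<exists>f. (\<forall>z. VV z \<epsilon> VV x \<longrightarrow> app f z = F z) \<and> F x = G x f"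
      using S(1) F by auto
  qed
qed

lemma rank_pr: "VV x \<epsilon> VV (pr x y)" "VV y \<epsilon> VV (pr x y)"
proof -
  have "VV (up x y) \<epsilon> VV (pr x y)" "VV x \<epsilon> VV (up x y)" "VV y \<epsilon> VV (up x y)"
    by (auto intro!: VV_mono simp: pr_def)
  then show "VV x \<epsilon> VV (pr x y)" "VV y \<epsilon> VV (pr x y)" using traD[OF VV_tra] by blast+
qed

lemma rank_pr2: "VV x \<epsilon> VV (pr k (pr x y))" "VV y \<epsilon> VV (pr k (pr x y))"
  by (rule traD[OF VV_tra rank_pr(2)], rule rank_pr)+

lemma Df_upd: "Tm UNIV T \<Longrightarrow> Tm UNIV U \<Longrightarrow> Tm UNIV V \<Longrightarrow> Tm UNIV W \<Longrightarrow> Df UNIV (\<lambda>s. upd c (T s) (U s) (V s) (W s))"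
  by (rule Dp_sub4[of mem UNIV "upd c"]) (unfold upd_def, (intro dfi)+)

lemma rank_c: "VV p \<epsilon> VV (cN p)" "VV p \<epsilon> VV (cC p q)" "VV q \<epsilon> VV (cC p q)" "VV q \<epsilon> VV (cX i q)"
  unfolding c_defs by (rule rank_pr rank_pr2)+

lemma c_inj [simp]:
  "cM i j = cM i' j' \<longleftrightarrow> i = i' \<and> j = j'" "cE i j = cE i' j' \<longleftrightarrow> i = i' \<and> j = j'" "cN i = cN i' \<longleftrightarrow> i = i'"
  "cC i j = cC i' j' \<longleftrightarrow> i = i' \<and> j = j'" "cX i j = cX i' j' \<longleftrightarrow> i = i' \<and> j = j'"
  unfolding c_defs by (simp_all del: num.simps)

lemma c_dist [simp]:
  "cM i j \<noteq> cE a b" "cM i j \<noteq> cN a" "cM i j \<noteq> cC a b" "cM i j \<noteq> cX a b"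
  "cE a b \<noteq> cM i j" "cE i j \<noteq> cN a" "cE i j \<noteq> cC a b" "cE i j \<noteq> cX a b"
  "cN i \<noteq> cM a b" "cN i \<noteq> cE a b" "cN i \<noteq> cC a b" "cN i \<noteq> cX a b"
  "cC i j \<noteq> cM a b" "cC i j \<noteq> cE a b" "cC i j \<noteq> cN a" "cC i j \<noteq> cX a b"
  "cX i j \<noteq> cM a b" "cX i j \<noteq> cE a b" "cX i j \<noteq> cN a" "cX i j \<noteq> cC a b"
  unfolding c_defs by (simp_all del: num.simps)

lemma Tm_codes [dfi]:
  "Tm K T \<Longrightarrow> Tm K U \<Longrightarrow> Tm K (\<lambda>s. cM (T s) (U s))" "Tm K T \<Longrightarrow> Tm K U \<Longrightarrow> Tm K (\<lambda>s. cE (T s) (U s))"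
  "Tm K T \<Longrightarrow> Tm K (\<lambda>s. cN (T s))" "Tm K T \<Longrightarrow> Tm K U \<Longrightarrow> Tm K (\<lambda>s. cC (T s) (U s))"
  "Tm K T \<Longrightarrow> Tm K U \<Longrightarrow> Tm K (\<lambda>s. cX (T s) (U s))"
  unfolding c_defs by (intro dfi; assumption)+

lemma in_pow2: "x \<epsilon> a \<Longrightarrow> y \<epsilon> b \<Longrightarrow> pr x y \<epsilon> pow (pow (un a b))"
  by (auto simp: pr_def sub_def)

lemma sub_prod: "(\<And>z. z \<epsilon> f \<Longrightarrow> \<exists>x y. x \<epsilon> a \<and> y \<epsilon> b \<and> z = pr x y) \<Longrightarrow> f \<epsilon> pow (pow (pow (un a b)))"
  unfolding mem_pow[of _ "pow (pow (un a b))"] sub_def[of mem f] using in_pow2 by metis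

text \<open>\<open>U\<close> consists of all functions from \<open>c\<close> to \<open>u\<close>,
  and \<open>F e\<close> is the set of those satisfying \<open>e\<close>. An \<open>e\<close> of
  none of the five shapes is satisfied by no assignment.\<close>

lemma Valid_ex:
  assumes s0: "fn s0 c" "\<And>i x. pr i x \<epsilon> s0 \<Longrightarrow> x \<epsilon> u"
  shows "\<exists>U T. Valid c u U T \<and> s0 \<epsilon> U"
proof -
  define U where "U = sep (pow (pow (pow (un c u)))) (\<lambda>s. fn s c \<and> (\<forall>i x. pr i x \<epsilon> s \<longrightarrow> x \<epsilon> u))"
  have "Df UNIV (\<lambda>s. fn (s 0) c \<and> (\<forall>i x. pr i x \<epsilon> s 0 \<longrightarrow> x \<epsilon> u))" by (intro dfi)
  note mU = mem_sep[OF this]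
  have U: "s \<epsilon> U \<longleftrightarrow> fn s c \<and> (\<forall>i x. pr i x \<epsilon> s \<longrightarrow> x \<epsilon> u)" for s
  proof -
    have "s \<epsilon> pow (pow (pow (un c u)))" if s: "fn s c" "\<forall>i x. pr i x \<epsilon> s \<longrightarrow> x \<epsilon> u"
    proof (rule sub_prod)
      fix z assume z: "z \<epsilon> s"
      then obtain x where "x \<epsilon> c" "z = pr x (app s x)" using fn_mem[OF s(1)] by blast
      then show "\<exists>x y. x \<epsilon> c \<and> y \<epsilon> u \<and> z = pr x y" using s(2) z by blast
    qed
    then show ?thesis unfolding U_def mU by blast
  qed
  let ?P = "\<lambda>e f s. (\<exists>i j. e = cM i j \<and> (\<exists>x y. pr i x \<epsilon> s \<and> pr j y \<epsilon> s \<and> x \<epsilon> y)) \<or>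
     (\<exists>i j. e = cE i j \<and> (\<exists>x y. pr i x \<epsilon> s \<and> pr j y \<epsilon> s \<and> x = y)) \<or>
     (\<exists>i. e = cN i \<and> \<not> s \<epsilon> app f i) \<or> (\<exists>i j. e = cC i j \<and> s \<epsilon> app f i \<and> s \<epsilon> app f j) \<or>
     (\<exists>i j. e = cX i j \<and> (\<exists>x t. x \<epsilon> u \<and> t \<epsilon> U \<and> upd c s i x t \<and> t \<epsilon> app f j))"
  have dP: "Tm UNIV T \<Longrightarrow> Tm UNIV X \<Longrightarrow> Tm UNIV Y \<Longrightarrow> Df UNIV (\<lambda>s. ?P (T s) (X s) (Y s))" for T X Y
    by (rule Dp_sub3[of mem UNIV ?P]) (intro dfi Df_upd)
  have "Df UNIV (\<lambda>t. t 0 = sep U (?P (t 1) (t 2)))" by (intro dfi dP)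
  from rank_recursion[of "\<lambda>e f. sep U (?P e f)", OF this]
  obtain F where F: "Tm UNIV (\<lambda>s. F (s 0))"
    and F1: "\<And>e. \<exists>f. (\<forall>z. VV z \<epsilon> VV e \<longrightarrow> app f z = F z) \<and> F e = sep U (?P e f)" by blast
  have mem: "s \<epsilon> sep U (?P e f) \<longleftrightarrow> s \<epsilon> U \<and> ?P e f s" for s e f
    by (rule mem_sep) (intro dP dfi)
  note F' = Tm_inst[OF F]
  define T where "T = sep (pow (pow (un c U))) (\<lambda>p. \<exists>e s. p = pr e s \<and> s \<epsilon> F e)"
  have "Df UNIV (\<lambda>t. \<exists>e s. t 0 = pr e s \<and> s \<epsilon> F e)" by (intro dfi F')
  from mem_sep[OF this] have T: "pr e s \<epsilon> T \<longleftrightarrow> s \<epsilon> F e" if "e \<epsilon> c" "s \<epsilon> U" for e s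
    unfolding T_def using in_pow2[OF that] by auto
  have "Valid c u U T" unfolding Valid_def
  proof (intro allI impI conjI)
    fix s assume s: "s \<epsilon> U"
    show "fn s c" using s U by blast
    show "x \<epsilon> u" if "pr i x \<epsilon> s" for i x using that s U by blast
    show "\<exists>t. t \<epsilon> U \<and> upd c s i x t" if i: "i \<epsilon> c" "x \<epsilon> u" for i x
    proof -
      have D: "Tm UNIV (\<lambda>t. if t 0 = i then x else app s (t 0))" by (intro dfi)
      let ?t = "lam c (\<lambda>k. if k = i then x else app s k)"
      have a: "pr k (app s k) \<epsilon> s" if "k \<epsilon> c" for k using fn_app[of s c k] that s U by blast
      then have "app s k \<epsilon> u" if "k \<epsilon> c" for k using that s U by blast
      then have "?t \<epsilon> U" unfolding U using i by (auto simp: fn_lam[OF D] mem_lam[OF D])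
      moreover have "upd c s i x ?t" unfolding upd_def mem_lam[OF D] using i fn_app[of s c] s U by auto
      ultimately show ?thesis by blast
    qed
    fix e i j assume c: "e \<epsilon> c" "i \<epsilon> c" "j \<epsilon> c"
    obtain f where f: "\<And>z. VV z \<epsilon> VV e \<Longrightarrow> app f z = F z" "F e = sep U (?P e f)" using F1 by blast
    have *: "pr e s \<epsilon> T \<longleftrightarrow> ?P e f s" using T[OF c(1) s] mem[of s e f] s f(2) by simp
    show "pr e s \<epsilon> T \<longleftrightarrow> (\<exists>x. pr i x \<epsilon> s \<and> (\<exists>y. pr j y \<epsilon> s \<and> x \<epsilon> y))" if "e = cM i j"
      unfolding * using that by auto
    show "pr e s \<epsilon> T \<longleftrightarrow> (\<exists>x. pr i x \<epsilon> s \<and> (\<exists>y. pr j y \<epsilon> s \<and> x = y))" if "e = cE i j"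
      unfolding * using that by auto
    show "pr e s \<epsilon> T \<longleftrightarrow> \<not> pr i s \<epsilon> T" if e: "e = cN i"
      unfolding * T[OF c(2) s] using f(1)[of i] rank_c e by simp
    show "pr e s \<epsilon> T \<longleftrightarrow> pr i s \<epsilon> T \<and> pr j s \<epsilon> T" if e: "e = cC i j"
      unfolding * T[OF c(2) s] T[OF c(3) s] using f(1)[of i] f(1)[of j] rank_c e by simp
    show "pr e s \<epsilon> T \<longleftrightarrow> (\<exists>x. x \<epsilon> u \<and> (\<exists>t. t \<epsilon> U \<and> upd c s i x t \<and> pr j t \<epsilon> T))" if e: "e = cX i j"
      unfolding * using T[OF c(3)] f(1)[of j] rank_c e by auto
  qed
  moreover have "s0 \<epsilon> U" unfolding U using s0 by blast
  ultimately show ?thesis by blast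
qed

section \<open>The hierarchy of correct levels\<close>

text \<open>\<open>E m\<close> is a \<open>\<Pi>\<^sub>m\<close> class of sets that are \<open>\<Sigma>\<^sub>m\<close>-elementary substructures of the universe:
  whenever some \<open>u\<close> in \<open>E m\<close> satisfies a formula at parameters from \<open>v\<close>, already some element of
  \<open>v\<close> in \<open>E m\<close> does.\<close>

primrec E :: "nat \<Rightarrow> 'a \<Rightarrow> bool" where
  "E 0 v = tra v"
| "E (Suc m) v = (level v \<and> om \<epsilon> v \<and> E m v \<and>
     (\<forall>c \<sigma> u U T. c \<epsilon> v \<and> \<sigma> \<epsilon> v \<and> E m u \<and> Valid c u U T \<and> \<sigma> \<epsilon> U \<longrightarrow>
       (\<exists>u'. u' \<epsilon> v \<and> (\<exists>U'. U' \<epsilon> v \<and> (\<exists>T'. T' \<epsilon> v \<and> E m u' \<and> Valid c u' U' T' \<and> \<sigma> \<epsilon> U' \<and>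
          (\<forall>e. e \<epsilon> c \<longrightarrow> (pr e \<sigma> \<epsilon> T \<longleftrightarrow> pr e \<sigma> \<epsilon> T')))))))"

lemma Df_E0: "Df K (\<lambda>s. E m (s i))"
proof (induction m arbitrary: i)
  case 0 then show ?case unfolding E.simps by (intro dfi)
next
  case (Suc m)
  have E: "Tm K T \<Longrightarrow> Df K (\<lambda>s. E m (T s))" for T by (rule Dp_sub1[OF Suc[of 0]])
  show ?case unfolding E.simps by (intro dfi E)
qed

lemma Df_E [dfi]: "Tm K T \<Longrightarrow> Df K (\<lambda>s. E m (T s))"
  by (rule Dp_sub1[OF Df_E0])

lemma E_tra: "E m v \<Longrightarrow> tra v"
  by (cases m) (auto intro: level_tra)

lemma E_mono: "E (Suc m) v \<Longrightarrow> E m v" by simp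

definition "correct m v \<longleftrightarrow> (\<forall>p s. (is_Sigma m p \<or> is_Pi m p) \<and> range s \<subseteq> ext v \<longrightarrow> sat mem (ext v) s p = sat mem UNIV s p)"

lemma Sigma_up:
  assumes "\<And>q s. is_Pi m q \<Longrightarrow> range s \<subseteq> D \<Longrightarrow> sat mem D s q \<Longrightarrow> sat mem D' s q" "D \<subseteq> D'"
  shows "is_Sigma (Suc m) p \<Longrightarrow> range s \<subseteq> D \<Longrightarrow> sat mem D s p \<Longrightarrow> sat mem D' s p"
proof (induction "Suc m" p arbitrary: s rule: is_Sigma_is_Pi.inducts(1)[where ?P2.0="\<lambda>_ _. True"])
  case (3 p x)
  then obtain a where a: "a \<in> D" "sat mem D (s(x := a)) p" by auto
  then have "sat mem D' (s(x := a)) p" by (intro assms(1) 3) (use 3 in auto)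
  then show ?case using a assms(2) by auto
next
  case (4 p x)
  then obtain a where a: "a \<in> D" "sat mem D (s(x := a)) p" by auto
  then have "sat mem D' (s(x := a)) p" by (intro 4) (use 4 in auto)
  then show ?case using a assms(2) by auto
qed auto

text \<open>The witnesses of the leading existential block are packed into one set \<open>b\<close>,
  and any correct \<open>u\<close> containing \<open>b\<close> contains them all.\<close>

lemma Sigma_witness:
  assumes E: "\<And>u. E m u \<Longrightarrow> correct m u"
  shows "is_Sigma (Suc m) p \<Longrightarrow> sat mem UNIV s p \<Longrightarrow> \<exists>b. \<forall>u. E m u \<and> b \<epsilon> u \<and> range s \<subseteq> ext u \<longrightarrow> sat mem (ext u) s p"
proof (induction "Suc m" p arbitrary: s rule: is_Sigma_is_Pi.inducts(1)[where ?P2.0="\<lambda>_ _. True"])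
  case (3 p x)
  then obtain a where a: "sat mem UNIV (s(x := a)) p" by auto
  have "sat mem (ext u) s (Exists x p)" if u: "E m u" "a \<epsilon> u" "range s \<subseteq> ext u" for u
  proof -
    have "range (s(x := a)) \<subseteq> ext u" using u by auto
    then have "sat mem (ext u) (s(x := a)) p" using E[OF u(1)] a 3 unfolding correct_def by blast
    then show ?thesis using u by auto
  qed
  then show ?case by blast
next
  case (4 p x)
  then obtain a where a: "sat mem UNIV (s(x := a)) p" by auto
  have "\<exists>b. \<forall>u. E m u \<and> b \<epsilon> u \<and> range (s(x := a)) \<subseteq> ext u \<longrightarrow> sat mem (ext u) (s(x := a)) p"
    by (rule 4) (use a in auto)
  then obtain b where b: "\<And>u. E m u \<Longrightarrow> b \<epsilon> u \<Longrightarrow> range (s(x := a)) \<subseteq> ext u \<Longrightarrow> sat mem (ext u) (s(x := a)) p"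
    by blast
  have "sat mem (ext u) s (Exists x p)" if u: "E m u" "up a b \<epsilon> u" "range s \<subseteq> ext u" for u
  proof -
    have ab: "a \<epsilon> u" "b \<epsilon> u" using traD[OF E_tra[OF u(1)] u(2)] by auto
    then have "range (s(x := a)) \<subseteq> ext u" using u by auto
    then have "sat mem (ext u) (s(x := a)) p" using b u ab by blast
    then show ?thesis using ab by auto
  qed
  then show ?case by blast
qed auto

text \<open>An assignment is an external function and need not be a set of the model. On finitely
  many variables it is coded by an element of \<open>v\<close>, with \<open>emp\<close> as the
  default elsewhere.\<close>

lemma assignment:
  assumes v: "level v" "c \<epsilon> v" "level c" and "finite X" and s: "range s \<subseteq> ext v"
  shows "\<exists>\<sigma>. \<sigma> \<epsilon> v \<and> fn \<sigma> c \<and> (\<forall>i x. pr i x \<epsilon> \<sigma> \<longrightarrow> x \<epsilon> v) \<and> (\<forall>i\<in>X. env \<sigma> i = s i)"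
  using assms(4)
proof (induction X)
  case empty
  have T: "Tm UNIV (\<lambda>s. emp)" by (intro dfi)
  have "lam c (\<lambda>_. emp) \<epsilon> pow (pow (pow (un c (sing emp))))"
    by (rule sub_prod) (auto simp: mem_lam[OF T])
  moreover have "pow (pow (pow (un c (sing emp)))) \<epsilon> v" using v by (intro level_pow level_un level_sing level_emp)
  ultimately have "lam c (\<lambda>_. emp) \<epsilon> v" using level_memD v by blast
  then show ?case using v by (intro exI[of _ "lam c (\<lambda>_. emp)"]) (auto simp: fn_lam[OF T] mem_lam[OF T] intro: level_emp)
next
  case (insert n X)
  then obtain \<sigma> where \<sigma>: "\<sigma> \<epsilon> v" "fn \<sigma> c" "\<And>i x. pr i x \<epsilon> \<sigma> \<Longrightarrow> x \<epsilon> v" "\<And>i. i\<in>X \<Longrightarrow> env \<sigma> i = s i" by blast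
  have sn: "s n \<epsilon> v" using s by (auto simp: image_subset_iff)
  let ?F = "\<lambda>k. if k = num n then s n else app \<sigma> k"
  have T: "Tm UNIV (\<lambda>t. ?F (t 0))" by (intro dfi)
  have a: "pr k (app \<sigma> k) \<epsilon> \<sigma>" if "k \<epsilon> c" for k using fn_app[OF \<sigma>(2) that] by blast
  have "sub mem (lam c ?F) (un \<sigma> (sing (pr (num n) (s n))))"
    unfolding sub_def mem_lam[OF T] using a by auto
  moreover have "un \<sigma> (sing (pr (num n) (s n))) \<epsilon> v"
    using v \<sigma>(1) sn by (intro level_un level_sing level_pr level_num) auto
  ultimately have "lam c ?F \<epsilon> v" using level_super v by blast
  moreover have "x \<epsilon> v" if "pr i x \<epsilon> lam c ?F" for i x
    using that a \<sigma>(3) sn unfolding mem_lam[OF T] by auto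
  moreover have "env (lam c ?F) i = s i" if "i \<in> insert n X" for i
    unfolding env_def using app_lam[OF T level_num[OF v(3)]] \<sigma>(4) that by (auto simp: env_def)
  ultimately show ?case using fn_lam[OF T] by blast
qed

text \<open>For the step from the universe to \<open>v\<close>, a correct \<open>u\<close>
  containing the witnesses makes \<open>p\<close> true. The reflection clause replaces it by some
  \<open>u' \<epsilon> v\<close> with the same theory of \<open>\<sigma>\<close>; since
  \<open>u'\<close> and \<open>v\<close> are both correct for the kernel of \<open>p\<close>, truth
  passes from \<open>u'\<close> up to \<open>v\<close>.\<close>

lemma correct_Suc:
  assumes cor: "\<And>u. E m u \<Longrightarrow> correct m u" and unb: "\<And>x. \<exists>u. E m u \<and> x \<epsilon> u" and v: "E (Suc m) v"
  shows "correct (Suc m) v"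
proof -
  have lv: "level v" "om \<epsilon> v" "E m v" using v by auto
  have Sig: "sat mem (ext v) s p = sat mem UNIV s p" if p: "is_Sigma (Suc m) p" and s: "range s \<subseteq> ext v" for p s
  proof
    assume sv: "sat mem (ext v) s p"
    have "sat mem UNIV s q" if "is_Pi m q" "range s \<subseteq> ext v" "sat mem (ext v) s q" for q s
      using cor[OF lv(3)] that unfolding correct_def by blast
    then show "sat mem UNIV s p" by (rule Sigma_up[OF _ subset_UNIV p s sv])
  next
    assume sp: "sat mem UNIV s p"
    obtain b where b: "\<And>u. E m u \<Longrightarrow> b \<epsilon> u \<Longrightarrow> range s \<subseteq> ext u \<Longrightarrow> sat mem (ext u) s p"
      using Sigma_witness[OF cor p sp] by blast
    obtain u where u: "E m u" "up b v \<epsilon> u" using unb by blast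
    have bu: "b \<epsilon> u" "v \<epsilon> u" using traD[OF E_tra[OF u(1)] u(2)] by auto
    have vu: "x \<epsilon> u" if "x \<epsilon> v" for x using traD[OF E_tra[OF u(1)] bu(2)] that .
    have su: "sat mem (ext u) s p" by (rule b) (use u bu vu s in auto)
    \<comment> \<open>A level that every member of \<open>E (Suc m)\<close> contains, and large
      enough for all codes of formulas.\<close>
    define c where "c = VV om"
    have c: "c \<epsilon> v" "level c" unfolding c_def using lv level_VV level_VV_om by auto
    obtain \<sigma> where \<sigma>: "\<sigma> \<epsilon> v" "fn \<sigma> c" "\<And>i x. pr i x \<epsilon> \<sigma> \<Longrightarrow> x \<epsilon> v" "\<And>i. i \<in> fv p \<Longrightarrow> env \<sigma> i = s i"
      using assignment[OF lv(1) c finite_fv s] by blast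
    obtain U T where V: "Valid c u U T" "\<sigma> \<epsilon> U" using Valid_ex[OF \<sigma>(2), of u] \<sigma>(3) vu by blast
    then obtain u' U' T' where u': "u' \<epsilon> v" "E m u'" "Valid c u' U' T'" "\<sigma> \<epsilon> U'"
        "\<And>e. e \<epsilon> c \<Longrightarrow> pr e \<sigma> \<epsilon> T \<longleftrightarrow> pr e \<sigma> \<epsilon> T'"
      using v c \<sigma>(1) u(1) unfolding E.simps by blast
    have "sat mem (ext u) (env \<sigma>) p = sat mem (ext u) s p" by (rule sat_cong) (rule \<sigma>(4))
    then have "pr (code p) \<sigma> \<epsilon> T" using Valid_sat[OF V(1) c(2) V(2)] su by blast
    then have su': "sat mem (ext u') (env \<sigma>) p" using Valid_sat[OF u'(3) c(2) u'(4)] u'(5)[OF level_code[OF c(2)]] by blast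
    have ru': "range (env \<sigma>) \<subseteq> ext u'"
    proof
      fix x assume "x \<in> range (env \<sigma>)"
      then obtain i where "x = app \<sigma> (num i)" by (auto simp: env_def)
      then have "pr (num i) x \<epsilon> \<sigma>" using fn_app[OF \<sigma>(2) level_num[OF c(2)]] by blast
      then show "x \<in> ext u'" using u'(3,4) unfolding Valid_def by auto
    qed
    have uv: "ext u' \<subseteq> ext v" using level_memD[OF lv(1) u'(1)] by auto
    have "sat mem (ext v) (env \<sigma>) p"
    proof (rule Sigma_up[OF _ uv p ru' su'])
      fix q s assume q: "is_Pi m q" "range s \<subseteq> ext u'" "sat mem (ext u') s q"
      then have "sat mem UNIV s q" using cor[OF u'(2)] unfolding correct_def by blast
      moreover have "range s \<subseteq> ext v" using q uv by blast
      ultimately show "sat mem (ext v) s q" using cor[OF lv(3)] q unfolding correct_def by blast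
    qed
    moreover have "sat mem (ext v) (env \<sigma>) p = sat mem (ext v) s p" by (rule sat_cong) (rule \<sigma>(4))
    ultimately show "sat mem (ext v) s p" by blast
  qed
  have "sat mem (ext v) s p = sat mem UNIV s p" if p: "is_Pi (Suc m) p" and s: "range s \<subseteq> ext v" for p s
  proof -
    obtain q where "is_Sigma (Suc m) q" "\<And>D s. sat mem D s q \<longleftrightarrow> \<not> sat mem D s p" using SP_neg(2)[OF p] by blast
    then show ?thesis using Sig[of q s] s by blast
  qed
  then show ?thesis using Sig unfolding correct_def by blast
qed

text \<open>The reflection clause has the two parameters \<open>c\<close> and
  \<open>\<sigma>\<close>; by linearity of levels they lie in a common member of the family.\<close>

lemma E_limit: "x \<epsilon> c \<Longrightarrow> (\<And>v. v \<epsilon> c \<Longrightarrow> level v \<and> E m v) \<Longrightarrow> E m (bU c)"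
proof (induction m)
  case 0 then show ?case unfolding E.simps tra_def mem_bU by blast
next
  case (Suc m)
  have lev: "level (bU c)" using level_Union Suc.prems by blast
  have IH: "E m (bU c)" using Suc by auto
  have "om \<epsilon> bU c" using Suc.prems by auto
  moreover have "\<exists>u'. u' \<epsilon> bU c \<and> (\<exists>U'. U' \<epsilon> bU c \<and> (\<exists>T'. T' \<epsilon> bU c \<and> E m u' \<and> Valid d u' U' T' \<and> \<sigma> \<epsilon> U' \<and>
          (\<forall>e. e \<epsilon> d \<longrightarrow> (pr e \<sigma> \<epsilon> T \<longleftrightarrow> pr e \<sigma> \<epsilon> T'))))"
    if h: "d \<epsilon> bU c" "\<sigma> \<epsilon> bU c" "E m u" "Valid d u U T" "\<sigma> \<epsilon> U" for d \<sigma> u U T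
  proof -
    obtain v1 v2 where v12: "v1 \<epsilon> c" "d \<epsilon> v1" "v2 \<epsilon> c" "\<sigma> \<epsilon> v2" using h by auto
    have "\<exists>v. v \<epsilon> c \<and> d \<epsilon> v \<and> \<sigma> \<epsilon> v"
      using level_linear[of v1 v2] level_memD[of v1 v2] level_memD[of v2 v1] v12 Suc.prems(2) by blast
    then obtain v where v: "v \<epsilon> c" "d \<epsilon> v" "\<sigma> \<epsilon> v" by blast
    then have "E (Suc m) v" using Suc.prems by blast
    then have "\<exists>u'. u' \<epsilon> v \<and> (\<exists>U'. U' \<epsilon> v \<and> (\<exists>T'. T' \<epsilon> v \<and> E m u' \<and> Valid d u' U' T' \<and> \<sigma> \<epsilon> U' \<and>
          (\<forall>e. e \<epsilon> d \<longrightarrow> (pr e \<sigma> \<epsilon> T \<longleftrightarrow> pr e \<sigma> \<epsilon> T'))))" using v h unfolding E.simps by blast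
    then show ?thesis using v(1) unfolding mem_bU by blast
  qed
  ultimately show ?case unfolding E.simps using lev IH by blast
qed

lemma E_unbounded: "\<exists>v. level v \<and> E m v \<and> x \<epsilon> v"
proof (induction m arbitrary: x)
  case 0 then show ?case using ex_level level_tra by auto
next
  case (Suc m)
  define N where "N y v \<longleftrightarrow> (\<forall>c \<sigma> u U T. c \<epsilon> y \<and> \<sigma> \<epsilon> y \<and> E m u \<and> Valid c u U T \<and> \<sigma> \<epsilon> U \<longrightarrow>
       (\<exists>u'. u' \<epsilon> v \<and> (\<exists>U'. U' \<epsilon> v \<and> (\<exists>T'. T' \<epsilon> v \<and> E m u' \<and> Valid c u' U' T' \<and> \<sigma> \<epsilon> U' \<and>
          (\<forall>e. e \<epsilon> c \<longrightarrow> (pr e \<sigma> \<epsilon> T \<longleftrightarrow> pr e \<sigma> \<epsilon> T'))))))" for y v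
  have dN: "Df UNIV (\<lambda>s. N (s 0) (s 1))" unfolding N_def by (intro dfi)
  have step: "\<exists>v. level v \<and> E m v \<and> y \<epsilon> v \<and> N y v" for y
  proof -
    \<comment> \<open>A case to be reflected is a triple of \<open>c\<close>,
      \<open>\<sigma>\<close> and the set \<open>\<theta>\<close> of codes true of
      \<open>\<sigma>\<close>. The structures \<open>u\<close> range over a proper class, but the
      triples in \<open>w\<close> form a set, so collection bounds the witnesses.\<close>
    define R where "R = (\<lambda>x z. \<exists>c \<sigma> \<theta> u U T. x = pr c (pr \<sigma> \<theta>) \<and> z = pr u (pr U T) \<and> E m u \<and> Valid c u U T \<and> \<sigma> \<epsilon> U \<and>
      (\<forall>e. e \<epsilon> c \<longrightarrow> (e \<epsilon> \<theta> \<longleftrightarrow> pr e \<sigma> \<epsilon> T)))"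
    obtain w where w: "level w" "y \<epsilon> w" using ex_level by blast
    have dR: "Df UNIV (\<lambda>s. R (s 0) (s 1))" unfolding R_def by (intro dfi)
    obtain b where b: "\<And>x. x \<epsilon> w \<Longrightarrow> \<exists>z. R x z \<Longrightarrow> \<exists>z. z \<epsilon> b \<and> R x z"
      using collection[of R w, OF dR] by blast
    obtain v where v: "level v" "E m v" "pr b y \<epsilon> v" using Suc by blast
    have bv: "b \<epsilon> v" "y \<epsilon> v" using level_prD[OF v(1,3)] by auto
    have "N y v" unfolding N_def
    proof (intro allI impI)
      fix c \<sigma> u U T assume h: "c \<epsilon> y \<and> \<sigma> \<epsilon> y \<and> E m u \<and> Valid c u U T \<and> \<sigma> \<epsilon> U"
      define \<theta> where "\<theta> = sep c (\<lambda>e. pr e \<sigma> \<epsilon> T)"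
      have "Df UNIV (\<lambda>s. pr (s 0) \<sigma> \<epsilon> T)" by (intro dfi)
      from mem_sep[OF this] have \<theta>: "e \<epsilon> \<theta> \<longleftrightarrow> e \<epsilon> c \<and> pr e \<sigma> \<epsilon> T" for e unfolding \<theta>_def .
      have cw: "c \<epsilon> w" "\<sigma> \<epsilon> w" using h level_memD[OF w] by auto
      have "\<theta> \<epsilon> w" by (rule level_super[OF w(1) cw(1)]) (simp add: sub_def \<theta>)
      then have "pr c (pr \<sigma> \<theta>) \<epsilon> w" using cw w(1) by (intro level_pr)
      moreover have "R (pr c (pr \<sigma> \<theta>)) (pr u (pr U T))" unfolding R_def using h \<theta> by blast
      ultimately obtain z where z: "z \<epsilon> b" "R (pr c (pr \<sigma> \<theta>)) z" using b by blast
      then obtain u' U' T' where r: "z = pr u' (pr U' T')" "E m u'" "Valid c u' U' T'" "\<sigma> \<epsilon> U'"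
         "\<And>e. e \<epsilon> c \<Longrightarrow> e \<epsilon> \<theta> \<longleftrightarrow> pr e \<sigma> \<epsilon> T'" unfolding R_def pr_inj by blast
      have "pr u' (pr U' T') \<epsilon> v" using level_memD[OF v(1) bv(1)] z r by blast
      then have "u' \<epsilon> v" "U' \<epsilon> v" "T' \<epsilon> v" using level_prD[OF v(1)] by blast+
      then show "\<exists>u'. u' \<epsilon> v \<and> (\<exists>U'. U' \<epsilon> v \<and> (\<exists>T'. T' \<epsilon> v \<and> E m u' \<and> Valid c u' U' T' \<and> \<sigma> \<epsilon> U' \<and>
          (\<forall>e. e \<epsilon> c \<longrightarrow> (pr e \<sigma> \<epsilon> T \<longleftrightarrow> pr e \<sigma> \<epsilon> T'))))"
        using r \<theta> by blast
    qed
    then show ?thesis using v bv by blast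
  qed
  have dE: "Df UNIV (\<lambda>s. E m (s 0))" by (intro dfi)
  have "\<exists>v. level v \<and> E m v \<and> pr x om \<epsilon> v \<and> (\<forall>y. y \<epsilon> v \<longrightarrow>
      (\<exists>z u. y \<epsilon> z \<and> z \<epsilon> u \<and> u \<epsilon> v \<and> level z \<and> E m z \<and> level u \<and> E m u \<and> N z u))"
    by (rule club[OF dE dN step]) (rule E_limit)
  then obtain v where v: "level v" "E m v" "pr x om \<epsilon> v"
    and vN0: "\<forall>y. y \<epsilon> v \<longrightarrow> (\<exists>z u. y \<epsilon> z \<and> z \<epsilon> u \<and> u \<epsilon> v \<and> level z \<and> E m z \<and> level u \<and> E m u \<and> N z u)"
    by (elim exE conjE)
  note vN = vN0[rule_format]
  have xv: "x \<epsilon> v" "om \<epsilon> v" using level_prD[OF v(1,3)] by auto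
  have "\<exists>u'. u' \<epsilon> v \<and> (\<exists>U'. U' \<epsilon> v \<and> (\<exists>T'. T' \<epsilon> v \<and> E m u' \<and> Valid c u' U' T' \<and> \<sigma> \<epsilon> U' \<and>
          (\<forall>e. e \<epsilon> c \<longrightarrow> (pr e \<sigma> \<epsilon> T \<longleftrightarrow> pr e \<sigma> \<epsilon> T'))))"
    if h: "c \<epsilon> v" "\<sigma> \<epsilon> v" "E m u" "Valid c u U T" "\<sigma> \<epsilon> U" for c \<sigma> u U T
  proof -
    obtain z w where z: "pr c \<sigma> \<epsilon> z" "w \<epsilon> v" "level z" "N z w" using vN[OF level_pr[OF v(1) h(1,2)]] by blast
    have "c \<epsilon> z" "\<sigma> \<epsilon> z" using level_prD[OF z(3,1)] by auto
    then have "\<exists>u'. u' \<epsilon> w \<and> (\<exists>U'. U' \<epsilon> w \<and> (\<exists>T'. T' \<epsilon> w \<and> E m u' \<and> Valid c u' U' T' \<and> \<sigma> \<epsilon> U' \<and>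
          (\<forall>e. e \<epsilon> c \<longrightarrow> (pr e \<sigma> \<epsilon> T \<longleftrightarrow> pr e \<sigma> \<epsilon> T'))))" using z(4) h unfolding N_def by blast
    then show ?thesis using level_memD[OF v(1) z(2)] by blast
  qed
  then show ?case using v xv unfolding E.simps by blast
qed

lemma E_correct: "E m v \<Longrightarrow> correct m v"
proof (induction m arbitrary: v)
  case 0
  have "sat mem (ext v) s p = sat mem UNIV s p" if "p \<in> Delta0_fm" "range s \<subseteq> ext v" for s p
    by (rule sat_Delta0[OF that(1) _ that(2)]) (use 0 traD in auto)
  then show ?case unfolding correct_def by (auto elim: is_Sigma_0E is_Pi_0E)
next
  case (Suc m) then show ?case using correct_Suc E_unbounded by blast
qed

lemma E_sat: "E m v \<Longrightarrow> is_Sigma m p \<or> is_Pi m p \<Longrightarrow> range s \<subseteq> ext v \<Longrightarrow> sat mem (ext v) s p = sat mem UNIV s p"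
  using E_correct unfolding correct_def by blast

text \<open>The conclusion of the reflection clause has \<open>E m u'\<close> under bounded
  existential quantifiers. As \<open>v\<close> is itself in \<open>E m\<close>, it can be read there
  as truth in \<open>v\<close> of the defining formula, which is bounded. The hypothesis
  \<open>E m u\<close> stands to the left of an implication below universal quantifiers and is
  harmless.\<close>

lemma PiP_E: "PiP mem m (\<lambda>s. E m (s i))"
proof (induction m arbitrary: i)
  case 0 then show ?case by (simp add: SigP_0 d0_tra)
next
  case (Suc m)
  obtain p where p: "is_Pi m p" "\<And>s. E m (s 0) = sat mem UNIV s p" using Suc[of 0] unfolding PiP_def by auto
  define S where "S v u = sat mem (ext v) (\<lambda>_. u) p" for v u
  have S: "E m u \<longleftrightarrow> S v u" if "E m v" "u \<epsilon> v" for u v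
    unfolding S_def using E_sat[OF that(1), of p "\<lambda>_. u"] p(1) p(2)[of "\<lambda>_. u"] that by auto
  have dS: "B0 (\<lambda>s. S (s i) (s j))" for i j unfolding S_def using d0_sat_ext[of i "\<lambda>_. j" p] by simp
  let ?D = "\<lambda>v c \<sigma> T. \<exists>u'. u' \<epsilon> v \<and> (\<exists>U'. U' \<epsilon> v \<and> (\<exists>T'. T' \<epsilon> v \<and> S v u' \<and> Valid c u' U' T' \<and> \<sigma> \<epsilon> U' \<and>
          (\<forall>e. e \<epsilon> c \<longrightarrow> (pr e \<sigma> \<epsilon> T \<longleftrightarrow> pr e \<sigma> \<epsilon> T'))))"
  have eq: "E (Suc m) v \<longleftrightarrow> level v \<and> E m v \<and> ((\<exists>w. w \<epsilon> v \<and> w = om) \<and>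
     (\<forall>c \<sigma> u U T. E m u \<longrightarrow> (c \<epsilon> v \<and> \<sigma> \<epsilon> v \<and> Valid c u U T \<and> \<sigma> \<epsilon> U \<longrightarrow> ?D v c \<sigma> T)))" for v
  proof (cases "E m v")
    case True
    define Y where "Y = ?D v"
    have X: "(\<exists>u'. u' \<epsilon> v \<and> (\<exists>U'. U' \<epsilon> v \<and> (\<exists>T'. T' \<epsilon> v \<and> E m u' \<and> Valid c u' U' T' \<and> \<sigma> \<epsilon> U' \<and>
          (\<forall>e. e \<epsilon> c \<longrightarrow> (pr e \<sigma> \<epsilon> T \<longleftrightarrow> pr e \<sigma> \<epsilon> T'))))) \<longleftrightarrow> Y c \<sigma> T" for c \<sigma> T
      unfolding Y_def by (rule ex_cong1) (use S[OF True] in blast)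
    have q: "(\<forall>c \<sigma> u U T. c \<epsilon> v \<and> \<sigma> \<epsilon> v \<and> E m u \<and> Valid c u U T \<and> \<sigma> \<epsilon> U \<longrightarrow> Y c \<sigma> T) \<longleftrightarrow>
      (\<forall>c \<sigma> u U T. E m u \<longrightarrow> (c \<epsilon> v \<and> \<sigma> \<epsilon> v \<and> Valid c u U T \<and> \<sigma> \<epsilon> U \<longrightarrow> Y c \<sigma> T))"
      by blast
    have Yd: "?D v c \<sigma> T \<longleftrightarrow> Y c \<sigma> T" for c \<sigma> T by (simp only: Y_def)
    show ?thesis unfolding E.simps X q Yd by auto
  qed simp
  have 1: "SigP mem (Suc m) (\<lambda>s. E m (s i))" for i by (rule SigP_PiP[OF Suc])
  have "PiP mem (Suc m) (\<lambda>s. \<forall>c \<sigma> u U T. E m u \<longrightarrow> (c \<epsilon> s i \<and> \<sigma> \<epsilon> s i \<and> Valid c u U T \<and> \<sigma> \<epsilon> U \<longrightarrow> ?D (s i) c \<sigma> T))"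
    by (intro PiP_all, rule PiP_imp, rule 1, rule SigP_D0(2)) (intro d0i dS)
  moreover have "PiP mem (Suc m) (\<lambda>s. \<exists>w. w \<epsilon> s i \<and> w = om)" by (intro SigP_D0(2) d0i)
  ultimately show ?case unfolding eq by (intro PiP_conj PiP_level PiP_Suc[OF Suc])
qed

end

context recursion
begin

lemma rec_induct:
  assumes P: "Df UNIV (\<lambda>s. P (s 0))" and step: "\<And>x. D x \<Longrightarrow> (\<And>y. R y x \<Longrightarrow> P y) \<Longrightarrow> P x" and x: "D x"
  shows "P x"
proof (rule ccontr)
  assume nP: "\<not> P x"
  obtain c where c: "x \<epsilon> c" "\<forall>y. y \<epsilon> c \<longrightarrow> D y" "\<forall>y z. y \<epsilon> c \<and> R z y \<longrightarrow> z \<epsilon> c" using closure[OF x] by blast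
  have b: "y \<epsilon> sep c (\<lambda>y. \<not> P y) \<longleftrightarrow> y \<epsilon> c \<and> \<not> P y" for y
    by (rule mem_sep) (rule Dp_not[OF P])
  obtain y where y: "y \<epsilon> c" "\<not> P y" "\<forall>z. z \<epsilon> c \<and> \<not> P z \<longrightarrow> \<not> R z y"
    using wf[of x "sep c (\<lambda>y. \<not> P y)"] nP c unfolding b by metis
  then show False using step[of y] c by blast
qed

end

context zfc
begin

lemma definable_funI:
  assumes "Tm UNIV (\<lambda>s. F (s 0))" shows "definable_fun mem F"
proof -
  have "Df UNIV (\<lambda>s. s 0 = F (s 1))" using assms by (simp add: Dt_def)
  then obtain p t where p: "\<And>s. (s 0 = F (s 1)) = sat mem UNIV (merge s t) p" unfolding Dp_def by auto
  let ?f = "\<lambda>i::nat. if i = 0 then 1 else if even i then 0 else i + 2"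
  let ?u = "\<lambda>i. t (i div 2 - 1)"
  have "(\<lambda>i. (?u(0 := x, 1 := y)) (?f i)) = merge (case_nat y (\<lambda>_. x)) t" for x y
    by (rule HOL.ext) (auto simp: merge_def elim!: oddE evenE split: nat.splits)
  then have "sat mem UNIV (?u(0 := x, 1 := y)) (ren p ?f) = (F x = y)" for x y
    unfolding sat_ren using p[of "case_nat y (\<lambda>_. x)"] by auto
  then show ?thesis unfolding definable_fun_def by blast
qed

lemma definable_classI:
  assumes "Df UNIV (\<lambda>s. P (s 0))" shows "definable_class mem {x. P x}"
proof -
  obtain p t where p: "\<And>s. P (s 0) = sat mem UNIV (merge s t) p" using assms unfolding Dp_def by auto
  let ?q = "ren p (\<lambda>i. if even i then 0 else i)"
  have "(\<lambda>i. ((merge t t)(0 := x)) (if even i then 0 else i)) = merge (\<lambda>_. x) t" for x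
    by (rule HOL.ext) (auto simp: merge_def elim!: oddE)
  then have "sat mem UNIV ((merge t t)(0 := x)) ?q = P x" for x
    unfolding sat_ren using p[of "\<lambda>_. x"] by simp
  then show ?thesis unfolding definable_class_def by blast
qed

section \<open>Operations on subsets of a level\<close>

text \<open>Both projections are total, with value \<open>emp\<close> at sets that are not pairs, so
  that levels are closed under them.\<close>

definition "p1 x = bU (sep (bU x) (\<lambda>a. \<exists>b. x = pr a b))"
definition "p2 x = bU (sep (bU x) (\<lambda>b. \<exists>a. x = pr a b))"

lemma Tm_p1 [dfi]: "Tm K T \<Longrightarrow> Tm K (\<lambda>s. p1 (T s))"
  by (rule Dt_sub1[of mem K p1]) (unfold p1_def, (intro dfi)+)
lemma Tm_p2 [dfi]: "Tm K T \<Longrightarrow> Tm K (\<lambda>s. p2 (T s))"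
  by (rule Dt_sub1[of mem K p2]) (unfold p2_def, (intro dfi)+)

lemma bU_sing [simp]: "bU (sing a) = a" by (rule ext_eqI) simp
lemma bU_emp [simp]: "bU emp = emp" by (rule ext_eqI) simp

lemma p1_pr [simp]: "p1 (pr a b) = a" and p2_pr [simp]: "p2 (pr a b) = b"
proof -
  have 1: "Df UNIV (\<lambda>s. \<exists>b'. pr a b = pr (s 0) b')" "Df UNIV (\<lambda>s. \<exists>b'. pr a b = pr b' (s 0))" by (intro dfi)+
  have "sep (bU (pr a b)) (\<lambda>a'. \<exists>b'. pr a b = pr a' b') = sing a"
    by (rule ext_eqI) (unfold mem_sep[OF 1(1)], auto simp: pr_def up_eq)
  then show "p1 (pr a b) = a" unfolding p1_def by simp
  have "sep (bU (pr a b)) (\<lambda>b'. \<exists>a'. pr a b = pr a' b') = sing b"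
    by (rule ext_eqI) (unfold mem_sep[OF 1(2)], auto simp: pr_def up_eq)
  then show "p2 (pr a b) = b" unfolding p2_def by simp
qed

lemma p12_nonpair: "\<not> (\<exists>a b. x = pr a b) \<Longrightarrow> p1 x = emp" "\<not> (\<exists>a b. x = pr a b) \<Longrightarrow> p2 x = emp"
proof -
  assume n: "\<not> (\<exists>a b. x = pr a b)"
  have 1: "Df UNIV (\<lambda>s. \<exists>b. x = pr (s 0) b)" "Df UNIV (\<lambda>s. \<exists>a. x = pr a (s 0))" by (intro dfi)+
  have "sep (bU x) (\<lambda>a. \<exists>b. x = pr a b) = emp" by (rule ext_eqI) (unfold mem_sep[OF 1(1)], use n in auto)
  then show "p1 x = emp" unfolding p1_def by simp
  have "sep (bU x) (\<lambda>b. \<exists>a. x = pr a b) = emp" by (rule ext_eqI) (unfold mem_sep[OF 1(2)], use n in auto)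
  then show "p2 x = emp" unfolding p2_def by simp
qed

lemma level_p1: "level v \<Longrightarrow> x \<epsilon> v \<Longrightarrow> p1 x \<epsilon> v" and level_p2: "level v \<Longrightarrow> x \<epsilon> v \<Longrightarrow> p2 x \<epsilon> v"
  using p12_nonpair[of x] level_prD[of v] level_emp[of v] p1_pr p2_pr by metis+

text \<open>Each operation maps \<open>X \<subseteq> v\<close> to \<open>{x \<in> v. \<phi> v x X}\<close> for one of the following bounded formulas
  \<open>\<phi>\<close>. A map between power sets of levels commuting with all of them is an extender.\<close>

definition phis :: "fm \<Rightarrow> ('a \<Rightarrow> 'a \<Rightarrow> 'a \<Rightarrow> bool) list" where
  "phis p = [
    \<lambda>v x X. pr (num 0) x \<epsilon> X,
    \<lambda>v x X. pr (num 1) x \<epsilon> X,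
    \<lambda>v x X. \<not> pr (num 0) x \<epsilon> X \<and> \<not> pr (num 1) x \<epsilon> X,
    \<lambda>v x X. \<exists>a b. x = pr a b \<and> a \<epsilon> X,
    \<lambda>v x X. \<exists>a b. x = pr a b \<and> b \<epsilon> X,
    \<lambda>v x X. \<exists>z c. x = pr z c \<and> (\<exists>a b. z = pr a b \<and> pr a c \<epsilon> X),
    \<lambda>v x X. \<exists>z c. x = pr z c \<and> (\<exists>a b. z = pr a b \<and> pr b c \<epsilon> X),
    \<lambda>v x X. pr x x \<epsilon> X,
    \<lambda>v x X. \<exists>a b. x = pr a b \<and> (\<exists>c. c \<epsilon> b \<and> pr a c \<epsilon> X),
    \<lambda>v x X. \<exists>a b. x = pr a b \<and> a \<epsilon> b,
    \<lambda>v x X. \<exists>z. z \<epsilon> x \<and> (z \<epsilon> X \<and> x = succ z),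
    \<lambda>v x X. (\<exists>n y. pr n y \<epsilon> x \<and> n = emp) \<and>
       (\<forall>n y. pr n y \<epsilon> x \<longrightarrow> natu n \<longrightarrow> (\<exists>m z. pr m z \<epsilon> x \<and> m = succ n)) \<and>
       (\<forall>n y. pr n y \<epsilon> x \<longrightarrow> natu n \<longrightarrow> (\<forall>m z. pr m z \<epsilon> x \<longrightarrow> m = succ n \<longrightarrow> (\<exists>k t. pr k t \<epsilon> X \<and> (k = n \<and> t = pr z y)))),
    \<lambda>v x X. sat mem (ext v) (\<lambda>_. x) p]"

abbreviation "nops \<equiv> 13::nat"

lemma all_less_13: "(\<forall>k<(13::nat). P k) \<longleftrightarrow> P 0 \<and> P 1 \<and> P 2 \<and> P 3 \<and> P 4 \<and> P 5 \<and> P 6 \<and> P 7 \<and> P 8 \<and> P 9 \<and> P 10 \<and> P 11 \<and> P 12"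
  by (simp add: eval_nat_numeral All_less_Suc) blast

text \<open>Numbers 0 to 2: a set codes two sets by tags, each can be extracted, and so can the
  complement of their union. Numbers 3 and 4 pull back along the projections, 5 and 6 omit the
  second or first entry of a triple, 7 is the diagonal. Number 8 is bounded existential
  quantification, 9 membership, 10 successor. Number 11 holds of an \<open>x\<close> that threads
  through \<open>X\<close> along all naturals, and 12 is the class defined by
  \<open>p\<close>.\<close>

lemma nth_phis [simp]:
  "phis p ! 0 = (\<lambda>v x X. pr (num 0) x \<epsilon> X)"
  "phis p ! 1 = (\<lambda>v x X. pr (num 1) x \<epsilon> X)"
  "phis p ! 2 = (\<lambda>v x X. \<not> pr (num 0) x \<epsilon> X \<and> \<not> pr (num 1) x \<epsilon> X)"
  "phis p ! 3 = (\<lambda>v x X. \<exists>a b. x = pr a b \<and> a \<epsilon> X)"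
  "phis p ! 4 = (\<lambda>v x X. \<exists>a b. x = pr a b \<and> b \<epsilon> X)"
  "phis p ! 5 = (\<lambda>v x X. \<exists>z c. x = pr z c \<and> (\<exists>a b. z = pr a b \<and> pr a c \<epsilon> X))"
  "phis p ! 6 = (\<lambda>v x X. \<exists>z c. x = pr z c \<and> (\<exists>a b. z = pr a b \<and> pr b c \<epsilon> X))"
  "phis p ! 7 = (\<lambda>v x X. pr x x \<epsilon> X)"
  "phis p ! 8 = (\<lambda>v x X. \<exists>a b. x = pr a b \<and> (\<exists>c. c \<epsilon> b \<and> pr a c \<epsilon> X))"
  "phis p ! 9 = (\<lambda>v x X. \<exists>a b. x = pr a b \<and> a \<epsilon> b)"
  "phis p ! 10 = (\<lambda>v x X. \<exists>z. z \<epsilon> x \<and> (z \<epsilon> X \<and> x = succ z))"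
  "phis p ! 11 = (\<lambda>v x X. (\<exists>n y. pr n y \<epsilon> x \<and> n = emp) \<and>
       (\<forall>n y. pr n y \<epsilon> x \<longrightarrow> natu n \<longrightarrow> (\<exists>m z. pr m z \<epsilon> x \<and> m = succ n)) \<and>
       (\<forall>n y. pr n y \<epsilon> x \<longrightarrow> natu n \<longrightarrow> (\<forall>m z. pr m z \<epsilon> x \<longrightarrow> m = succ n \<longrightarrow> (\<exists>k t. pr k t \<epsilon> X \<and> (k = n \<and> t = pr z y)))))"
  "phis p ! 12 = (\<lambda>v x X. sat mem (ext v) (\<lambda>_. x) p)"
  by (simp_all add: phis_def del: num.simps)

lemma d0_numin: "B0 (\<lambda>s. pr (num n) (s i) \<epsilon> s j)"
proof -
  have "pr (num n) (s i) \<epsilon> s j \<longleftrightarrow> (\<exists>k t. pr k t \<epsilon> s j \<and> (k = num n \<and> t = s i))" for s :: "nat \<Rightarrow> 'a" by blast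
  then show ?thesis by (simp only:) (intro d0i)
qed

lemma d0_phis: "k < nops \<Longrightarrow> B0 (\<lambda>s. (phis p ! k) (s a) (s b) (s c))"
proof -
  have "\<forall>k<nops. B0 (\<lambda>s. (phis p ! k) (s a) (s b) (s c))"
    unfolding all_less_13 nth_phis
    by (intro conjI d0i d0_numin)
  then show "k < nops \<Longrightarrow> B0 (\<lambda>s. (phis p ! k) (s a) (s b) (s c))" by blast
qed

lemma Df_phis: "k < nops \<Longrightarrow> Tm K T \<Longrightarrow> Tm K U \<Longrightarrow> Tm K V \<Longrightarrow> Df K (\<lambda>s. (phis p ! k) (T s) (U s) (V s))"
  by (rule Dp_sub3[of mem K "phis p ! k"]) (auto intro!: Dp_D0 d0_phis)

definition "op p k v X = sep v (\<lambda>x. (phis p ! k) v x X)"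

lemma mem_op: "k < nops \<Longrightarrow> x \<epsilon> op p k v X \<longleftrightarrow> x \<epsilon> v \<and> (phis p ! k) v x X"
  unfolding op_def by (rule mem_sep) (intro Df_phis dfi)

definition "ophom p v w e \<longleftrightarrow> (\<forall>X. sub mem X v \<longrightarrow> sub mem (e X) w \<and> (\<forall>k<nops. e (op p k v X) = op p k w (e X)))"

end

text \<open>Seeds come from a level \<open>w0\<close> properly inside \<open>w\<close>, so that
  every subset of \<open>w0\<close>, such as a sequence of seeds, is an element of
  \<open>w\<close>.\<close>

locale extender = zfc +
  fixes p :: fm and v w w0 :: 'a and e :: "'a \<Rightarrow> 'a"
  assumes lv: "level v" and lw: "level w" and lw0: "level w0" and w0w: "w0 \<epsilon> w"
    and oph: "ophom p v w e" and de: "Dt mem UNIV (\<lambda>s. e (s 0))"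
begin

text \<open>For \<open>a \<epsilon> w\<close> the sets whose image under \<open>e\<close> contains
  \<open>a\<close> form an ultrafilter on \<open>v\<close>; the seed \<open>a\<close> forces what
  holds almost everywhere for it.\<close>

definition "force a P \<longleftrightarrow> a \<epsilon> e (sep v P)"

lemma sub_sep: "Df UNIV (\<lambda>s. P (s 0)) \<Longrightarrow> sub mem (sep v P) v"
  by (simp add: sub_def mem_sep)

lemma e_op: "sub mem X v \<Longrightarrow> k < nops \<Longrightarrow> x \<epsilon> e (op p k v X) \<longleftrightarrow> x \<epsilon> w \<and> (phis p ! k) w x (e X)"
  using oph mem_op unfolding ophom_def by simp

lemma e_sub: "sub mem X v \<Longrightarrow> x \<epsilon> e X \<Longrightarrow> x \<epsilon> w"
  using oph unfolding ophom_def sub_def by blast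

lemma force_op:
  assumes P: "Df UNIV (\<lambda>s. P (s 0))" and k: "k < nops" and Q: "Df UNIV (\<lambda>s. Q (s 0))"
    and eq: "\<And>x. x \<epsilon> v \<Longrightarrow> (phis p ! k) v x (sep v P) \<longleftrightarrow> Q x"
  shows "force a Q \<longleftrightarrow> a \<epsilon> w \<and> (phis p ! k) w a (e (sep v P))"
proof -
  have "op p k v (sep v P) = sep v Q"
    by (rule ext_eqI) (use eq in \<open>auto simp: mem_op[OF k] mem_sep[OF Q]\<close>)
  then show ?thesis using e_op[OF sub_sep[OF P] k] unfolding force_def by simp
qed

lemma force_cong:
  assumes "Df UNIV (\<lambda>s. P (s 0))" "Df UNIV (\<lambda>s. Q (s 0))" "\<And>x. x \<epsilon> v \<Longrightarrow> P x \<longleftrightarrow> Q x"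
  shows "force a P \<longleftrightarrow> force a Q"
proof -
  have "sep v P = sep v Q" by (rule ext_eqI) (use assms in \<open>auto simp: mem_sep\<close>)
  then show ?thesis unfolding force_def by simp
qed

lemma force_w: "Df UNIV (\<lambda>s. P (s 0)) \<Longrightarrow> force a P \<Longrightarrow> a \<epsilon> w"
  unfolding force_def using e_sub sub_sep by blast

text \<open>An operation has a single argument, so the two sets are packed into \<open>W\<close>
  with tags 0 and 1. Joint denial then yields the other connectives.\<close>

lemma force_nor:
  assumes P: "Df UNIV (\<lambda>s. P (s 0))" and Q: "Df UNIV (\<lambda>s. Q (s 0))"
  shows "force a (\<lambda>x. \<not> P x \<and> \<not> Q x) \<longleftrightarrow> a \<epsilon> w \<and> \<not> force a P \<and> \<not> force a Q"
proof -
  note P' = Dp_sub1[OF P] and Q' = Dp_sub1[OF Q]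
  define W where "W = (\<lambda>q. \<exists>x. (q = pr (num 0) x \<and> P x) \<or> (q = pr (num 1) x \<and> Q x))"
  have W: "Df UNIV (\<lambda>s. W (s 0))" unfolding W_def by (intro dfi P' Q')
  have W01: "pr (num 0) x \<epsilon> sep v W \<longleftrightarrow> P x" "pr (num 1) x \<epsilon> sep v W \<longleftrightarrow> Q x" if "x \<epsilon> v" for x
    using level_pr[OF lv level_num[OF lv] that] num_inj[of 0 1] unfolding mem_sep[OF W] by (auto simp: W_def simp del: num.simps num_inj)
  have 0: "force a P \<longleftrightarrow> a \<epsilon> w \<and> pr (num 0) a \<epsilon> e (sep v W)" for a
    by (rule force_op[OF W, of 0 P a, unfolded nth_phis]) (use P W01 in auto)
  have 1: "force a Q \<longleftrightarrow> a \<epsilon> w \<and> pr (num 1) a \<epsilon> e (sep v W)" for a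
    by (rule force_op[OF W, of 1 Q a, unfolded nth_phis]) (use Q W01 in auto)
  have "Df UNIV (\<lambda>s. \<not> P (s 0) \<and> \<not> Q (s 0))" by (intro dfi P Q)
  then have "force a (\<lambda>x. \<not> P x \<and> \<not> Q x) \<longleftrightarrow> a \<epsilon> w \<and> \<not> pr (num 0) a \<epsilon> e (sep v W) \<and> \<not> pr (num 1) a \<epsilon> e (sep v W)"
    by (intro force_op[OF W, of 2 "\<lambda>x. \<not> P x \<and> \<not> Q x" a, unfolded nth_phis]) (use W01 in auto)
  then show ?thesis using 0 1 by blast
qed

lemma force_not:
  assumes P: "Df UNIV (\<lambda>s. P (s 0))" "a \<epsilon> w" shows "force a (\<lambda>x. \<not> P x) \<longleftrightarrow> \<not> force a P"
  using force_nor[OF P(1) P(1), of a] P(2) by simp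

lemma force_conj:
  assumes P: "Df UNIV (\<lambda>s. P (s 0))" and Q: "Df UNIV (\<lambda>s. Q (s 0))"
  shows "force a (\<lambda>x. P x \<and> Q x) \<longleftrightarrow> force a P \<and> force a Q"
  using force_nor[OF Dp_not[OF P] Dp_not[OF Q], of a] force_not[OF P] force_not[OF Q] force_w[OF P] force_w[OF Q] by auto

lemma force_mono:
  assumes P: "Df UNIV (\<lambda>s. P (s 0))" and Q: "Df UNIV (\<lambda>s. Q (s 0))"
    and "force a P" "\<And>x. x \<epsilon> v \<Longrightarrow> P x \<Longrightarrow> Q x"
  shows "force a Q"
proof -
  have "force a (\<lambda>x. P x \<and> Q x) \<longleftrightarrow> force a P"
    by (rule force_cong) (use assms in \<open>auto intro: dfi\<close>)
  then show ?thesis using force_conj[OF P Q] assms(3) by blast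
qed

lemma force_mono2:
  assumes P: "Df UNIV (\<lambda>s. P (s 0))" and Q: "Df UNIV (\<lambda>s. Q (s 0))" and R: "Df UNIV (\<lambda>s. R (s 0))"
    and "force a P" "force a Q" "\<And>x. x \<epsilon> v \<Longrightarrow> P x \<Longrightarrow> Q x \<Longrightarrow> R x"
  shows "force a R"
  by (rule force_mono[OF Dp_conj[OF P Q] R]) (use assms(4-6) force_conj[OF P Q] in auto)

lemma force_disj:
  assumes P: "Df UNIV (\<lambda>s. P (s 0))" and Q: "Df UNIV (\<lambda>s. Q (s 0))" and "force a (\<lambda>x. P x \<or> Q x)"
  shows "force a P \<or> force a Q"
proof (rule ccontr)
  assume n: "\<not> (force a P \<or> force a Q)"
  have aw: "a \<epsilon> w" using force_w[OF Dp_disj[OF P Q] assms(3)] .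
  then have "force a (\<lambda>x. \<not> P x \<and> \<not> Q x)" using force_nor[OF P Q] n by blast
  moreover have "force a (\<lambda>x. \<not> (P x \<or> Q x))"
    by (rule force_mono[OF _ _ calculation]) (use Dp_not[OF Dp_disj[OF P Q]] Dp_conj[OF Dp_not[OF P] Dp_not[OF Q]] in auto)
  ultimately show False using force_not[OF Dp_disj[OF P Q] aw] assms(3) by blast
qed

lemma force_top: "a \<epsilon> w \<Longrightarrow> (\<And>x. x \<epsilon> v \<Longrightarrow> P x) \<Longrightarrow> Df UNIV (\<lambda>s. P (s 0)) \<Longrightarrow> force a P"
proof -
  assume a: "a \<epsilon> w" and P: "\<And>x. x \<epsilon> v \<Longrightarrow> P x" "Df UNIV (\<lambda>s. P (s 0))"
  have "force a P \<or> force a (\<lambda>x. \<not> P x)" using force_not[OF P(2) a] by blast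
  then show "force a P"
  proof
    assume "force a (\<lambda>x. \<not> P x)" then show ?thesis
      by (rule force_mono[OF Dp_not[OF P(2)] P(2)]) (use P in blast)
  qed
qed

lemma force_bot: "force a P \<Longrightarrow> (\<And>x. x \<epsilon> v \<Longrightarrow> \<not> P x) \<Longrightarrow> Df UNIV (\<lambda>s. P (s 0)) \<Longrightarrow> False"
  using force_top[of a "\<lambda>x. \<not> P x"] force_not[of P a] force_w[of P a] Dp_not by blast

lemma pair_force:
  assumes ab: "a \<epsilon> w" "b \<epsilon> w" shows "force (pr a b) (\<lambda>x. \<exists>c d. x = pr c d)"
proof -
  have T: "Df UNIV (\<lambda>s. True)" by (intro dfi)
  have "force (pr a b) (\<lambda>x. \<exists>c d. x = pr c d) \<longleftrightarrow> pr a b \<epsilon> w \<and> (phis p ! 3) w (pr a b) (e (sep v (\<lambda>x. True)))"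
  proof (rule force_op[OF T])
    show "Df UNIV (\<lambda>s. \<exists>c d. s 0 = pr c d)" by (intro dfi)
    fix x assume x: "x \<epsilon> v"
    have "a \<epsilon> v \<and> b \<epsilon> v" if "x = pr a b" for a b using level_prD[OF lv] x that by metis
    then show "(phis p ! 3) v x (sep v (\<lambda>x. True)) \<longleftrightarrow> (\<exists>c d. x = pr c d)" by (auto simp: mem_sep[OF T])
  qed simp
  then show ?thesis using force_top[OF ab(1) _ T] level_pr[OF lw ab] by (simp add: force_def)
qed

lemma force_pairI:
  assumes P: "Df UNIV (\<lambda>s. P (s 0))" and Q: "Df UNIV (\<lambda>s. Q (s 0))"
    and ab: "a \<epsilon> w" "b \<epsilon> w" and eq: "\<And>x y. x \<epsilon> v \<Longrightarrow> y \<epsilon> v \<Longrightarrow> P (pr x y) \<longleftrightarrow> Q (pr x y)"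
  shows "force (pr a b) P \<longleftrightarrow> force (pr a b) Q"
proof -
  have pq: "Df UNIV (\<lambda>s. \<exists>c d. s 0 = pr c d)" by (intro dfi)
  have "force (pr a b) (\<lambda>x. P x \<and> (\<exists>c d. x = pr c d)) \<longleftrightarrow> force (pr a b) (\<lambda>x. Q x \<and> (\<exists>c d. x = pr c d))"
    by (rule force_cong[OF Dp_conj[OF P pq] Dp_conj[OF Q pq]]) (use eq level_prD[OF lv] in blast)
  then show ?thesis using force_conj[OF P pq] force_conj[OF Q pq] pair_force[OF ab] by blast
qed

text \<open>The ultrafilter of \<open>pr a b\<close> projects to that of \<open>a\<close>. Together
  with the lemmas that follow, this allows the variables of a forced statement to be rearranged as
  in a calculus of relations.\<close>

lemma R1:
  assumes P: "Df UNIV (\<lambda>s. P (s 0))" and ab: "a \<epsilon> w" "b \<epsilon> w"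
  shows "force (pr a b) (\<lambda>x. P (p1 x)) \<longleftrightarrow> force a P"
proof -
  note P' = Dp_sub1[OF P]
  have Q: "Df UNIV (\<lambda>s. \<exists>c d. s 0 = pr c d \<and> P c)" by (intro dfi P')
  have "force (pr a b) (\<lambda>x. \<exists>c d. x = pr c d \<and> P c) \<longleftrightarrow> pr a b \<epsilon> w \<and> (phis p ! 3) w (pr a b) (e (sep v P))"
  proof (rule force_op[OF P _ Q])
    fix x assume x: "x \<epsilon> v"
    have "a \<epsilon> v \<and> b \<epsilon> v" if "x = pr a b" for a b using level_prD[OF lv] x that by metis
    then show "(phis p ! 3) v x (sep v P) \<longleftrightarrow> (\<exists>c d. x = pr c d \<and> P c)" by (auto simp: mem_sep[OF P])
  qed simp
  moreover have "force (pr a b) (\<lambda>x. P (p1 x)) \<longleftrightarrow> force (pr a b) (\<lambda>x. \<exists>c d. x = pr c d \<and> P c)"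
    by (rule force_pairI[OF _ Q ab]) (auto intro!: dfi P')
  ultimately show ?thesis using level_pr[OF lw ab] by (simp add: force_def)
qed

lemma R2:
  assumes P: "Df UNIV (\<lambda>s. P (s 0))" and ab: "a \<epsilon> w" "b \<epsilon> w"
  shows "force (pr a b) (\<lambda>x. P (p2 x)) \<longleftrightarrow> force b P"
proof -
  note P' = Dp_sub1[OF P]
  have Q: "Df UNIV (\<lambda>s. \<exists>c d. s 0 = pr c d \<and> P d)" by (intro dfi P')
  have "force (pr a b) (\<lambda>x. \<exists>c d. x = pr c d \<and> P d) \<longleftrightarrow> pr a b \<epsilon> w \<and> (phis p ! 4) w (pr a b) (e (sep v P))"
  proof (rule force_op[OF P _ Q])
    fix x assume x: "x \<epsilon> v"
    have "a \<epsilon> v \<and> b \<epsilon> v" if "x = pr a b" for a b using level_prD[OF lv] x that by metis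
    then show "(phis p ! 4) v x (sep v P) \<longleftrightarrow> (\<exists>c d. x = pr c d \<and> P d)" by (auto simp: mem_sep[OF P])
  qed simp
  moreover have "force (pr a b) (\<lambda>x. P (p2 x)) \<longleftrightarrow> force (pr a b) (\<lambda>x. \<exists>c d. x = pr c d \<and> P d)"
    by (rule force_pairI[OF _ Q ab]) (auto intro!: dfi P')
  ultimately show ?thesis using level_pr[OF lw ab] by (simp add: force_def)
qed

lemma dP2:
  assumes "Df UNIV (\<lambda>s. P (s 0) (s 1))" "Tm UNIV T" "Tm UNIV U" shows "Df UNIV (\<lambda>s. P (T s) (U s))"
  by (rule Dp_sub2[OF assms])

abbreviation "force2 a b P \<equiv> force (pr a b) (\<lambda>x. P (p1 x) (p2 x))"

text \<open>Views a statement about \<open>a\<close> and \<open>c\<close> on the triple with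
  \<open>b\<close> inserted; with \<open>R1\<close> and \<open>R23\<close>, relations between three
  seeds can be combined on one.\<close>

lemma R13:
  assumes P: "Df UNIV (\<lambda>s. P (s 0) (s 1))" and abc: "a \<epsilon> w" "b \<epsilon> w" "c \<epsilon> w"
  shows "force (pr (pr a b) c) (\<lambda>x. P (p1 (p1 x)) (p2 x)) \<longleftrightarrow> force2 a c P"
proof -
  note P' = dP2[OF P]
  have Q: "Df UNIV (\<lambda>s. \<exists>z c. s 0 = pr z c \<and> (\<exists>a b. z = pr a b \<and> P a c))" by (intro dfi P')
  have S: "Df UNIV (\<lambda>s. P (p1 (s 0)) (p2 (s 0)))" by (intro dfi P')
  have ab: "pr a b \<epsilon> w" using level_pr[OF lw] abc by blast
  have pf: "Df UNIV (\<lambda>s. \<exists>c d. s 0 = pr c d)" by (intro dfi)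
  have  "force (pr (pr a b) c) (\<lambda>x. \<exists>z c. x = pr z c \<and> (\<exists>a b. z = pr a b \<and> P a c)) \<longleftrightarrow>
    pr (pr a b) c \<epsilon> w \<and> (phis p ! 5) w (pr (pr a b) c) (e (sep v (\<lambda>x. P (p1 x) (p2 x))))"
  proof (rule force_op[OF S _ Q])
    fix x assume x: "x \<epsilon> v"
    have "pr a c \<epsilon> v" if "x = pr (pr a b) c" for a b c
      using level_prD[OF lv] level_pr[OF lv] x that by metis
    then show "(phis p ! 5) v x (sep v (\<lambda>x. P (p1 x) (p2 x))) \<longleftrightarrow> (\<exists>z c. x = pr z c \<and> (\<exists>a b. z = pr a b \<and> P a c))"
      by (auto simp: mem_sep[OF S])
  qed simp
  moreover have "force (pr (pr a b) c) (\<lambda>x. \<exists>z c. x = pr z c \<and> (\<exists>a b. z = pr a b \<and> P a c)) \<longleftrightarrow>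
     force (pr (pr a b) c) (\<lambda>x. P (p1 (p1 x)) (p2 x) \<and> (\<exists>c d. p1 x = pr c d))"
    by (rule force_pairI[OF Q _ ab abc(3)]) (auto intro!: dfi P')
  moreover have "force (pr (pr a b) c) (\<lambda>x. \<exists>c d. p1 x = pr c d)"
    using R1[of "\<lambda>x. \<exists>c d. x = pr c d", OF pf ab abc(3)] pair_force[OF abc(1,2)] by blast
  moreover have "force (pr (pr a b) c) (\<lambda>x. P (p1 (p1 x)) (p2 x) \<and> (\<exists>c d. p1 x = pr c d)) \<longleftrightarrow>
     force (pr (pr a b) c) (\<lambda>x. P (p1 (p1 x)) (p2 x)) \<and> force (pr (pr a b) c) (\<lambda>x. \<exists>c d. p1 x = pr c d)"
    by (rule force_conj) (intro dfi P')+
  ultimately show ?thesis using level_pr[OF lw ab abc(3)] by (simp add: force_def)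
qed

lemma R23:
  assumes P: "Df UNIV (\<lambda>s. P (s 0) (s 1))" and abc: "a \<epsilon> w" "b \<epsilon> w" "c \<epsilon> w"
  shows "force (pr (pr a b) c) (\<lambda>x. P (p2 (p1 x)) (p2 x)) \<longleftrightarrow> force2 b c P"
proof -
  note P' = dP2[OF P]
  have Q: "Df UNIV (\<lambda>s. \<exists>z c. s 0 = pr z c \<and> (\<exists>a b. z = pr a b \<and> P b c))" by (intro dfi P')
  have S: "Df UNIV (\<lambda>s. P (p1 (s 0)) (p2 (s 0)))" by (intro dfi P')
  have ab: "pr a b \<epsilon> w" using level_pr[OF lw] abc by blast
  have pf: "Df UNIV (\<lambda>s. \<exists>c d. s 0 = pr c d)" by (intro dfi)
  have  "force (pr (pr a b) c) (\<lambda>x. \<exists>z c. x = pr z c \<and> (\<exists>a b. z = pr a b \<and> P b c)) \<longleftrightarrow>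
    pr (pr a b) c \<epsilon> w \<and> (phis p ! 6) w (pr (pr a b) c) (e (sep v (\<lambda>x. P (p1 x) (p2 x))))"
  proof (rule force_op[OF S _ Q])
    fix x assume x: "x \<epsilon> v"
    have "pr b c \<epsilon> v" if "x = pr (pr a b) c" for a b c
      using level_prD[OF lv] level_pr[OF lv] x that by metis
    then show "(phis p ! 6) v x (sep v (\<lambda>x. P (p1 x) (p2 x))) \<longleftrightarrow> (\<exists>z c. x = pr z c \<and> (\<exists>a b. z = pr a b \<and> P b c))"
      by (auto simp: mem_sep[OF S])
  qed simp
  moreover have "force (pr (pr a b) c) (\<lambda>x. \<exists>z c. x = pr z c \<and> (\<exists>a b. z = pr a b \<and> P b c)) \<longleftrightarrow>
     force (pr (pr a b) c) (\<lambda>x. P (p2 (p1 x)) (p2 x) \<and> (\<exists>c d. p1 x = pr c d))"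
    by (rule force_pairI[OF Q _ ab abc(3)]) (auto intro!: dfi P')
  moreover have "force (pr (pr a b) c) (\<lambda>x. \<exists>c d. p1 x = pr c d)"
    using R1[of "\<lambda>x. \<exists>c d. x = pr c d", OF pf ab abc(3)] pair_force[OF abc(1,2)] by blast
  moreover have "force (pr (pr a b) c) (\<lambda>x. P (p2 (p1 x)) (p2 x) \<and> (\<exists>c d. p1 x = pr c d)) \<longleftrightarrow>
     force (pr (pr a b) c) (\<lambda>x. P (p2 (p1 x)) (p2 x)) \<and> force (pr (pr a b) c) (\<lambda>x. \<exists>c d. p1 x = pr c d)"
    by (rule force_conj) (intro dfi P')+
  ultimately show ?thesis using level_pr[OF lw ab abc(3)] by (simp add: force_def)
qed

lemma Rd:
  assumes P: "Df UNIV (\<lambda>s. P (s 0) (s 1))" and a: "a \<epsilon> w"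
  shows "force2 a a P \<longleftrightarrow> force a (\<lambda>x. P x x)"
proof -
  note P' = dP2[OF P]
  have Q: "Df UNIV (\<lambda>s. P (s 0) (s 0))" by (intro dfi P')
  have S: "Df UNIV (\<lambda>s. P (p1 (s 0)) (p2 (s 0)))" by (intro dfi P')
  have "force a (\<lambda>x. P x x) \<longleftrightarrow> a \<epsilon> w \<and> (phis p ! 7) w a (e (sep v (\<lambda>x. P (p1 x) (p2 x))))"
    by (rule force_op[OF S _ Q]) (use level_pr[OF lv] in \<open>auto simp: mem_sep[OF S]\<close>)
  then show ?thesis using a by (simp add: force_def)
qed

text \<open>The bounded quantifier on the side of \<open>w\<close> supplies a seed inside
  \<open>b\<close> for the element \<open>z\<close>. This is why the identity function represents
  every seed by itself, see \<open>pi_id\<close>.\<close>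

lemma Rb:
  assumes P: "Df UNIV (\<lambda>s. P (s 0) (s 1))" and ab: "a \<epsilon> w" "b \<epsilon> w"
    and f: "force2 a b (\<lambda>x y. \<exists>z. z \<epsilon> y \<and> P x z)"
  shows "\<exists>c. c \<epsilon> b \<and> force2 a c P"
proof -
  note P' = dP2[OF P]
  have Q: "Df UNIV (\<lambda>s. \<exists>x y. s 0 = pr x y \<and> (\<exists>z. z \<epsilon> y \<and> P x z))" by (intro dfi P')
  have S: "Df UNIV (\<lambda>s. P (p1 (s 0)) (p2 (s 0)))" by (intro dfi P')
  have "force (pr a b) (\<lambda>x. \<exists>a b. x = pr a b \<and> (\<exists>z. z \<epsilon> b \<and> P a z)) \<longleftrightarrow>
     pr a b \<epsilon> w \<and> (phis p ! 8) w (pr a b) (e (sep v (\<lambda>x. P (p1 x) (p2 x))))"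
  proof (rule force_op[OF S _ Q])
    fix x assume x: "x \<epsilon> v"
    have *: "pr a c \<epsilon> v" if "x = pr a b" "c \<epsilon> b" for a b c
      using level_prD[OF lv] level_pr[OF lv] level_memD[OF lv] x that by metis
    show "(phis p ! 8) v x (sep v (\<lambda>x. P (p1 x) (p2 x))) \<longleftrightarrow> (\<exists>a b. x = pr a b \<and> (\<exists>z. z \<epsilon> b \<and> P a z))"
      unfolding nth_phis mem_sep[OF S] p1_pr p2_pr using * by blast
  qed simp
  moreover have "force (pr a b) (\<lambda>x. \<exists>z. z \<epsilon> p2 x \<and> P (p1 x) z) \<longleftrightarrow> force (pr a b) (\<lambda>x. \<exists>a b. x = pr a b \<and> (\<exists>z. z \<epsilon> b \<and> P a z))"
    by (rule force_pairI[OF _ Q ab]) (auto intro!: dfi P')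
  ultimately show ?thesis using f by (auto simp: force_def)
qed

lemma Rm: assumes ab: "a \<epsilon> w" "b \<epsilon> w" shows "force2 a b (\<epsilon>) \<longleftrightarrow> a \<epsilon> b"
proof -
  have T: "Df UNIV (\<lambda>s. True)" by (intro dfi)
  have Q: "Df UNIV (\<lambda>s. \<exists>x y. s 0 = pr x y \<and> x \<epsilon> y)" by (intro dfi)
  have "force (pr a b) (\<lambda>x. \<exists>a b. x = pr a b \<and> a \<epsilon> b) \<longleftrightarrow> pr a b \<epsilon> w \<and> (phis p ! 9) w (pr a b) (e (sep v (\<lambda>x. True)))"
    by (rule force_op[OF T _ Q]) auto
  moreover have "force (pr a b) (\<lambda>x. p1 x \<epsilon> p2 x) \<longleftrightarrow> force (pr a b) (\<lambda>x. \<exists>a b. x = pr a b \<and> a \<epsilon> b)"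
    by (rule force_pairI[OF _ Q ab]) (auto intro!: dfi)
  ultimately show ?thesis using level_pr[OF lw ab] by auto
qed

text \<open>All three seeds are put into the triple \<open>pr (pr a b) c\<close>, where the two
  hypotheses can be conjoined.\<close>

lemma comp:
  assumes P: "Df UNIV (\<lambda>s. P (s 0) (s 1))" and Q: "Df UNIV (\<lambda>s. Q (s 0) (s 1))" and R: "Df UNIV (\<lambda>s. R (s 0) (s 1))"
    and abc: "a \<epsilon> w" "b \<epsilon> w" "c \<epsilon> w" and f: "force2 a b P" "force2 b c Q"
    and i: "\<And>x y z. x \<epsilon> v \<Longrightarrow> y \<epsilon> v \<Longrightarrow> z \<epsilon> v \<Longrightarrow> P x y \<Longrightarrow> Q y z \<Longrightarrow> R x z"
  shows "force2 a c R"
proof -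
  note P' = dP2[OF P] and Q' = dP2[OF Q] and R' = dP2[OF R]
  have ab: "pr a b \<epsilon> w" using level_pr[OF lw] abc by blast
  have "Df UNIV (\<lambda>s. P (p1 (s 0)) (p2 (s 0)))" by (intro P' dfi)
  from R1[of "\<lambda>x. P (p1 x) (p2 x)", OF this ab abc(3)] f
  have 1: "force (pr (pr a b) c) (\<lambda>x. P (p1 (p1 x)) (p2 (p1 x)))" by blast
  have 2: "force (pr (pr a b) c) (\<lambda>x. Q (p2 (p1 x)) (p2 x))" using R23[OF Q abc] f by blast
  have "force (pr (pr a b) c) (\<lambda>x. R (p1 (p1 x)) (p2 x))"
    by (rule force_mono2[OF _ _ _ 1 2]) (auto intro!: P' Q' R' dfi intro: i level_p1[OF lv] level_p2[OF lv])
  then show ?thesis using R13[OF R abc] by blast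
qed

text \<open>No operation exchanges coordinates. The exchange is obtained from the triple
  \<open>pr (pr b a) b\<close>, whose first and last entries are forced to be equal.\<close>

lemma fsym:
  assumes P: "Df UNIV (\<lambda>s. P (s 0) (s 1))" and ab: "a \<epsilon> w" "b \<epsilon> w" and f: "force2 a b P"
  shows "force2 b a (\<lambda>x y. P y x)"
proof -
  note P' = dP2[OF P]
  have ba: "pr b a \<epsilon> w" using level_pr[OF lw] ab by blast
  have 1: "force (pr (pr b a) b) (\<lambda>x. P (p2 (p1 x)) (p2 x))" using R23[OF P ab(2,1,2)] f by blast
  have E: "Df UNIV (\<lambda>s. s 0 = s 1)" by (intro dfi)
  have "force b (\<lambda>x. x = x)" by (rule force_top[OF ab(2)]) (auto intro: dfi)
  then have "force2 b b (=)" using Rd[OF E ab(2)] by blast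
  then have 2: "force (pr (pr b a) b) (\<lambda>x. p1 (p1 x) = p2 x)" using R13[OF E ab(2,1,2)] by blast
  have "force (pr (pr b a) b) (\<lambda>x. P (p2 (p1 x)) (p1 (p1 x)))"
    by (rule force_mono2[OF _ _ _ 1 2]) (auto intro!: P' dfi)
  moreover have "Df UNIV (\<lambda>s. P (p2 (s 0)) (p1 (s 0)))" by (intro P' dfi)
  ultimately show ?thesis using R1[of "\<lambda>x. P (p2 x) (p1 x)", OF _ ba ab(2)] by blast
qed

text \<open>Lifting a predicate on a pair to the relation between the pair and its components.\<close>

lemma lift1:
  assumes P: "Df UNIV (\<lambda>s. P (s 0) (s 1))" and ab: "a \<epsilon> w" "b \<epsilon> w" and f: "force (pr a b) (\<lambda>z. P z (p1 z))"
  shows "force2 (pr a b) a P"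
proof -
  note P' = dP2[OF P]
  have w: "pr a b \<epsilon> w" using level_pr[OF lw] ab by blast
  have E: "Df UNIV (\<lambda>s. s 0 = s 1)" by (intro dfi)
  have "force a (\<lambda>x. x = x)" by (rule force_top[OF ab(1)]) (auto intro: dfi)
  then have "force2 a a (=)" using Rd[OF E ab(1)] by blast
  then have 2: "force (pr (pr a b) a) (\<lambda>x. p1 (p1 x) = p2 x)" using R13[OF E ab(1,2,1)] by blast
  have "Df UNIV (\<lambda>s. P (s 0) (p1 (s 0)))" by (intro P' dfi)
  from R1[of "\<lambda>z. P z (p1 z)", OF this w ab(1)] f have 1: "force (pr (pr a b) a) (\<lambda>x. P (p1 x) (p1 (p1 x)))" by blast
  show ?thesis by (rule force_mono2[OF _ _ _ 1 2]) (auto intro!: P' dfi)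
qed

lemma lift2:
  assumes P: "Df UNIV (\<lambda>s. P (s 0) (s 1))" and ab: "a \<epsilon> w" "b \<epsilon> w" and f: "force (pr a b) (\<lambda>z. P z (p2 z))"
  shows "force2 (pr a b) b P"
proof -
  note P' = dP2[OF P]
  have w: "pr a b \<epsilon> w" using level_pr[OF lw] ab by blast
  have E: "Df UNIV (\<lambda>s. s 0 = s 1)" by (intro dfi)
  have "force b (\<lambda>x. x = x)" by (rule force_top[OF ab(2)]) (auto intro: dfi)
  then have "force2 b b (=)" using Rd[OF E ab(2)] by blast
  then have 2: "force (pr (pr a b) b) (\<lambda>x. p2 (p1 x) = p2 x)" using R23[OF E ab(1,2,2)] by blast
  have "Df UNIV (\<lambda>s. P (s 0) (p2 (s 0)))" by (intro P' dfi)
  from R1[of "\<lambda>z. P z (p2 z)", OF this w ab(2)] f have 1: "force (pr (pr a b) b) (\<lambda>x. P (p1 x) (p2 (p1 x)))" by blast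
  show ?thesis by (rule force_mono2[OF _ _ _ 1 2]) (auto intro!: P' dfi)
qed

text \<open>Naturals are not moved: \<open>emp\<close> by bounded quantification and the step by the
  successor operation. Well-foundedness needs this because a sequence of seeds carries its indices
  as seeds too.\<close>

lemma force_nat: assumes "natu n" shows "force n (\<lambda>x. x = n)"
proof -
  have de': "Tm UNIV T \<Longrightarrow> Tm UNIV (\<lambda>s. e (T s))" for T by (rule Tm_inst[OF de])
  have nw: "n \<epsilon> w" if "natu n" for n
    by (rule natu_induct[of "\<lambda>n. n \<epsilon> w"]) (use level_emp[OF lw] level_succ[OF lw] that in \<open>auto intro: dfi\<close>)
  show ?thesis
  proof (rule natu_induct[of "\<lambda>n. force n (\<lambda>x. x = n)"])
    show "Df UNIV (\<lambda>s. force (s 0) (\<lambda>x. x = s 0))" unfolding force_def by (intro dfi de')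
    have ew: "emp \<epsilon> w" by (rule nw[OF natu_emp])
    have X: "Df UNIV (\<lambda>s. \<exists>z. z \<epsilon> s 1 \<and> True)" "Df UNIV (\<lambda>s. True)" "Df UNIV (\<lambda>s. \<exists>z. z \<epsilon> s 0 \<and> True)" by (intro dfi)+
    have "\<not> force2 emp emp (\<lambda>x y. \<exists>z. z \<epsilon> y \<and> True)" using Rb[of "\<lambda>_ _. True", OF X(2) ew ew] by auto
    then have "\<not> force emp (\<lambda>x. \<exists>z. z \<epsilon> x \<and> True)" using Rd[of "\<lambda>x y. \<exists>z. z \<epsilon> y \<and> True", OF X(1) ew] by blast
    then have "force emp (\<lambda>x. \<not> (\<exists>z. z \<epsilon> x \<and> True))" using force_not[OF X(3) ew] by blast
    then show "force emp (\<lambda>x. x = emp)" by (rule force_mono[rotated 2]) (auto intro!: dfi simp: emp_iff)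
    fix n assume n: "natu n" "force n (\<lambda>x. x = n)"
    have E: "Df UNIV (\<lambda>s. s 0 = n)" "Df UNIV (\<lambda>s. s 0 = succ n)" by (intro dfi)+
    have Q: "Df UNIV (\<lambda>s. s 0 = succ n \<and> n \<epsilon> v)" by (intro dfi)
    have "force (succ n) (\<lambda>x. x = succ n \<and> n \<epsilon> v) \<longleftrightarrow> succ n \<epsilon> w \<and> (phis p ! 10) w (succ n) (e (sep v (\<lambda>x. x = n)))"
      by (rule force_op[OF E(1) _ Q]) (auto simp: mem_sep[OF E(1)])
    then have "force (succ n) (\<lambda>x. x = succ n \<and> n \<epsilon> v)" using nw[OF natu_succ] n unfolding force_def by auto
    then show "force (succ n) (\<lambda>x. x = succ n)" by (rule force_mono[OF Q E(2)]) simp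
  qed (rule assms)
qed

end

section \<open>The extender ultrapower\<close>

context extender
begin

text \<open>A point of the ultrapower is a pair of a seed \<open>a\<close> and a function on \<open>v\<close>. To make the membership
  relation set-like, the functions of members are required to take values in \<open>bd f\<close>.\<close>

definition "pt q \<longleftrightarrow> (\<exists>a f. q = pr a f \<and> a \<epsilon> w0 \<and> fn f v)"
definition "bd f = un (bU (bU (bU f))) (sing emp)"
definition "S2 P = sep v (\<lambda>x. P (p1 x) (p2 x))"
definition "below q' q \<longleftrightarrow> (\<exists>b g a f. q' = pr b g \<and> q = pr a f \<and> b \<epsilon> w0 \<and> fn g v \<and> (\<forall>x. x \<epsilon> v \<longrightarrow> app g x \<epsilon> bd f) \<and>
   pr b a \<epsilon> e (sep v (\<lambda>x. app g (p1 x) \<epsilon> app f (p2 x))))"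

lemma de': "Tm UNIV T \<Longrightarrow> Tm UNIV (\<lambda>s. e (T s))"
  by (rule Tm_inst[OF de])

lemma Df_pt: "Tm UNIV T \<Longrightarrow> Df UNIV (\<lambda>s. pt (T s))"
  by (rule Dp_sub1[of mem UNIV pt]) (unfold pt_def, (intro dfi)+)

lemma Df_below: "Tm UNIV T \<Longrightarrow> Tm UNIV U \<Longrightarrow> Df UNIV (\<lambda>s. below (T s) (U s))"
  by (rule Dp_sub2[of mem UNIV below]) (unfold below_def bd_def, (intro dfi de')+)

lemma below_iff:
  "below (pr b g) (pr a f) \<longleftrightarrow> b \<epsilon> w0 \<and> fn g v \<and> (\<forall>x. x \<epsilon> v \<longrightarrow> app g x \<epsilon> bd f) \<and> force2 b a (\<lambda>x y. app g x \<epsilon> app f y)"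
  unfolding below_def force_def by auto

lemma w0_w: "a \<epsilon> w0 \<Longrightarrow> a \<epsilon> w"
  using level_memD[OF lw w0w] .

lemma app_bd: "fn f v \<Longrightarrow> x \<epsilon> v \<Longrightarrow> y \<epsilon> app f x \<Longrightarrow> y \<epsilon> bd f"
proof -
  assume f: "fn f v" and x: "x \<epsilon> v" and y: "y \<epsilon> app f x"
  have "pr x (app f x) \<epsilon> f" using fn_app[OF f x] by blast
  then have "app f x \<epsilon> bU (bU f)" using pr_parts by blast
  then show "y \<epsilon> bd f" unfolding bd_def using y mem_bU mem_un by blast
qed

text \<open>If \<open>u\<close> is a level containing \<open>v\<close> and \<open>f\<close>, the
  points whose functions take values in \<open>u\<close> form a closed set, since the bound
  \<open>bd g\<close> of such a function \<open>g\<close> lies within \<open>u\<close>.\<close>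

lemma pt_closure: assumes "pt q" shows "\<exists>c. q \<epsilon> c \<and> (\<forall>y. y \<epsilon> c \<longrightarrow> pt y) \<and> (\<forall>y z. y \<epsilon> c \<and> below z y \<longrightarrow> z \<epsilon> c)"
proof -
  obtain a f where q: "q = pr a f" "a \<epsilon> w0" "fn f v" using assms unfolding pt_def by blast
  obtain u where u: "level u" "pr v f \<epsilon> u" using ex_level by blast
  have vf: "v \<epsilon> u" "f \<epsilon> u" using level_prD[OF u] by auto
  define F where "F = pow (pow (pow (un v u)))"
  define c where "c = sep (pow (pow (un w0 F))) (\<lambda>q. \<exists>b g. q = pr b g \<and> b \<epsilon> w0 \<and> fn g v \<and> (\<forall>x. x \<epsilon> v \<longrightarrow> app g x \<epsilon> u))"
  have D: "Df UNIV (\<lambda>s. \<exists>b g. s 0 = pr b g \<and> b \<epsilon> w0 \<and> fn g v \<and> (\<forall>x. x \<epsilon> v \<longrightarrow> app g x \<epsilon> u))" by (intro dfi)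
  have gF: "g \<epsilon> F" if "fn g v" "\<forall>x. x \<epsilon> v \<longrightarrow> app g x \<epsilon> u" for g
    unfolding F_def by (rule sub_prod) (use that fn_mem[OF that(1)] in blast)
  have c: "pr b g \<epsilon> c \<longleftrightarrow> b \<epsilon> w0 \<and> fn g v \<and> (\<forall>x. x \<epsilon> v \<longrightarrow> app g x \<epsilon> u)" for b g
    unfolding c_def mem_sep[OF D] using in_pow2[of b w0 g F] gF[of g] by auto
  have cp: "\<exists>b g. y = pr b g" if "y \<epsilon> c" for y using that unfolding c_def mem_sep[OF D] by blast
  have "app f x \<epsilon> u" if "x \<epsilon> v" for x
  proof -
    have "pr x (app f x) \<epsilon> f" using fn_app[OF q(3) that] by blast
    then show ?thesis using level_memD[OF u(1) vf(2)] level_prD[OF u(1)] by blast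
  qed
  then have "q \<epsilon> c" using q c by blast
  moreover have "pt y" if "y \<epsilon> c" for y using that cp[OF that] c unfolding pt_def by blast
  moreover have "z \<epsilon> c" if y: "y \<epsilon> c" and z: "below z y" for y z
  proof -
    obtain b g where yb: "y = pr b g" using cp[OF y] by blast
    have g: "fn g v" "\<And>x. x \<epsilon> v \<Longrightarrow> app g x \<epsilon> u" using y c yb by auto
    obtain d h where zd: "z = pr d h" "d \<epsilon> w0" "fn h v" "\<And>x. x \<epsilon> v \<Longrightarrow> app h x \<epsilon> bd g"
      using z yb unfolding below_def by auto
    have "g \<epsilon> pow (pow (pow u))"
    proof -
      have "z \<epsilon> pow (pow u)" if zg: "z \<epsilon> g" for z
      proof -
        obtain x where "x \<epsilon> v" "z = pr x (app g x)" using fn_mem[OF g(1), of z] zg by blast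
        then have "z = pr x (app g x)" "x \<epsilon> u" "app g x \<epsilon> u" using g(2) level_memD[OF u(1) vf(1)] by auto
        then show ?thesis by (auto simp: pr_def sub_def)
      qed
      then show ?thesis by (simp add: sub_def[of mem g])
    qed
    then have "z \<epsilon> u" if "z \<epsilon> bU (bU (bU g))" for z
      using that level_memD[OF u(1)] unfolding mem_bU mem_pow sub_def by blast
    then have "bd g = bd g \<and> (\<forall>z. z \<epsilon> bd g \<longrightarrow> z \<epsilon> u)" unfolding bd_def using level_emp[OF u(1)] by auto
    then show ?thesis using zd c by blast
  qed
  ultimately show ?thesis by blast
qed

text \<open>A descending sequence of points yields the set \<open>A\<close> of its indexed seeds, an
  element of \<open>w\<close> and thus itself a seed. Operation 11 turns the descent of each pair of
  neighbours into the statement that \<open>A\<close> is forced to thread through \<open>W\<close>.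
  No element of \<open>v\<close> does so, since it would give an actual descent in
  \<open>\<epsilon>\<close>; hence \<open>A\<close> would force a contradiction.\<close>

lemma below_wf:
  assumes x: "x \<epsilon> c" and c: "\<forall>y. y \<epsilon> c \<longrightarrow> pt y"
  shows "\<exists>y. y \<epsilon> c \<and> (\<forall>z. z \<epsilon> c \<longrightarrow> \<not> below z y)"
proof (rule ccontr)
  assume n: "\<not> (\<exists>y. y \<epsilon> c \<and> (\<forall>z. z \<epsilon> c \<longrightarrow> \<not> below z y))"
  have "\<exists>h. fn h c \<and> (\<forall>y. y \<epsilon> c \<longrightarrow> app h y \<epsilon> c \<and> below (app h y) y)"
    by (rule choice[of "\<lambda>y z. z \<epsilon> c \<and> below z y"]) (intro dfi Df_below, use n in blast)
  then obtain h where h: "\<And>y. y \<epsilon> c \<Longrightarrow> app h y \<epsilon> c" "\<And>y. y \<epsilon> c \<Longrightarrow> below (app h y) y" by blast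
  have "Tm UNIV (\<lambda>s. app h (s 0))" by (intro dfi)
  from iterate[OF this, of x] obtain Q where Q: "app Q emp = x" "\<And>n. natu n \<Longrightarrow> app Q (succ n) = app h (app Q n)" by blast
  have Qc: "app Q n \<epsilon> c" if "natu n" for n
  proof (rule natu_induct[of "\<lambda>n. app Q n \<epsilon> c"])
    show "Df UNIV (\<lambda>s. app Q (s 0) \<epsilon> c)" by (intro dfi)
  qed (use Q h x that in auto)
  define A where "A = lam om (\<lambda>n. p1 (app Q n))"
  have TA: "Tm UNIV (\<lambda>s. p1 (app Q (s 0)))" by (intro dfi)
  have A: "pr n y \<epsilon> A \<longleftrightarrow> natu n \<and> y = p1 (app Q n)" for n y
    unfolding A_def mem_lam[OF TA] by auto
  have Qp: "app Q n = pr (p1 (app Q n)) (p2 (app Q n)) \<and> p1 (app Q n) \<epsilon> w0 \<and> fn (p2 (app Q n)) v" if "natu n" for n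
    using c Qc[OF that] unfolding pt_def by auto
  let ?f = "\<lambda>n. p2 (app Q n)" and ?a = "\<lambda>n. p1 (app Q n)"
  have desc: "force2 (?a (succ n)) (?a n) (\<lambda>x y. app (?f (succ n)) x \<epsilon> app (?f n) y)" if n: "natu n" for n
  proof -
    have "below (app Q (succ n)) (app Q n)" using Q(2)[OF n] h(2)[OF Qc[OF n]] by simp
    then have "below (pr (?a (succ n)) (?f (succ n))) (pr (?a n) (?f n))" using Qp[OF n] Qp[OF natu_succ[OF n]] by simp
    then show ?thesis unfolding below_iff by blast
  qed
  have omw0: "n \<epsilon> w0" if "natu n" for n
    by (rule natu_induct[of "\<lambda>n. n \<epsilon> w0"]) (use level_emp[OF lw0] level_succ[OF lw0] that in \<open>auto intro: dfi\<close>)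
  have Aw: "A \<epsilon> w"
  proof -
    have "sub mem A w0" unfolding sub_def
    proof (intro allI impI)
      fix z assume "z \<epsilon> A"
      then obtain n where "natu n" "z = pr n (?a n)" unfolding A_def mem_lam[OF TA] by auto
      then show "z \<epsilon> w0" using level_pr[OF lw0] omw0 Qp by blast
    qed
    then show ?thesis using level_super[OF lw w0w] by blast
  qed
  define W where "W = (\<lambda>p. app (?f (succ (p1 p))) (p1 (p2 p)) \<epsilon> app (?f (p1 p)) (p2 (p2 p)))"
  have dW: "Df UNIV (\<lambda>s. W (s 0))" unfolding W_def by (intro dfi)
  have W: "force (pr n (pr (?a (succ n)) (?a n))) W" if n: "natu n" for n
  proof -
    have w: "n \<epsilon> w" "?a (succ n) \<epsilon> w" "?a n \<epsilon> w" using omw0[OF n] w0_w Qp[OF n] Qp[OF natu_succ[OF n]] by auto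
    have w2: "pr (?a (succ n)) (?a n) \<epsilon> w" using level_pr[OF lw] w by blast
    have D: "Df UNIV (\<lambda>s. s 0 = n)" "Df UNIV (\<lambda>s. app (?f (succ n)) (p1 (s 0)) \<epsilon> app (?f n) (p2 (s 0)))" by (intro dfi)+
    have 1: "force (pr n (pr (?a (succ n)) (?a n))) (\<lambda>x. p1 x = n)"
      using R1[of "\<lambda>x. x = n", OF D(1) w(1) w2] force_nat[OF n] by blast
    have 2: "force (pr n (pr (?a (succ n)) (?a n))) (\<lambda>x. app (?f (succ n)) (p1 (p2 x)) \<epsilon> app (?f n) (p2 (p2 x)))"
      using R2[of "\<lambda>x. app (?f (succ n)) (p1 x) \<epsilon> app (?f n) (p2 x)", OF D(2) w(1) w2] desc[OF n] by blast
    show ?thesis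
      by (rule force_mono2[OF _ _ dW 1 2]) (auto intro!: dfi simp: W_def)
  qed
  \<comment> \<open>A thread \<open>y\<close> may have several entries at one index, so the minimal
    value is taken over all its entries; the next index always supplies a smaller one.\<close>
  have bot: "\<not> (phis p ! 11) v y (sep v W)" if y: "y \<epsilon> v" for y
  proof
    assume y: "(phis p ! 11) v y (sep v W)"
    then have y1: "\<exists>z. pr emp z \<epsilon> y" and y2: "\<And>n z. pr n z \<epsilon> y \<Longrightarrow> natu n \<Longrightarrow> \<exists>t. pr (succ n) t \<epsilon> y"
      and y3: "\<And>n z t. pr n z \<epsilon> y \<Longrightarrow> natu n \<Longrightarrow> pr (succ n) t \<epsilon> y \<Longrightarrow> W (pr n (pr t z))"
      unfolding nth_phis mem_sep[OF dW] by blast+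
    define B where "B = sep (pow (pow (un om (bU (bU y))))) (\<lambda>q. q \<epsilon> y)"
    let ?P = "\<lambda>t. \<exists>n z. natu n \<and> pr n z \<epsilon> y \<and> t = app (?f n) z"
    obtain z0 where z0: "pr emp z0 \<epsilon> y" using y1 by blast
    define T where "T = mk ((\<lambda>q. app (?f (p1 q)) (p2 q)) ` ext y)"
    have TT: "Tm UNIV (\<lambda>s. app (?f (p1 (s 0))) (p2 (s 0)))" by (intro dfi)
    have T: "t \<epsilon> T \<longleftrightarrow> (\<exists>q. q \<epsilon> y \<and> t = app (?f (p1 q)) (p2 q))" for t
      unfolding T_def mem_mk[OF small_repl[OF TT]] by auto
    have dP: "Df UNIV (\<lambda>s. ?P (s 0))" by (intro dfi)
    have PT: "t \<epsilon> T" if "?P t" for t using that unfolding T by force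
    have P0: "?P (app (?f emp) z0)" using z0 natu_emp by blast
    have "\<exists>t. t \<epsilon> T \<and> ?P t \<and> (\<forall>s. s \<epsilon> t \<and> s \<epsilon> T \<longrightarrow> \<not> ?P s)"
      by (rule least_mem[of ?P "app (?f emp) z0" T, OF dP PT[OF P0] P0])
    then obtain t where t: "?P t" "\<And>s. s \<epsilon> t \<Longrightarrow> s \<epsilon> T \<Longrightarrow> \<not> ?P s" by metis
    from t(1) obtain n z where n: "natu n" "pr n z \<epsilon> y" "t = app (?f n) z" by (elim exE conjE)
    obtain z' where z': "pr (succ n) z' \<epsilon> y" using y2 n by blast
    have "W (pr n (pr z' z))" using y3 n z' by blast
    then have "app (?f (succ n)) z' \<epsilon> t" unfolding W_def n(3) by simp
    moreover have "?P (app (?f (succ n)) z')" using z' natu_succ[OF n(1)] by blast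
    ultimately show False using t(2) PT by blast
  qed
  have F: "Df UNIV (\<lambda>s. False)" by (intro dfi)
  have "force A (\<lambda>x. False) \<longleftrightarrow> A \<epsilon> w \<and> (phis p ! 11) w A (e (sep v W))"
    by (rule force_op[OF dW _ F]) (use bot in auto)
  moreover have "(phis p ! 11) w A (e (sep v W))"
    unfolding nth_phis A using W natu_succ natu_emp unfolding force_def by auto
  ultimately have "force A (\<lambda>x. False)" using Aw by blast
  then show False using force_bot[OF _ _ F] by blast
qed

text \<open>Recursion in which each value is the set of the earlier values is the Mostowski
  collapse.\<close>

sublocale ult: recursion mem UNIV pt below "\<lambda>q S. S"
proof
  show "Df UNIV (\<lambda>s. pt (s 0))" by (intro Df_pt dfi)
  show "Df UNIV (\<lambda>s. below (s 0) (s 1))" by (intro Df_below dfi)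
  show "Df UNIV (\<lambda>s. s 0 = s 2)" by (intro dfi)
qed (use pt_closure below_wf in blast)+

abbreviation "\<pi> a f \<equiv> ult.recf (pr a f)"

lemma pt_pr [simp]: "pt (pr a f) \<longleftrightarrow> a \<epsilon> w0 \<and> fn f v"
  unfolding pt_def by auto

lemma mem_pi: "a \<epsilon> w0 \<Longrightarrow> fn f v \<Longrightarrow> y \<epsilon> \<pi> a f \<longleftrightarrow> (\<exists>b g. below (pr b g) (pr a f) \<and> y = \<pi> b g)"
proof -
  assume "a \<epsilon> w0" "fn f v"
  then have pt: "pt (pr a f)" by simp
  have "y \<epsilon> \<pi> a f \<longleftrightarrow> (\<exists>q. below q (pr a f) \<and> y = ult.recf q)"
    using ult.recf_eq[OF pt] mem_mk[OF ult.recf_small[OF pt]] by simp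
  also have "\<dots> \<longleftrightarrow> (\<exists>b g. below (pr b g) (pr a f) \<and> y = \<pi> b g)"
    unfolding below_def by blast
  finally show ?thesis .
qed

lemma Tm_pi: "Tm UNIV T \<Longrightarrow> Tm UNIV U \<Longrightarrow> Tm UNIV (\<lambda>s. \<pi> (T s) (U s))"
  by (intro ult.Tm_recf dfi)

text \<open>The bound on values in \<open>below\<close> loses no members: where \<open>g\<close>
  leaves \<open>bd f\<close> it is reset to \<open>emp\<close>, which belongs to
  \<open>bd f\<close>, and this changes it only on a null set for \<open>b\<close>.\<close>

lemma bounding:
  assumes g: "fn g v" and f: "fn f v" and ba: "b \<epsilon> w0" "a \<epsilon> w0" and fo: "force2 b a (\<lambda>x y. app g x \<epsilon> app f y)"
  shows "\<exists>g'. fn g' v \<and> below (pr b g') (pr a f) \<and> force b (\<lambda>x. app g' x = app g x)"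
proof -
  let ?F = "\<lambda>x. if app g x \<epsilon> bd f then app g x else emp"
  have bw: "b \<epsilon> w" "a \<epsilon> w" using ba w0_w by auto
  have T: "Tm UNIV (\<lambda>s. ?F (s 0))" by (intro dfi)
  define g' where "g' = lam v ?F"
  have g': "app g' x = ?F x" if "x \<epsilon> v" for x unfolding g'_def by (rule app_lam[OF T that])
  have D1: "Df UNIV (\<lambda>s. app g (p1 (s 0)) \<epsilon> app f (p2 (s 0)))" by (intro dfi)
  have D2: "Df UNIV (\<lambda>s. app g (s 0) \<epsilon> bd f)" by (intro dfi)
  have D3: "Df UNIV (\<lambda>s. app g' (s 0) = app g (s 0))" by (intro dfi)
  have D4: "Df UNIV (\<lambda>s. app g' (p1 (s 0)) \<epsilon> app f (p2 (s 0)))" by (intro dfi)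
  have D5: "Df UNIV (\<lambda>s. app g (p1 (s 0)) \<epsilon> bd f)" by (intro dfi)
  have "force (pr b a) (\<lambda>x. app g (p1 x) \<epsilon> bd f)"
    by (rule force_mono[OF D1 D5 fo]) (use app_bd[OF f] level_p2[OF lv] in blast)
  then have "force b (\<lambda>x. app g x \<epsilon> bd f)" using R1[of "\<lambda>x. app g x \<epsilon> bd f", OF D2 bw] by blast
  then have "force b (\<lambda>x. app g' x = app g x)" by (rule force_mono[OF D2 D3]) (simp add: g')
  moreover have "force2 b a (\<lambda>x y. app g' x \<epsilon> app f y)"
  proof (rule force_mono[OF D1 D4 fo])
    fix x assume x: "x \<epsilon> v" "app g (p1 x) \<epsilon> app f (p2 x)"
    then have "app g (p1 x) \<epsilon> bd f" using app_bd[OF f] level_p2[OF lv] by blast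
    then show "app g' (p1 x) \<epsilon> app f (p2 x)" using g'[OF level_p1[OF lv x(1)]] x by simp
  qed
  moreover have "fn g' v" unfolding g'_def by (rule fn_lam[OF T])
  moreover have "\<forall>x. x \<epsilon> v \<longrightarrow> app g' x \<epsilon> bd f" using g' by (auto simp: bd_def)
  ultimately show ?thesis unfolding below_iff using ba by blast
qed

lemma fe: "Df UNIV (\<lambda>s. app f (s 0) = app g (s 1))" "Df UNIV (\<lambda>s. app f (s 0) \<epsilon> app g (s 1))"
  by (intro dfi)+

lemma force_diag:
  assumes "b \<epsilon> w" "force b (\<lambda>x. app g' x = app g x)" shows "force2 b b (\<lambda>x y. app g' x = app g y)"
  using Rd[of "\<lambda>x y. app g' x = app g y", OF fe(1) assms(1)] assms(2) by blast

lemma pi_eq_aux1: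
  assumes IH: "\<And>c h d k. below (pr c h) (pr a f) \<Longrightarrow> d \<epsilon> w0 \<Longrightarrow> fn k v \<Longrightarrow> \<pi> c h = \<pi> d k \<longleftrightarrow> force2 c d (\<lambda>x y. app h x = app k y)"
    and pts: "a \<epsilon> w0" "fn f v" "b \<epsilon> w0" "fn g v" and eq: "force2 a b (\<lambda>x y. app f x = app g y)"
  shows "\<pi> a f = \<pi> b g"
proof (rule ext_eqI)
  fix y
  note w = w0_w[OF pts(1)] w0_w[OF pts(3)]
  show "y \<epsilon> \<pi> a f \<longleftrightarrow> y \<epsilon> \<pi> b g"
  proof
    assume "y \<epsilon> \<pi> a f"
    then obtain c h where h: "below (pr c h) (pr a f)" "y = \<pi> c h" using mem_pi pts by blast
    then have c: "c \<epsilon> w0" "fn h v" "force2 c a (\<lambda>x y. app h x \<epsilon> app f y)" unfolding below_iff by auto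
    have "force2 c b (\<lambda>x y. app h x \<epsilon> app g y)"
      by (rule comp[OF fe(2) fe(1) fe(2) w0_w[OF c(1)] w c(3) eq]) simp
    from bounding[OF c(2) pts(4) c(1) pts(3) this] obtain h' where h': "fn h' v" "below (pr c h') (pr b g)" "force c (\<lambda>x. app h' x = app h x)"
      by blast
    have "force2 c c (\<lambda>x y. app h x = app h' y)"
      using fsym[OF fe(1) _ _ force_diag[OF w0_w[OF c(1)] h'(3)]] w0_w[OF c(1)] by (simp add: eq_commute)
    then have "\<pi> c h = \<pi> c h'" using IH[OF h(1) c(1) h'(1)] by blast
    then have "y = \<pi> c h'" using h(2) by simp
    then show "y \<epsilon> \<pi> b g" unfolding mem_pi[OF pts(3,4)] using h'(2) by blast
  next
    assume "y \<epsilon> \<pi> b g"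
    then obtain c h where h: "below (pr c h) (pr b g)" "y = \<pi> c h" using mem_pi pts by blast
    then have c: "c \<epsilon> w0" "fn h v" "force2 c b (\<lambda>x y. app h x \<epsilon> app g y)" unfolding below_iff by auto
    have gf: "force2 b a (\<lambda>x y. app g x = app f y)" using fsym[OF fe(1) w eq] by (simp add: eq_commute)
    have "force2 c a (\<lambda>x y. app h x \<epsilon> app f y)"
      by (rule comp[OF fe(2) fe(1) fe(2) w0_w[OF c(1)] w(2,1) c(3) gf]) metis
    from bounding[OF c(2) pts(2) c(1) pts(1) this] obtain h' where h': "fn h' v" "below (pr c h') (pr a f)" "force c (\<lambda>x. app h' x = app h x)"
      by blast
    have "\<pi> c h' = \<pi> c h" using IH[OF h'(2) c(1,2)] force_diag[OF w0_w[OF c(1)] h'(3)] by blast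
    then have "y = \<pi> c h'" using h(2) by simp
    then show "y \<epsilon> \<pi> a f" unfolding mem_pi[OF pts(1,2)] using h'(2) by blast
  qed
qed

text \<open>Extensionality of the ultrapower: over the joint seed \<open>pr a b\<close>, the
  function \<open>h\<close> chooses an element of the symmetric difference of the two values. One of
  the two directions of the difference is then forced.\<close>

lemma pi_ne_aux:
  assumes pts: "a \<epsilon> w0" "fn f v" "b \<epsilon> w0" "fn g v" and ne: "\<not> force2 a b (\<lambda>x y. app f x = app g y)"
  shows "\<exists>c h. c \<epsilon> w0 \<and> fn h v \<and> ((force2 c a (\<lambda>x y. app h x \<epsilon> app f y) \<and> \<not> force2 c b (\<lambda>x y. app h x \<epsilon> app g y)) \<or>
     (force2 c b (\<lambda>x y. app h x \<epsilon> app g y) \<and> \<not> force2 c a (\<lambda>x y. app h x \<epsilon> app f y)))"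
proof -
  note w = w0_w[OF pts(1)] w0_w[OF pts(3)]
  let ?c = "pr a b"
  have c: "?c \<epsilon> w0" "?c \<epsilon> w" using level_pr[OF lw0] pts w0_w by blast+
  let ?N = "\<lambda>z. app f (p1 z) \<noteq> app g (p2 z)"
  let ?H = "\<lambda>z t. ?N z \<longrightarrow> (t \<epsilon> app f (p1 z) \<and> \<not> t \<epsilon> app g (p2 z)) \<or> (t \<epsilon> app g (p2 z) \<and> \<not> t \<epsilon> app f (p1 z))"
  have "\<exists>h. fn h v \<and> (\<forall>z. z \<epsilon> v \<longrightarrow> ?H z (app h z))"
  proof (rule choice[of ?H])
    show "Df UNIV (\<lambda>s. ?H (s 0) (s 1))" by (intro dfi)
    fix z show "\<exists>t. ?H z t" using ext_eqI[of "app f (p1 z)" "app g (p2 z)"] by blast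
  qed
  then obtain h where h: "fn h v" "\<And>z. z \<epsilon> v \<Longrightarrow> ?H z (app h z)" by blast
  have DN: "Df UNIV (\<lambda>s. ?N (s 0))" by (intro dfi)
  let ?A = "\<lambda>z. app h z \<epsilon> app f (p1 z)" and ?B = "\<lambda>z. app h z \<epsilon> app g (p2 z)"
  have DA: "Df UNIV (\<lambda>s. ?A (s 0))" and DB: "Df UNIV (\<lambda>s. ?B (s 0))" by (intro dfi)+
  have DE: "Df UNIV (\<lambda>s. app f (p1 (s 0)) = app g (p2 (s 0)))" by (intro dfi)
  have "force ?c ?N" using force_not[of "\<lambda>z. app f (p1 z) = app g (p2 z)", OF DE c(2)] ne by blast
  then have "force ?c (\<lambda>z. (?A z \<and> \<not> ?B z) \<or> (?B z \<and> \<not> ?A z))"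
    by (rule force_mono[OF DN, rotated]) (use h(2) in blast, intro dfi)
  then have "force ?c (\<lambda>z. ?A z \<and> \<not> ?B z) \<or> force ?c (\<lambda>z. ?B z \<and> \<not> ?A z)"
    by (rule force_disj[rotated 2]) (intro dfi)+
  moreover have A: "force2 ?c a (\<lambda>x y. app h x \<epsilon> app f y)" if "force ?c ?A"
    by (rule lift1[of "\<lambda>x y. app h x \<epsilon> app f y", OF fe(2) w that])
  moreover have B: "force2 ?c b (\<lambda>x y. app h x \<epsilon> app g y)" if "force ?c ?B"
    by (rule lift2[of "\<lambda>x y. app h x \<epsilon> app g y", OF fe(2) w that])
  moreover have nA: "\<not> force2 ?c a (\<lambda>x y. app h x \<epsilon> app f y)" if n: "force ?c (\<lambda>z. \<not> ?A z)"
  proof -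
    have D: "Df UNIV (\<lambda>s. \<not> app h (s 0) \<epsilon> app f (s 1))" and D2: "Df UNIV (\<lambda>s. app h (p1 (s 0)) \<epsilon> app f (p2 (s 0)))"
      by (intro dfi)+
    have "force2 ?c a (\<lambda>x y. \<not> app h x \<epsilon> app f y)"
      by (rule lift1[of "\<lambda>x y. \<not> app h x \<epsilon> app f y", OF D w n])
    then show ?thesis
      using force_not[of "\<lambda>x. app h (p1 x) \<epsilon> app f (p2 x)" "pr ?c a", OF D2 level_pr[OF lw c(2) w(1)]] by blast
  qed
  moreover have nB: "\<not> force2 ?c b (\<lambda>x y. app h x \<epsilon> app g y)" if n: "force ?c (\<lambda>z. \<not> ?B z)"
  proof -
    have D: "Df UNIV (\<lambda>s. \<not> app h (s 0) \<epsilon> app g (s 1))" and D2: "Df UNIV (\<lambda>s. app h (p1 (s 0)) \<epsilon> app g (p2 (s 0)))"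
      by (intro dfi)+
    have "force2 ?c b (\<lambda>x y. \<not> app h x \<epsilon> app g y)"
      by (rule lift2[of "\<lambda>x y. \<not> app h x \<epsilon> app g y", OF D w n])
    then show ?thesis
      using force_not[of "\<lambda>x. app h (p1 x) \<epsilon> app g (p2 x)" "pr ?c b", OF D2 level_pr[OF lw c(2) w(2)]] by blast
  qed
  ultimately show ?thesis using force_conj[OF DA Dp_not[OF DB], of ?c] force_conj[OF DB Dp_not[OF DA], of ?c] c(1) h(1)
    by blast
qed

text \<open>The induction is on the left point only, while the right one stays arbitrary. A member
  of the right-hand class is compared through its equal on the left, which is where symmetry of
  forcing enters.\<close>

lemma pi_eq0:
  "\<forall>a f b g. q = pr a f \<and> pt (pr b g) \<longrightarrow> (ult.recf q = \<pi> b g \<longleftrightarrow> force2 a b (\<lambda>x y. app f x = app g y))" if "pt q"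
proof (rule ult.rec_induct[of "\<lambda>q. \<forall>a f b g. q = pr a f \<and> pt (pr b g) \<longrightarrow> (ult.recf q = \<pi> b g \<longleftrightarrow> force2 a b (\<lambda>x y. app f x = app g y))"])
  show "Df UNIV (\<lambda>s. \<forall>a f b g. s 0 = pr a f \<and> pt (pr b g) \<longrightarrow> (ult.recf (s 0) = \<pi> b g \<longleftrightarrow> force2 a b (\<lambda>x y. app f x = app g y)))"
    unfolding force_def by (intro dfi Df_pt ult.Tm_recf de')
  fix q assume q: "pt q" and IH0: "\<And>q'. below q' q \<Longrightarrow> \<forall>a f b g. q' = pr a f \<and> pt (pr b g) \<longrightarrow>
      (ult.recf q' = \<pi> b g \<longleftrightarrow> force2 a b (\<lambda>x y. app f x = app g y))"
  show "\<forall>a f b g. q = pr a f \<and> pt (pr b g) \<longrightarrow> (ult.recf q = \<pi> b g \<longleftrightarrow> force2 a b (\<lambda>x y. app f x = app g y))"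
  proof (intro allI impI)
    fix a f b g assume "q = pr a f \<and> pt (pr b g)"
    then have qa: "q = pr a f" and pts: "a \<epsilon> w0" "fn f v" "b \<epsilon> w0" "fn g v" using q by auto
    note w = w0_w[OF pts(1)] w0_w[OF pts(3)]
    have IH: "\<pi> c h = \<pi> d k \<longleftrightarrow> force2 c d (\<lambda>x y. app h x = app k y)"
      if "below (pr c h) (pr a f)" "d \<epsilon> w0" "fn k v" for c h d k
      using IH0[of "pr c h"] that unfolding qa by auto
    show "ult.recf q = \<pi> b g \<longleftrightarrow> force2 a b (\<lambda>x y. app f x = app g y)"
    proof
      assume fo: "force2 a b (\<lambda>x y. app f x = app g y)"
      show "ult.recf q = \<pi> b g" unfolding qa by (rule pi_eq_aux1[OF IH pts fo])
    next
      assume eq: "ult.recf q = \<pi> b g"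
      show "force2 a b (\<lambda>x y. app f x = app g y)"
      proof (rule ccontr)
        assume "\<not> force2 a b (\<lambda>x y. app f x = app g y)"
        then obtain c h where c: "c \<epsilon> w0" "fn h v" and
          h: "(force2 c a (\<lambda>x y. app h x \<epsilon> app f y) \<and> \<not> force2 c b (\<lambda>x y. app h x \<epsilon> app g y)) \<or>
              (force2 c b (\<lambda>x y. app h x \<epsilon> app g y) \<and> \<not> force2 c a (\<lambda>x y. app h x \<epsilon> app f y))"
          using pi_ne_aux[OF pts] by blast
        have cw: "c \<epsilon> w" using w0_w c by blast
        from h show False
        proof
          assume h1: "force2 c a (\<lambda>x y. app h x \<epsilon> app f y) \<and> \<not> force2 c b (\<lambda>x y. app h x \<epsilon> app g y)"
          then obtain h' where h': "fn h' v" "below (pr c h') (pr a f)" "force c (\<lambda>x. app h' x = app h x)"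
            using bounding[OF c(2) pts(2) c(1) pts(1)] by blast
          have "\<pi> c h' \<epsilon> \<pi> a f" unfolding mem_pi[OF pts(1,2)] using h'(2) by blast
          then have "\<pi> c h' \<epsilon> \<pi> b g" using eq unfolding qa by simp
          then obtain d k where k: "below (pr d k) (pr b g)" "\<pi> c h' = \<pi> d k" using mem_pi[OF pts(3,4)] by blast
          then have d: "d \<epsilon> w0" "fn k v" "force2 d b (\<lambda>x y. app k x \<epsilon> app g y)" unfolding below_iff by auto
          have 1: "force2 c d (\<lambda>x y. app h' x = app k y)" using IH[OF h'(2) d(1,2)] k by blast
          have 2: "force2 c b (\<lambda>x y. app h' x \<epsilon> app g y)"
            by (rule comp[OF fe(1) fe(2) fe(2) cw w0_w[OF d(1)] w(2) 1 d(3)]) simp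
          have 3: "force2 c c (\<lambda>x y. app h x = app h' y)"
            using fsym[OF fe(1) cw cw force_diag[OF cw h'(3)]] by (simp add: eq_commute)
          have "force2 c b (\<lambda>x y. app h x \<epsilon> app g y)"
            by (rule comp[OF fe(1) fe(2) fe(2) cw cw w(2) 3 2]) simp
          then show False using h1 by blast
        next
          assume h1: "force2 c b (\<lambda>x y. app h x \<epsilon> app g y) \<and> \<not> force2 c a (\<lambda>x y. app h x \<epsilon> app f y)"
          then obtain h' where h': "fn h' v" "below (pr c h') (pr b g)" "force c (\<lambda>x. app h' x = app h x)"
            using bounding[OF c(2) pts(4) c(1) pts(3)] by blast
          have "\<pi> c h' \<epsilon> \<pi> b g" unfolding mem_pi[OF pts(3,4)] using h'(2) by blast
          then have "\<pi> c h' \<epsilon> \<pi> a f" using eq unfolding qa by simp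
          then obtain d k where k: "below (pr d k) (pr a f)" "\<pi> d k = \<pi> c h'" using mem_pi[OF pts(1,2)] by metis
          then have d: "d \<epsilon> w0" "fn k v" "force2 d a (\<lambda>x y. app k x \<epsilon> app f y)" unfolding below_iff by auto
          have 0: "force2 d c (\<lambda>x y. app k x = app h' y)" using IH[OF k(1) c(1) h'(1)] k by blast
          have 1: "force2 c d (\<lambda>x y. app h' x = app k y)"
            using fsym[OF fe(1) w0_w[OF d(1)] cw 0] by (simp add: eq_commute)
          have 2: "force2 c a (\<lambda>x y. app h' x \<epsilon> app f y)"
            by (rule comp[OF fe(1) fe(2) fe(2) cw w0_w[OF d(1)] w(1) 1 d(3)]) simp
          have 3: "force2 c c (\<lambda>x y. app h x = app h' y)"
            using fsym[OF fe(1) cw cw force_diag[OF cw h'(3)]] by (simp add: eq_commute)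
          have "force2 c a (\<lambda>x y. app h x \<epsilon> app f y)"
            by (rule comp[OF fe(1) fe(2) fe(2) cw cw w(1) 3 2]) simp
          then show False using h1 by blast
        qed
      qed
    qed
  qed
qed (rule that)

lemma pi_eq:
  assumes "a \<epsilon> w0" "fn f v" "b \<epsilon> w0" "fn g v" shows "\<pi> a f = \<pi> b g \<longleftrightarrow> force2 a b (\<lambda>x y. app f x = app g y)"
  using pi_eq0[of "pr a f"] assms by auto

lemma pi_mem:
  assumes pts: "a \<epsilon> w0" "fn f v" "b \<epsilon> w0" "fn g v" shows "\<pi> a f \<epsilon> \<pi> b g \<longleftrightarrow> force2 a b (\<lambda>x y. app f x \<epsilon> app g y)"
proof
  note w = w0_w[OF pts(1)] w0_w[OF pts(3)]
  assume "\<pi> a f \<epsilon> \<pi> b g"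
  then obtain c h where h: "below (pr c h) (pr b g)" "\<pi> a f = \<pi> c h" using mem_pi pts by blast
  then have c: "c \<epsilon> w0" "fn h v" "force2 c b (\<lambda>x y. app h x \<epsilon> app g y)" unfolding below_iff by auto
  have 1: "force2 a c (\<lambda>x y. app f x = app h y)" using pi_eq[OF pts(1,2) c(1,2)] h by blast
  show "force2 a b (\<lambda>x y. app f x \<epsilon> app g y)"
    by (rule comp[OF fe(1) fe(2) fe(2) w(1) w0_w[OF c(1)] w(2) 1 c(3)]) simp
next
  assume "force2 a b (\<lambda>x y. app f x \<epsilon> app g y)"
  from bounding[OF pts(2,4,1,3) this] obtain f' where f': "fn f' v" "below (pr a f') (pr b g)" "force a (\<lambda>x. app f' x = app f x)"
    by blast
  have "\<pi> a f' = \<pi> a f" using pi_eq[OF pts(1) f'(1) pts(1,2)] force_diag[OF w0_w[OF pts(1)] f'(3)] by blast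
  moreover have "\<pi> a f' \<epsilon> \<pi> b g" unfolding mem_pi[OF pts(3,4)] using f'(2) by blast
  ultimately show "\<pi> a f \<epsilon> \<pi> b g" by simp
qed

definition "M = {y. \<exists>a f. a \<epsilon> w0 \<and> fn f v \<and> y = \<pi> a f}"

lemma Df_satf: "Df UNIV (\<lambda>t. sat mem UNIV (\<lambda>i. app (gs i) (t 0)) q)"
  by (intro dfi)

text \<open>Isolated, with the induction hypothesis as an assumption, because the universal case of
  Los's theorem applies it to \<open>Neg q\<close>.\<close>

lemma Los_ex:
  assumes IH: "\<And>b gs. b \<epsilon> w0 \<Longrightarrow> (\<And>i. fn (gs i) v) \<Longrightarrow>
      sat mem M (\<lambda>i. \<pi> b (gs i)) q \<longleftrightarrow> force b (\<lambda>x. sat mem UNIV (\<lambda>i. app (gs i) x) q)"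
    and b: "b \<epsilon> w0" and gs: "\<And>i. fn (gs i) v"
  shows "sat mem M (\<lambda>i. \<pi> b (gs i)) (Exists x q) \<longleftrightarrow> force b (\<lambda>z. sat mem UNIV (\<lambda>i. app (gs i) z) (Exists x q))"
proof -
  let ?s = "\<lambda>i. \<pi> b (gs i)"
  have bw: "b \<epsilon> w" using b w0_w by blast
  have DE: "Df UNIV (\<lambda>t. sat mem UNIV (\<lambda>i. app (gs i) (t 0)) (Exists x q))" by (rule Df_satf)
  show ?thesis
  proof
    assume "sat mem M ?s (Exists x q)"
    then obtain a f where a: "a \<epsilon> w0" "fn f v" "sat mem M (?s(x := \<pi> a f)) q" unfolding M_def by auto
    have aw: "a \<epsilon> w" using a w0_w by blast
    \<comment> \<open>The witness comes with a seed of its own. Over the joint seed every function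
      is composed with the projection to its original seed, which does not change the points
      represented.\<close>
    define c where "c = pr b a"
    have c: "c \<epsilon> w0" "c \<epsilon> w" unfolding c_def using level_pr[OF lw0] b a w0_w by blast+
    define hs where "hs i = (if i = x then lam v (\<lambda>z. app f (p2 z)) else lam v (\<lambda>z. app (gs i) (p1 z)))" for i
    have T1: "Tm UNIV (\<lambda>s. app f (p2 (s 0)))" by (intro dfi)
    have T2: "Tm UNIV (\<lambda>s. app (gs i) (p1 (s 0)))" for i by (intro dfi)
    have hf: "fn (hs i) v" for i unfolding hs_def using fn_lam[OF T1] fn_lam[OF T2] by simp
    have h1: "app (hs i) z = app (gs i) (p1 z)" if "z \<epsilon> v" "i \<noteq> x" for i z
      unfolding hs_def using app_lam[OF T2 that(1)] that(2) by simp
    have h2: "app (hs x) z = app f (p2 z)" if "z \<epsilon> v" for z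
      unfolding hs_def using app_lam[OF T1 that(1)] by simp
    have e1: "\<pi> c (hs i) = \<pi> b (gs i)" if "i \<noteq> x" for i
    proof -
      have "force c (\<lambda>z. app (hs i) z = app (gs i) (p1 z))"
        by (rule force_top[OF c(2)]) (use h1 that in \<open>auto intro!: dfi\<close>)
      then have "force2 c b (\<lambda>x y. app (hs i) x = app (gs i) y)"
        unfolding c_def by (intro lift1[of "\<lambda>x y. app (hs i) x = app (gs i) y", OF fe(1) bw aw])
      then show ?thesis using pi_eq[OF c(1) hf b gs] by blast
    qed
    have e2: "\<pi> c (hs x) = \<pi> a f"
    proof -
      have "force c (\<lambda>z. app (hs x) z = app f (p2 z))"
        by (rule force_top[OF c(2)]) (use h2 in \<open>auto intro!: dfi\<close>)
      then have "force2 c a (\<lambda>x' y. app (hs x) x' = app f y)"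
        unfolding c_def by (intro lift2[of "\<lambda>x' y. app (hs x) x' = app f y", OF fe(1) bw aw])
      then show ?thesis using pi_eq[OF c(1) hf a(1,2)] by blast
    qed
    have "(\<lambda>i. \<pi> c (hs i)) = ?s(x := \<pi> a f)" using e1 e2 by auto
    then have "force c (\<lambda>z. sat mem UNIV (\<lambda>i. app (hs i) z) q)" using IH[of c hs, OF c(1) hf] a(3) by simp
    note fh = this
    have "force c (\<lambda>z. sat mem UNIV (\<lambda>i. app (gs i) (p1 z)) (Exists x q))"
    proof (rule force_mono[OF Df_satf _ fh])
      show "Df UNIV (\<lambda>t. sat mem UNIV (\<lambda>i. app (gs i) (p1 (t 0))) (Exists x q))" by (intro dfi)
      fix z assume z: "z \<epsilon> v" "sat mem UNIV (\<lambda>i. app (hs i) z) q"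
      have "(\<lambda>i. app (hs i) z) = (\<lambda>i. app (gs i) (p1 z))(x := app f (p2 z))" using h1[OF z(1)] h2[OF z(1)] by auto
      then show "sat mem UNIV (\<lambda>i. app (gs i) (p1 z)) (Exists x q)" using z(2) by auto
    qed
    then show "force b (\<lambda>z. sat mem UNIV (\<lambda>i. app (gs i) z) (Exists x q))"
      unfolding c_def using R1[OF DE bw aw] by blast
  next
    assume fo: "force b (\<lambda>z. sat mem UNIV (\<lambda>i. app (gs i) z) (Exists x q))"
    \<comment> \<open>Witnesses are chosen at all points that have one; elsewhere any value will
      do.\<close>
    let ?H = "\<lambda>z t. sat mem UNIV (\<lambda>i. app (gs i) z) (Exists x q) \<longrightarrow> sat mem UNIV ((\<lambda>i. app (gs i) z)(x := t)) q"
    have "\<exists>h. fn h v \<and> (\<forall>z. z \<epsilon> v \<longrightarrow> ?H z (app h z))"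
    proof (rule choice[of ?H])
      have "Df UNIV (\<lambda>s. sat mem UNIV (\<lambda>i. if i = x then s 1 else app (gs i) (s 0)) q)" by (intro dfi)
      moreover have "(\<lambda>i. if i = x then t else app (gs i) z) = (\<lambda>i. app (gs i) z)(x := t)" for z t by auto
      ultimately have "Df UNIV (\<lambda>s. sat mem UNIV ((\<lambda>i. app (gs i) (s 0))(x := s 1)) q)" by simp
      then show "Df UNIV (\<lambda>s. ?H (s 0) (s 1))" by (intro Dp_imp DE)
      fix z show "\<exists>t. ?H z t" by auto
    qed
    then obtain h where h: "fn h v" "\<And>z. z \<epsilon> v \<Longrightarrow> ?H z (app h z)" by blast
    have gh: "fn ((gs(x := h)) i) v" for i using gs h(1) by simp
    have "force b (\<lambda>z. sat mem UNIV (\<lambda>i. app ((gs(x := h)) i) z) q)"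
    proof (rule force_mono[OF DE Df_satf fo])
      fix z assume z: "z \<epsilon> v" "sat mem UNIV (\<lambda>i. app (gs i) z) (Exists x q)"
      have "(\<lambda>i. app ((gs(x := h)) i) z) = (\<lambda>i. app (gs i) z)(x := app h z)" by auto
      then show "sat mem UNIV (\<lambda>i. app ((gs(x := h)) i) z) q" using h(2)[OF z(1)] z(2) by simp
    qed
    then have "sat mem M (\<lambda>i. \<pi> b ((gs(x := h)) i)) q" using IH[of b "gs(x := h)", OF b gh] by blast
    moreover have "(\<lambda>i. \<pi> b ((gs(x := h)) i)) = ?s(x := \<pi> b h)" by auto
    moreover have "\<pi> b h \<in> M" unfolding M_def using b h by blast
    ultimately show "sat mem M ?s (Exists x q)" by auto
  qed
qed

lemma Los: "b \<epsilon> w0 \<Longrightarrow> (\<And>i. fn (gs i) v) \<Longrightarrow>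
   sat mem M (\<lambda>i. \<pi> b (gs i)) q \<longleftrightarrow> force b (\<lambda>x. sat mem UNIV (\<lambda>i. app (gs i) x) q)"
proof (induction q arbitrary: b gs)
  case (Mem i j)
  have bw: "b \<epsilon> w" using Mem w0_w by blast
  show ?case using pi_mem[OF Mem(1,2) Mem(1,2)] Rd[of "\<lambda>x y. app (gs i) x \<epsilon> app (gs j) y", OF fe(2) bw] by simp
next
  case (Eq i j)
  have bw: "b \<epsilon> w" using Eq w0_w by blast
  show ?case using pi_eq[OF Eq(1,2) Eq(1,2)] Rd[of "\<lambda>x y. app (gs i) x = app (gs j) y", OF fe(1) bw] by simp
next
  case (Neg q)
  have bw: "b \<epsilon> w" using Neg w0_w by blast
  show ?case using Neg force_not[OF Df_satf bw] by simp
next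
  case (Conj q r) then show ?case using force_conj[OF Df_satf Df_satf] by simp
next
  case (Exists x q) show ?case by (rule Los_ex) (use Exists in auto)
next
  case (Forall x q)
  have bw: "b \<epsilon> w" using Forall w0_w by blast
  have N: "sat mem M (\<lambda>i. \<pi> b (gs i)) (Neg q) \<longleftrightarrow> force b (\<lambda>x. sat mem UNIV (\<lambda>i. app (gs i) x) (Neg q))"
    if b: "b \<epsilon> w0" "\<And>i. fn (gs i) v" for b gs
    using Forall.IH[OF b] force_not[OF Df_satf w0_w[OF b(1)]] by simp
  have "sat mem M (\<lambda>i. \<pi> b (gs i)) (Exists x (Neg q)) \<longleftrightarrow> force b (\<lambda>z. sat mem UNIV (\<lambda>i. app (gs i) z) (Exists x (Neg q)))"
    by (rule Los_ex[OF N]) (use Forall in auto)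
  moreover have "force b (\<lambda>z. sat mem UNIV (\<lambda>i. app (gs i) z) (Exists x (Neg q))) \<longleftrightarrow>
      \<not> force b (\<lambda>z. sat mem UNIV (\<lambda>i. app (gs i) z) (Forall x q))"
    using force_not[OF Df_satf[of gs "Forall x q"] bw] by simp
  ultimately show ?case unfolding sat.simps by blast
qed

definition "j x = \<pi> emp (lam v (\<lambda>_. x))"

lemma fn_const: "fn (lam v (\<lambda>_. x)) v" and app_const: "z \<epsilon> v \<Longrightarrow> app (lam v (\<lambda>_. x)) z = x"
proof -
  have T: "Tm UNIV (\<lambda>s. x)" by (intro dfi)
  show "fn (lam v (\<lambda>_. x)) v" by (rule fn_lam[OF T])
  show "z \<epsilon> v \<Longrightarrow> app (lam v (\<lambda>_. x)) z = x" by (rule app_lam[OF T])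
qed

lemma Tm_j: "Tm UNIV T \<Longrightarrow> Tm UNIV (\<lambda>s. j (T s))"
  unfolding j_def by (rule Tm_inst) (intro Tm_pi dfi)+

lemma w0_emp: "emp \<epsilon> w0" by (rule level_emp[OF lw0])

lemma j_elementary: "elementary_embedding mem j M"
  unfolding elementary_embedding_def
proof (intro conjI allI ballI impI)
  show "definable_fun mem j" by (rule definable_funI) (intro Tm_j dfi)
  have "Df UNIV (\<lambda>s. \<exists>a f. a \<epsilon> w0 \<and> fn f v \<and> s 0 = \<pi> a f)" by (intro dfi Tm_pi)
  then show "definable_class mem M" unfolding M_def by (rule definable_classI)
  show "y \<in> M" if x: "x \<in> M" and y: "y \<epsilon> x" for x y
  proof -
    obtain a f where a: "a \<epsilon> w0" "fn f v" "x = \<pi> a f" using x unfolding M_def by blast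
    then obtain b g where "below (pr b g) (pr a f)" "y = \<pi> b g" using mem_pi y by blast
    then show ?thesis unfolding M_def below_iff by blast
  qed
  show "range j \<subseteq> M" unfolding M_def j_def using w0_emp fn_const by blast
  fix q s
  have "sat mem M (\<lambda>i. \<pi> emp (lam v (\<lambda>_. s i))) q \<longleftrightarrow> force emp (\<lambda>x. sat mem UNIV (\<lambda>i. app (lam v (\<lambda>_. s i)) x) q)"
    by (rule Los[OF w0_emp fn_const])
  also have "\<dots> \<longleftrightarrow> force emp (\<lambda>x. sat mem UNIV s q)"
    by (rule force_cong) (use app_const in \<open>auto intro!: dfi\<close>)
  also have "\<dots> \<longleftrightarrow> sat mem UNIV s q"
  proof (cases "sat mem UNIV s q")
    case True
    then show ?thesis using force_top[of emp "\<lambda>x. sat mem UNIV s q", OF w0_w[OF w0_emp]] by (auto intro: dfi)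
  next
    case False
    then show ?thesis using force_bot[of emp "\<lambda>x. sat mem UNIV s q"] by (auto intro: dfi)
  qed
  finally show "sat mem UNIV s q \<longleftrightarrow> sat mem M (j \<circ> s) q" unfolding j_def comp_def by blast
qed

definition "idf = lam v (\<lambda>x. x)"

lemma fn_idf: "fn idf v" and app_idf: "z \<epsilon> v \<Longrightarrow> app idf z = z"
proof -
  have T: "Tm UNIV (\<lambda>s. s 0)" by (intro dfi)
  show "fn idf v" unfolding idf_def by (rule fn_lam[OF T])
  show "z \<epsilon> v \<Longrightarrow> app idf z = z" unfolding idf_def by (rule app_lam[OF T])
qed

text \<open>A function forced to be an element of the identity at \<open>a\<close> is, by
  \<open>Rb\<close>, forced equal to the identity at some seed \<open>c \<epsilon> a\<close>, which
  by induction represents \<open>c\<close>.\<close>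

lemma pi_id: "a \<epsilon> w0 \<Longrightarrow> \<pi> a idf = a"
proof -
  have "a \<epsilon> w0 \<longrightarrow> \<pi> a idf = a"
  proof (rule mem_induct[of "\<lambda>a. a \<epsilon> w0 \<longrightarrow> \<pi> a idf = a"])
    show "Df UNIV (\<lambda>s. s 0 \<epsilon> w0 \<longrightarrow> \<pi> (s 0) idf = s 0)" by (intro dfi Tm_pi)
    fix a assume IH: "\<And>c. c \<epsilon> a \<Longrightarrow> c \<epsilon> w0 \<longrightarrow> \<pi> c idf = c"
    show "a \<epsilon> w0 \<longrightarrow> \<pi> a idf = a"
    proof
      assume a: "a \<epsilon> w0"
      have aw: "a \<epsilon> w" using w0_w a by blast
      have cl: "c \<epsilon> w0" "\<pi> c idf = c" if "c \<epsilon> a" for c using level_memD[OF lw0 a that] IH[OF that] by auto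
      show "\<pi> a idf = a"
      proof (rule ext_eqI)
        fix y show "y \<epsilon> \<pi> a idf \<longleftrightarrow> y \<epsilon> a"
        proof
          assume "y \<epsilon> \<pi> a idf"
          then obtain b g where b: "below (pr b g) (pr a idf)" "y = \<pi> b g" using mem_pi[OF a fn_idf] by blast
          then have b': "b \<epsilon> w0" "fn g v" "force2 b a (\<lambda>x y. app g x \<epsilon> app idf y)" unfolding below_iff by auto
          have bw: "b \<epsilon> w" using w0_w b' by blast
          have D: "Df UNIV (\<lambda>s. app g (s 0) = app idf (s 1))" by (rule fe)
          have "force2 b a (\<lambda>x y. \<exists>z. z \<epsilon> y \<and> app g x = app idf z)"
          proof (rule force_mono[OF _ _ b'(3)])
            fix x assume x: "x \<epsilon> v" "app g (p1 x) \<epsilon> app idf (p2 x)"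
            have 2: "p2 x \<epsilon> v" by (rule level_p2[OF lv x(1)])
            then have "app g (p1 x) \<epsilon> p2 x" using x(2) app_idf by simp
            then show "\<exists>z. z \<epsilon> p2 x \<and> app g (p1 x) = app idf z" using app_idf level_memD[OF lv 2] by metis
          qed (intro dfi)+
          then obtain c where c: "c \<epsilon> a" "force2 b c (\<lambda>x y. app g x = app idf y)"
            using Rb[of "\<lambda>x y. app g x = app idf y", OF D bw aw] by blast
          then have "\<pi> b g = \<pi> c idf" using pi_eq[OF b'(1,2) cl(1)[OF c(1)] fn_idf] by blast
          then show "y \<epsilon> a" using b(2) cl c by simp
        next
          assume y: "y \<epsilon> a"
          note yc = cl[OF y]
          have "force2 y a (\<epsilon>)" using Rm[OF w0_w[OF yc(1)] aw] y by blast
          then have "force2 y a (\<lambda>x y. app idf x \<epsilon> app idf y)"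
            by (rule force_mono[rotated 2]) (use app_idf level_p1[OF lv] level_p2[OF lv] in \<open>auto intro!: dfi\<close>)
          then show "y \<epsilon> \<pi> a idf" using pi_mem[OF yc(1) fn_idf a fn_idf] yc(2) by metis
        qed
      qed
    qed
  qed
  then show "a \<epsilon> w0 \<Longrightarrow> \<pi> a idf = a" by blast
qed

lemma w0_M: "ext w0 \<subseteq> M"
proof
  fix a assume "a \<in> ext w0"
  then have "a \<epsilon> w0" "a = \<pi> a idf" using pi_id by auto
  then show "a \<in> M" unfolding M_def using fn_idf by blast
qed

text \<open>Reads off from the action of the extender on singletons which sets are moved, and
  thereby the critical point.\<close>

lemma j_iff: "a \<epsilon> w0 \<Longrightarrow> j x = a \<longleftrightarrow> force a (\<lambda>y. y = x)"
proof -
  assume a: "a \<epsilon> w0"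
  have "j x = a \<longleftrightarrow> force2 emp a (\<lambda>z y. app (lam v (\<lambda>_. x)) z = app idf y)"
    unfolding j_def using pi_eq[OF w0_emp fn_const a fn_idf] pi_id[OF a] by simp
  also have "\<dots> \<longleftrightarrow> force (pr emp a) (\<lambda>z. p2 z = x)"
    by (rule force_cong) (use app_const app_idf level_p1[OF lv] level_p2[OF lv] in \<open>auto intro!: dfi\<close>)
  also have "\<dots> \<longleftrightarrow> force a (\<lambda>y. y = x)"
    by (rule R2[of "\<lambda>y. y = x"]) (use w0_w a w0_emp in \<open>auto intro!: dfi\<close>)
  finally show ?thesis .
qed

lemma sat_M_iff: "a \<epsilon> w0 \<Longrightarrow> sat mem M (\<lambda>_. a) q \<longleftrightarrow> force a (\<lambda>x. sat mem UNIV (\<lambda>_. x) q)"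
proof -
  assume a: "a \<epsilon> w0"
  have "sat mem M (\<lambda>_. a) q \<longleftrightarrow> force a (\<lambda>x. sat mem UNIV (\<lambda>i. app idf x) q)"
    using Los[OF a fn_idf, of q] pi_id[OF a] by simp
  also have "\<dots> \<longleftrightarrow> force a (\<lambda>x. sat mem UNIV (\<lambda>_. x) q)"
    by (rule force_cong) (use app_idf in \<open>auto intro!: dfi\<close>)
  finally show ?thesis .
qed

end

context zfc
begin

section \<open>Elementary embeddings\<close>

lemma Tm_definable_fun: "definable_fun mem F \<Longrightarrow> Tm UNIV (\<lambda>s. F (s 0))"
proof -
  assume "definable_fun mem F"
  then obtain p t where p: "\<And>x y. F x = y \<longleftrightarrow> sat mem UNIV (t(0 := x, 1 := y)) p" unfolding definable_fun_def by blast
  have "Df UNIV (\<lambda>s. sat mem UNIV (\<lambda>i. if i = 1 then s 0 else if i = 0 then s 1 else t i) p)" by (intro dfi)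
  moreover have "(\<lambda>i. if i = 1 then y else if i = 0 then x else t i) = t(0 := x, 1 := y)" for x y by auto
  ultimately have "Df UNIV (\<lambda>s. F (s 1) = s 0)" unfolding p by simp
  then show ?thesis unfolding Dt_def by (simp add: eq_commute)
qed

lemma el_sat: "elementary_embedding mem j M \<Longrightarrow> sat mem UNIV s p \<longleftrightarrow> sat mem M (\<lambda>i. j (s i)) p"
  unfolding elementary_embedding_def comp_def by blast

lemma el_tra: "elementary_embedding mem j M \<Longrightarrow> x \<in> M \<Longrightarrow> y \<epsilon> x \<Longrightarrow> y \<in> M"
  unfolding elementary_embedding_def by blast

lemma el_M: "elementary_embedding mem j M \<Longrightarrow> j x \<in> M"
  unfolding elementary_embedding_def by blast

lemma el_Tm: "elementary_embedding mem j M \<Longrightarrow> Tm UNIV (\<lambda>s. j (s 0))"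
  unfolding elementary_embedding_def using Tm_definable_fun by blast

text \<open>\<open>j\<close> preserves truth between the universe and \<open>M\<close>, and
  \<open>M\<close> is transitive, so a bounded statement about images may be read in the universe
  again.\<close>

lemma el_D0: assumes "elementary_embedding mem j M" "B0 Q" shows "Q s \<longleftrightarrow> Q (\<lambda>i. j (s i))"
proof -
  obtain p where p: "p \<in> Delta0_fm" "\<And>s. Q s = sat mem UNIV s p" using assms unfolding D0_def by blast
  have "sat mem M (\<lambda>i. j (s i)) p = sat mem UNIV (\<lambda>i. j (s i)) p"
    by (rule sat_Delta0[OF p(1)]) (use el_tra[OF assms(1)] el_M[OF assms(1)] in blast)+
  then show ?thesis using el_sat[OF assms(1)] p by blast
qed

lemma el_D0_1: "elementary_embedding mem j M \<Longrightarrow> B0 (\<lambda>s. Q (s 0)) \<Longrightarrow> Q a \<longleftrightarrow> Q (j a)"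
  using el_D0[of j M "\<lambda>s. Q (s 0)" "\<lambda>_. a"] by simp

lemma el_D0_2: "elementary_embedding mem j M \<Longrightarrow> B0 (\<lambda>s. Q (s 0) (s 1)) \<Longrightarrow> Q a b \<longleftrightarrow> Q (j a) (j b)"
  using el_D0[of j M "\<lambda>s. Q (s 0) (s 1)" "\<lambda>i. if i = 0 then a else b"] by simp

lemma el_D0_3: "elementary_embedding mem j M \<Longrightarrow> B0 (\<lambda>s. Q (s 0) (s 1) (s 2)) \<Longrightarrow> Q a b c \<longleftrightarrow> Q (j a) (j b) (j c)"
  using el_D0[of j M "\<lambda>s. Q (s 0) (s 1) (s 2)" "\<lambda>i. if i = 0 then a else if i = 1 then b else c"] by simp

lemma el_mem: assumes "elementary_embedding mem j M" shows "x \<epsilon> y \<longleftrightarrow> j x \<epsilon> j y"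
  by (rule el_D0_2[OF assms, of "(\<epsilon>)"]) (intro d0i)

lemma el_pr: assumes "elementary_embedding mem j M" shows "j (pr a b) = pr (j a) (j b)"
  using el_D0_3[OF assms, of "\<lambda>x y z. x = pr y z" "pr a b" a b] by (simp add: d0_pr)

lemma crit_less:
  assumes el: "elementary_embedding mem j M" and cr: "critical_point mem j \<kappa>"
  shows "\<kappa> \<epsilon> j \<kappa>" "ord (j \<kappa>)"
proof -
  have o: "ord \<kappa>" "j \<kappa> \<noteq> \<kappa>" and fx: "\<And>\<alpha>. \<alpha> \<epsilon> \<kappa> \<Longrightarrow> j \<alpha> = \<alpha>" using cr unfolding critical_point_def by auto
  show oj: "ord (j \<kappa>)" using el_D0_1[OF el, of ord \<kappa>] d0_ord o by simp
  have "\<not> j \<kappa> \<epsilon> \<kappa>"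
  proof
    assume "j \<kappa> \<epsilon> \<kappa>"
    then have "j (j \<kappa>) \<epsilon> j \<kappa>" "j (j \<kappa>) = j \<kappa>" using el_mem[OF el, of "j \<kappa>" \<kappa>] fx by blast+
    then show False by simp
  qed
  then show "\<kappa> \<epsilon> j \<kappa>" using ord_linear[OF oj o(1)] o(2) by auto
qed

text \<open>A surjection \<open>f\<close> from some \<open>\<alpha> \<epsilon> \<kappa>\<close> onto
  \<open>\<kappa>\<close> would become a surjection from \<open>\<alpha>\<close> onto
  \<open>j \<kappa>\<close> with the same values, all of them in \<open>\<kappa>\<close>; but
  \<open>\<kappa>\<close> itself is an element of \<open>j \<kappa>\<close>.\<close>

lemma crit_cardinal:
  assumes el: "elementary_embedding mem j M" and cr: "critical_point mem j \<kappa>"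
  shows "is_cardinal mem \<kappa>"
proof -
  have o: "ord \<kappa>" and fx: "\<And>\<alpha>. \<alpha> \<epsilon> \<kappa> \<Longrightarrow> j \<alpha> = \<alpha>" using cr unfolding critical_point_def by auto
  have "False" if a: "\<alpha> \<epsilon> \<kappa>" and b: "is_bij mem f \<alpha> \<kappa>" for \<alpha> f
  proof -
    let ?Q = "\<lambda>f a k. fn f a \<and> (\<forall>y. y \<epsilon> k \<longrightarrow> (\<exists>x. x \<epsilon> a \<and> pr x y \<epsilon> f))"
    have fn: "fn f \<alpha>" and ran: "\<And>x y. pr x y \<epsilon> f \<Longrightarrow> y \<epsilon> \<kappa>" and sur: "\<And>y. y \<epsilon> \<kappa> \<Longrightarrow> \<exists>x. pr x y \<epsilon> f"
      using b unfolding is_bij_def is_map_def fn_def related_iff by (auto simp: Ex1_def)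
    have "?Q f \<alpha> \<kappa>" using fn sur fn_dom[OF fn] by blast
    moreover have D: "B0 (\<lambda>s. ?Q (s 0) (s 1) (s 2))" by (intro d0i)
    ultimately have "?Q (j f) (j \<alpha>) (j \<kappa>)" using el_D0_3[where Q = ?Q, OF el D, of f \<alpha> \<kappa>] by blast
    then have q: "fn (j f) \<alpha>" "\<exists>x. x \<epsilon> \<alpha> \<and> pr x \<kappa> \<epsilon> j f" using crit_less[OF el cr] fx[OF a] by auto
    then obtain x where x: "x \<epsilon> \<alpha>" "pr x \<kappa> \<epsilon> j f" by blast
    have "pr x (app f x) \<epsilon> f" using fn_app[OF fn x(1)] by blast
    then have "pr x (app f x) \<epsilon> j f" "app f x \<epsilon> \<kappa>"
      using el_mem[OF el, of "pr x (app f x)" f] el_pr[OF el] fx ran traD[OF ord_trans[OF o] a x(1)] by auto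
    then have "app f x = \<kappa>" using fn_app[OF q(1) x(1)] x(2) by metis
    then show False using \<open>app f x \<epsilon> \<kappa>\<close> by simp
  qed
  then show ?thesis unfolding is_cardinal_def using o by blast
qed

text \<open>The rank of \<open>a\<close> as an ordinal: the ordinals in \<open>V\<close> at that
  rank.\<close>

definition "rk a = sep (VV a) ord"

lemma mem_rk: "x \<epsilon> rk a \<longleftrightarrow> x \<epsilon> VV a \<and> ord x"
  unfolding rk_def by (rule mem_sep) (intro dfi)

lemma ord_rk: "ord (rk a)"
proof (rule ord_class)
  show "tra (rk a)" unfolding tra_def mem_rk using traD[OF VV_tra] ord_mem by blast
qed (simp add: mem_rk)

lemma VV_rk: "VV (rk a) = VV a"
proof (rule sub_antisym)
  show "sub mem (VV (rk a)) (VV a)" by (rule VV_le) (simp add: sub_def mem_rk)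
  show "sub mem (VV a) (VV (rk a))"
  proof (rule ccontr)
    assume "\<not> sub mem (VV a) (VV (rk a))"
    then have "VV (rk a) \<epsilon> VV a" using VV_linear[of "rk a" a] by blast
    then have "rk a \<epsilon> VV a" using VV_super sub_VV by blast
    then have "rk a \<epsilon> rk a" using ord_rk mem_rk by blast
    then show False by simp
  qed
qed

lemma rk_sub: "sub mem (rk a) (VV a)"
  by (simp add: sub_def mem_rk)

text \<open>Take a moved \<open>b\<close> of least rank and \<open>u = VV b\<close>, and let
  \<open>g\<close> enumerate the levels below the rank of \<open>b\<close>. Arguments and values of
  \<open>g\<close> are not moved, so \<open>j g\<close> agrees with \<open>g\<close>; the subsets of
  its values cover \<open>j u\<close>, whence \<open>j u\<close> is included in \<open>u\<close>. So
  \<open>j b\<close> has only unmoved elements and equals \<open>b\<close>.\<close>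

lemma fix_ordinals:
  assumes el: "elementary_embedding mem j M" and w: "level w" and fx: "\<And>k. k \<epsilon> w \<Longrightarrow> ord k \<Longrightarrow> j k = k" and aw: "a \<epsilon> w"
  shows "j a = a"
proof (rule ccontr)
  assume na: "j a \<noteq> a"
  have T: "Tm UNIV T \<Longrightarrow> Tm UNIV (\<lambda>s. j (T s))" for T by (rule Tm_inst[OF el_Tm[OF el]])
  have D: "Df UNIV (\<lambda>s. \<exists>a. a \<epsilon> w \<and> j a \<noteq> a \<and> s 0 = VV a)" by (intro dfi T)
  obtain u where u: "\<exists>a. a \<epsilon> w \<and> j a \<noteq> a \<and> u = VV a" "\<forall>z. z \<epsilon> u \<and> z \<epsilon> w \<longrightarrow> \<not> (\<exists>a. a \<epsilon> w \<and> j a \<noteq> a \<and> z = VV a)"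
    using least_mem[of "\<lambda>u. \<exists>a. a \<epsilon> w \<and> j a \<noteq> a \<and> u = VV a" "VV a" w, OF D level_VV[OF w aw]] na aw by blast
  then obtain b where b: "b \<epsilon> w" "j b \<noteq> b" "u = VV b" by blast
  have uw: "u \<epsilon> w" using level_VV[OF w b(1)] b(3) by simp
  have low: "j y = y" if y: "y \<epsilon> u" for y
  proof -
    obtain c where "c \<epsilon> b" "sub mem y (VV c)" using y mem_VV[of y b] b(3) by blast
    then have "VV y \<epsilon> u" using VV_le[of y c] mem_VV[of "VV y" b] b(3) by blast
    then show ?thesis using u(2) level_memD[OF w uw] y by blast
  qed
  define \<rho> where "\<rho> = rk b"
  have r: "ord \<rho>" "VV \<rho> = u" "sub mem \<rho> u" using ord_rk VV_rk rk_sub b(3) by (auto simp: \<rho>_def)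
  have rw: "\<rho> \<epsilon> w" using level_super[OF w uw r(3)] .
  have jr: "j \<rho> = \<rho>" using fx rw r by blast
  have TV: "Tm UNIV (\<lambda>s. VV (s 0))" by (intro dfi)
  define g where "g = lam \<rho> VV"
  have g: "fn g \<rho>" "\<And>z. z \<epsilon> \<rho> \<Longrightarrow> pr z (VV z) \<epsilon> g" unfolding g_def using fn_lam[OF TV] mem_lam[OF TV] by auto
  let ?Q = "\<lambda>g r u. fn g r \<and> (\<forall>y. y \<epsilon> u \<longrightarrow> (\<exists>z. z \<epsilon> r \<and> (\<exists>t. pr z t \<epsilon> g \<and> sub mem y t)))"
  have "\<exists>z. z \<epsilon> \<rho> \<and> (\<exists>t. pr z t \<epsilon> g \<and> sub mem y t)" if y: "y \<epsilon> u" for y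
    using y mem_VV[of y \<rho>] r(2) g(2) by metis
  then have "?Q g \<rho> u" using g(1) by blast
  moreover have D: "B0 (\<lambda>s. ?Q (s 0) (s 1) (s 2))" by (intro d0i)
  ultimately have "?Q (j g) (j \<rho>) (j u)" using el_D0_3[where Q = ?Q, OF el D, of g \<rho> u] by blast
  then have q: "fn (j g) \<rho>" "\<And>y. y \<epsilon> j u \<Longrightarrow> \<exists>z. z \<epsilon> \<rho> \<and> (\<exists>t. pr z t \<epsilon> j g \<and> sub mem y t)" unfolding jr by auto
  have ju: "y \<epsilon> u" if y: "y \<epsilon> j u" for y
  proof -
    obtain z t where z: "z \<epsilon> \<rho>" "pr z t \<epsilon> j g" "sub mem y t" using q(2)[OF y] by blast
    have zu: "z \<epsilon> u" using mem_sub[OF r(3) z(1)] .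
    have vu: "VV z \<epsilon> u" using VV_mono[OF z(1)] r(2) by simp
    have "pr z (VV z) \<epsilon> j g" using el_mem[OF el, of "pr z (VV z)" g] g(2)[OF z(1)] el_pr[OF el] low[OF zu] low[OF vu] by simp
    then have "t = VV z" using fn_app[OF q(1) z(1)] z(2) by metis
    then show ?thesis using z mem_VV[of y \<rho>] r(2) by blast
  qed
  have "sub mem b u" using sub_VV b(3) by simp
  then have "sub mem (j b) (j u)" using el_D0_2[OF el, of "sub mem" b u] by (simp add: d0_sub)
  then have jb: "y \<epsilon> u" if "y \<epsilon> j b" for y using ju that by (auto simp: sub_def)
  have "j b = b"
  proof (rule ext_eqI)
    fix y show "y \<epsilon> j b \<longleftrightarrow> y \<epsilon> b"
      using jb low el_mem[OF el, of y b] mem_sub[OF \<open>sub mem b u\<close>] by metis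
  qed
  then show False using b by simp
qed

section \<open>Intersections with lower levels\<close>

definition "itr X w = sep X (\<lambda>x. x \<epsilon> w)"

lemma mem_itr [simp]: "x \<epsilon> itr X w \<longleftrightarrow> x \<epsilon> X \<and> x \<epsilon> w"
  unfolding itr_def by (rule mem_sep) (intro dfi)

lemma Tm_itr [dfi]: "Tm K T \<Longrightarrow> Tm K U \<Longrightarrow> Tm K (\<lambda>s. itr (T s) (U s))"
  by (rule Dt_sub2[of mem K itr]) (unfold itr_def, (intro dfi)+)

text \<open>At a point \<open>x\<close> of \<open>w\<close> each operation consults \<open>X\<close>
  only at points formed from \<open>x\<close> and its constituents, which again lie in
  \<open>w\<close>. For operation 12 the agreement of truth in \<open>v\<close> and in
  \<open>w\<close> is assumed.\<close>

lemma phis_itr: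
  assumes v: "level v" and w: "level w" "w = v \<or> w \<epsilon> v" and k: "k < nops" and x: "x \<epsilon> w"
    and p: "\<And>x. x \<epsilon> w \<Longrightarrow> sat mem (ext v) (\<lambda>_. x) p \<longleftrightarrow> sat mem (ext w) (\<lambda>_. x) p"
  shows "(phis p ! k) v x X \<longleftrightarrow> (phis p ! k) w x (itr X w)"
proof -
  have n: "pr (num i) x \<epsilon> w" for i using level_pr[OF w(1) level_num[OF w(1)] x] .
  have xx: "pr x x \<epsilon> w" using level_pr[OF w(1) x x] .
  have ab: "a \<epsilon> w \<and> b \<epsilon> w" if "x = pr a b" for a b using level_prD[OF w(1)] x that by blast
  have 5: "pr a c \<epsilon> w \<and> pr b c \<epsilon> w" if "x = pr (pr a b) c" for a b c
    using level_prD[OF w(1)] level_pr[OF w(1)] x that by metis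
  have 8: "pr a c \<epsilon> w" if "x = pr a b" "c \<epsilon> b" for a b c
    using ab[OF that(1)] level_memD[OF w(1)] level_pr[OF w(1)] that(2) by blast
  have s: "z \<epsilon> w" if "z \<epsilon> x" for z using level_memD[OF w(1) x that] .
  have 11: "pr n (pr z y) \<epsilon> w" if "pr n y \<epsilon> x" "pr m z \<epsilon> x" for n m y z
    using s[OF that(1)] s[OF that(2)] level_prD[OF w(1)] level_pr[OF w(1)] by metis
  have "\<forall>k<nops. (phis p ! k) v x X \<longleftrightarrow> (phis p ! k) w x (itr X w)"
    unfolding all_less_13 nth_phis mem_itr
  proof (intro conjI)
    show "(\<exists>a b. x = pr a b \<and> (\<exists>c. c \<epsilon> b \<and> pr a c \<epsilon> X)) \<longleftrightarrow> (\<exists>a b. x = pr a b \<and> (\<exists>c. c \<epsilon> b \<and> pr a c \<epsilon> X \<and> pr a c \<epsilon> w))"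
      using 8 by blast
    have e: "(\<exists>k t. pr k t \<epsilon> X \<and> (k = n \<and> t = pr z y)) \<longleftrightarrow> pr n (pr z y) \<epsilon> X"
      "(\<exists>k t. (pr k t \<epsilon> X \<and> pr k t \<epsilon> w) \<and> (k = n \<and> t = pr z y)) \<longleftrightarrow> pr n (pr z y) \<epsilon> X \<and> pr n (pr z y) \<epsilon> w" for n z y by auto
    have "(\<forall>n y. pr n y \<epsilon> x \<longrightarrow> natu n \<longrightarrow> (\<forall>m z. pr m z \<epsilon> x \<longrightarrow> m = succ n \<longrightarrow> pr n (pr z y) \<epsilon> X)) \<longleftrightarrow>
       (\<forall>n y. pr n y \<epsilon> x \<longrightarrow> natu n \<longrightarrow> (\<forall>m z. pr m z \<epsilon> x \<longrightarrow> m = succ n \<longrightarrow> pr n (pr z y) \<epsilon> X \<and> pr n (pr z y) \<epsilon> w))"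
      using 11 by blast
    then show "((\<exists>n y. pr n y \<epsilon> x \<and> n = emp) \<and>
       (\<forall>n y. pr n y \<epsilon> x \<longrightarrow> natu n \<longrightarrow> (\<exists>m z. pr m z \<epsilon> x \<and> m = succ n)) \<and>
       (\<forall>n y. pr n y \<epsilon> x \<longrightarrow> natu n \<longrightarrow> (\<forall>m z. pr m z \<epsilon> x \<longrightarrow> m = succ n \<longrightarrow> (\<exists>k t. pr k t \<epsilon> X \<and> (k = n \<and> t = pr z y))))) \<longleftrightarrow>
      ((\<exists>n y. pr n y \<epsilon> x \<and> n = emp) \<and>
       (\<forall>n y. pr n y \<epsilon> x \<longrightarrow> natu n \<longrightarrow> (\<exists>m z. pr m z \<epsilon> x \<and> m = succ n)) \<and>
       (\<forall>n y. pr n y \<epsilon> x \<longrightarrow> natu n \<longrightarrow> (\<forall>m z. pr m z \<epsilon> x \<longrightarrow> m = succ n \<longrightarrow> (\<exists>k t. (pr k t \<epsilon> X \<and> pr k t \<epsilon> w) \<and> (k = n \<and> t = pr z y)))))"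
      unfolding e by (simp only:)
  qed (use n[of 0] n[of 1] xx ab 5 s p[OF x] in auto)
  then show ?thesis using k by blast
qed

lemma op_itr:
  assumes v: "level v" and w: "level w" "w = v \<or> w \<epsilon> v" and k: "k < nops"
    and p: "\<And>x. x \<epsilon> w \<Longrightarrow> sat mem (ext v) (\<lambda>_. x) p \<longleftrightarrow> sat mem (ext w) (\<lambda>_. x) p"
  shows "itr (op p k v X) w = op p k w (itr X w)"
proof (rule ext_eqI)
  fix x
  have "x \<epsilon> v" if "x \<epsilon> w" using w that level_memD[OF v] by blast
  then show "x \<epsilon> itr (op p k v X) w \<longleftrightarrow> x \<epsilon> op p k w (itr X w)"
    using phis_itr[OF v w k _ p] by (auto simp: mem_op[OF k])
qed

end

text \<open>\<open>E m\<close> is a complete \<open>\<Pi>\<^sub>m\<close> class: embeddings that respect it respect every \<open>\<Sigma>\<^sub>m\<^sub>+\<^sub>1\<close> class.\<close>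

locale main = zfc +
  fixes m :: nat and pE :: fm
  assumes m1: "m \<ge> 1" and pE: "is_Pi m pE" and pE_fv: "fv pE \<subseteq> {0}" and pE_E: "\<And>s. E m (s 0) = sat mem UNIV s pE"
begin

lemma E_level: "E m v \<Longrightarrow> level v"
  using m1 by (cases m) auto

lemma E_om: "E m v \<Longrightarrow> om \<epsilon> v"
  using m1 by (cases m) auto

lemma pE_const: "sat mem UNIV (\<lambda>_. x) pE \<longleftrightarrow> E m x"
  using pE_E[of "\<lambda>_. x"] by simp

lemma sat_pE: "E m v \<Longrightarrow> x \<epsilon> v \<Longrightarrow> sat mem (ext v) (\<lambda>_. x) pE \<longleftrightarrow> E m x"
  using E_sat[of m v pE "\<lambda>_. x"] pE pE_const by auto

lemma E_op_itr:
  assumes "E m v" "E m w" "w = v \<or> w \<epsilon> v" "k < nops" shows "itr (op pE k v X) w = op pE k w (itr X w)"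
proof (rule op_itr[OF E_level[OF assms(1)] E_level[OF assms(2)] assms(3,4)])
  fix x assume x: "x \<epsilon> w"
  then have "x \<epsilon> v" using assms level_memD[OF E_level[OF assms(1)]] by blast
  then show "sat mem (ext v) (\<lambda>_. x) pE \<longleftrightarrow> sat mem (ext w) (\<lambda>_. x) pE" using sat_pE assms x by blast
qed

definition "sg v x = sep v (\<lambda>y. y = x)"

lemma mem_sg [simp]: "y \<epsilon> sg v x \<longleftrightarrow> y \<epsilon> v \<and> y = x"
  unfolding sg_def by (rule mem_sep) (intro dfi)

lemma sub_sg: "sub mem (sg v x) v" by (simp add: sub_def)

lemma Tm_sg [dfi]: "Tm K T \<Longrightarrow> Tm K U \<Longrightarrow> Tm K (\<lambda>s. sg (T s) (U s))"
  by (rule Dt_sub2[of mem K sg]) (unfold sg_def, (intro dfi)+)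

text \<open>\<open>OH b u w g x\<close>: the set \<open>g\<close> is an extender from \<open>u\<close> to \<open>w\<close> with critical point \<open>x\<close>; the set \<open>b\<close>
  only serves to bound quantifiers.\<close>

definition "OH b u w g x \<longleftrightarrow>
   (\<forall>X. X \<epsilon> b \<longrightarrow> sub mem X u \<longrightarrow> (\<exists>Y. pr X Y \<epsilon> g \<and> sub mem Y w)) \<and>
   (\<forall>X Y. pr X Y \<epsilon> g \<longrightarrow> (\<forall>X' Y'. pr X' Y' \<epsilon> g \<longrightarrow> (X = X' \<longrightarrow> Y = Y') \<and>
      \<not> (\<exists>k<nops. (sub mem X' u \<and> (\<forall>z. z \<epsilon> u \<longrightarrow> (z \<epsilon> X' \<longleftrightarrow> (phis pE ! k) u z X))) \<and>
                 \<not> (sub mem Y' w \<and> (\<forall>z. z \<epsilon> w \<longrightarrow> (z \<epsilon> Y' \<longleftrightarrow> (phis pE ! k) w z Y)))))) \<and>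
   (\<forall>X Y. pr X Y \<epsilon> g \<longrightarrow> (\<forall>\<xi>. \<xi> \<epsilon> x \<longrightarrow> (\<forall>z. z \<epsilon> X \<longrightarrow> z \<epsilon> u \<and> z = \<xi>) \<and> (\<xi> \<epsilon> u \<longrightarrow> \<xi> \<epsilon> X) \<longrightarrow> \<xi> \<epsilon> Y)) \<and>
   (\<forall>X Y. pr X Y \<epsilon> g \<longrightarrow> (\<forall>z. z \<epsilon> X \<longrightarrow> z \<epsilon> u \<and> z = x) \<and> (x \<epsilon> u \<longrightarrow> x \<epsilon> X) \<longrightarrow> \<not> x \<epsilon> Y)"

lemma d0_phis': "k < nops \<Longrightarrow> B0 (\<lambda>s. (phis pE ! k) (s a) (s b) (s c))"
  by (rule d0_phis)

lemma d0_exops: "(\<And>k. k < nops \<Longrightarrow> B0 (Q k)) \<Longrightarrow> B0 (\<lambda>s. \<exists>k<nops. Q k s)"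
proof -
  assume Q: "\<And>k. k < nops \<Longrightarrow> B0 (Q k)"
  have "B0 (\<lambda>s. \<exists>k<nops. (if k < nops then Q k s else False))"
  proof (rule D0_exnat)
    show "B0 (\<lambda>s. if k < nops then Q k s else False)" for k using Q D0_const by (cases "k < nops") auto
  qed
  moreover have "(\<exists>k<nops. (if k < nops then Q k s else False)) \<longleftrightarrow> (\<exists>k<nops. Q k s)" for s by auto
  ultimately show ?thesis by simp
qed

lemma d0_OH [d0i]: "B0 (\<lambda>s. OH (s a) (s b) (s c) (s d) (s e))"
  unfolding OH_def by (intro D0_conj D0_ball D0_imp d0_rall d0_rex1 d0_sub D0_not d0_exops D0_iff D0_mem D0_eq d0_phis')

lemma is_op: "k < nops \<Longrightarrow> sub mem X' u \<and> (\<forall>z. z \<epsilon> u \<longrightarrow> (z \<epsilon> X' \<longleftrightarrow> (phis pE ! k) u z X)) \<longleftrightarrow> X' = op pE k u X"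
proof
  assume k: "k < nops" and h: "sub mem X' u \<and> (\<forall>z. z \<epsilon> u \<longrightarrow> (z \<epsilon> X' \<longleftrightarrow> (phis pE ! k) u z X))"
  show "X' = op pE k u X" by (rule ext_eqI) (use h in \<open>auto simp: mem_op[OF k] sub_def\<close>)
next
  assume k: "k < nops" and h: "X' = op pE k u X"
  show "sub mem X' u \<and> (\<forall>z. z \<epsilon> u \<longrightarrow> (z \<epsilon> X' \<longleftrightarrow> (phis pE ! k) u z X))" unfolding h by (simp add: mem_op[OF k] sub_def)
qed

lemma is_sg: "(\<forall>z. z \<epsilon> X \<longrightarrow> z \<epsilon> u \<and> z = x) \<and> (x \<epsilon> u \<longrightarrow> x \<epsilon> X) \<longleftrightarrow> X = sg u x"
proof
  assume h: "(\<forall>z. z \<epsilon> X \<longrightarrow> z \<epsilon> u \<and> z = x) \<and> (x \<epsilon> u \<longrightarrow> x \<epsilon> X)"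
  show "X = sg u x" by (rule ext_eqI) (use h in auto)
qed simp

text \<open>\<open>OH\<close> describes operations and singletons elementwise in order to stay
  bounded; this is its readable form.\<close>

lemma OH_iff: "OH b u w g x \<longleftrightarrow>
   (\<forall>X. X \<epsilon> b \<longrightarrow> sub mem X u \<longrightarrow> (\<exists>Y. pr X Y \<epsilon> g \<and> sub mem Y w)) \<and>
   (\<forall>X Y. pr X Y \<epsilon> g \<longrightarrow> (\<forall>X' Y'. pr X' Y' \<epsilon> g \<longrightarrow> (X = X' \<longrightarrow> Y = Y') \<and> (\<forall>k<nops. X' = op pE k u X \<longrightarrow> Y' = op pE k w Y))) \<and>
   (\<forall>X Y. pr X Y \<epsilon> g \<longrightarrow> (\<forall>\<xi>. \<xi> \<epsilon> x \<longrightarrow> X = sg u \<xi> \<longrightarrow> \<xi> \<epsilon> Y)) \<and>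
   (\<forall>X Y. pr X Y \<epsilon> g \<longrightarrow> X = sg u x \<longrightarrow> \<not> x \<epsilon> Y)"
  unfolding OH_def is_sg using is_op by (simp cong: conj_cong) blast

lemma sub_op: "k < nops \<Longrightarrow> sub mem (op pE k v X) v"
  by (simp add: sub_def mem_op)

lemma OH_intro:
  assumes b: "level b" "u \<epsilon> b" "w \<epsilon> b" and T: "Tm UNIV (\<lambda>s. e (s 0))" and oph: "ophom pE u w e"
    and fx: "\<And>\<xi>. \<xi> \<epsilon> x \<Longrightarrow> \<xi> \<epsilon> e (sg u \<xi>)" and nx: "\<not> x \<epsilon> e (sg u x)"
  shows "\<exists>g. g \<epsilon> b \<and> OH b u w g x"
proof -
  let ?g = "lam (pow u) e"
  have g: "pr X Y \<epsilon> ?g \<longleftrightarrow> sub mem X u \<and> Y = e X" for X Y unfolding mem_lam[OF T] by auto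
  have sw: "sub mem (e X) w" and ok: "\<And>k. k < nops \<Longrightarrow> e (op pE k u X) = op pE k w (e X)" if "sub mem X u" for X
    using oph that unfolding ophom_def by auto
  have "?g \<epsilon> pow (pow (pow (un (pow u) (pow w))))"
    by (rule sub_prod) (use sw in \<open>auto simp: mem_lam[OF T]\<close>)
  moreover have "pow (pow (pow (un (pow u) (pow w)))) \<epsilon> b" using b by (intro level_pow level_un)
  ultimately have "?g \<epsilon> b" using level_memD[OF b(1)] by blast
  moreover have "OH b u w ?g x" unfolding OH_iff g using sw ok fx nx by auto
  ultimately show ?thesis by blast
qed

lemma OH_elim:
  assumes b: "level b" "u \<epsilon> b" and oh: "OH b u w g x"
  shows "ophom pE u w (app g)" "\<And>\<xi>. \<xi> \<epsilon> x \<Longrightarrow> \<xi> \<epsilon> app g (sg u \<xi>)" "\<not> x \<epsilon> app g (sg u x)"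
proof -
  note o = oh[unfolded OH_iff]
  have Xb: "X \<epsilon> b" if "sub mem X u" for X using level_super[OF b that] .
  have ag: "pr X (app g X) \<epsilon> g" "sub mem (app g X) w" if X: "sub mem X u" for X
  proof -
    obtain Y where Y: "pr X Y \<epsilon> g" "sub mem Y w" using o Xb[OF X] X by blast
    have "app g X = Y" by (rule app_eq[OF Y(1)]) (use o Y in blast)
    then show "pr X (app g X) \<epsilon> g" "sub mem (app g X) w" using Y by auto
  qed
  show "ophom pE u w (app g)" unfolding ophom_def
  proof (intro allI impI conjI)
    fix X k assume X: "sub mem X u"
    show "sub mem (app g X) w" using ag[OF X] by blast
    assume k: "k < nops"
    show "app g (op pE k u X) = op pE k w (app g X)" using o ag(1)[OF X] ag(1)[OF sub_op[OF k, of u X]] k by blast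
  qed
  show "\<And>\<xi>. \<xi> \<epsilon> x \<Longrightarrow> \<xi> \<epsilon> app g (sg u \<xi>)" "\<not> x \<epsilon> app g (sg u x)" using o ag(1)[OF sub_sg] by blast+
qed

text \<open>In the definition of the class \<open>I\<close> the second clause says that no ordinal \<open>x\<close> of \<open>v\<close> carries
  extenders to all levels below \<open>v\<close>.\<close>

definition "I v \<longleftrightarrow> E m v \<and> (\<forall>x. x \<epsilon> v \<longrightarrow> (\<exists>w. w \<epsilon> v \<and> E m w \<and> x \<epsilon> w \<and>
   (ord x \<longrightarrow> (\<forall>u. u \<epsilon> v \<longrightarrow> (\<forall>g. g \<epsilon> v \<longrightarrow> E m u \<and> (u = w \<or> u \<epsilon> w) \<longrightarrow> \<not> OH v u w g x)))))"

lemma I_E: "I v \<Longrightarrow> E m v" by (simp add: I_def)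
lemma I_level: "I v \<Longrightarrow> level v" using I_E E_level by blast

text \<open>All occurrences of \<open>E m\<close> inside the second clause concern elements of
  \<open>v\<close>, so they can be read as truth of \<open>pE\<close> in \<open>v\<close>. What
  remains is \<open>E m v\<close> and a bounded formula.\<close>

lemma PiP_I: "PiP mem m (\<lambda>s. I (s i))"
proof -
  let ?S = "\<lambda>v u. sat mem (ext v) (\<lambda>_. u) pE"
  have dS: "B0 (\<lambda>s. ?S (s i) (s j))" for i j using d0_sat_ext[of i "\<lambda>_. j" pE] by simp
  have eq: "I v \<longleftrightarrow> E m v \<and> (\<forall>x. x \<epsilon> v \<longrightarrow> (\<exists>w. w \<epsilon> v \<and> ?S v w \<and> x \<epsilon> w \<and>
   (ord x \<longrightarrow> (\<forall>u. u \<epsilon> v \<longrightarrow> (\<forall>g. g \<epsilon> v \<longrightarrow> ?S v u \<and> (u = w \<or> u \<epsilon> w) \<longrightarrow> \<not> OH v u w g x)))))" for v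
  proof (cases "E m v")
    case True
    have 1: "?S v u \<longleftrightarrow> E m u" if "u \<epsilon> v" for u by (rule sat_pE[OF True that])
    show ?thesis unfolding I_def by (simp add: 1 cong: conj_cong imp_cong)
  qed (simp add: I_def)
  have "B0 (\<lambda>s. \<forall>x. x \<epsilon> s i \<longrightarrow> (\<exists>w. w \<epsilon> s i \<and> ?S (s i) w \<and> x \<epsilon> w \<and>
   (ord x \<longrightarrow> (\<forall>u. u \<epsilon> s i \<longrightarrow> (\<forall>g. g \<epsilon> s i \<longrightarrow> ?S (s i) u \<and> (u = w \<or> u \<epsilon> w) \<longrightarrow> \<not> OH (s i) u w g x)))))"
    by (intro d0i dS)
  then show ?thesis unfolding eq by (intro PiP_conj PiP_E SigP_D0(2))
qed

lemma Df_I [dfi]: "Tm K T \<Longrightarrow> Df K (\<lambda>s. I (T s))"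
proof (rule Dp_sub1[of mem K I])
  obtain p where p: "\<And>s. I (s 0) = sat mem UNIV s p" using PiP_I[of 0] unfolding PiP_def by blast
  have "Df K (\<lambda>s. sat mem UNIV (\<lambda>i. (\<lambda>s. s i) s) p)" by (rule Dp_sat) (intro dfi)
  then show "Df K (\<lambda>s. I (s 0))" unfolding p .
qed

text \<open>Otherwise let \<open>\<kappa>\<close> be the critical point of \<open>e\<close>. For the level \<open>w'\<close> that \<open>w \<in> I\<close> provides for \<open>\<kappa>\<close>, cutting
  \<open>e\<close> down to \<open>w'\<close> (and also its source, if \<open>v\<close> lies above \<open>w'\<close>) gives an extender excluded by \<open>I\<close>.\<close>

lemma rigid:
  assumes Iv: "I v" and Iw: "I w" and T: "Tm UNIV (\<lambda>s. e (s 0))" and oph: "ophom pE v w e"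
  shows "(w = v \<or> w \<epsilon> v) \<and> (\<forall>X. sub mem X v \<longrightarrow> e X = itr X w)"
proof -
  note lv = I_level[OF Iv] and lw = I_level[OF Iw] and Ev = I_E[OF Iv] and Ew = I_E[OF Iw]
  have T': "Tm UNIV U \<Longrightarrow> Tm UNIV (\<lambda>s. e (U s))" for U by (rule Tm_inst[OF T])
  have sw: "sub mem (e X) w" and ok: "\<And>k. k < nops \<Longrightarrow> e (op pE k v X) = op pE k w (e X)" if "sub mem X v" for X
    using oph that unfolding ophom_def by auto
  \<comment> \<open>The condition expresses that \<open>e\<close> does not move \<open>k\<close>.
    The least ordinal of \<open>w\<close> violating it, which exists because \<open>e\<close> is
    definable, is the critical point.\<close>
  have fixed: "k \<epsilon> e (sg v k)" if k: "k \<epsilon> w" "ord k" for k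
  proof (rule ccontr)
    assume "\<not> k \<epsilon> e (sg v k)"
    moreover have "Df UNIV (\<lambda>s. s 0 \<epsilon> w \<and> \<not> s 0 \<epsilon> e (sg v (s 0)))" by (intro dfi T')
    ultimately obtain \<kappa> where \<kappa>: "ord \<kappa>" "\<kappa> \<epsilon> w" "\<not> \<kappa> \<epsilon> e (sg v \<kappa>)"
      and less: "\<And>\<xi>. \<xi> \<epsilon> \<kappa> \<Longrightarrow> \<not> (\<xi> \<epsilon> w \<and> \<not> \<xi> \<epsilon> e (sg v \<xi>))"
      using ord_least[of "\<lambda>k. k \<epsilon> w \<and> \<not> k \<epsilon> e (sg v k)" k] k by blast
    have below: "\<xi> \<epsilon> e (sg v \<xi>)" if "\<xi> \<epsilon> \<kappa>" for \<xi> using less[OF that] level_memD[OF lw \<kappa>(2) that] by blast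
    obtain w' where w': "w' \<epsilon> w" "E m w'" "\<kappa> \<epsilon> w'"
      and no: "\<And>u g. u \<epsilon> w \<Longrightarrow> g \<epsilon> w \<Longrightarrow> E m u \<Longrightarrow> u = w' \<or> u \<epsilon> w' \<Longrightarrow> \<not> OH w u w' g \<kappa>"
      using Iw \<kappa>(1,2) unfolding I_def by blast
    note lw' = E_level[OF w'(2)]
    define e1 where "e1 X = itr (e X) w'" for X
    have T1: "Tm UNIV (\<lambda>s. e1 (s 0))" unfolding e1_def by (intro dfi T')
    have oph1: "ophom pE v w' e1" unfolding ophom_def
    proof (intro allI impI conjI)
      fix X k assume X: "sub mem X v"
      show "sub mem (e1 X) w'" by (simp add: e1_def sub_def)
      assume k: "k < nops"
      show "e1 (op pE k v X) = op pE k w' (e1 X)"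
        unfolding e1_def ok[OF X k] using E_op_itr[OF Ew w'(2) _ k] w'(1) by blast
    qed
    have k1: "\<not> \<kappa> \<epsilon> e1 (sg v \<kappa>)" using \<kappa>(3) by (simp add: e1_def)
    have b1: "\<xi> \<epsilon> e1 (sg v \<xi>)" if "\<xi> \<epsilon> \<kappa>" for \<xi> using below[OF that] level_memD[OF lw' w'(3) that] by (simp add: e1_def)
    show False
    \<comment> \<open>The clause of \<open>I\<close> excludes only sources that are not above
      \<open>w'\<close>, whereas \<open>v\<close> may be larger than \<open>w\<close>
      itself.\<close>
    proof (cases "v = w' \<or> v \<epsilon> w'")
      case True
      have vw: "v \<epsilon> w" using True w'(1) level_memD[OF lw] by blast
      obtain g where "g \<epsilon> w" "OH w v w' g \<kappa>"
        using OH_intro[OF lw vw w'(1) T1 oph1 b1 k1] by blast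
      then show False using no[OF vw _ Ev True] by blast
    next
      case False
      then have wv: "w' \<epsilon> v" using level_linear[OF lv lw'] by blast
      \<comment> \<open>Only forcing is used from this interpretation and not the ultrapower, so any
        level inside \<open>w'\<close> may serve as the level of seeds.\<close>
      interpret X: extender mem pE v w' "VV om" e1
        by unfold_locales (use lv lw' level_VV_om level_VV[OF lw' E_om[OF w'(2)]] oph1 T1 in auto)
      \<comment> \<open>No seed concentrates on sets of larger rank. Elements outside
        \<open>VV a\<close> would by \<open>X.Rb\<close> be represented by a seed
        \<open>c \<epsilon> a\<close>; but \<open>c\<close> concentrates on subsets of
        \<open>VV c\<close>, which are elements of \<open>VV a\<close>.\<close>
      have rank: "a \<epsilon> w' \<longrightarrow> X.force a (\<lambda>x. sub mem x (VV a))" for a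
      proof (rule mem_induct[of "\<lambda>a. a \<epsilon> w' \<longrightarrow> X.force a (\<lambda>x. sub mem x (VV a))"])
        show "Df UNIV (\<lambda>s. s 0 \<epsilon> w' \<longrightarrow> X.force (s 0) (\<lambda>x. sub mem x (VV (s 0))))"
          unfolding X.force_def by (intro dfi X.de')
        fix a assume IH: "\<And>z. z \<epsilon> a \<Longrightarrow> z \<epsilon> w' \<longrightarrow> X.force z (\<lambda>x. sub mem x (VV z))"
        show "a \<epsilon> w' \<longrightarrow> X.force a (\<lambda>x. sub mem x (VV a))"
        proof (intro impI, rule ccontr)
          assume a: "a \<epsilon> w'" and n: "\<not> X.force a (\<lambda>x. sub mem x (VV a))"
          have D1: "Df UNIV (\<lambda>s. sub mem (s 0) (VV a))" by (intro dfi)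
          have D2: "Df UNIV (\<lambda>s. \<exists>z. z \<epsilon> s 1 \<and> \<not> z \<epsilon> VV a)" by (intro dfi)
          have D3: "Df UNIV (\<lambda>s. \<not> s 1 \<epsilon> VV a)" by (intro dfi)
          have D4: "Df UNIV (\<lambda>s. \<not> s 0 \<epsilon> VV a)" by (intro dfi)
          have D5: "Df UNIV (\<lambda>s. \<exists>z. z \<epsilon> s 0 \<and> \<not> z \<epsilon> VV a)" by (intro dfi)
          have "X.force a (\<lambda>x. \<not> sub mem x (VV a))" using X.force_not[OF D1 a] n by blast
          then have "X.force a (\<lambda>x. \<exists>z. z \<epsilon> x \<and> \<not> z \<epsilon> VV a)"
            using X.force_mono[OF Dp_not[OF D1] D5] by (auto simp: sub_def)
          then have "X.force2 a a (\<lambda>x y. \<exists>z. z \<epsilon> y \<and> \<not> z \<epsilon> VV a)"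
            using X.Rd[of "\<lambda>x y. \<exists>z. z \<epsilon> y \<and> \<not> z \<epsilon> VV a", OF D2 a] by blast
          then obtain c where c: "c \<epsilon> a" "X.force2 a c (\<lambda>x y. \<not> y \<epsilon> VV a)"
            using X.Rb[of "\<lambda>x y. \<not> y \<epsilon> VV a", OF D3 a a] by blast
          have cw: "c \<epsilon> w'" using level_memD[OF lw' a c(1)] .
          have c2: "X.force c (\<lambda>y. \<not> y \<epsilon> VV a)" using X.R2[of "\<lambda>y. \<not> y \<epsilon> VV a", OF D4 a cw] c(2) by blast
          have D6: "Df UNIV (\<lambda>s. sub mem (s 0) (VV c))" by (intro dfi)
          have D7: "Df UNIV (\<lambda>s. False)" by (intro dfi)
          have "X.force c (\<lambda>x. sub mem x (VV c))" using IH[OF c(1)] cw by blast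
          then have "X.force c (\<lambda>x. False)"
            by (rule X.force_mono2[OF D6 D4 D7 _ c2]) (use c(1) mem_VV[of _ a] in blast)
          then show False using X.force_bot[OF _ _ D7] by blast
        qed
      qed
      have top: "X.force a (\<lambda>x. x \<epsilon> w')" if a: "a \<epsilon> w'" for a
      proof (rule X.force_mono[OF _ _ rank[of a, THEN mp, OF a]])
        show "x \<epsilon> w'" if "sub mem x (VV a)" for x using level_super[OF lw' level_VV[OF lw' a] that] .
      qed (intro dfi)+
      have sub_wv: "sub mem X v" if "sub mem X w'" for X
        using that level_memD[OF lv wv] by (auto simp: sub_def)
      have Xs: "sep v (\<lambda>x. x \<epsilon> X) = X" if "sub mem X v" for X
      proof (rule ext_eqI)
        have "Df UNIV (\<lambda>s. s 0 \<epsilon> X)" by (intro dfi)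
        from mem_sep[OF this] show "x \<epsilon> sep v (\<lambda>x. x \<epsilon> X) \<longleftrightarrow> x \<epsilon> X" for x using that by (auto simp: sub_def)
      qed
      \<comment> \<open>By \<open>top\<close> only the part of a set inside \<open>w'\<close>
        matters for \<open>e1\<close>, so the source can be cut down to \<open>w'\<close> as
        well.\<close>
      have int: "a \<epsilon> e1 (itr X w')" if X: "sub mem X v" and a: "a \<epsilon> e1 X" for X a
      proof -
        have D: "Df UNIV (\<lambda>s. s 0 \<epsilon> X)" "Df UNIV (\<lambda>s. s 0 \<epsilon> w')" "Df UNIV (\<lambda>s. s 0 \<epsilon> itr X w')" by (intro dfi)+
        have aw: "a \<epsilon> w'" using a by (simp add: e1_def)
        have "X.force a (\<lambda>x. x \<epsilon> X)" unfolding X.force_def Xs[OF X] by (rule a)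
        from X.force_mono2[OF D this top[OF aw]] have "X.force a (\<lambda>x. x \<epsilon> itr X w')" by simp
        then have f: "a \<epsilon> e1 (sep v (\<lambda>x. x \<epsilon> itr X w'))" unfolding X.force_def .
        have "sub mem (itr X w') v" using X by (simp add: sub_def)
        from Xs[OF this] show ?thesis using f by (simp only:)
      qed
      have oph2: "ophom pE w' w' e1" unfolding ophom_def
      proof (intro allI impI conjI)
        fix X k assume X: "sub mem X w'"
        show "sub mem (e1 X) w'" by (simp add: e1_def sub_def)
        assume k: "k < nops"
        have iX: "itr X w' = X" by (rule ext_eqI) (use X in \<open>auto simp: sub_def\<close>)
        have "op pE k w' X = itr (op pE k v X) w'" using E_op_itr[OF Ev w'(2) _ k, of X] wv iX by simp
        then have 1: "e1 (op pE k w' X) = e1 (itr (op pE k v X) w')" by simp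
        have 2: "sub mem (op pE k v X) v" by (rule sub_op[OF k])
        have 3: "e1 (op pE k v X) = op pE k w' (e1 X)" using oph1 sub_wv[OF X] k unfolding ophom_def by blast
        show "e1 (op pE k w' X) = op pE k w' (e1 X)"
        proof (rule ext_eqI)
          fix a
          have D: "Df UNIV (\<lambda>s. s 0 \<epsilon> itr (op pE k v X) w')" "Df UNIV (\<lambda>s. s 0 \<epsilon> op pE k v X)" by (intro dfi)+
          have s: "sub mem (itr (op pE k v X) w') v" using 2 by (simp add: sub_def)
          have "a \<epsilon> e1 (op pE k v X)" if "a \<epsilon> e1 (itr (op pE k v X) w')"
          proof -
            have "X.force a (\<lambda>x. x \<epsilon> itr (op pE k v X) w')" unfolding X.force_def Xs[OF s] by (rule that)
            moreover have "x \<epsilon> op pE k v X" if "x \<epsilon> itr (op pE k v X) w'" for x using that by simp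
            ultimately have "X.force a (\<lambda>x. x \<epsilon> op pE k v X)" using X.force_mono[OF D] by blast
            then show ?thesis unfolding X.force_def Xs[OF 2] .
          qed
          then show "a \<epsilon> e1 (op pE k w' X) \<longleftrightarrow> a \<epsilon> op pE k w' (e1 X)" unfolding 1 3[symmetric] using int[OF 2] by blast
        qed
      qed
      have sgw: "sg w' x = sg v x" if "x \<epsilon> w'" for x
        by (rule ext_eqI) (use that level_memD[OF lv wv] in auto)
      obtain g where "g \<epsilon> w" "OH w w' w' g \<kappa>"
        using OH_intro[OF lw w'(1) w'(1) T1 oph2, of \<kappa>] b1 k1 sgw w'(3) level_memD[OF lw' w'(3)] by auto
      then show False using no[OF w'(1) _ w'(2)] by blast
    qed
  qed
  \<comment> \<open>The first fact concerns ordinals only. The ultrapower embedding carries it over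
    to all sets, by way of \<open>fix_ordinals\<close>.\<close>
  have fixed2: "a \<epsilon> e (sg v a)" if a: "a \<epsilon> w" for a
  proof -
    obtain w0 where w0: "w0 \<epsilon> w" "E m w0" "a \<epsilon> w0" using Iw a unfolding I_def by blast
    note l0 = E_level[OF w0(2)]
    interpret X: extender mem pE v w w0 e
      by unfold_locales (use lv lw l0 w0 oph T in auto)
    have "X.j k = k" if "k \<epsilon> w0" "ord k" for k
      using X.j_iff[OF that(1)] fixed[OF X.w0_w[OF that(1)] that(2)] unfolding X.force_def sg_def by simp
    then have "X.j a = a" using fix_ordinals[OF X.j_elementary l0 _ w0(3)] by blast
    then show ?thesis using X.j_iff[OF w0(3)] unfolding X.force_def sg_def by simp
  qed
  obtain w0 where w0: "w0 \<epsilon> w" "E m w0" using Iw E_om[OF Ew] unfolding I_def by blast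
  interpret X: extender mem pE v w w0 e
    by unfold_locales (use lv lw E_level[OF w0(2)] w0 oph T in auto)
  \<comment> \<open>If \<open>a\<close> is outside \<open>v\<close>, then its singleton has no point
    in \<open>v\<close>, and a seed forcing it would force a contradiction.\<close>
  have inv: "a \<epsilon> v" if a: "a \<epsilon> w" for a
  proof (rule ccontr)
    assume n: "\<not> a \<epsilon> v"
    have D: "Df UNIV (\<lambda>s. s 0 = a)" by (intro dfi)
    have "X.force a (\<lambda>x. x = a)" using fixed2[OF a] unfolding X.force_def sg_def .
    then show False using X.force_bot[OF _ _ D] n by blast
  qed
  have wv: "w = v \<or> w \<epsilon> v" using level_linear[OF lv lw] inv[of v] by auto
  have "e X = itr X w" if X: "sub mem X v" for X
  proof (rule ext_eqI)
    fix a
    have D: "Df UNIV (\<lambda>s. s 0 = a)" "Df UNIV (\<lambda>s. s 0 \<epsilon> X)" "Df UNIV (\<lambda>s. \<not> s 0 \<epsilon> X)" by (intro dfi)+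
    have XX: "sep v (\<lambda>x. x \<epsilon> X) = X" by (rule ext_eqI) (use X in \<open>auto simp: mem_sep[OF D(2)] sub_def\<close>)
    have f: "X.force a (\<lambda>x. x \<epsilon> X) \<longleftrightarrow> a \<epsilon> e X" unfolding X.force_def XX ..
    show "a \<epsilon> e X \<longleftrightarrow> a \<epsilon> itr X w"
    proof (cases "a \<epsilon> w")
      case True
      have fa: "X.force a (\<lambda>x. x = a)" using fixed2[OF True] unfolding X.force_def sg_def .
      show ?thesis
      proof (cases "a \<epsilon> X")
        case aX: True
        have "X.force a (\<lambda>x. x \<epsilon> X)" by (rule X.force_mono[OF D(1,2) fa]) (use aX in simp)
        then show ?thesis using f aX True by simp
      next
        case aX: False
        have "X.force a (\<lambda>x. \<not> x \<epsilon> X)" by (rule X.force_mono[OF D(1,3) fa]) (use aX in simp)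
        then show ?thesis using f aX X.force_not[OF D(2) True] by simp
      qed
    next
      case False then show ?thesis using sw[OF X] by (auto simp: sub_def)
    qed
  qed
  then show ?thesis using wv by blast
qed

lemma Df_OH [dfi]: "Df K (\<lambda>s. OH (s a) (s b) (s c) (s d) (s e))"
  by (rule Dp_D0[OF d0_OH])

text \<open>The target of the ultrapower contains all seeds, hence \<open>VV \<theta>\<close>, and
  by \<open>j_iff\<close> the clauses of \<open>OH\<close> on singletons make \<open>x\<close> the
  critical point.\<close>

lemma OH_strong:
  assumes E: "E m u" "E m w" and w0: "level w0" "w0 \<epsilon> w" "pr \<theta> x \<epsilon> w0"
    and b: "level b" "u \<epsilon> b" and oh: "OH b u w g x" and x: "ord x"
  shows "\<exists>j M. elementary_embedding mem j M \<and> critical_point mem j x \<and> ext (VV \<theta>) \<subseteq> M \<and>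
    (\<forall>y. y \<epsilon> VV \<theta> \<longrightarrow> E m y \<longrightarrow> sat mem M (\<lambda>_. y) pE)"
proof -
  note o = OH_elim[OF b oh]
  have lu: "level u" and lw: "level w" using E E_level by auto
  have T: "Tm UNIV (\<lambda>s. app g (s 0))" by (intro dfi)
  interpret X: extender mem pE u w w0 "app g"
    by unfold_locales (use lu lw w0 o(1) T in auto)
  have t: "\<theta> \<epsilon> w0" "x \<epsilon> w0" using level_prD[OF w0(1,3)] by auto
  have V: "VV \<theta> \<epsilon> w0" using level_VV[OF w0(1) t(1)] .
  have jx: "X.j \<xi> = \<xi> \<longleftrightarrow> \<xi> \<epsilon> app g (sg u \<xi>)" if "\<xi> \<epsilon> w0" for \<xi>
    using X.j_iff[OF that] unfolding X.force_def sg_def .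
  have "critical_point mem X.j x" unfolding critical_point_def
    using x jx o(2,3) t(2) level_memD[OF w0(1) t(2)] by blast
  moreover have "ext (VV \<theta>) \<subseteq> X.M" using X.w0_M level_memD[OF w0(1) V] by auto
  moreover have "sat mem X.M (\<lambda>_. y) pE" if y: "y \<epsilon> VV \<theta>" "E m y" for y
  proof -
    have y0: "y \<epsilon> w0" using level_memD[OF w0(1) V y(1)] .
    have yw: "y \<epsilon> w" using level_memD[OF lw w0(2) y0] .
    have D: "Df UNIV (\<lambda>s. E m (s 0))" "Df UNIV (\<lambda>s. True)" by (intro dfi)+
    \<comment> \<open>The trace of \<open>E m\<close> on \<open>u\<close> is a value of operation
      12, so the extender maps it to the value at \<open>w\<close>, which by correctness of
      \<open>w\<close> is the trace of \<open>E m\<close> on \<open>w\<close>.\<close>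
    have U: "sep u (E m) = op pE 12 u (sep u (\<lambda>x. True))"
      by (rule ext_eqI) (use sat_pE[OF E(1)] pE_const in \<open>auto simp: mem_sep[OF D(1)] mem_op\<close>)
    have "app g (op pE 12 u (sep u (\<lambda>x. True))) = op pE 12 w (app g (sep u (\<lambda>x. True)))"
      using o(1) unfolding ophom_def by (auto simp: sub_def mem_sep[OF D(2)])
    then have "y \<epsilon> app g (sep u (E m))"
      unfolding U using yw y(2) sat_pE[OF E(2) yw] by (simp add: mem_op)
    then show ?thesis unfolding X.sat_M_iff[OF y0] X.force_def pE_const .
  qed
  ultimately show ?thesis using X.j_elementary by blast
qed

end

section \<open>The case that no cardinal is strong for \<open>E m\<close>\<close>

locale anti = main +
  assumes NS: "\<And>\<kappa>. \<exists>\<theta>. ord \<theta> \<and> \<not> (\<exists>j M. elementary_embedding mem j M \<and> critical_point mem j \<kappa> \<and>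
    ext (VV \<theta>) \<subseteq> M \<and> (\<forall>y. y \<epsilon> VV \<theta> \<longrightarrow> E m y \<longrightarrow> sat mem M (\<lambda>_. y) pE))"
begin

definition "goodw x w \<longleftrightarrow> E m w \<and> x \<epsilon> w \<and>
  (ord x \<longrightarrow> (\<forall>b u g. level b \<and> u \<epsilon> b \<and> E m u \<longrightarrow> \<not> OH b u w g x))"

lemma Df_goodw: "Df K (\<lambda>s. goodw (s a) (s b))"
  unfolding goodw_def by (intro dfi)

text \<open>If strength of \<open>x\<close> fails at \<open>\<theta>\<close>, a level above one that
  contains \<open>\<theta>\<close> and \<open>x\<close> is not the target of any extender with
  critical point \<open>x\<close>, as the ultrapower would show strength at
  \<open>\<theta>\<close>.\<close>

lemma ex_goodw: "\<exists>w. goodw x w"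
proof -
  obtain \<theta> where t: "\<not> (\<exists>j M. elementary_embedding mem j M \<and> critical_point mem j x \<and>
    ext (VV \<theta>) \<subseteq> M \<and> (\<forall>y. y \<epsilon> VV \<theta> \<longrightarrow> E m y \<longrightarrow> sat mem M (\<lambda>_. y) pE))" using NS[of x] by blast
  obtain w0 where w0: "level w0" "E m w0" "pr \<theta> x \<epsilon> w0" using E_unbounded by blast
  obtain w where w: "level w" "E m w" "w0 \<epsilon> w" using E_unbounded by blast
  have "x \<epsilon> w" using level_prD[OF w0(1,3)] level_memD[OF w(1,3)] by blast
  then show ?thesis unfolding goodw_def using w(2) t OH_strong[OF _ w(2) w0(1) w(3) w0(3)] by blast
qed

lemma I_unbounded: "\<exists>v. I v \<and> x \<epsilon> v"
proof -
  define N where "N y v \<longleftrightarrow> (\<forall>x. x \<epsilon> y \<longrightarrow> (\<exists>w. w \<epsilon> v \<and> goodw x w))" for y v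
  have "\<exists>v. level v \<and> E m v \<and> x \<epsilon> v \<and>
    (\<forall>y. y \<epsilon> v \<longrightarrow> (\<exists>z u. y \<epsilon> z \<and> z \<epsilon> u \<and> u \<epsilon> v \<and> level z \<and> E m z \<and> level u \<and> E m u \<and> N z u))"
  proof (rule club)
    show "Df UNIV (\<lambda>s. E m (s 0))" by (intro dfi)
    show "Df UNIV (\<lambda>s. N (s 0) (s 1))" unfolding N_def by (intro dfi Df_goodw)
    show "\<And>c x. x \<epsilon> c \<Longrightarrow> (\<And>v. v \<epsilon> c \<Longrightarrow> level v \<and> E m v) \<Longrightarrow> E m (bU c)" by (rule E_limit)
    fix y
    obtain b where b: "\<And>x. x \<epsilon> y \<Longrightarrow> \<exists>w. w \<epsilon> b \<and> goodw x w"
      using collection[of goodw y, OF Df_goodw] ex_goodw by blast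
    obtain v where v: "level v" "E m v" "pr y b \<epsilon> v" using E_unbounded by blast
    have "y \<epsilon> v" "b \<epsilon> v" using level_prD[OF v(1,3)] by auto
    then show "\<exists>v. level v \<and> E m v \<and> y \<epsilon> v \<and> N y v" unfolding N_def using v b level_memD[OF v(1)] by blast
  qed
  then obtain v where v: "level v" "E m v" "x \<epsilon> v"
    and cl: "\<And>y. y \<epsilon> v \<Longrightarrow> \<exists>z u. y \<epsilon> z \<and> z \<epsilon> u \<and> u \<epsilon> v \<and> level z \<and> E m z \<and> level u \<and> E m u \<and> N z u" by blast
  have "I v" unfolding I_def
  proof (intro conjI allI impI)
    fix y assume "y \<epsilon> v"
    then obtain z u where "y \<epsilon> z" "u \<epsilon> v" "N z u" using cl by blast
    then obtain w where w: "w \<epsilon> u" "goodw y w" "w \<epsilon> v" unfolding N_def using level_memD[OF v(1)] by blast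
    show "\<exists>w. w \<epsilon> v \<and> E m w \<and> y \<epsilon> w \<and> (ord y \<longrightarrow> (\<forall>u. u \<epsilon> v \<longrightarrow> (\<forall>g. g \<epsilon> v \<longrightarrow> E m u \<and> (u = w \<or> u \<epsilon> w) \<longrightarrow> \<not> OH v u w g y)))"
      using w v(1) unfolding goodw_def by blast
  qed (rule v)
  then show ?thesis using v by blast
qed

end

section \<open>Enumerating a class of levels\<close>

context zfc
begin

text \<open>\<open>f\<close> is the Mostowski collapse of the elements \<open>u\<close> of \<open>v\<close> with \<open>X u\<close>.\<close>

definition "collapse X f v \<longleftrightarrow> (\<forall>u. u \<epsilon> v \<longrightarrow> X u \<longrightarrow> (\<exists>y. pr u y \<epsilon> f)) \<and>
  (\<forall>u y. pr u y \<epsilon> f \<longrightarrow> u \<epsilon> v \<and> X u \<and>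
    (\<forall>t. t \<epsilon> y \<longrightarrow> (\<exists>u' y'. pr u' y' \<epsilon> f \<and> (u' \<epsilon> u \<and> t = y'))) \<and>
    (\<forall>u' y'. pr u' y' \<epsilon> f \<longrightarrow> u' \<epsilon> u \<longrightarrow> y' \<epsilon> y))"

lemma d0_collapse:
  assumes X: "\<And>i j. D0 mem (\<lambda>s. X (s i) (s j))"
  shows "D0 mem (\<lambda>s. collapse (X (s c)) (s a) (s b))"
proof -
  have "(\<exists>y. pr u y \<epsilon> f) \<longleftrightarrow> (\<exists>y. pr u y \<epsilon> f \<and> True)" for u f by simp
  then show ?thesis unfolding collapse_def by (simp only:) (intro d0i X)
qed

end

locale enum = zfc +
  fixes P :: "'a \<Rightarrow> bool"
  assumes DP: "Dp mem UNIV (\<lambda>s. P (s 0))" and P_level: "\<And>v. P v \<Longrightarrow> level v"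
    and unbounded: "\<And>x. \<exists>v. P v \<and> x \<epsilon> v"
begin

lemma DP': "Tm UNIV T \<Longrightarrow> Df UNIV (\<lambda>s. P (T s))" by (rule Dp_sub1[OF DP])

interpretation R: recursion mem UNIV "\<lambda>_. True" "\<lambda>u v. u \<epsilon> v \<and> P u" "\<lambda>_ w. w"
proof
  show "Df UNIV (\<lambda>s. True)" by (intro dfi)
  show "Df UNIV (\<lambda>s. s 0 \<epsilon> s 1 \<and> P (s 0))" by (intro dfi DP')
  show "Df UNIV (\<lambda>s. s 0 = s 2)" by (intro dfi)
  show "\<exists>c. x \<epsilon> c \<and> (\<forall>y. y \<epsilon> c \<longrightarrow> True) \<and> (\<forall>y z. y \<epsilon> c \<and> z \<epsilon> y \<and> P z \<longrightarrow> z \<epsilon> c)" for x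
    using ex_tra[of "sing x"] by (auto simp: sub_def tra_def)
  show "\<exists>y. y \<epsilon> c \<and> (\<forall>z. z \<epsilon> c \<longrightarrow> \<not> (z \<epsilon> y \<and> P z))" if "x \<epsilon> c" for c x
    using foundation[OF that] by blast
qed

definition "ot = R.recf"

lemma mem_ot: "t \<epsilon> ot x \<longleftrightarrow> (\<exists>z. z \<epsilon> x \<and> P z \<and> t = ot z)"
proof -
  have "ot x = mk {u. \<exists>z. (z \<epsilon> x \<and> P z) \<and> u = ot z}" unfolding ot_def by (rule R.recf_eq) simp
  moreover have "small {u. \<exists>z. (z \<epsilon> x \<and> P z) \<and> u = ot z}" unfolding ot_def by (rule R.recf_small) simp
  ultimately show ?thesis using mem_mk[of "{u. \<exists>z. (z \<epsilon> x \<and> P z) \<and> u = ot z}" t] by auto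
qed

lemma Tm_ot: "Tm UNIV T \<Longrightarrow> Tm UNIV (\<lambda>s. ot (T s))"
  unfolding ot_def by (rule R.Tm_recf)

lemma ord_ot: "P x \<Longrightarrow> ord (ot x)"
proof -
  have "P x \<longrightarrow> ord (ot x)"
  proof (rule mem_induct[of "\<lambda>x. P x \<longrightarrow> ord (ot x)"])
    show "Df UNIV (\<lambda>s. P (s 0) \<longrightarrow> ord (ot (s 0)))" by (intro dfi DP' Tm_ot)
    fix x assume IH: "\<And>y. y \<epsilon> x \<Longrightarrow> P y \<longrightarrow> ord (ot y)"
    show "P x \<longrightarrow> ord (ot x)"
    proof
      assume x: "P x"
      show "ord (ot x)"
      proof (rule ord_class)
        show "\<And>t. t \<epsilon> ot x \<Longrightarrow> ord t" unfolding mem_ot using IH by blast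
        show "tra (ot x)" unfolding tra_def mem_ot using mem_ot level_memD[OF P_level[OF x]] by blast
      qed
    qed
  qed
  then show "P x \<Longrightarrow> ord (ot x)" by blast
qed

lemma ot_less: "P v \<Longrightarrow> v \<epsilon> w \<Longrightarrow> ot v \<epsilon> ot w"
  unfolding mem_ot[of _ w] by blast

lemma ot_less_iff: "P v \<Longrightarrow> P w \<Longrightarrow> ot v \<epsilon> ot w \<longleftrightarrow> v \<epsilon> w"
  using ot_less[of v w] ot_less[of w v] level_linear[of v w] P_level not_mem_cycle not_mem_self by metis

lemma ot_inj: "P v \<Longrightarrow> P w \<Longrightarrow> ot v = ot w \<longleftrightarrow> v = w"
  using ot_less[of v w] ot_less[of w v] level_linear[of v w] P_level not_mem_self by metis

text \<open>Makes \<open>ot\<close> accessible to bounded formulas: its restriction to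
  \<open>v\<close> is determined by a bounded condition on an auxiliary set, provided that
  \<open>X\<close> expresses the class inside \<open>v\<close>.\<close>

lemma collapse_iff:
  assumes v: "level v" and X: "\<And>u. u \<epsilon> v \<Longrightarrow> X u \<longleftrightarrow> P u" and c: "collapse X f v"
  shows "pr u y \<epsilon> f \<longleftrightarrow> u \<epsilon> v \<and> P u \<and> y = ot u"
proof -
  have 1: "\<exists>y. pr u y \<epsilon> f" if "u \<epsilon> v" "P u" for u
    using c X that unfolding collapse_def by blast
  have 2: "u \<epsilon> v \<and> P u \<and> (\<forall>t. t \<epsilon> y \<longrightarrow> (\<exists>u' y'. pr u' y' \<epsilon> f \<and> (u' \<epsilon> u \<and> t = y'))) \<and>
    (\<forall>u' y'. pr u' y' \<epsilon> f \<longrightarrow> u' \<epsilon> u \<longrightarrow> y' \<epsilon> y)" if "pr u y \<epsilon> f" for u y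
    using c X that unfolding collapse_def by blast
  have 3: "\<forall>y. pr u y \<epsilon> f \<longrightarrow> y = ot u" for u
  proof (rule mem_induct[of "\<lambda>u. \<forall>y. pr u y \<epsilon> f \<longrightarrow> y = ot u"])
    show "Df UNIV (\<lambda>s. \<forall>y. pr (s 0) y \<epsilon> f \<longrightarrow> y = ot (s 0))" by (intro dfi Tm_ot)
    fix u assume IH: "\<And>z. z \<epsilon> u \<Longrightarrow> \<forall>y. pr z y \<epsilon> f \<longrightarrow> y = ot z"
    show "\<forall>y. pr u y \<epsilon> f \<longrightarrow> y = ot u"
    proof (intro allI impI ext_eqI)
      fix y t assume uy: "pr u y \<epsilon> f"
      show "t \<epsilon> y \<longleftrightarrow> t \<epsilon> ot u"
      proof
        assume "t \<epsilon> y"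
        then obtain z where z: "pr z t \<epsilon> f" "z \<epsilon> u" using 2[OF uy] by blast
        then have "P z" "t = ot z" using 2[OF z(1)] IH by blast+
        then show "t \<epsilon> ot u" unfolding mem_ot[of t u] using z by blast
      next
        assume "t \<epsilon> ot u"
        then obtain z where z: "z \<epsilon> u" "P z" "t = ot z" unfolding mem_ot[of t u] by blast
        then have "z \<epsilon> v" using 2[OF uy] level_memD[OF v] by blast
        then obtain y' where "pr z y' \<epsilon> f" using 1 z by blast
        moreover from this have "y' = ot z" using IH[OF z(1)] by blast
        ultimately show "t \<epsilon> y" using 2[OF uy] z by blast
      qed
    qed
  qed
  show ?thesis
  proof
    assume "pr u y \<epsilon> f" then show "u \<epsilon> v \<and> P u \<and> y = ot u" using 2 3 by blast
  next
    assume u: "u \<epsilon> v \<and> P u \<and> y = ot u"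
    then obtain z where "pr u z \<epsilon> f" using 1 by blast
    then show "pr u y \<epsilon> f" using 3 u by blast
  qed
qed

lemma collapse_ex:
  assumes v: "level v" and X: "\<And>u. u \<epsilon> v \<Longrightarrow> X u \<longleftrightarrow> P u"
  shows "\<exists>f. collapse X f v"
proof -
  have D: "Df UNIV (\<lambda>s. P (s 0))" "Tm UNIV (\<lambda>s. ot (s 0))" by (intro DP Tm_ot dfi)+
  have f: "pr u y \<epsilon> lam (sep v P) ot \<longleftrightarrow> u \<epsilon> v \<and> P u \<and> y = ot u" for u y
    unfolding mem_lam[OF D(2)] mem_sep[OF D(1)] by auto
  have "collapse X (lam (sep v P) ot) v" unfolding collapse_def f
  proof (intro conjI allI impI)
    fix u y assume u: "u \<epsilon> v \<and> P u \<and> y = ot u"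
    then show "u \<epsilon> v" "X u" using X by auto
    show "\<exists>u' y'. (u' \<epsilon> v \<and> P u' \<and> y' = ot u') \<and> u' \<epsilon> u \<and> t = y'" if "t \<epsilon> y" for t
    proof -
      have "t \<epsilon> ot u" using u that by simp
      then obtain z where "z \<epsilon> u" "P z" "t = ot z" unfolding mem_ot[of t u] by blast
      moreover from this have "z \<epsilon> v" using u level_memD[OF v] by blast
      ultimately show ?thesis by blast
    qed
    show "y' \<epsilon> y" if "u' \<epsilon> v \<and> P u' \<and> y' = ot u'" "u' \<epsilon> u" for u' y'
      using that u ot_less by simp
  qed (use X in blast)
  then show ?thesis by blast
qed

text \<open>The class cannot be indexed by \<open>\<alpha>\<close>, for \<open>F\<close> would make
  it a set. The least member whose index is not in \<open>\<alpha>\<close> then has index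
  \<open>\<alpha>\<close>.\<close>

lemma ot_onto: assumes "ord \<alpha>" shows "\<exists>v. P v \<and> ot v = \<alpha>"
proof -
  define F where "F \<beta> = lev (\<lambda>v. P v \<and> ot v = \<beta>)" for \<beta>
  have D: "Df UNIV (\<lambda>s. P (s 0) \<and> ot (s 0) = \<beta>)" for \<beta> by (intro dfi DP' Tm_ot)
  have T: "Tm UNIV (\<lambda>s. F (s 0))" unfolding F_def by (intro dfi DP' Tm_ot)
  have F: "F (ot v) = v" if "P v" for v
  proof -
    have "P (F (ot v)) \<and> ot (F (ot v)) = ot v" unfolding F_def
      using lev_props[OF D, of v] P_level that by blast
    then show ?thesis using ot_inj that by blast
  qed
  have "\<exists>v. P v \<and> \<not> ot v \<epsilon> \<alpha>"
  proof (rule ccontr)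
    assume n: "\<nexists>v. P v \<and> \<not> ot v \<epsilon> \<alpha>"
    define b where "b = mk (F ` ext \<alpha>)"
    have b: "z \<epsilon> b \<longleftrightarrow> (\<exists>\<beta>. \<beta> \<epsilon> \<alpha> \<and> z = F \<beta>)" for z unfolding b_def mem_mk[OF small_repl[OF T]] by auto
    obtain v where v: "P v" "b \<epsilon> v" using unbounded by blast
    then have "v \<epsilon> b" using n F b by metis
    then show False using v not_mem_cycle by blast
  qed
  then obtain v0 where v0: "P v0 \<and> \<not> ot v0 \<epsilon> \<alpha>" by blast
  have D2: "Df UNIV (\<lambda>s. P (s 0) \<and> \<not> ot (s 0) \<epsilon> \<alpha>)" by (intro dfi DP' Tm_ot)
  obtain v where v: "P v" "\<not> ot v \<epsilon> \<alpha>" and least: "\<And>u. P u \<Longrightarrow> \<not> ot u \<epsilon> \<alpha> \<Longrightarrow> v = u \<or> v \<epsilon> u"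
    using level_least[of "\<lambda>v. P v \<and> \<not> ot v \<epsilon> \<alpha>" v0, OF D2] v0 P_level by blast
  have "sub mem (ot v) \<alpha>" unfolding sub_def mem_ot
    using least not_mem_cycle not_mem_self by blast
  then have "ot v = \<alpha>" using ord_subset[OF ord_ot[OF v(1)] assms] v(2) by blast
  then show ?thesis using v by blast
qed

end

context zfc
begin

section \<open>Graphs\<close>

lemma fn_rel: "fn f a \<Longrightarrow> pr x y \<epsilon> f \<longleftrightarrow> x \<epsilon> a \<and> y = app f x"
  using fn_app[of f a x y] fn_dom[of f a x y] by auto

lemma graph_with_iff: "is_graph_with mem A G R \<longleftrightarrow> A = pr G R \<and> (\<exists>x. x \<epsilon> G) \<and>
    (\<forall>z. z \<epsilon> R \<longrightarrow> (\<exists>x y. x \<epsilon> G \<and> y \<epsilon> G \<and> z = pr x y))"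
  unfolding is_graph_with_def by simp

lemma graph_with_pr: "is_graph_with mem (pr G R) G' R' \<longleftrightarrow> G' = G \<and> R' = R \<and> is_graph mem (pr G R)"
  unfolding is_graph_def graph_with_iff by auto

lemma graph_edge: "is_graph mem (pr G R) \<Longrightarrow> pr x y \<epsilon> R \<Longrightarrow> x \<epsilon> G \<and> y \<epsilon> G"
  unfolding is_graph_def graph_with_iff by fastforce

lemma hom_iff: "is_hom mem h (pr G R) (pr H T) \<longleftrightarrow> is_graph mem (pr G R) \<and> is_graph mem (pr H T) \<and> fn h G \<and>
    (\<forall>x. x \<epsilon> G \<longrightarrow> app h x \<epsilon> H) \<and> (\<forall>x y. pr x y \<epsilon> R \<longrightarrow> pr (app h x) (app h y) \<epsilon> T)"
proof (cases "is_graph mem (pr G R) \<and> fn h G")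
  case True
  then have g: "is_graph mem (pr G R)" and h: "fn h G" by auto
  have "is_map mem h G H \<longleftrightarrow> (\<forall>x. x \<epsilon> G \<longrightarrow> app h x \<epsilon> H)"
    unfolding is_map_def fn_def[symmetric] related_iff fn_rel[OF h] using h by auto
  moreover have "(\<forall>x y x' y'. pr x y \<epsilon> R \<and> pr x x' \<epsilon> h \<and> pr y y' \<epsilon> h \<longrightarrow> pr x' y' \<epsilon> T) \<longleftrightarrow>
     (\<forall>x y. pr x y \<epsilon> R \<longrightarrow> pr (app h x) (app h y) \<epsilon> T)"
    unfolding fn_rel[OF h] using graph_edge[OF g] by blast
  ultimately show ?thesis unfolding is_hom_def graph_with_pr related_iff using g h by simp
next
  case False
  then have "\<not> is_hom mem h (pr G R) (pr H T)"
    unfolding is_hom_def graph_with_pr is_map_def fn_def[symmetric] by blast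
  then show ?thesis using False by blast
qed

lemma graph_pr: "is_graph mem A \<Longrightarrow> \<exists>G R. A = pr G R"
  unfolding is_graph_def graph_with_iff by blast

lemma hom_graphs: "is_hom mem h A B \<Longrightarrow> is_graph mem A \<and> is_graph mem B"
  unfolding is_hom_def is_graph_def by blast

lemma hom_comp:
  assumes "is_hom mem h A B" "is_hom mem k B C" shows "\<exists>l. is_hom mem l A C"
proof -
  obtain G R where A: "A = pr G R" using hom_graphs[OF assms(1)] graph_pr by blast
  obtain H T where B: "B = pr H T" using hom_graphs[OF assms(1)] graph_pr by blast
  obtain J W where C: "C = pr J W" using hom_graphs[OF assms(2)] graph_pr by blast
  have T: "Tm UNIV (\<lambda>s. app k (app h (s 0)))" by (intro dfi)
  have "is_hom mem (lam G (\<lambda>x. app k (app h x))) (pr G R) (pr J W)"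
    using assms graph_edge[of G R] unfolding A B C hom_iff by (auto simp: fn_lam[OF T] app_lam[OF T])
  then show ?thesis using A C by blast
qed

lemma choice_fun_iff: "is_choice_fun mem f S \<longleftrightarrow> fn f S \<and> (\<forall>A. A \<epsilon> S \<longrightarrow> (\<exists>H T. is_graph_with mem A H T \<and> app f A \<epsilon> H))"
proof (cases "fn f S")
  case True
  then show ?thesis unfolding is_choice_fun_def fn_def[symmetric] related_iff fn_rel[OF True] using True by auto
qed (simp add: is_choice_fun_def fn_def)

lemma product_iff: "is_product mem P S \<longleftrightarrow> (\<exists>G R. P = pr G R \<and> (\<forall>f. f \<epsilon> G \<longleftrightarrow> is_choice_fun mem f S) \<and>
    (\<forall>z. z \<epsilon> R \<longleftrightarrow> (\<exists>f g. f \<epsilon> G \<and> g \<epsilon> G \<and> z = pr f g \<and>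
       (\<forall>A H T. A \<epsilon> S \<and> is_graph_with mem A H T \<longrightarrow> pr (app f A) (app g A) \<epsilon> T))))"
proof -
  have *: "(\<forall>A H T x y. A \<epsilon> S \<and> is_graph_with mem A H T \<and> pr A x \<epsilon> f \<and> pr A y \<epsilon> g \<longrightarrow> pr x y \<epsilon> T) \<longleftrightarrow>
     (\<forall>A H T. A \<epsilon> S \<and> is_graph_with mem A H T \<longrightarrow> pr (app f A) (app g A) \<epsilon> T)"
    if "is_choice_fun mem f S" "is_choice_fun mem g S" for f g
  proof -
    have f: "fn f S" and g: "fn g S" using that unfolding choice_fun_iff by auto
    show ?thesis unfolding fn_rel[OF f] fn_rel[OF g] by auto
  qed
  have "(f \<epsilon> G \<and> g \<epsilon> G \<and> z = pr f g \<and> (\<forall>A H T x y. A \<epsilon> S \<and> is_graph_with mem A H T \<and> pr A x \<epsilon> f \<and> pr A y \<epsilon> g \<longrightarrow> pr x y \<epsilon> T)) \<longleftrightarrow>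
    (f \<epsilon> G \<and> g \<epsilon> G \<and> z = pr f g \<and> (\<forall>A H T. A \<epsilon> S \<and> is_graph_with mem A H T \<longrightarrow> pr (app f A) (app g A) \<epsilon> T))"
    if "\<forall>f. f \<epsilon> G \<longleftrightarrow> is_choice_fun mem f S" for f g z G
    using *[of f g] that by (intro conj_cong) auto
  then show ?thesis unfolding is_product_def is_pair_iff related_iff by (simp cong: conj_cong)
qed

lemma Df_graph_with [dfi]: "Tm K T \<Longrightarrow> Tm K U \<Longrightarrow> Tm K V \<Longrightarrow> Df K (\<lambda>s. is_graph_with mem (T s) (U s) (V s))"
  by (rule Dp_sub3[of mem K "is_graph_with mem"]) (unfold graph_with_iff, (intro dfi)+)

lemma Df_hom [dfi]: "Tm K T \<Longrightarrow> Tm K U \<Longrightarrow> Tm K V \<Longrightarrow> Df K (\<lambda>s. is_hom mem (T s) (U s) (V s))"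
  by (rule Dp_sub3[of mem K "is_hom mem"]) (unfold is_hom_def is_map_def related_iff fn_def[symmetric], (intro dfi)+)

lemma Df_choice_fun [dfi]: "Tm K T \<Longrightarrow> Tm K U \<Longrightarrow> Df K (\<lambda>s. is_choice_fun mem (T s) (U s))"
  by (rule Dp_sub2[of mem K "is_choice_fun mem"]) (unfold choice_fun_iff, (intro dfi)+)

lemma Df_product [dfi]: "Tm K T \<Longrightarrow> Tm K U \<Longrightarrow> Df K (\<lambda>s. is_product mem (T s) (U s))"
  by (rule Dp_sub2[of mem K "is_product mem"]) (unfold product_iff, (intro dfi)+)

lemma ex_product: "\<exists>P. is_product mem P S"
proof -
  define G where "G = sep (pow (pow (pow (un S (bU (bU (bU S))))))) (\<lambda>f. is_choice_fun mem f S)"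
  have "Df UNIV (\<lambda>s. is_choice_fun mem (s 0) S)" by (intro dfi)
  note G0 = mem_sep[OF this]
  have G: "f \<epsilon> G \<longleftrightarrow> is_choice_fun mem f S" for f
  proof -
    have "f \<epsilon> pow (pow (pow (un S (bU (bU (bU S))))))" if f: "is_choice_fun mem f S"
    proof (rule sub_prod)
      fix z assume "z \<epsilon> f"
      moreover have "fn f S" using f choice_fun_iff by blast
      ultimately obtain A where A: "A \<epsilon> S" "z = pr A (app f A)" using fn_mem by blast
      then obtain H T where "A = pr H T" "app f A \<epsilon> H" using f unfolding choice_fun_iff graph_with_iff by blast
      then have "app f A \<epsilon> bU (bU (bU S))" using A(1) pr_parts[of H T "S"] unfolding mem_bU[of _ "bU (bU S)"] by blast
      then show "\<exists>x y. x \<epsilon> S \<and> y \<epsilon> bU (bU (bU S)) \<and> z = pr x y" using A by blast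
    qed
    then show ?thesis unfolding G_def G0 by blast
  qed
  define R where "R = sep (pow (pow (un G G))) (\<lambda>z. \<exists>f g. f \<epsilon> G \<and> g \<epsilon> G \<and> z = pr f g \<and>
       (\<forall>A H T. A \<epsilon> S \<and> is_graph_with mem A H T \<longrightarrow> pr (app f A) (app g A) \<epsilon> T))"
  have "Df UNIV (\<lambda>s. \<exists>f g. f \<epsilon> G \<and> g \<epsilon> G \<and> s 0 = pr f g \<and>
       (\<forall>A H T. A \<epsilon> S \<and> is_graph_with mem A H T \<longrightarrow> pr (app f A) (app g A) \<epsilon> T))" by (intro dfi)
  from mem_sep[OF this] have "z \<epsilon> R \<longleftrightarrow> (\<exists>f g. f \<epsilon> G \<and> g \<epsilon> G \<and> z = pr f g \<and>
       (\<forall>A H T. A \<epsilon> S \<and> is_graph_with mem A H T \<longrightarrow> pr (app f A) (app g A) \<epsilon> T))" for z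
    unfolding R_def using in_pow2 by auto
  then show ?thesis unfolding product_iff using G by blast
qed

text \<open>Homomorphisms to the members of \<open>S\<close> are chosen simultaneously, and
  \<open>b\<close> is sent to the tuple of its images. These tuples also show that the product is
  nonempty.\<close>

lemma hom_product:
  assumes B: "is_graph mem B" and h: "\<And>A. A \<epsilon> S \<Longrightarrow> \<exists>h. is_hom mem h B A" and P: "is_product mem P S"
  shows "\<exists>h. is_hom mem h B P"
proof -
  obtain G R where Be: "B = pr G R" using graph_pr[OF B] by blast
  obtain H T where PP: "P = pr H T" "\<And>f. f \<epsilon> H \<longleftrightarrow> is_choice_fun mem f S"
    "\<And>z. z \<epsilon> T \<longleftrightarrow> (\<exists>f g. f \<epsilon> H \<and> g \<epsilon> H \<and> z = pr f g \<and>
       (\<forall>A H T. A \<epsilon> S \<and> is_graph_with mem A H T \<longrightarrow> pr (app f A) (app g A) \<epsilon> T))" using P unfolding product_iff by blast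
  have D: "Df UNIV (\<lambda>s. is_hom mem (s 1) B (s 0))" by (intro dfi)
  obtain k where k: "\<And>A. A \<epsilon> S \<Longrightarrow> is_hom mem (app k A) B A"
    using choice[of "\<lambda>A h. is_hom mem h B A" S, OF D h] by blast
  define c where "c b = lam S (\<lambda>A. app (app k A) b)" for b
  have T1: "Tm UNIV (\<lambda>s. app (app k (s 0)) b)" for b by (intro dfi)
  have T2: "Tm UNIV (\<lambda>s. c (s 0))" unfolding c_def by (intro dfi)
  have c: "fn (c b) S" "\<And>A. A \<epsilon> S \<Longrightarrow> app (c b) A = app (app k A) b" for b
    unfolding c_def using fn_lam[OF T1] app_lam[OF T1] by auto
  have kk: "is_graph_with mem A (p1 A) (p2 A) \<and> A = pr (p1 A) (p2 A) \<and> (\<forall>x. x \<epsilon> G \<longrightarrow> app (app k A) x \<epsilon> p1 A) \<and>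
     (\<forall>x y. pr x y \<epsilon> R \<longrightarrow> pr (app (app k A) x) (app (app k A) y) \<epsilon> p2 A)" if AS: "A \<epsilon> S" for A
  proof -
    obtain J W where A: "A = pr J W" using hom_graphs[OF k[OF AS]] graph_pr by blast
    show ?thesis using k[OF AS] unfolding Be A hom_iff by (auto simp: is_graph_def graph_with_iff)
  qed
  have cH: "c b \<epsilon> H" if "b \<epsilon> G" for b
    unfolding PP(2) choice_fun_iff using c kk that by metis
  have cT: "pr (c a) (c b) \<epsilon> T" if "pr a b \<epsilon> R" for a b
  proof -
    have "a \<epsilon> G" "b \<epsilon> G" using graph_edge[of G R] B Be that by blast+
    moreover have "pr (app (c a) A) (app (c b) A) \<epsilon> W" if A: "A \<epsilon> S" and g: "is_graph_with mem A J W" for A J W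
    proof -
      have "W = p2 A" using g unfolding graph_with_iff by auto
      then show ?thesis using kk[OF A] \<open>pr a b \<epsilon> R\<close> c(2)[OF A] by simp
    qed
    ultimately show ?thesis unfolding PP(3) using cH by blast
  qed
  obtain b where "b \<epsilon> G" using B Be unfolding is_graph_def graph_with_iff by auto
  then have "is_graph mem P" unfolding PP(1) is_graph_def graph_with_iff using cH PP(3) by blast
  then have "is_hom mem (lam G c) (pr G R) (pr H T)" unfolding hom_iff
    using B cH cT graph_edge[of G R] unfolding Be PP(1) by (auto simp: fn_lam[OF T2] app_lam[OF T2])
  then show ?thesis using Be PP(1) by blast
qed

end

text \<open>Strict increase counted from the left end gives \<open>i \<le> l i\<close>, counted
  towards the right end \<open>l i \<le> i\<close>.\<close>

lemma increasing_id:
  fixes l :: "nat \<Rightarrow> nat"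
  assumes "\<And>i. Suc i < n \<Longrightarrow> l i < l (Suc i)" "\<And>i. i < n \<Longrightarrow> l i < n" "i < n"
  shows "l i = i"
proof -
  have *: "i + d < n \<Longrightarrow> l i + d \<le> l (i + d)" for i d
  proof (induction d)
    case (Suc d) then show ?case using assms(1)[of "i + d"] by simp
  qed simp
  show ?thesis using *[of 0 i] *[of i "n - 1 - i"] assms(2)[of "n - 1"] assms(3) by simp
qed

section \<open>Coding levels by graphs\<close>

context zfc
begin

lemma mem_num: "x \<epsilon> num n \<longleftrightarrow> (\<exists>i<n. x = num i)"
  by (induction n) (auto simp: less_Suc_eq)

end

context main
begin

text \<open>The vertices of \<open>Gr v\<close> are the subsets of \<open>v\<close> in 15 layers. A homomorphism cannot change layers;
  the edges from layer \<open>0\<close> to layer \<open>k + 2\<close> make it commute with the \<open>k\<close>-th operation.\<close>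

definition "edge v n X n' Y \<longleftrightarrow> n \<epsilon> num 15 \<and> n' \<epsilon> num 15 \<and> sub mem X v \<and> sub mem Y v \<and>
  ((n' = succ n \<and> Y = X) \<or> (\<exists>k<nops. n = num 0 \<and> n' = num (k + 2) \<and> Y = op pE k v X))"

definition "UU v = sep (pow (pow (un (num 15) (pow v)))) (\<lambda>z. \<exists>n X. z = pr n X \<and> n \<epsilon> num 15 \<and> sub mem X v)"

definition "RR v = sep (pow (pow (un (UU v) (UU v)))) (\<lambda>z. \<exists>n X n' Y. z = pr (pr n X) (pr n' Y) \<and> edge v n X n' Y)"

definition "Gr v = pr (UU v) (RR v)"

lemma edge_alt: "edge v n X n' Y \<longleftrightarrow> (\<exists>i<15. n = num i) \<and> (\<exists>i<15. n' = num i) \<and> sub mem X v \<and> sub mem Y v \<and>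
  ((n' = succ n \<and> Y = X) \<or> (\<exists>k<nops. n = num 0 \<and> n' = num (k + 2) \<and> sub mem Y v \<and> (\<forall>z. z \<epsilon> v \<longrightarrow> (z \<epsilon> Y \<longleftrightarrow> (phis pE ! k) v z X))))"
  unfolding edge_def mem_num using is_op[of _ Y v X] by (simp cong: conj_cong) blast

lemma d0_edge: "B0 (\<lambda>s. edge (s a) (s b) (s c) (s d) (s e))"
  unfolding edge_alt by (intro D0_conj D0_disj D0_exnat d0_num d0_sub d0_exops D0_ball D0_iff D0_mem D0_eq d0_succ d0_phis')

lemma mem_UU: "z \<epsilon> UU v \<longleftrightarrow> (\<exists>n X. z = pr n X \<and> n \<epsilon> num 15 \<and> sub mem X v)"
proof -
  have "Df UNIV (\<lambda>s. \<exists>n X. s 0 = pr n X \<and> n \<epsilon> num 15 \<and> sub mem X v)" by (intro dfi)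
  from mem_sep[OF this] show ?thesis unfolding UU_def using in_pow2[of _ "num 15" _ "pow v"] by auto
qed

lemma mem_RR: "z \<epsilon> RR v \<longleftrightarrow> (\<exists>n X n' Y. z = pr (pr n X) (pr n' Y) \<and> edge v n X n' Y)"
proof -
  have D: "Df UNIV (\<lambda>s. \<exists>n X n' Y. s 0 = pr (pr n X) (pr n' Y) \<and> edge (s 1) n X n' Y)"
    by (intro dfi Dp_D0[OF d0_edge])
  have "Df UNIV (\<lambda>s. \<exists>n X n' Y. s 0 = pr (pr n X) (pr n' Y) \<and> edge v n X n' Y)"
    by (rule Dp_sub2[where P = "\<lambda>z v. \<exists>n X n' Y. z = pr (pr n X) (pr n' Y) \<and> edge v n X n' Y", OF D]) (intro dfi)+
  note s = mem_sep[OF this]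
  have "z \<epsilon> pow (pow (un (UU v) (UU v)))" if z: "z = pr (pr n X) (pr n' Y)" "edge v n X n' Y" for n X n' Y
  proof -
    have "pr n X \<epsilon> UU v" "pr n' Y \<epsilon> UU v" using z(2) unfolding mem_UU edge_def by auto
    then show ?thesis unfolding z(1) by (rule in_pow2)
  qed
  then show ?thesis unfolding RR_def s by blast
qed

lemma edge_RR: "pr (pr n X) (pr n' Y) \<epsilon> RR v \<longleftrightarrow> edge v n X n' Y"
  unfolding mem_RR by auto

lemma graph_Gr: "is_graph mem (Gr v)"
proof -
  have "pr (num 0) v \<epsilon> UU v" using num_less[of 0 15] by (simp add: mem_UU)
  moreover have "\<exists>x y. x \<epsilon> UU v \<and> y \<epsilon> UU v \<and> z = pr x y" if "z \<epsilon> RR v" for z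
    using that unfolding mem_RR mem_UU edge_def by blast
  ultimately show ?thesis unfolding is_graph_def graph_with_iff Gr_def by blast
qed

lemma Gr_parts: "level u \<Longrightarrow> Gr v \<epsilon> u \<Longrightarrow> v \<epsilon> u"
proof -
  assume u: "level u" and "Gr v \<epsilon> u"
  then have "UU v \<epsilon> u" unfolding Gr_def using level_prD by blast
  moreover have "pr (num 0) v \<epsilon> UU v" using num_less[of 0 15] by (simp add: mem_UU)
  ultimately show ?thesis using level_memD[OF u] level_prD[OF u] by blast
qed

definition "can v w = lam (UU v) (\<lambda>z. pr (p1 z) (itr (p2 z) w))"

lemma can_hom:
  assumes "E m v" "E m w" "w = v \<or> w \<epsilon> v"
  shows "is_hom mem (can v w) (Gr v) (Gr w)"
proof -
  have T: "Tm UNIV (\<lambda>s. pr (p1 (s 0)) (itr (p2 (s 0)) w))" by (intro dfi)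
  have a: "app (can v w) (pr n X) = pr n (itr X w)" if "pr n X \<epsilon> UU v" for n X
    unfolding can_def using app_lam[OF T that] by simp
  have s: "sub mem (itr X w) w" for X by (simp add: sub_def)
  have e: "edge w n (itr X w) n' (itr Y w) \<and> pr n X \<epsilon> UU v \<and> pr n' Y \<epsilon> UU v" if "edge v n X n' Y" for n X n' Y
    using that s E_op_itr[OF assms] unfolding edge_def mem_UU by auto
  show ?thesis unfolding Gr_def hom_iff
  proof (intro conjI allI impI)
    show "is_graph mem (pr (UU v) (RR v))" "is_graph mem (pr (UU w) (RR w))" using graph_Gr unfolding Gr_def by auto
    show "fn (can v w) (UU v)" unfolding can_def by (rule fn_lam[OF T])
    show "app (can v w) x \<epsilon> UU w" if x: "x \<epsilon> UU v" for x
    proof -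
      obtain n X where "x = pr n X" "n \<epsilon> num 15" using x mem_UU by blast
      then show ?thesis using a[of n X] x s mem_UU by auto
    qed
    show "pr (app (can v w) x) (app (can v w) y) \<epsilon> RR w" if xy: "pr x y \<epsilon> RR v" for x y
    proof -
      obtain n X n' Y where "x = pr n X" "y = pr n' Y" "edge v n X n' Y" using xy mem_RR[of "pr x y" v] by auto
      then show ?thesis using e[of n X n' Y] a edge_RR by auto
    qed
  qed
qed

text \<open>Every edge leads to a higher layer. The chain of the 15 copies of \<open>X\<close> is
  thus mapped to a strictly increasing sequence of layers, which must be the identity, and the
  second component stays constant along it. An edge from layer 0 to layer \<open>k + 2\<close> is
  never a chain edge, so its image witnesses the \<open>k\<close>-th operation.\<close>

lemma hom_ophom:
  assumes h: "is_hom mem h (Gr v) (Gr w)"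
  shows "\<exists>e. Tm UNIV (\<lambda>s. e (s 0)) \<and> ophom pE v w e \<and>
    (\<forall>n X. n \<epsilon> num 15 \<longrightarrow> sub mem X v \<longrightarrow> app h (pr n X) = pr n (e X))"
proof -
  define e where "e X = p2 (app h (pr (num 0) X))" for X
  have hm: "\<And>x. x \<epsilon> UU v \<Longrightarrow> app h x \<epsilon> UU w" and he: "\<And>x y. pr x y \<epsilon> RR v \<Longrightarrow> pr (app h x) (app h y) \<epsilon> RR w"
    using h unfolding Gr_def hom_iff by auto
  have inc: "i < j" if "edge w (num i) Y (num j) Z" "i < 15" "j < 15" for i j Y Z
  proof -
    have "num j = succ (num i) \<or> (\<exists>k. num i = num 0 \<and> num j = num (k + 2))" using that(1) unfolding edge_def by blast
    then have "num j = num (Suc i) \<or> (\<exists>k. num i = num 0 \<and> num j = num (k + 2))" by simp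
    then show ?thesis unfolding num_inj by auto
  qed
  have main: "app h (pr (num i) X) = pr (num i) (e X) \<and> sub mem (e X) w" if i: "i < 15" and X: "sub mem X v" for i X
  proof -
    have "\<exists>l Y. l < 15 \<and> sub mem Y w \<and> app h (pr (num i) X) = pr (num l) Y" if "i < 15" for i
      using hm[of "pr (num i) X"] that X unfolding mem_UU mem_num by auto
    then obtain l Y where lY: "\<And>i. i < 15 \<Longrightarrow> l i < 15 \<and> sub mem (Y i) w \<and> app h (pr (num i) X) = pr (num (l i)) (Y i)"
      by metis
    have ed: "edge w (num (l i)) (Y i) (num (l (Suc i))) (Y (Suc i))" if i: "Suc i < 15" for i
    proof -
      have "num (Suc i) = succ (num i)" "num i \<epsilon> num 15" "num (Suc i) \<epsilon> num 15"
        using num_less[of i 15] num_less[OF i] i by simp_all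
      then have "edge v (num i) X (num (Suc i)) X" unfolding edge_def using X by blast
      then have "pr (app h (pr (num i) X)) (app h (pr (num (Suc i)) X)) \<epsilon> RR w" using he edge_RR by blast
      then show ?thesis using lY[of i] lY[of "Suc i"] i by (simp add: edge_RR del: num.simps)
    qed
    have li: "l i = i" if "i < 15" for i
    proof (rule increasing_id[of 15 l, OF _ _ that])
      show "l i < l (Suc i)" if i: "Suc i < 15" for i
        by (rule inc[OF ed[OF i]]) (use lY i in simp_all)
    qed (use lY in simp)
    have Y0: "i < 15 \<Longrightarrow> Y i = Y 0" for i
    proof (induction i)
      case (Suc i)
      have "edge w (num i) (Y i) (num (Suc i)) (Y (Suc i))" using ed[of i] li[of i] li[of "Suc i"] Suc.prems by simp
      then have "Y (Suc i) = Y i \<or> (\<exists>k. num i = num 0 \<and> num (Suc i) = num (k + 2))" unfolding edge_def by blast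
      then have "Y (Suc i) = Y i" unfolding num_inj by auto
      then show ?case using Suc by simp
    qed simp
    have "e X = Y 0" unfolding e_def using lY[of 0] by simp
    then show ?thesis using lY[OF i] unfolding li[OF i] Y0[OF i] by simp
  qed
  have "ophom pE v w e" unfolding ophom_def
  proof (intro allI impI conjI)
    fix X k assume X: "sub mem X v"
    show "sub mem (e X) w" using main[of 0, OF _ X] by simp
    assume k: "k < nops"
    have k2: "k + 2 < 15" using k by simp
    have s: "sub mem (op pE k v X) v" by (rule sub_op[OF k])
    have "num 0 \<epsilon> num 15" "num (k + 2) \<epsilon> num 15" using num_less[of 0 15] num_less[OF k2] by simp_all
    then have "edge v (num 0) X (num (k + 2)) (op pE k v X)" unfolding edge_def using X s k by blast
    then have "pr (app h (pr (num 0) X)) (app h (pr (num (k + 2)) (op pE k v X))) \<epsilon> RR w" using he edge_RR by blast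
    then have "edge w (num 0) (e X) (num (k + 2)) (e (op pE k v X))"
      using main[of 0, OF _ X] main[OF k2 s] edge_RR by (simp del: num.simps)
    then have "num (k + 2) = num (Suc 0) \<or> (\<exists>k'<nops. num (k + 2) = num (k' + 2) \<and> e (op pE k v X) = op pE k' w (e X))"
      unfolding edge_def by auto
    then show "e (op pE k v X) = op pE k w (e X)" unfolding num_inj by auto
  qed
  moreover have "Tm UNIV (\<lambda>s. e (s 0))" unfolding e_def by (intro dfi)
  moreover have "app h (pr n X) = pr n (e X)" if n: "n \<epsilon> num 15" and X: "sub mem X v" for n X
  proof -
    obtain i where i: "i < 15" "n = num i" using n mem_num by blast
    show ?thesis unfolding i(2) using main[OF i(1) X] by blast
  qed
  ultimately show ?thesis by (intro exI[of _ e] conjI allI impI)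
qed

lemma Gr_rigid:
  assumes "I v" "I w" "is_hom mem h (Gr v) (Gr w)"
  shows "w = v \<or> w \<epsilon> v" "h = can v w"
proof -
  obtain e where e: "Tm UNIV (\<lambda>s. e (s 0))" "ophom pE v w e"
    and he: "\<And>n X. n \<epsilon> num 15 \<Longrightarrow> sub mem X v \<Longrightarrow> app h (pr n X) = pr n (e X)"
    using hom_ophom[OF assms(3)] by blast
  note r = rigid[OF assms(1,2) e]
  then show "w = v \<or> w \<epsilon> v" by blast
  have T: "Tm UNIV (\<lambda>s. pr (p1 (s 0)) (itr (p2 (s 0)) w))" by (intro dfi)
  show "h = can v w"
  proof (rule fn_eqI)
    show "fn h (UU v)" using assms(3) unfolding Gr_def hom_iff by blast
    show "fn (can v w) (UU v)" unfolding can_def by (rule fn_lam[OF T])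
    fix x assume x: "x \<epsilon> UU v"
    then obtain n X where x': "x = pr n X" "n \<epsilon> num 15" "sub mem X v" using mem_UU by blast
    then show "app h x = app (can v w) x" unfolding can_def app_lam[OF T x] using he r by simp
  qed
qed

section \<open>Definability of the coding\<close>

text \<open>That the vertices include all subsets of \<open>v\<close> takes one unbounded universal
  quantifier, available because \<open>m \<ge> 1\<close>; vertices and edges are recognized by
  bounded formulas.\<close>

lemma PiP_Gr: "PiP mem m (\<lambda>s. s i = Gr (s j))"
proof -
  obtain k where k: "m = Suc k" using m1 by (cases m) auto
  define iU where "iU z v \<longleftrightarrow> (\<exists>n X. z = pr n X \<and> (\<exists>i<15. n = num i) \<and> sub mem X v)" for z v
  define iR where "iR z v \<longleftrightarrow> (\<exists>a b. z = pr a b \<and> (\<exists>n X. a = pr n X \<and> (\<exists>n' Y. b = pr n' Y \<and> edge v n X n' Y)))" for z v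
  have U: "z \<epsilon> UU v \<longleftrightarrow> iU z v" and R: "z \<epsilon> RR v \<longleftrightarrow> iR z v" for z v
    unfolding mem_UU mem_RR iU_def iR_def mem_num by blast+
  have d: "B0 (\<lambda>s. iU (s a) (s b))" "B0 (\<lambda>s. iR (s a) (s b))" for a b
    unfolding iU_def iR_def by (intro d0i d0_edge)+
  have eq: "x = Gr v \<longleftrightarrow> (\<exists>U R. x = pr U R \<and> True) \<and> (\<forall>U R. x = pr U R \<longrightarrow> (\<forall>z. (z \<epsilon> U \<longleftrightarrow> iU z v) \<and> (z \<epsilon> R \<longleftrightarrow> iR z v)))" for x v
  proof
    assume "x = Gr v"
    then show "(\<exists>U R. x = pr U R \<and> True) \<and> (\<forall>U R. x = pr U R \<longrightarrow> (\<forall>z. (z \<epsilon> U \<longleftrightarrow> iU z v) \<and> (z \<epsilon> R \<longleftrightarrow> iR z v)))"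
      unfolding Gr_def by (auto simp: U R)
  next
    assume "(\<exists>U R. x = pr U R \<and> True) \<and> (\<forall>U R. x = pr U R \<longrightarrow> (\<forall>z. (z \<epsilon> U \<longleftrightarrow> iU z v) \<and> (z \<epsilon> R \<longleftrightarrow> iR z v)))"
    then obtain A B where "x = pr A B" "\<And>z. z \<epsilon> A \<longleftrightarrow> z \<epsilon> UU v" "\<And>z. z \<epsilon> B \<longleftrightarrow> z \<epsilon> RR v"
      unfolding U R by blast
    then show "x = Gr v" unfolding Gr_def using ext_eqI[of A "UU v"] ext_eqI[of B "RR v"] by blast
  qed
  have 1: "PiP mem m (\<lambda>s. \<exists>U R. s i = pr U R \<and> True)" by (intro SigP_D0(2) d0i)
  have 2: "PiP mem m (\<lambda>s. \<forall>U R. s i = pr U R \<longrightarrow> (\<forall>z. (z \<epsilon> U \<longleftrightarrow> iU z (s j)) \<and> (z \<epsilon> R \<longleftrightarrow> iR z (s j))))"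
    unfolding k by (intro PiP_all PiP_imp SigP_D0 d0i d)
  show ?thesis unfolding eq by (rule PiP_conj[OF 1 2])
qed

text \<open>\<open>v\<close> is recovered from \<open>Gr v\<close> as the largest second component of a vertex.\<close>

definition "largest U v \<longleftrightarrow> (\<forall>n X. pr n X \<epsilon> U \<longrightarrow> sub mem X v)"

lemma d0_largest: "B0 (\<lambda>s. largest (s i) (s j))"
  unfolding largest_def by (intro d0i)

lemma largest_UU: "pr n u \<epsilon> UU v \<and> largest (UU v) u \<longleftrightarrow> n \<epsilon> num 15 \<and> u = v"
proof -
  have n: "num 0 \<epsilon> num 15" using num_less[of 0 15] by simp
  then have "pr (num 0) v \<epsilon> UU v" unfolding mem_UU by auto
  then show ?thesis unfolding largest_def mem_UU using sub_antisym by auto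
qed

text \<open>An existential quantifier over \<open>v\<close> in front of \<open>Q\<close> would leave
  the \<open>\<Pi>\<^sub>m\<close> formulas. As \<open>v\<close> is determined by the graph through
  a bounded condition, it is replaced by a universal one.\<close>

lemma Gr_conv: "(\<exists>v. Q v \<and> x = Gr v) \<longleftrightarrow> (\<exists>U R. x = pr U R \<and> (\<exists>n v. pr n v \<epsilon> U \<and> largest U v)) \<and>
  (\<forall>U R. x = pr U R \<longrightarrow> (\<forall>n v. pr n v \<epsilon> U \<longrightarrow> largest U v \<longrightarrow> Q v \<and> x = Gr v))"
  (is "?L \<longleftrightarrow> ?R")
proof
  assume ?L
  then obtain v where v: "Q v" "x = Gr v" by blast
  have "num 0 \<epsilon> num 15" using num_less[of 0 15] by simp
  then have "pr (num 0) v \<epsilon> UU v \<and> largest (UU v) v" unfolding largest_UU by blast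
  moreover have "u = v" if "pr n u \<epsilon> UU v" "largest (UU v) u" for n u using that largest_UU by blast
  ultimately show ?R using v unfolding Gr_def by auto
qed blast

lemma PiP_Gr_ex:
  assumes "PiP mem m (\<lambda>s. Q (s 0) (\<lambda>i. s (Suc i)))"
  shows "PiP mem m (\<lambda>s. \<exists>v. Q v s \<and> s i = Gr v)"
proof -
  obtain k where k: "m = Suc k" using m1 by (cases m) auto
  have 1: "PiP mem m (\<lambda>s. \<exists>U R. s i = pr U R \<and> (\<exists>n v. pr n v \<epsilon> U \<and> largest U v))" by (intro SigP_D0(2) d0i d0_largest)
  have Q: "PiP mem m (\<lambda>s. Q (s 0) (\<lambda>i. s (Suc (Suc (Suc (Suc i))))))"
    using PiP_ren[OF assms, of "case_nat 0 (\<lambda>i. Suc (Suc (Suc (Suc i))))"] by simp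
  have 2: "PiP mem m (\<lambda>s. \<forall>U R. s i = pr U R \<longrightarrow> (\<forall>n v. pr n v \<epsilon> U \<longrightarrow> largest U v \<longrightarrow> Q v s \<and> s i = Gr v))"
    unfolding k by (intro PiP_all PiP_imp SigP_D0(1) d0i d0_largest PiP_conj) (use Q PiP_Gr k in simp_all)
  show ?thesis unfolding Gr_conv[of "\<lambda>v. Q v _"] by (rule PiP_conj[OF 1 2])
qed

end

context anti
begin

sublocale en: enum mem I
  by unfold_locales (use I_level I_unbounded in \<open>auto intro: Df_I Dt_var\<close>)

text \<open>For \<open>v\<close> in \<open>I\<close> a collapse exists and all collapses have range
  \<open>ot v\<close>, so it may be quantified universally, with membership in \<open>I\<close> read
  as truth in \<open>v\<close>.\<close>

lemma PiP_ot: "\<exists>Q. PiP mem m (\<lambda>s. Q (s 0) (s 1)) \<and> (\<forall>\<alpha> v. I v \<longrightarrow> (Q \<alpha> v \<longleftrightarrow> \<alpha> = en.ot v))"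
proof -
  obtain k where k: "m = Suc k" using m1 by (cases m) auto
  obtain pI where pI: "is_Pi m pI" "\<And>s. I (s 0) = sat mem UNIV s pI" using PiP_I[of 0] unfolding PiP_def by blast
  define X where "X v u \<longleftrightarrow> sat mem (ext v) (\<lambda>_. u) pI" for v u
  have dX: "B0 (\<lambda>s. X (s i) (s j))" for i j unfolding X_def using d0_sat_ext[of i "\<lambda>_. j" pI] by simp
  define Q where "Q \<alpha> v \<longleftrightarrow> (\<forall>f. collapse (X v) f v \<longrightarrow> (\<forall>t. t \<epsilon> \<alpha> \<longrightarrow> (\<exists>u y. pr u y \<epsilon> f \<and> t = y)) \<and> (\<forall>u y. pr u y \<epsilon> f \<longrightarrow> y \<epsilon> \<alpha>))" for \<alpha> v
  have PQ: "PiP mem m (\<lambda>s. Q (s 0) (s 1))" unfolding Q_def k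
    by (intro PiP_all PiP_imp SigP_D0 d0_collapse dX d0i)
  have "Q \<alpha> v \<longleftrightarrow> \<alpha> = en.ot v" if v: "I v" for \<alpha> v
  proof -
    note lv = I_level[OF v]
    have si: "X v u \<longleftrightarrow> I u" if "u \<epsilon> v" for u
      using E_sat[OF I_E[OF v], of pI "\<lambda>_. u"] pI(1) pI(2)[of "\<lambda>_. u"] that unfolding X_def by auto
    obtain f where f: "collapse (X v) f v" using en.collapse_ex[of v "X v", OF lv si] by blast
    have ran: "t \<epsilon> en.ot v \<longleftrightarrow> (\<exists>u. pr u t \<epsilon> g)" if g: "collapse (X v) g v" for t g
    proof -
      have "pr u t \<epsilon> g \<longleftrightarrow> u \<epsilon> v \<and> I u \<and> t = en.ot u" for u
        by (rule en.collapse_iff[of v "X v" g, OF lv si g])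
      then show ?thesis unfolding en.mem_ot[of t v] by blast
    qed
    show ?thesis
    proof
      assume "Q \<alpha> v"
      then have q: "(\<forall>t. t \<epsilon> \<alpha> \<longrightarrow> (\<exists>u y. pr u y \<epsilon> f \<and> t = y)) \<and> (\<forall>u y. pr u y \<epsilon> f \<longrightarrow> y \<epsilon> \<alpha>)"
        unfolding Q_def using f by blast
      show "\<alpha> = en.ot v"
      proof (rule ext_eqI)
        fix t show "t \<epsilon> \<alpha> \<longleftrightarrow> t \<epsilon> en.ot v" unfolding ran[OF f] using q by blast
      qed
    next
      assume a: "\<alpha> = en.ot v"
      show "Q \<alpha> v" unfolding Q_def a using ran by blast
    qed
  qed
  then show ?thesis using PQ by blast
qed

lemma coding_definable: "definable_by mem (Pi_fm m) {x. \<exists>v. I v \<and> x = Gr v}"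
  by (rule definable_by_Pi) (use PiP_Gr_ex[of "\<lambda>v s. I v", OF PiP_I] in simp)

lemma sequence_definable: "definable_by mem (Pi_fm m) {x. \<exists>v. I v \<and> x = pr (en.ot v) (Gr v)}"
proof (rule definable_by_Pi)
  obtain k where k: "m = Suc k" using m1 by (cases m) auto
  obtain Q where Q: "PiP mem m (\<lambda>s. Q (s 0) (s 1))" "\<And>\<alpha> v. I v \<Longrightarrow> Q \<alpha> v \<longleftrightarrow> \<alpha> = en.ot v" using PiP_ot by blast
  have "PiP mem m (\<lambda>s. Q (s 2) (s 0))" using PiP_ren[OF Q(1), of "\<lambda>i. if i = 0 then 2 else 0"] by simp
  then have "PiP mem m (\<lambda>s. I (s 0) \<and> Q (s 2) (s 0))" by (intro PiP_conj PiP_I)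
  then have 1: "PiP mem m (\<lambda>s. \<exists>v. (I v \<and> Q (s 1) v) \<and> s 0 = Gr v)"
    by (intro PiP_Gr_ex) (simp add: numeral_2_eq_2)
  have e: "(\<exists>v. I v \<and> x = pr (en.ot v) (Gr v)) \<longleftrightarrow> (\<exists>\<alpha> G. x = pr \<alpha> G \<and> True) \<and> (\<forall>\<alpha> G. x = pr \<alpha> G \<longrightarrow> (\<exists>v. (I v \<and> Q \<alpha> v) \<and> G = Gr v))"
    (is "?L \<longleftrightarrow> ?A \<and> ?B") for x
  proof
    assume ?L
    then obtain v where v: "I v" "x = pr (en.ot v) (Gr v)" by blast
    then have "Q (en.ot v) v" using Q(2) by blast
    then show "?A \<and> ?B" using v by auto
  next
    assume "?A \<and> ?B"
    then obtain \<alpha> G v where v: "x = pr \<alpha> G" "I v" "Q \<alpha> v" "G = Gr v" by blast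
    then have "\<alpha> = en.ot v" using Q(2) by simp
    then show ?L using v by blast
  qed
  have 2: "PiP mem m (\<lambda>s. \<exists>\<alpha> G. s 0 = pr \<alpha> G \<and> True)" by (intro SigP_D0(2) d0i)
  have 3: "PiP mem m (\<lambda>s. \<forall>\<alpha> G. s 0 = pr \<alpha> G \<longrightarrow> (\<exists>v. (I v \<and> Q \<alpha> v) \<and> G = Gr v))"
    unfolding k by (intro PiP_all PiP_imp SigP_D0(1) d0i) (use 1 k in simp)
  show "PiP mem m (\<lambda>s. s 0 \<in> {x. \<exists>v. I v \<and> x = pr (en.ot v) (Gr v)})"
    unfolding mem_Collect_eq e by (rule PiP_conj[OF 2 3])
qed

lemma not_WVP: "\<not> WVP mem (Pi_fm m)"
proof -
  define F where "F = {x. \<exists>v. I v \<and> x = pr (en.ot v) (Gr v)}"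
  have at: "seq_at mem F \<alpha> G \<longleftrightarrow> (\<exists>v. I v \<and> \<alpha> = en.ot v \<and> G = Gr v)" for \<alpha> G
    unfolding seq_at_def F_def by auto
  have "is_graph_sequence mem F" unfolding is_graph_sequence_def seq_at_def[symmetric] at
  proof (intro conjI ballI allI impI)
    fix z assume "z \<in> F"
    then show "\<exists>\<alpha> G. ord \<alpha> \<and> is_graph mem G \<and> is_pair mem z \<alpha> G" unfolding F_def using en.ord_ot graph_Gr by auto
  next
    fix \<alpha> assume "ord \<alpha>"
    then obtain v where "I v" "en.ot v = \<alpha>" using en.ot_onto by blast
    then show "\<exists>!G. \<exists>v. I v \<and> \<alpha> = en.ot v \<and> G = Gr v" using en.ot_inj by metis
  qed
  moreover have "((\<alpha> \<epsilon> \<beta> \<or> \<alpha> = \<beta>) \<longrightarrow> (\<exists>!h. is_hom mem h B A)) \<and> (\<alpha> \<epsilon> \<beta> \<longrightarrow> \<not> (\<exists>h. is_hom mem h A B))"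
    if "seq_at mem F \<alpha> A \<and> seq_at mem F \<beta> B" for \<alpha> \<beta> A B
  proof -
    obtain v w where v: "I v" "\<alpha> = en.ot v" "A = Gr v" and w: "I w" "\<beta> = en.ot w" "B = Gr w"
      using \<open>seq_at mem F \<alpha> A \<and> seq_at mem F \<beta> B\<close> unfolding at by blast
    have 1: "\<alpha> \<epsilon> \<beta> \<longleftrightarrow> v \<epsilon> w" "\<alpha> = \<beta> \<longleftrightarrow> v = w"
      using en.ot_less_iff[OF v(1) w(1)] en.ot_inj[OF v(1) w(1)] v w by auto
    show ?thesis unfolding 1 v(3) w(3)
      using can_hom[OF I_E[OF w(1)] I_E[OF v(1)]] Gr_rigid[OF w(1) v(1)] Gr_rigid(1)[OF v(1) w(1)]
        not_mem_cycle[of v w] not_mem_self by metis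
  qed
  moreover have "definable_by mem (Pi_fm m) F" unfolding F_def by (rule sequence_definable)
  ultimately show ?thesis unfolding WVP_def not_not by (intro exI[of _ F] conjI allI impI) blast+
qed

text \<open>For \<open>v\<close> above \<open>S\<close> and \<open>w\<close> above \<open>v\<close>,
  the canonical maps send \<open>Gr v\<close> to all members of \<open>S\<close>, hence to the
  product, and reflection sends it on to \<open>Gr w\<close>, against rigidity.\<close>

lemma not_PRP: "\<not> PRP mem (Pi_fm m)"
proof
  assume prp: "PRP mem (Pi_fm m)"
  define C where "C = {x. \<exists>v. I v \<and> x = Gr v}"
  have "\<not> small C"
  proof
    assume "small C"
    then obtain c where c: "C = ext c" unfolding small_alt by blast
    obtain v where v: "I v" "c \<epsilon> v" using I_unbounded by blast
    have "Gr v \<in> C" using v unfolding C_def by blast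
    then have "Gr v \<epsilon> v" using c level_memD[OF I_level[OF v(1)] v(2)] by auto
    then have "v \<epsilon> v" using Gr_parts[OF I_level[OF v(1)]] by blast
    then show False by simp
  qed
  moreover have "\<forall>A\<in>C. is_graph mem A" unfolding C_def using graph_Gr by blast
  moreover have "definable_by mem (Pi_fm m) C \<and> \<not> small C \<and> (\<forall>A\<in>C. is_graph mem A) \<longrightarrow>
     (\<exists>S. (\<forall>A. A \<epsilon> S \<longrightarrow> A \<in> C) \<and> (\<forall>G\<in>C. \<exists>P h. is_product mem P S \<and> is_hom mem h P G))"
    using prp unfolding PRP_def by (rule spec)
  moreover have "definable_by mem (Pi_fm m) C" unfolding C_def by (rule coding_definable)
  ultimately obtain S where S: "\<And>A. A \<epsilon> S \<Longrightarrow> A \<in> C" and h: "\<And>G. G \<in> C \<Longrightarrow> \<exists>P h. is_product mem P S \<and> is_hom mem h P G"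
    by blast
  obtain v where v: "I v" "S \<epsilon> v" using I_unbounded by blast
  obtain w where w: "I w" "v \<epsilon> w" using I_unbounded by blast
  have "Gr w \<in> C" using w unfolding C_def by blast
  then obtain P k where P: "is_product mem P S" "is_hom mem k P (Gr w)" using h by blast
  have "\<exists>h. is_hom mem h (Gr v) A" if A: "A \<epsilon> S" for A
  proof -
    obtain u where u: "I u" "A = Gr u" using S[OF A] unfolding C_def by blast
    have "u \<epsilon> v" using Gr_parts[OF I_level[OF v(1)]] level_memD[OF I_level[OF v(1)] v(2) A] u by blast
    then show ?thesis using can_hom[OF I_E[OF v(1)] I_E[OF u(1)]] u by blast
  qed
  then obtain h where "is_hom mem h (Gr v) P" using hom_product[OF graph_Gr _ P(1)] by blast
  then obtain l where "is_hom mem l (Gr v) (Gr w)" using hom_comp P(2) by blast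
  then have "w = v \<or> w \<epsilon> v" using Gr_rigid(1)[OF v(1) w(1)] by blast
  then show False using w not_mem_cycle not_mem_self by blast
qed

end

context zfc
begin

section \<open>Transfer along elementary embeddings\<close>

text \<open>\<open>j\<close> preserves the universal closure of \<open>r\<close>, which can then be
  instantiated at elements of \<open>M\<close> outside the range of \<open>j\<close>.\<close>

lemma el_all2:
  assumes el: "elementary_embedding mem j M" and r: "\<And>x y. sat mem UNIV (s(0 := x, 1 := y)) r" and M: "x \<in> M" "y \<in> M"
  shows "sat mem M ((\<lambda>i. j (s i))(0 := x, 1 := y)) r"
proof -
  have "sat mem UNIV s (Forall 0 (Forall 1 r))" using r by simp
  then have "sat mem M (\<lambda>i. j (s i)) (Forall 0 (Forall 1 r))" using el_sat[OF el] by blast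
  then show ?thesis using M by simp
qed

lemma is_V_iff: assumes "ord \<theta>" shows "is_V mem \<theta> v \<longleftrightarrow> v = VV \<theta>"
proof
  assume "is_V mem \<theta> v"
  then obtain f \<delta> where d: "ord \<delta>" "\<theta> \<epsilon> \<delta>" "fn f \<delta>" "pr \<theta> v \<epsilon> f"
    and r: "\<And>\<beta> b. pr \<beta> b \<epsilon> f \<Longrightarrow> (\<forall>x. x \<epsilon> b \<longleftrightarrow> (\<exists>\<gamma> c. \<gamma> \<epsilon> \<beta> \<and> pr \<gamma> c \<epsilon> f \<and> sub mem x c))"
    unfolding is_V_def related_iff fn_def[symmetric] by blast
  have "\<beta> \<epsilon> \<delta> \<longrightarrow> app f \<beta> = VV \<beta>" for \<beta>
  proof (rule mem_induct[of "\<lambda>\<beta>. \<beta> \<epsilon> \<delta> \<longrightarrow> app f \<beta> = VV \<beta>"])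
    show "Df UNIV (\<lambda>s. s 0 \<epsilon> \<delta> \<longrightarrow> app f (s 0) = VV (s 0))" by (intro dfi)
    fix \<beta> assume IH: "\<And>y. y \<epsilon> \<beta> \<Longrightarrow> y \<epsilon> \<delta> \<longrightarrow> app f y = VV y"
    show "\<beta> \<epsilon> \<delta> \<longrightarrow> app f \<beta> = VV \<beta>"
    proof (intro impI ext_eqI)
      fix x assume b: "\<beta> \<epsilon> \<delta>"
      have "pr \<beta> (app f \<beta>) \<epsilon> f" using fn_rel[OF d(3)] b by blast
      from r[OF this] have "x \<epsilon> app f \<beta> \<longleftrightarrow> (\<exists>\<gamma>. \<gamma> \<epsilon> \<beta> \<and> \<gamma> \<epsilon> \<delta> \<and> sub mem x (app f \<gamma>))"
        unfolding fn_rel[OF d(3)] by blast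
      also have "\<dots> \<longleftrightarrow> (\<exists>\<gamma>. \<gamma> \<epsilon> \<beta> \<and> sub mem x (VV \<gamma>))" using IH traD[OF ord_trans[OF d(1)] b] by metis
      finally show "x \<epsilon> app f \<beta> \<longleftrightarrow> x \<epsilon> VV \<beta>" using mem_VV[of x \<beta>] by simp
    qed
  qed
  then show "v = VV \<theta>" using d fn_rel[OF d(3)] by simp
next
  assume v: "v = VV \<theta>"
  have T: "Tm UNIV (\<lambda>s. VV (s 0))" by (intro dfi)
  have f: "pr x y \<epsilon> lam (succ \<theta>) VV \<longleftrightarrow> (x \<epsilon> \<theta> \<or> x = \<theta>) \<and> y = VV x" for x y unfolding mem_lam[OF T] by auto
  show "is_V mem \<theta> v" unfolding is_V_def related_iff fn_def[symmetric]
  proof (rule exI[of _ "lam (succ \<theta>) VV"], rule exI[of _ "succ \<theta>"], intro conjI allI impI)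
    show "ord (succ \<theta>)" by (rule ord_succ[OF assms])
    show "fn (lam (succ \<theta>) VV) (succ \<theta>)" by (rule fn_lam[OF T])
    fix \<beta> b x assume "pr \<beta> b \<epsilon> lam (succ \<theta>) VV"
    then have b: "(\<beta> \<epsilon> \<theta> \<or> \<beta> = \<theta>) \<and> b = VV \<beta>" unfolding f .
    show "x \<epsilon> b \<longleftrightarrow> (\<exists>\<gamma> c. \<gamma> \<epsilon> \<beta> \<and> pr \<gamma> c \<epsilon> lam (succ \<theta>) VV \<and> sub mem x c)"
      unfolding f using b mem_VV[of x \<beta>] traD[OF ord_trans[OF assms], of \<beta>] by auto
  qed (simp_all add: f v)
qed

lemma VV_ord: "u \<epsilon> VV (succ (rk u))" "ord (succ (rk u))"
  using mem_VV[of u "succ (rk u)"] VV_rk[of u] sub_VV[of u] ord_succ[OF ord_rk] by auto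

end

section \<open>Strength with respect to the single class \<open>E m\<close>\<close>

context main
begin

definition "Astrong \<kappa> \<longleftrightarrow> (\<forall>\<theta>. ord \<theta> \<longrightarrow> (\<exists>j M. elementary_embedding mem j M \<and> critical_point mem j \<kappa> \<and>
    ext (VV \<theta>) \<subseteq> M \<and> (\<forall>y. y \<epsilon> VV \<theta> \<longrightarrow> E m y \<longrightarrow> sat mem M (\<lambda>_. y) pE)))"

lemma Astrong_cardinal: "Astrong \<kappa> \<Longrightarrow> is_cardinal mem \<kappa>"
  unfolding Astrong_def using crit_cardinal ord_emp by blast

lemma strong_Pi_Astrong: assumes "strong mem (Pi_fm m) \<kappa>" shows "Astrong \<kappa>"
  unfolding Astrong_def
proof (intro allI impI)
  fix \<theta> assume t: "ord \<theta>"
  then have "level_strong mem (Pi_fm m) \<theta> \<kappa>" using assms unfolding strong_def by blast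
  moreover have "pE \<in> Pi_fm m" using pE unfolding Pi_fm_def by simp
  ultimately obtain j M v where h: "elementary_embedding mem j M" "critical_point mem j \<kappa>" "is_V mem \<theta> v"
    "ext v \<subseteq> M" "class_in mem UNIV pE \<inter> ext v \<subseteq> class_in mem M pE"
    unfolding level_strong_def ext_def using pE_fv by blast
  have v: "v = VV \<theta>" using h(3) is_V_iff[OF t] by blast
  have "sat mem M (\<lambda>_. y) pE" if "y \<epsilon> VV \<theta>" "E m y" for y
  proof -
    have "y \<in> class_in mem UNIV pE \<inter> ext v" using that pE_const v unfolding class_in_def by simp
    then show ?thesis using h(5) unfolding class_in_def by blast
  qed
  then show "\<exists>j M. elementary_embedding mem j M \<and> critical_point mem j \<kappa> \<and>
    ext (VV \<theta>) \<subseteq> M \<and> (\<forall>y. y \<epsilon> VV \<theta> \<longrightarrow> E m y \<longrightarrow> sat mem M (\<lambda>_. y) pE)" using h v by blast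
qed

text \<open>The implication from \<open>E m v\<close> to \<open>Q\<close> is valid for all
  \<open>v\<close> and \<open>f\<close>, so \<open>M\<close> satisfies it with its own reading of
  \<open>E m\<close>. Being bounded, the conclusion then holds in the universe.\<close>

lemma el_transfer:
  assumes el: "elementary_embedding mem j M" and Q: "B0 (\<lambda>s. Q (s 0) (s 1) (s 2) (s 3))"
    and t: "\<And>v f. E m v \<Longrightarrow> Q v f a b" and v: "v \<in> M" "f \<in> M" "sat mem M (\<lambda>_. v) pE"
  shows "Q v f (j a) (j b)"
proof -
  obtain q where q: "q \<in> Delta0_fm" "\<And>s. Q (s 0) (s 1) (s 2) (s 3) = sat mem UNIV s q" using Q unfolding D0_def by blast
  let ?s = "\<lambda>i. if i = 2 then a else b"
  have "sat mem M ((\<lambda>i. j (?s i))(0 := v, 1 := f)) (Imp (ren pE (\<lambda>_. 0)) q)"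
    by (rule el_all2[OF el _ v(1,2)]) (use t in \<open>auto simp: sat_ren pE_const q(2)[symmetric]\<close>)
  then have "sat mem M ((\<lambda>i. j (?s i))(0 := v, 1 := f)) q" using v(3) by (simp add: sat_ren)
  also have "sat mem M ((\<lambda>i. j (?s i))(0 := v, 1 := f)) q = sat mem UNIV ((\<lambda>i. j (?s i))(0 := v, 1 := f)) q"
    by (rule sat_Delta0[OF q(1)]) (use el_tra[OF el] el_M[OF el] v in auto)
  finally show ?thesis unfolding q(2)[symmetric] by simp
qed

text \<open>Upward persistence of \<open>q\<close> from members of \<open>E m\<close> is one
  sentence, hence true in \<open>M\<close>; it applies there to any \<open>u\<close> that
  \<open>M\<close> takes to be in \<open>E m\<close>.\<close>

lemma el_reflect:
  assumes el: "elementary_embedding mem j M"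
    and t: "\<And>x u. E m u \<Longrightarrow> x \<epsilon> u \<Longrightarrow> sat mem (ext u) (\<lambda>_. x) q \<Longrightarrow> sat mem UNIV (\<lambda>_. x) q"
    and u: "u \<in> M" "sat mem M (\<lambda>_. u) pE" "x \<epsilon> u" "sat mem (ext u) (\<lambda>_. x) q"
  shows "sat mem M (\<lambda>_. x) q"
proof -
  have x: "x \<in> M" using el_tra[OF el u(1,3)] .
  obtain r where r: "r \<in> Delta0_fm" "\<And>s. sat mem (ext (s 1)) (\<lambda>_. s 0) q = sat mem UNIV s r"
    using d0_sat_ext[of 1 "\<lambda>_. 0" q] unfolding D0_def by blast
  let ?s = "\<lambda>_. j emp"
  let ?t = "?s(0 := x, 1 := u)"
  have "sat mem M ?t (Imp (Conj (ren pE (\<lambda>_. 1)) (Conj (Mem 0 1) r)) (ren q (\<lambda>_. 0)))"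
    by (rule el_all2[OF el _ x u(1), of "\<lambda>_. emp"]) (use t in \<open>auto simp: sat_ren pE_const r(2)[symmetric]\<close>)
  moreover have "sat mem M ?t r = sat mem UNIV ?t r"
    by (rule sat_Delta0[OF r(1)]) (use el_tra[OF el] el_M[OF el] u x in auto)
  ultimately show ?thesis using u by (simp add: sat_ren r(2)[symmetric])
qed

lemma Sigma_upward:
  assumes p: "is_Sigma (Suc m) p" and u: "E m u" "x \<epsilon> u" "sat mem (ext u) (\<lambda>_. x) p"
  shows "sat mem UNIV (\<lambda>_. x) p"
proof (rule Sigma_up[OF _ _ p _ u(3)])
  show "sat mem UNIV s q" if "is_Pi m q" "range s \<subseteq> ext u" "sat mem (ext u) s q" for q s
    using that E_sat[OF u(1)] by blast
qed (use u in auto)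

lemma Astrong_strong: assumes k: "Astrong \<kappa>" shows "strong mem (Sigma_fm (Suc m)) \<kappa>"
  unfolding strong_def
proof (intro conjI allI impI)
  show c: "is_cardinal mem \<kappa>" by (rule Astrong_cardinal[OF k])
  fix \<theta> assume t: "ord \<theta>"
  show "level_strong mem (Sigma_fm (Suc m)) \<theta> \<kappa>" unfolding level_strong_def
  proof (intro conjI c ballI impI)
    fix p assume "p \<in> Sigma_fm (Suc m)" and fp: "fv p \<subseteq> {0}"
    then have p: "is_Sigma (Suc m) p" unfolding Sigma_fm_def by simp
    \<comment> \<open>Order \<open>Suc m\<close> makes \<open>u\<close> evaluate \<open>p\<close>
      exactly, while \<open>M\<close> has to recognize \<open>u\<close> only as a member of
      \<open>E m\<close>, since \<open>p\<close> persists upwards from such levels.\<close>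
    obtain u where u: "level u" "E (Suc m) u" "VV \<theta> \<epsilon> u" using E_unbounded by blast
    have Eu: "E m u" by (rule E_mono[OF u(2)])
    \<comment> \<open>The embedding is taken at an ordinal whose level contains \<open>u\<close>,
      well beyond \<open>\<theta>\<close>.\<close>
    obtain j M where h: "elementary_embedding mem j M" "critical_point mem j \<kappa>" "ext (VV (succ (rk u))) \<subseteq> M"
      "\<And>y. y \<epsilon> VV (succ (rk u)) \<Longrightarrow> E m y \<Longrightarrow> sat mem M (\<lambda>_. y) pE"
      using k VV_ord(2)[of u] unfolding Astrong_def by blast
    have uM: "u \<in> M" "sat mem M (\<lambda>_. u) pE" using h(3,4) VV_ord(1)[of u] Eu by auto
    have M: "x \<in> M" if "x \<epsilon> VV \<theta>" for x using el_tra[OF h(1)] uM(1) level_memD[OF u(1,3)] that by blast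
    have "sat mem M (\<lambda>_. x) p" if x: "x \<epsilon> VV \<theta>" "sat mem UNIV (\<lambda>_. x) p" for x
    proof (rule el_reflect[OF h(1) Sigma_upward[OF p] uM])
      show xu: "x \<epsilon> u" using level_memD[OF u(1,3) x(1)] .
      have "sat mem (ext u) (\<lambda>_. x) p = sat mem UNIV (\<lambda>_. x) p" by (rule E_sat[OF u(2)]) (use p xu in auto)
      then show "sat mem (ext u) (\<lambda>_. x) p" using x(2) by simp
    qed
    then have "class_in mem UNIV p \<inter> {x. x \<epsilon> VV \<theta>} \<subseteq> class_in mem M p" unfolding class_in_def using M by blast
    then show "\<exists>j M v. elementary_embedding mem j M \<and> critical_point mem j \<kappa> \<and> is_V mem \<theta> v \<and>
           {x. x \<epsilon> v} \<subseteq> M \<and> class_in mem UNIV p \<inter> {x. x \<epsilon> v} \<subseteq> class_in mem M p"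
      using h(1,2) M is_V_iff[OF t] by (intro exI[of _ j] exI[of _ M] exI[of _ "VV \<theta>"]) auto
  qed
qed

end

section \<open>Strong cardinals imply product reflection\<close>

context zfc
begin

definition "gr H T \<longleftrightarrow> (\<exists>x. x \<epsilon> H \<and> True) \<and> (\<forall>z. z \<epsilon> T \<longrightarrow> (\<exists>x y. z = pr x y \<and> (x \<epsilon> H \<and> y \<epsilon> H)))"

lemma gr_iff: "is_graph_with mem A H T \<longleftrightarrow> A = pr H T \<and> gr H T"
  unfolding graph_with_iff gr_def by auto

lemma d0_gr: "B0 (\<lambda>s. gr (s i) (s j))"
  unfolding gr_def by (intro d0i)

definition "chf f S \<longleftrightarrow> fn f S \<and> (\<forall>A x. pr A x \<epsilon> f \<longrightarrow> (\<exists>H T. A = pr H T \<and> (gr H T \<and> x \<epsilon> H)))"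

lemma chf_iff: "is_choice_fun mem f S \<longleftrightarrow> chf f S"
  unfolding is_choice_fun_def chf_def fn_def related_iff gr_iff by auto

lemma d0_chf: "B0 (\<lambda>s. chf (s i) (s j))"
  unfolding chf_def by (intro d0i d0_gr)

definition "ptw f g S \<longleftrightarrow> (\<forall>A. A \<epsilon> S \<longrightarrow> (\<forall>H T. A = pr H T \<longrightarrow> gr H T \<longrightarrow> (\<forall>x. pr A x \<epsilon> f \<longrightarrow> (\<forall>y. pr A y \<epsilon> g \<longrightarrow> pr x y \<epsilon> T))))"

lemma d0_ptw: "B0 (\<lambda>s. ptw (s i) (s j) (s k))"
  unfolding ptw_def by (intro d0i d0_gr)

definition "PH S G \<longleftrightarrow> (\<exists>P h. is_product mem P S \<and> is_hom mem h P G)"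

definition "PHb b S G \<longleftrightarrow> (\<exists>h. h \<epsilon> b \<and> (\<exists>H T. G = pr H T \<and> (gr H T \<and>
  (\<forall>f. f \<epsilon> b \<longrightarrow> chf f S \<longrightarrow> (\<exists>x. pr f x \<epsilon> h \<and> x \<epsilon> H) \<and>
     (\<forall>g. g \<epsilon> b \<longrightarrow> chf g S \<longrightarrow> ptw f g S \<longrightarrow> (\<forall>x. pr f x \<epsilon> h \<longrightarrow> (\<forall>y. pr g y \<epsilon> h \<longrightarrow> pr x y \<epsilon> T)))))))"

lemma d0_PHb: "B0 (\<lambda>s. PHb (s i) (s j) (s k))"
  unfolding PHb_def by (intro d0i d0_gr d0_chf d0_ptw)

lemma product_elim:
  assumes "is_product mem P S"
  obtains G R where "P = pr G R" "\<And>f. f \<epsilon> G \<longleftrightarrow> chf f S" "\<And>f g. pr f g \<epsilon> R \<longleftrightarrow> chf f S \<and> chf g S \<and> ptw f g S"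
    "\<And>z. z \<epsilon> R \<Longrightarrow> \<exists>f g. f \<epsilon> G \<and> g \<epsilon> G \<and> z = pr f g"
proof -
  obtain G R where P: "P = pr G R" "\<And>f. f \<epsilon> G \<longleftrightarrow> is_choice_fun mem f S"
    "\<And>z. z \<epsilon> R \<longleftrightarrow> (\<exists>f g. f \<epsilon> G \<and> g \<epsilon> G \<and> z = pr f g \<and>
       (\<forall>A H T. A \<epsilon> S \<and> is_graph_with mem A H T \<longrightarrow> pr (app f A) (app g A) \<epsilon> T))" using assms unfolding product_iff by blast
  have G: "\<And>f. f \<epsilon> G \<longleftrightarrow> chf f S" using P(2) chf_iff by blast
  have pt: "(\<forall>A H T. A \<epsilon> S \<and> is_graph_with mem A H T \<longrightarrow> pr (app f A) (app g A) \<epsilon> T) \<longleftrightarrow> ptw f g S"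
    if "chf f S" "chf g S" for f g
  proof -
    have f: "fn f S" and g: "fn g S" using that unfolding chf_def by auto
    show ?thesis unfolding ptw_def gr_iff fn_rel[OF f] fn_rel[OF g] by blast
  qed
  have R: "pr f g \<epsilon> R \<longleftrightarrow> chf f S \<and> chf g S \<and> ptw f g S" for f g
    unfolding P(3) using G pt[of f g] by auto
  show ?thesis by (rule that[OF P(1) G R]) (use P(3) in blast)
qed

lemma PH_iff:
  assumes G: "G = pr H T" "gr H T" and S: "\<And>A. A \<epsilon> S \<Longrightarrow> is_graph mem A"
  shows "PH S G \<longleftrightarrow> (\<exists>h. (\<forall>f. chf f S \<longrightarrow> app h f \<epsilon> H) \<and>
    (\<forall>f g. chf f S \<longrightarrow> chf g S \<longrightarrow> ptw f g S \<longrightarrow> pr (app h f) (app h g) \<epsilon> T))"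
proof
  assume "PH S G"
  then obtain P h where P: "is_product mem P S" "is_hom mem h P G" unfolding PH_def by blast
  obtain K R where K: "P = pr K R" "\<And>f. f \<epsilon> K \<longleftrightarrow> chf f S" "\<And>f g. pr f g \<epsilon> R \<longleftrightarrow> chf f S \<and> chf g S \<and> ptw f g S"
    "\<And>z. z \<epsilon> R \<Longrightarrow> \<exists>f g. f \<epsilon> K \<and> g \<epsilon> K \<and> z = pr f g"
    by (rule product_elim[OF P(1)]) (rule that, assumption+)
  then show "\<exists>h. (\<forall>f. chf f S \<longrightarrow> app h f \<epsilon> H) \<and>
    (\<forall>f g. chf f S \<longrightarrow> chf g S \<longrightarrow> ptw f g S \<longrightarrow> pr (app h f) (app h g) \<epsilon> T)"
    using P(2) unfolding K(1) G(1) hom_iff by blast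
next
  assume "\<exists>h. (\<forall>f. chf f S \<longrightarrow> app h f \<epsilon> H) \<and>
    (\<forall>f g. chf f S \<longrightarrow> chf g S \<longrightarrow> ptw f g S \<longrightarrow> pr (app h f) (app h g) \<epsilon> T)"
  then obtain h where h: "\<And>f. chf f S \<Longrightarrow> app h f \<epsilon> H"
    "\<And>f g. chf f S \<Longrightarrow> chf g S \<Longrightarrow> ptw f g S \<Longrightarrow> pr (app h f) (app h g) \<epsilon> T" by blast
  obtain P where P: "is_product mem P S" using ex_product by blast
  obtain K R where K: "P = pr K R" "\<And>f. f \<epsilon> K \<longleftrightarrow> chf f S" "\<And>f g. pr f g \<epsilon> R \<longleftrightarrow> chf f S \<and> chf g S \<and> ptw f g S"
    "\<And>z. z \<epsilon> R \<Longrightarrow> \<exists>f g. f \<epsilon> K \<and> g \<epsilon> K \<and> z = pr f g"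
    by (rule product_elim[OF P]) (rule that, assumption+)
  \<comment> \<open>A product of nonempty graphs has an element by choice; otherwise it would not
    count as a graph.\<close>
  have D: "Df UNIV (\<lambda>s. s 1 \<epsilon> p1 (s 0))" by (intro dfi)
  have ex: "\<exists>x. x \<epsilon> p1 A" if "A \<epsilon> S" for A
    using S[OF that] unfolding is_graph_def graph_with_iff by auto
  obtain f where f: "fn f S" "\<And>A. A \<epsilon> S \<Longrightarrow> app f A \<epsilon> p1 A"
    using choice[of "\<lambda>A x. x \<epsilon> p1 A" S, OF D ex] by blast
  have "chf f S" unfolding chf_def fn_rel[OF f(1)]
    using f S unfolding is_graph_def gr_iff by fastforce
  then have gP: "is_graph mem P" unfolding K(1) is_graph_def graph_with_iff using K(2,4) by blast
  have T: "Tm UNIV (\<lambda>s. app h (s 0))" by (intro dfi)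
  have gG: "is_graph mem G" unfolding is_graph_def gr_iff using G by blast
  have "is_hom mem (lam K (app h)) (pr K R) (pr H T)" unfolding hom_iff
    using gP gG h K(2,3) unfolding K(1) G(1) by (auto simp: fn_lam[OF T] app_lam[OF T])
  then show "PH S G" unfolding PH_def using P K(1) G(1) by blast
qed

text \<open>A level containing \<open>S\<close> and \<open>G\<close> contains all choice functions
  on \<open>S\<close> and all maps from them to the vertices of \<open>G\<close>, so the bound is no
  restriction. \<open>PHb\<close> admits a many-valued \<open>h\<close>, which the axiom of choice
  thins out to a function.\<close>

lemma PHb_iff:
  assumes b: "level b" "S \<epsilon> b" "G \<epsilon> b" and G: "is_graph mem G" and S: "\<And>A. A \<epsilon> S \<Longrightarrow> is_graph mem A"
  shows "PHb b S G \<longleftrightarrow> PH S G"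
proof -
  obtain H T where HT: "G = pr H T" "gr H T" using G unfolding is_graph_def gr_iff by blast
  have Hb: "H \<epsilon> b" using level_prD[OF b(1)] b(3) HT(1) by blast
  define B where "B = pow (pow (pow (un S (bU (bU (bU S))))))"
  have Bb: "B \<epsilon> b" unfolding B_def using b(1,2) by (intro level_pow level_un level_bU)
  have fB: "f \<epsilon> B" if f: "chf f S" for f
    unfolding B_def
  proof (rule sub_prod)
    fix z assume z: "z \<epsilon> f"
    have ff: "fn f S" using f unfolding chf_def by blast
    obtain A where A: "A \<epsilon> S" "z = pr A (app f A)" using z fn_mem[OF ff] by blast
    then obtain J W where J: "A = pr J W" "app f A \<epsilon> J" using f z unfolding chf_def by blast
    then have "J \<epsilon> bU (bU S)" using A pr_parts[of J W S] by simp
    then have "app f A \<epsilon> bU (bU (bU S))" unfolding mem_bU[of _ "bU (bU S)"] using J by blast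
    then show "\<exists>x y. x \<epsilon> S \<and> y \<epsilon> bU (bU (bU S)) \<and> z = pr x y" using A by blast
  qed
  have fb: "f \<epsilon> b" if "chf f S" for f using fB[OF that] level_memD[OF b(1) Bb] by blast
  have PHi: "PH S G \<longleftrightarrow> (\<exists>h. (\<forall>f. chf f S \<longrightarrow> app h f \<epsilon> H) \<and>
    (\<forall>f g. chf f S \<longrightarrow> chf g S \<longrightarrow> ptw f g S \<longrightarrow> pr (app h f) (app h g) \<epsilon> T))"
    by (rule PH_iff[OF HT]) (rule S)
  show ?thesis
  proof
    assume "PHb b S G"
    then obtain h where h: "\<And>f. chf f S \<Longrightarrow> \<exists>x. pr f x \<epsilon> h \<and> x \<epsilon> H"
      "\<And>f g x y. chf f S \<Longrightarrow> chf g S \<Longrightarrow> ptw f g S \<Longrightarrow> pr f x \<epsilon> h \<Longrightarrow> pr g y \<epsilon> h \<Longrightarrow> pr x y \<epsilon> T"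
      unfolding PHb_def HT(1) pr_inj using fb by blast
    have D: "Df UNIV (\<lambda>s. pr (s 0) (s 1) \<epsilon> h \<and> s 1 \<epsilon> H)" by (intro dfi)
    have DB: "Df UNIV (\<lambda>s. chf (s 0) S)" unfolding chf_iff[symmetric] by (intro dfi)
    have cB: "f \<epsilon> sep B (\<lambda>f. chf f S) \<longleftrightarrow> chf f S" for f unfolding mem_sep[OF DB] using fB by blast
    obtain k where "\<And>f. f \<epsilon> sep B (\<lambda>f. chf f S) \<Longrightarrow> pr f (app k f) \<epsilon> h \<and> app k f \<epsilon> H"
      using choice[of "\<lambda>f x. pr f x \<epsilon> h \<and> x \<epsilon> H" "sep B (\<lambda>f. chf f S)", OF D] h(1) unfolding cB by blast
    then have "(\<forall>f. chf f S \<longrightarrow> app k f \<epsilon> H) \<and>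
      (\<forall>f g. chf f S \<longrightarrow> chf g S \<longrightarrow> ptw f g S \<longrightarrow> pr (app k f) (app k g) \<epsilon> T)" unfolding cB using h(2) by blast
    then show "PH S G" unfolding PHi by blast
  next
    assume "PH S G"
    then obtain h where h: "\<And>f. chf f S \<Longrightarrow> app h f \<epsilon> H"
      "\<And>f g. chf f S \<Longrightarrow> chf g S \<Longrightarrow> ptw f g S \<Longrightarrow> pr (app h f) (app h g) \<epsilon> T"
      unfolding PHi by blast
    define k where "k = sep (pow (pow (un B H))) (\<lambda>z. \<exists>f. chf f S \<and> z = pr f (app h f))"
    have "Df UNIV (\<lambda>s. \<exists>f. is_choice_fun mem f S \<and> s 0 = pr f (app h f))" by (intro dfi)
    then have D: "Df UNIV (\<lambda>s. \<exists>f. chf f S \<and> s 0 = pr f (app h f))" unfolding chf_iff .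
    have k: "pr f x \<epsilon> k \<longleftrightarrow> chf f S \<and> x = app h f" for f x
      unfolding k_def mem_sep[OF D] using in_pow2[OF fB h(1)] by auto
    have "sub mem k (pow (pow (un B H)))" unfolding sub_def k_def mem_sep[OF D] by blast
    then have "k \<epsilon> pow (pow (pow (un B H)))" by simp
    moreover have "pow (pow (pow (un B H))) \<epsilon> b" using b(1) Bb Hb by (intro level_pow level_un)
    ultimately have kb: "k \<epsilon> b" using level_memD[OF b(1)] by blast
    have kA: "(\<exists>x. pr f x \<epsilon> k \<and> x \<epsilon> H) \<and>
       (\<forall>g. g \<epsilon> b \<longrightarrow> chf g S \<longrightarrow> ptw f g S \<longrightarrow> (\<forall>x. pr f x \<epsilon> k \<longrightarrow> (\<forall>y. pr g y \<epsilon> k \<longrightarrow> pr x y \<epsilon> T)))"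
      if "chf f S" for f unfolding k using h that by blast
    show "PHb b S G" unfolding PHb_def
      by (rule exI[of _ k], rule conjI[OF kb], rule exI[of _ H], rule exI[of _ T], intro conjI[OF HT(1)] conjI[OF HT(2)])
        (use kA in blast)
  qed
qed

end

section \<open>A class of graphs without product reflection\<close>

locale counterexample = main +
  fixes p :: fm
  assumes p: "is_Sigma (Suc m) p" and graphs: "\<And>x. sat mem UNIV (\<lambda>_. x) p \<Longrightarrow> is_graph mem x"
    and fails: "\<And>S. (\<And>A. A \<epsilon> S \<Longrightarrow> sat mem UNIV (\<lambda>_. A) p) \<Longrightarrow> \<exists>G. sat mem UNIV (\<lambda>_. G) p \<and> \<not> PH S G"
begin

text \<open>A bounded substitute for membership in the class, true in ever larger \<open>v\<close>:
  visible graphs belong to the class, and each member of the class is seen by large enough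
  \<open>v\<close>.\<close>

definition "CV v G \<longleftrightarrow> (\<exists>v'. v' \<epsilon> v \<and> (sat mem (ext v) (\<lambda>_. v') pE \<and> G \<epsilon> v' \<and> sat mem (ext v') (\<lambda>_. G) p))"

text \<open>Closure under counterexamples, written with \<open>CV\<close> and \<open>PHb\<close> so
  that the formula is bounded and \<open>M\<close> agrees on it.\<close>

definition "cl v \<longleftrightarrow> (\<forall>S. S \<epsilon> v \<longrightarrow> (\<forall>A. A \<epsilon> S \<longrightarrow> CV v A) \<longrightarrow> (\<exists>G. G \<epsilon> v \<and> (CV v G \<and> \<not> PHb v S G)))"

lemma d0_CV: "B0 (\<lambda>s. CV (s i) (s j))"
proof -
  have 1: "B0 (\<lambda>s. sat mem (ext (s i)) (\<lambda>_. s j) q)" for i j q using d0_sat_ext[of i "\<lambda>_. j" q] by simp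
  show ?thesis unfolding CV_def by (intro D0_bex D0_conj 1 D0_mem)
qed

lemma d0_cl: "B0 (\<lambda>s. cl (s i))"
  unfolding cl_def by (intro d0i d0_CV d0_PHb)

lemma CV_iff: "E m v \<Longrightarrow> CV v G \<longleftrightarrow> (\<exists>v'. v' \<epsilon> v \<and> E m v' \<and> G \<epsilon> v' \<and> sat mem (ext v') (\<lambda>_. G) p)"
  unfolding CV_def using sat_pE by blast

lemma CV_sat: "E m v \<Longrightarrow> CV v G \<Longrightarrow> sat mem UNIV (\<lambda>_. G) p"
  unfolding CV_iff using Sigma_upward[OF p] by blast

lemma CV_mem: "E m v \<Longrightarrow> CV v G \<Longrightarrow> G \<epsilon> v"
  unfolding CV_iff using E_tra traD by blast

lemma CV_mono: "E m v \<Longrightarrow> E m w \<Longrightarrow> v \<epsilon> w \<Longrightarrow> CV v G \<Longrightarrow> CV w G"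
  unfolding CV_iff using E_tra[of m w] traD by blast

lemma ex_CV: assumes "sat mem UNIV (\<lambda>_. G) p" shows "\<exists>u. E m u \<and> G \<epsilon> u \<and> sat mem (ext u) (\<lambda>_. G) p"
proof -
  obtain u where u: "E (Suc m) u" "G \<epsilon> u" using E_unbounded by blast
  have "sat mem (ext u) (\<lambda>_. G) p = sat mem UNIV (\<lambda>_. G) p" by (rule E_sat[OF u(1)]) (use p u in auto)
  then show ?thesis using assms u E_mono by blast
qed

definition "K v \<longleftrightarrow> E m v \<and> cl v"

lemma K_level: "K v \<Longrightarrow> level v"
  unfolding K_def using E_level by blast

lemma Df_K: "Df UNIV (\<lambda>s. K (s i))"
  unfolding K_def by (intro dfi Dp_D0[OF d0_cl])

lemma K_fails:
  assumes v: "K v" and S: "S \<epsilon> v" "\<And>A. A \<epsilon> S \<Longrightarrow> CV v A"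
  shows "\<exists>G. CV v G \<and> \<not> PH S G"
proof -
  have Ev: "E m v" and "cl v" using v unfolding K_def by auto
  then obtain G where G: "G \<epsilon> v" "CV v G" "\<not> PHb v S G" unfolding cl_def using S by blast
  have "is_graph mem G" "\<And>A. A \<epsilon> S \<Longrightarrow> is_graph mem A" using graphs CV_sat[OF Ev] G(2) S(2) by blast+
  then have "\<not> PH S G" using PHb_iff[OF K_level[OF v] S(1) G(1)] G(3) by blast
  then show ?thesis using G by blast
qed

lemma K_unbounded: "\<exists>v. K v \<and> x \<epsilon> v"
proof -
  define good where "good S G u \<longleftrightarrow> E m u \<and> G \<epsilon> u \<and> sat mem (ext u) (\<lambda>_. G) p \<and> \<not> PH S G" for S G u
  define N where "N y v \<longleftrightarrow> (\<forall>S. S \<epsilon> y \<longrightarrow> (\<forall>A. A \<epsilon> S \<longrightarrow> sat mem UNIV (\<lambda>_. A) p) \<longrightarrow> (\<exists>G u. u \<epsilon> v \<and> good S G u))" for y v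
  have "Df UNIV (\<lambda>s. sat mem (ext (s i)) (\<lambda>_. s j) p)" for i j
    using Dp_D0[OF d0_sat_ext[of i "\<lambda>_. j" p]] by simp
  then have Dg: "Df UNIV (\<lambda>s. good (s i) (s j) (s k))" for i j k
    unfolding good_def PH_def by (intro dfi)
  have Dh: "Df UNIV (\<lambda>s. sat mem UNIV (\<lambda>_. s i) p)" for i by (intro dfi)
  have "\<exists>v. level v \<and> E m v \<and> x \<epsilon> v \<and>
    (\<forall>y. y \<epsilon> v \<longrightarrow> (\<exists>z u. y \<epsilon> z \<and> z \<epsilon> u \<and> u \<epsilon> v \<and> level z \<and> E m z \<and> level u \<and> E m u \<and> N z u))"
  proof (rule club)
    show "Df UNIV (\<lambda>s. E m (s 0))" by (intro dfi)
    show "Df UNIV (\<lambda>s. N (s 0) (s 1))" unfolding N_def by (intro Dp_all Dp_imp Dp_ex Dp_conj Dg Dh Dp_mem Dt_var)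
    show "\<And>c x. x \<epsilon> c \<Longrightarrow> (\<And>v. v \<epsilon> c \<Longrightarrow> level v \<and> E m v) \<Longrightarrow> E m (bU c)" by (rule E_limit)
    fix y
    have D: "Df UNIV (\<lambda>s. \<exists>G. good (s 0) G (s 1))" by (intro Dp_ex Dg)
    obtain b where b: "\<And>S. S \<epsilon> y \<Longrightarrow> \<exists>u G. good S G u \<Longrightarrow> \<exists>u. u \<epsilon> b \<and> (\<exists>G. good S G u)"
      using collection[of "\<lambda>S u. \<exists>G. good S G u" y, OF D] by blast
    have ex: "\<exists>u G. good S G u" if S: "\<forall>A. A \<epsilon> S \<longrightarrow> sat mem UNIV (\<lambda>_. A) p" for S
    proof -
      obtain G where "sat mem UNIV (\<lambda>_. G) p" "\<not> PH S G" using fails[of S] S by blast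
      then show ?thesis unfolding good_def using ex_CV by blast
    qed
    obtain v where v: "level v" "E m v" "pr y b \<epsilon> v" using E_unbounded by blast
    have "y \<epsilon> v" "b \<epsilon> v" using level_prD[OF v(1,3)] by auto
    moreover have "N y v" unfolding N_def using b ex level_memD[OF v(1) \<open>b \<epsilon> v\<close>] by blast
    ultimately show "\<exists>v. level v \<and> E m v \<and> y \<epsilon> v \<and> N y v" using v by blast
  qed
  then obtain v where v: "level v" "E m v" "x \<epsilon> v"
    and lim: "\<And>y. y \<epsilon> v \<Longrightarrow> \<exists>z u. y \<epsilon> z \<and> z \<epsilon> u \<and> u \<epsilon> v \<and> level z \<and> E m z \<and> level u \<and> E m u \<and> N z u" by blast
  have "cl v" unfolding cl_def
  proof (intro allI impI)
    fix S assume S: "S \<epsilon> v" "\<forall>A. A \<epsilon> S \<longrightarrow> CV v A"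
    have S2: "\<forall>A. A \<epsilon> S \<longrightarrow> sat mem UNIV (\<lambda>_. A) p" using S CV_sat[OF v(2)] by blast
    obtain z w where "S \<epsilon> z" "w \<epsilon> v" "N z w" using lim[OF S(1)] by blast
    then obtain G u where G: "u \<epsilon> w" "good S G u" unfolding N_def using S2 by blast
    have uv: "u \<epsilon> v" using level_memD[OF v(1) \<open>w \<epsilon> v\<close> G(1)] .
    then have C: "CV v G" unfolding CV_iff[OF v(2)] using G(2) unfolding good_def by blast
    have Gv: "G \<epsilon> v" by (rule CV_mem[OF v(2) C])
    have "is_graph mem G" "\<And>A. A \<epsilon> S \<Longrightarrow> is_graph mem A" using graphs CV_sat[OF v(2)] C S2 by blast+
    then have "\<not> PHb v S G" using PHb_iff[OF v(1) S(1) Gv] G(2) unfolding good_def by blast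
    then show "\<exists>G. G \<epsilon> v \<and> (CV v G \<and> \<not> PHb v S G)" using Gv C by blast
  qed
  then show ?thesis unfolding K_def using v by blast
qed

sublocale en: enum mem K
  by unfold_locales (use K_level K_unbounded Df_K in auto)

text \<open>Let \<open>v\<^sub>0\<close> and \<open>v\<^sub>1\<close> be the members of \<open>K\<close> with indices \<open>\<kappa>\<close> and \<open>\<kappa> + 1\<close>, and let \<open>S\<close> be the part of the class that
  is visible in \<open>v\<^sub>0\<close>. Since \<open>\<kappa> < j \<kappa>\<close>, the graph \<open>G\<close> visible in \<open>v\<^sub>1\<close> that reflection misses is in \<open>j S\<close>, and
  \<open>f \<mapsto> (j f)(G)\<close> is a homomorphism from the product of \<open>S\<close> to \<open>G\<close>.\<close>

lemma no_Astrong: "\<not> Astrong \<kappa>"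
proof
  assume k: "Astrong \<kappa>"
  have ok: "ord \<kappa>" using Astrong_cardinal[OF k] unfolding is_cardinal_def by blast
  obtain v0 where v0: "K v0" "en.ot v0 = \<kappa>" using en.ot_onto[OF ok] by blast
  obtain v1 where v1: "K v1" "en.ot v1 = succ \<kappa>" using en.ot_onto[OF ord_succ[OF ok]] by blast
  have E0: "E m v0" and E1: "E m v1" using v0 v1 unfolding K_def by auto
  note l0 = K_level[OF v0(1)] and l1 = K_level[OF v1(1)]
  have v01: "v0 \<epsilon> v1" using en.ot_less_iff[OF v0(1) v1(1)] v0 v1 by simp
  define X where "X v u \<longleftrightarrow> sat mem (ext v) (\<lambda>_. u) pE \<and> cl u" for v u
  have dX: "B0 (\<lambda>s. X (s i) (s j))" for i j
    unfolding X_def using d0_sat_ext[of i "\<lambda>_. j" pE] by (intro D0_conj d0_cl) simp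
  have X: "X v u \<longleftrightarrow> K u" if "E m v" "u \<epsilon> v" for u v
    unfolding X_def K_def using sat_pE that by blast
  obtain f1 where f1: "collapse (X v1) f1 v1" using en.collapse_ex[of v1 "X v1", OF l1 X[OF E1]] by blast
  define S where "S = sep v0 (CV v0)"
  have S: "A \<epsilon> S \<longleftrightarrow> CV v0 A" for A
  proof -
    have "Df UNIV (\<lambda>s. CV (s 1) (s 0))" by (rule Dp_D0[OF d0_CV])
    from Dp_sub2[where P = "\<lambda>A v. CV v A", of mem UNIV "\<lambda>s. s 0" "\<lambda>s. v0"] this have "Df UNIV (\<lambda>s. CV v0 (s 0))"
      by (simp add: Dt_var Dt_constU Dp_D0[OF d0_CV])
    from mem_sep[OF this] show ?thesis unfolding S_def using CV_mem[OF E0] by blast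
  qed
  have "S \<epsilon> v1" by (rule level_super[OF l1 v01]) (use S CV_mem[OF E0] in \<open>simp add: sub_def\<close>)
  then obtain G where G: "CV v1 G" "\<not> PH S G" using K_fails[OF v1(1)] S CV_mono[OF E0 E1 v01] by blast
  \<comment> \<open>A level holding both \<open>v1\<close> and its collapse \<open>f1\<close>.
    Strength beyond its rank puts them into \<open>M\<close> and lets \<open>M\<close> see that
    \<open>v1\<close> is in \<open>E m\<close>.\<close>
  obtain w where w: "level w" "E m w" "pr v1 f1 \<epsilon> w" using E_unbounded by blast
  have w': "v1 \<epsilon> w" "f1 \<epsilon> w" using level_prD[OF w(1,3)] by auto
  obtain j M where h: "elementary_embedding mem j M" "critical_point mem j \<kappa>" "ext (VV (succ (rk w))) \<subseteq> M"
    "\<And>y. y \<epsilon> VV (succ (rk w)) \<Longrightarrow> E m y \<Longrightarrow> sat mem M (\<lambda>_. y) pE"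
    using k VV_ord(2)[of w] unfolding Astrong_def by blast
  have wV: "y \<epsilon> VV (succ (rk w))" if "y \<epsilon> w" for y using traD[OF VV_tra VV_ord(1)[of w]] that by blast
  have M: "y \<in> M" if "y \<epsilon> w" for y using wV[OF that] h(3) by auto
  have EM: "sat mem M (\<lambda>_. y) pE" if "y \<epsilon> w" "E m y" for y using wV h(4) that by blast
  have kj: "\<kappa> \<epsilon> j \<kappa>" using crit_less[OF h(1,2)] by blast
  have j0: "tra (j v0)" using el_D0_1[OF h(1), of tra v0] d0_tra level_tra[OF l0] by blast
  \<comment> \<open>In the universe, a member of \<open>K\<close> above \<open>v0\<close> has
    \<open>\<kappa>\<close> in the range of its collapse. Transferred to \<open>M\<close>, with
    \<open>v1\<close> above \<open>j v0\<close>, this would make \<open>j \<kappa>\<close> an index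
    below that of \<open>v1\<close>, which is \<open>succ \<kappa>\<close>.\<close>
  have below: "v1 = j v0 \<or> v1 \<epsilon> j v0"
  proof (rule ccontr)
    assume n: "\<not> (v1 = j v0 \<or> v1 \<epsilon> j v0)"
    define Q where "Q v f a b \<longleftrightarrow> (cl v \<and> collapse (X v) f v \<and> \<not> (v = a \<or> v \<epsilon> a) \<longrightarrow> (\<exists>u y. pr u y \<epsilon> f \<and> y = b))" for v f a b
    have dQ: "B0 (\<lambda>s. Q (s 0) (s 1) (s 2) (s 3))" unfolding Q_def by (intro d0i d0_cl d0_collapse dX)
    have "Q v f v0 \<kappa>" if "E m v" for v f unfolding Q_def
    proof
      assume a: "cl v \<and> collapse (X v) f v \<and> \<not> (v = v0 \<or> v \<epsilon> v0)"
      then have Kv: "K v" using that unfolding K_def by blast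
      have "v0 \<epsilon> v" using level_linear[OF l0 K_level[OF Kv]] a by blast
      then have "pr v0 \<kappa> \<epsilon> f" using en.collapse_iff[of v "X v" f v0 \<kappa>, OF K_level[OF Kv]] X[OF that] a v0 by blast
      then show "\<exists>u y. pr u y \<epsilon> f \<and> y = \<kappa>" by blast
    qed
    then have "Q v1 f1 (j v0) (j \<kappa>)" using el_transfer[where Q = Q, OF h(1) dQ] M w' EM[OF w'(1) E1] by blast
    then obtain u where "pr u (j \<kappa>) \<epsilon> f1" using f1 n v1(1) unfolding Q_def K_def by blast
    then have "u \<epsilon> v1 \<and> K u \<and> j \<kappa> = en.ot u" using en.collapse_iff[of v1 "X v1" f1 u "j \<kappa>", OF l1] X[OF E1] f1 by blast
    then have "j \<kappa> \<epsilon> en.ot v1" using en.mem_ot[of "j \<kappa>" v1] by blast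
    then have "j \<kappa> \<epsilon> \<kappa> \<or> j \<kappa> = \<kappa>" unfolding v1(2) by simp
    then show False using kj not_mem_cycle not_mem_self by metis
  qed
  \<comment> \<open>The level \<open>v'\<close> that shows \<open>G\<close> to be visible lies in
    \<open>j v0\<close> by \<open>below\<close>, and \<open>M\<close> recognizes it as correct; so
    \<open>G\<close> is visible in \<open>j v0\<close> for \<open>M\<close>.\<close>
  have GS: "G \<epsilon> j S"
  proof -
    obtain v' where v': "v' \<epsilon> v1" "E m v'" "G \<epsilon> v'" "sat mem (ext v') (\<lambda>_. G) p" using G(1) unfolding CV_iff[OF E1] by blast
    have v'w: "v' \<epsilon> w" "G \<epsilon> w" using level_memD[OF w(1)] w'(1) v' by blast+
    have "v' \<epsilon> j v0" using below v'(1) traD[OF j0] by blast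
    moreover define Q where "Q u A a b \<longleftrightarrow> (u \<epsilon> a \<and> A \<epsilon> u \<and> sat mem (ext u) (\<lambda>_. A) p \<longrightarrow> A \<epsilon> b)" for u A a b
    have dQ: "B0 (\<lambda>s. Q (s 0) (s 1) (s 2) (s 3))" unfolding Q_def by (intro d0i)
    have "Q u A v0 S" if "E m u" for u A unfolding Q_def S CV_iff[OF E0] using that by blast
    then have "Q v' G (j v0) (j S)" using el_transfer[where Q = Q, OF h(1) dQ] M v'w EM[OF v'w(1) v'(2)] by blast
    ultimately show ?thesis unfolding Q_def using v' by blast
  qed
  have "is_graph mem G" using graphs CV_sat[OF E1 G(1)] by blast
  then obtain H T where HT: "G = pr H T" "gr H T" unfolding is_graph_def gr_iff by blast
  have "\<And>A. A \<epsilon> S \<Longrightarrow> is_graph mem A" using graphs S CV_sat[OF E0] by blast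
  note PHi = PH_iff[OF HT this]
  have Tj: "Tm UNIV U \<Longrightarrow> Tm UNIV (\<lambda>s. j (U s))" for U by (rule Tm_inst[OF el_Tm[OF h(1)]])
  have chj: "chf (j f) (j S)" if "chf f S" for f using el_D0_2[OF h(1), of chf f S] d0_chf that by blast
  have ptj: "ptw (j f) (j g) (j S)" if "ptw f g S" for f g using el_D0_3[OF h(1), of ptw f g S] d0_ptw that by blast
  obtain P where "is_product mem P S" using ex_product by blast
  then obtain D R where D: "\<And>f. f \<epsilon> D \<longleftrightarrow> chf f S" unfolding product_iff chf_iff by blast
  define k where "k = lam D (\<lambda>f. app (j f) G)"
  have T: "Tm UNIV (\<lambda>s. app (j (s 0)) G)" by (intro dfi Tj)
  have kf: "app k f = app (j f) G" if "chf f S" for f unfolding k_def using app_lam[OF T] D that by blast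
  have in_f: "pr G (app (j f) G) \<epsilon> j f" if "chf f S" for f
    using chj[OF that] GS fn_rel unfolding chf_def by blast
  have "app k f \<epsilon> H" if f: "chf f S" for f
  proof -
    obtain H' T' where "pr H T = pr H' T'" "app (j f) G \<epsilon> H'"
      using chj[OF f] in_f[OF f] unfolding chf_def HT(1) by blast
    then show ?thesis unfolding kf[OF f] by simp
  qed
  moreover have "pr (app k f) (app k g) \<epsilon> T" if "chf f S" "chf g S" "ptw f g S" for f g
    unfolding kf[OF that(1)] kf[OF that(2)] using ptj[OF that(3)] in_f[OF that(1)] in_f[OF that(2)] GS HT(2)
    unfolding ptw_def HT(1) by blast
  ultimately have "PH S G" using PHi by blast
  then show False using G(2) by blast
qed

end

context main
begin

lemma Astrong_PRP: assumes k: "Astrong \<kappa>" shows "PRP mem (Sigma_fm (Suc m))"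
  unfolding PRP_def
proof (intro allI impI)
  fix C assume C: "definable_by mem (Sigma_fm (Suc m)) C \<and> \<not> small C \<and> (\<forall>A\<in>C. is_graph mem A)"
  then obtain p where p: "is_Sigma (Suc m) p" "C = class_in mem UNIV p"
    unfolding definable_by_def Sigma_fm_def by blast
  have Cp: "x \<in> C \<longleftrightarrow> sat mem UNIV (\<lambda>_. x) p" for x unfolding p(2) class_in_def by simp
  show "\<exists>S. (\<forall>A. A \<epsilon> S \<longrightarrow> A \<in> C) \<and> (\<forall>G\<in>C. \<exists>P h. is_product mem P S \<and> is_hom mem h P G)"
  proof (rule ccontr)
    assume n: "\<not> ?thesis"
    have "\<exists>G. sat mem UNIV (\<lambda>_. G) p \<and> \<not> PH S G" if S: "\<And>A. A \<epsilon> S \<Longrightarrow> sat mem UNIV (\<lambda>_. A) p" for S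
    proof -
      have "\<not> ((\<forall>A. A \<epsilon> S \<longrightarrow> A \<in> C) \<and> (\<forall>G\<in>C. PH S G))" using n unfolding PH_def by blast
      then show ?thesis using S Cp by blast
    qed
    then interpret counterexample mem m pE p
      by unfold_locales (use p(1) C Cp in auto)
    show False using k no_Astrong by blast
  qed
qed

lemma PRP_SWVP: assumes prp: "PRP mem (Sigma_fm (Suc m))" shows "SWVP mem (Sigma_fm (Suc m))"
  unfolding SWVP_def
proof (intro notI, elim exE conjE)
  fix F
  assume dF: "definable_by mem (Sigma_fm (Suc m)) F" and gF: "is_graph_sequence mem F"
    and bad: "\<forall>\<alpha> \<beta> A B. seq_at mem F \<alpha> A \<and> seq_at mem F \<beta> B \<longrightarrow>
             (\<alpha> \<epsilon> \<beta> \<or> \<alpha> = \<beta> \<longrightarrow> (\<exists>h. is_hom mem h B A)) \<and> (\<alpha> \<epsilon> \<beta> \<longrightarrow> \<not> (\<exists>h. is_hom mem h A B))"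
  have at: "seq_at mem F \<alpha> G \<longleftrightarrow> pr \<alpha> G \<in> F" for \<alpha> G unfolding seq_at_def by simp
  have S0: "SigP mem (Suc m) (\<lambda>s. s i \<in> F)" for i by (rule definable_by_SigmaD[OF dF])
  then obtain q where q: "\<And>s. (s 0 \<in> F) = sat mem UNIV s q" unfolding SigP_def by blast
  have "Df UNIV (\<lambda>s. sat mem UNIV (\<lambda>i. (\<lambda>s. s i) s) q)" by (intro dfi)
  then have "Df UNIV (\<lambda>s. s 0 \<in> F)" unfolding q by simp
  then have DF: "Tm UNIV T \<Longrightarrow> Df UNIV (\<lambda>s. T s \<in> F)" for T by (rule Dp_sub1)
  have graph: "is_graph mem G \<and> ord \<alpha>" if "pr \<alpha> G \<in> F" for \<alpha> G
    using gF that unfolding is_graph_sequence_def by fastforce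
  have ex: "\<exists>G. pr \<alpha> G \<in> F" if "ord \<alpha>" for \<alpha>
    using gF that unfolding is_graph_sequence_def seq_at_def[symmetric] at by blast
  have down: "\<exists>h. is_hom mem h B A" "\<not> (\<exists>h. is_hom mem h A B)" if "pr \<alpha> A \<in> F" "pr \<beta> B \<in> F" "\<alpha> \<epsilon> \<beta>" for \<alpha> \<beta> A B
    using bad that unfolding at by blast+
  \<comment> \<open>Equal graphs at different indices would give a homomorphism upwards, contrary to
    the choice of the sequence.\<close>
  have inj: "\<alpha> = \<beta>" if "pr \<alpha> A \<in> F" "pr \<beta> A \<in> F" for \<alpha> \<beta> A
    using ord_linear[of \<alpha> \<beta>] down[of \<alpha> A \<beta> A] down[of \<beta> A \<alpha> A] graph that by blast
  define C where "C = {G. \<exists>\<alpha>. pr \<alpha> G \<in> F}"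
  \<comment> \<open>The range of the sequence is a projection, which costs an existential
    quantifier; this is absorbed in the \<open>\<Sigma>\<close> form of reflection.\<close>
  have "SigP mem (Suc m) (\<lambda>s. \<exists>\<alpha> z. z = pr \<alpha> (s 0) \<and> z \<in> F)"
    by (intro SigP_ex SigP_conj S0 SigP_D0 d0i)
  then have dC: "definable_by mem (Sigma_fm (Suc m)) C" unfolding C_def by (intro definable_by_Sigma) simp
  have D: "Df UNIV (\<lambda>s. pr (s 1) (s 0) \<in> F)" by (intro DF dfi)
  have "\<not> small C"
  proof
    assume "small C"
    then obtain c where c: "C = ext c" unfolding small_alt by blast
    obtain b where b: "\<And>G. G \<epsilon> c \<Longrightarrow> \<exists>\<alpha>. pr \<alpha> G \<in> F \<Longrightarrow> \<exists>\<alpha>. \<alpha> \<epsilon> b \<and> pr \<alpha> G \<in> F"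
      using collection[of "\<lambda>G \<alpha>. pr \<alpha> G \<in> F" c, OF D] by blast
    have all: "\<alpha> \<epsilon> b" if o: "ord \<alpha>" for \<alpha>
    proof -
      obtain G where G: "pr \<alpha> G \<in> F" using ex[OF o] by blast
      then have "G \<epsilon> c" using c unfolding C_def by auto
      then obtain \<beta> where "\<beta> \<epsilon> b" "pr \<beta> G \<in> F" using b G by blast
      then show ?thesis using inj G by blast
    qed
    have "rk b \<epsilon> rk b" unfolding mem_rk using all[OF ord_rk] ord_rk mem_sub[OF sub_VV] by blast
    then show False by simp
  qed
  moreover have "\<forall>A\<in>C. is_graph mem A" unfolding C_def using graph by blast
  moreover have "definable_by mem (Sigma_fm (Suc m)) C \<and> \<not> small C \<and> (\<forall>A\<in>C. is_graph mem A) \<longrightarrow>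
     (\<exists>S. (\<forall>A. A \<epsilon> S \<longrightarrow> A \<in> C) \<and> (\<forall>G\<in>C. \<exists>P h. is_product mem P S \<and> is_hom mem h P G))"
    using prp unfolding PRP_def by (rule spec)
  ultimately obtain S where S: "\<And>A. A \<epsilon> S \<Longrightarrow> A \<in> C" and h: "\<And>G. G \<in> C \<Longrightarrow> \<exists>P h. is_product mem P S \<and> is_hom mem h P G"
    using dC by blast
  obtain b where b: "\<And>A. A \<epsilon> S \<Longrightarrow> \<exists>\<alpha>. pr \<alpha> A \<in> F \<Longrightarrow> \<exists>\<alpha>. \<alpha> \<epsilon> b \<and> pr \<alpha> A \<in> F"
    using collection[of "\<lambda>G \<alpha>. pr \<alpha> G \<in> F" S, OF D] by blast
  \<comment> \<open>\<open>b\<close> contains an index of each member of \<open>S\<close>, so all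
    these indices are below \<open>rk b\<close>, and the graph at \<open>rk b\<close> maps to all of
    \<open>S\<close>.\<close>
  obtain B where B: "pr (rk b) B \<in> F" using ex[OF ord_rk] by blast
  obtain G where G: "pr (succ (rk b)) G \<in> F" using ex[OF ord_succ[OF ord_rk]] by blast
  have hB: "\<exists>h. is_hom mem h B A" if A: "A \<epsilon> S" for A
  proof -
    obtain \<alpha> where a: "\<alpha> \<epsilon> b" "pr \<alpha> A \<in> F" using b[OF A] S[OF A] unfolding C_def by blast
    have "\<alpha> \<epsilon> rk b" unfolding mem_rk using a graph mem_sub[OF sub_VV] by blast
    then show ?thesis using down(1)[OF a(2) B] by blast
  qed
  have "G \<in> C" using G unfolding C_def by blast
  then obtain P k where P: "is_product mem P S" "is_hom mem k P G" using h by blast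
  have "is_graph mem B" using graph B by blast
  then obtain l where "is_hom mem l B P" using hom_product[OF _ hB P(1)] by blast
  then have "\<exists>h. is_hom mem h B G" using hom_comp P(2) by blast
  then show False using down(2)[OF B G] by simp
qed

end

section \<open>The equivalences\<close>

context zfc
begin

lemma strong_mono: assumes "strong mem (Sigma_fm (Suc m)) \<kappa>" shows "strong mem (Pi_fm m) \<kappa>"
  unfolding strong_def level_strong_def
proof (intro conjI allI impI ballI)
  show "is_cardinal mem \<kappa>" "is_cardinal mem \<kappa>" using assms unfolding strong_def by blast+
  fix \<theta> p assume t: "ord \<theta>" and p: "p \<in> Pi_fm m" "fv p \<subseteq> {0}"
  \<comment> \<open>A vacuous quantifier gives the formula the required prenex shape; over the
    nonempty classes \<open>UNIV\<close> and \<open>M\<close> it does not change its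
    meaning.\<close>
  have "is_Sigma (Suc m) (Exists 1 p)" using p(1) unfolding Pi_fm_def by (auto intro: is_Sigma_is_Pi.intros)
  then have "Exists 1 p \<in> Sigma_fm (Suc m)" "fv (Exists 1 p) \<subseteq> {0}" using p(2) unfolding Sigma_fm_def by auto
  then obtain j M v where h: "elementary_embedding mem j M" "critical_point mem j \<kappa>" "is_V mem \<theta> v"
    "{x. x \<epsilon> v} \<subseteq> M" "class_in mem UNIV (Exists 1 p) \<inter> {x. x \<epsilon> v} \<subseteq> class_in mem M (Exists 1 p)"
    using assms t unfolding strong_def level_strong_def by blast
  have "sat mem D ((\<lambda>_. x)(1 := a)) p = sat mem D (\<lambda>_. x) p" for D x a
    by (rule sat_cong) (use p(2) in auto)
  then have "class_in mem D (Exists 1 p) = class_in mem D p" if "D \<noteq> {}" for D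
    using that unfolding class_in_def by auto
  moreover have "M \<noteq> {}" using h(1) unfolding elementary_embedding_def by auto
  ultimately show "\<exists>j M v. elementary_embedding mem j M \<and> critical_point mem j \<kappa> \<and> is_V mem \<theta> v \<and>
           {x. x \<epsilon> v} \<subseteq> M \<and> class_in mem UNIV p \<inter> {x. x \<epsilon> v} \<subseteq> class_in mem M p" using h by force
qed

lemma PRP_mono: "PRP mem (Sigma_fm (Suc m)) \<Longrightarrow> PRP mem (Pi_fm m)"
  unfolding PRP_def using Pi_sub_Sigma by blast

lemma SWVP_mono: "SWVP mem (Sigma_fm (Suc m)) \<Longrightarrow> SWVP mem (Pi_fm m)"
  unfolding SWVP_def by (erule contrapos_nn, elim exE conjE, intro exI conjI, rule Pi_sub_Sigma)

lemma WVP_mono: "WVP mem (Sigma_fm (Suc m)) \<Longrightarrow> WVP mem (Pi_fm m)"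
  unfolding WVP_def by (erule contrapos_nn, elim exE conjE, intro exI conjI, rule Pi_sub_Sigma)

lemma SWVP_WVP: "SWVP mem \<Gamma> \<Longrightarrow> WVP mem \<Gamma>"
proof -
  assume s: "SWVP mem \<Gamma>"
  show ?thesis unfolding WVP_def
  proof (intro notI, elim exE conjE)
    fix F
    assume F: "definable_by mem \<Gamma> F" "is_graph_sequence mem F"
      and bad: "\<forall>\<alpha> \<beta> A B. seq_at mem F \<alpha> A \<and> seq_at mem F \<beta> B \<longrightarrow>
             (\<alpha> \<epsilon> \<beta> \<or> \<alpha> = \<beta> \<longrightarrow> (\<exists>!h. is_hom mem h B A)) \<and> (\<alpha> \<epsilon> \<beta> \<longrightarrow> \<not> (\<exists>h. is_hom mem h A B))"
    have g: "\<forall>\<alpha> \<beta> A B. seq_at mem F \<alpha> A \<and> seq_at mem F \<beta> B \<longrightarrow>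
             (\<alpha> \<epsilon> \<beta> \<or> \<alpha> = \<beta> \<longrightarrow> (\<exists>h. is_hom mem h B A)) \<and> (\<alpha> \<epsilon> \<beta> \<longrightarrow> \<not> (\<exists>h. is_hom mem h A B))"
    proof (intro allI)
      fix \<alpha> \<beta> A B
      from bad[THEN spec, THEN spec, THEN spec, THEN spec, of \<alpha> A \<beta> B]
      show "seq_at mem F \<alpha> A \<and> seq_at mem F \<beta> B \<longrightarrow>
             (\<alpha> \<epsilon> \<beta> \<or> \<alpha> = \<beta> \<longrightarrow> (\<exists>h. is_hom mem h B A)) \<and> (\<alpha> \<epsilon> \<beta> \<longrightarrow> \<not> (\<exists>h. is_hom mem h A B))" by blast
    qed
    show False by (rule notE[OF s[unfolded SWVP_def]], rule exI[of _ F]) (intro conjI F g)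
  qed
qed

end

theorem theorem6p13:
  fixes mem :: "'a \<Rightarrow> 'a \<Rightarrow> bool" and n :: nat
  assumes "models_ZFC mem" and "n \<ge> 2"
  shows "((\<exists>\<kappa>. strong mem (Sigma_fm n) \<kappa>) \<longleftrightarrow> (\<exists>\<kappa>. strong mem (Pi_fm (n - 1)) \<kappa>)) \<and>
         ((\<exists>\<kappa>. strong mem (Pi_fm (n - 1)) \<kappa>) \<longleftrightarrow> PRP mem (Sigma_fm n)) \<and>
         (PRP mem (Sigma_fm n) \<longleftrightarrow> PRP mem (Pi_fm (n - 1))) \<and>
         (PRP mem (Pi_fm (n - 1)) \<longleftrightarrow> SWVP mem (Sigma_fm n)) \<and>
         (SWVP mem (Sigma_fm n) \<longleftrightarrow> SWVP mem (Pi_fm (n - 1))) \<and>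
         (SWVP mem (Pi_fm (n - 1)) \<longleftrightarrow> WVP mem (Sigma_fm n)) \<and>
         (WVP mem (Sigma_fm n) \<longleftrightarrow> WVP mem (Pi_fm (n - 1)))"
proof -
  define m where "m = n - 1"
  have n: "n = Suc m" "m \<ge> 1" using assms(2) unfolding m_def by auto
  interpret zfc mem by unfold_locales (rule assms(1))
  obtain p where p: "is_Pi m p" "\<And>s. E m (s 0) = sat mem UNIV s p" using PiP_E[of m 0] unfolding PiP_def by blast
  \<comment> \<open>Collapsing all variables to 0 leaves at most one free variable, as the
    parameter-free classes in the definition of strength require.\<close>
  interpret main mem m "ren p (\<lambda>_. 0)"
    by unfold_locales (use n p(1) p(2)[of "\<lambda>_. _ 0"] SP_ren in \<open>auto simp: sat_ren fv_ren\<close>)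
  have 1: "(\<exists>\<kappa>. strong mem (Pi_fm m) \<kappa>) \<Longrightarrow> \<exists>\<kappa>. Astrong \<kappa>" using strong_Pi_Astrong by blast
  have 2: "(\<exists>\<kappa>. Astrong \<kappa>) \<Longrightarrow> (\<exists>\<kappa>. strong mem (Sigma_fm (Suc m)) \<kappa>)" using Astrong_strong by blast
  have 3: "(\<exists>\<kappa>. strong mem (Sigma_fm (Suc m)) \<kappa>) \<Longrightarrow> (\<exists>\<kappa>. strong mem (Pi_fm m) \<kappa>)" using strong_mono by blast
  have 4: "(\<exists>\<kappa>. Astrong \<kappa>) \<Longrightarrow> PRP mem (Sigma_fm (Suc m))" using Astrong_PRP by blast
  have 5: "\<exists>\<kappa>. Astrong \<kappa>" if "PRP mem (Pi_fm m) \<or> WVP mem (Pi_fm m)"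
  proof (rule ccontr)
    assume "\<not> ?thesis"
    then interpret anti mem m "ren p (\<lambda>_. 0)"
      by unfold_locales (auto simp: Astrong_def)
    show False using not_PRP not_WVP that by blast
  qed
  \<comment> \<open>Every principle implies the \<open>\<Pi>\<close> form of \<open>PRP\<close> or
    of \<open>WVP\<close>, and fact 5 leads from there back to a strong cardinal.\<close>
  show ?thesis unfolding n(1) diff_Suc_1
    using 1 2 3 4 5 PRP_SWVP PRP_mono[of m] SWVP_mono[of m] WVP_mono[of m]
      SWVP_WVP[of "Sigma_fm (Suc m)"] SWVP_WVP[of "Pi_fm m"] by blast
qed

end
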